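(* Let $(M^4,g(t))_{t\in[0,T)}$ be a solution to Ricci flow satisfying the basic assumptions, and let $(X,d_X)$, $f:M\to X$ and $x_1,\dots,x_L\in X$ be as described in the context. Then $N=X\setminus\{x_1,\dots,x_L\}$ has a natural (smooth) manifold structure, and with this structure $f|_V:V\to N$ is a diffeomorphism, where $V:=f^{-1}(N)$. There is a natural Riemannian metric $l$ on $N$ defined by $l:=\lim_{t\nearrow T}f_*g(t)$ (in particular this limit exists on $N$ and is a Riemannian metric).
   Context: Basic assumptions: $M^4$ is a smooth, compact, connected four-dimensional manifold without boundary; $(M^4,g(t))_{t\in[0,T)}$ is a smooth solution of the Ricci flow $\partial_t g=-2\,\mathrm{Ricci}(g)$; $T<\infty$; and the scalar curvature satisfies $\sup_{M\times[0,T)}|\mathrm R|\le1$. Notation: $d(x,y,t)$ is the distance of $g(t)$; ${}^tB_r(p)$ is the open $g(t)$-ball. The manifold structure on $N$ is compatible with the topology induced by $d_X$; $f_*g(t)$ is the push-forward of $g(t)|_V$ by $f|_V$, and the limit is taken for the metric components in local coordinates. Good time: $t\in[0,T)$ with $\int_M|\mathrm{Rc}|^4(\cdot,t)\,d\mu_{g(t)}\le\frac1{T-t}$. Regular and singular points of $M$: $\mathrm{Reg}(M)$ is the set of $p\in M$ for which there is $r>0$ with $\int_{{}^tB_r(p)}|\mathrm{Riem}|^2(\cdot,t)\,d\mu_{g(t)}\le\varepsilon_0$ for all $t\in[0,T)$; $\mathrm{Sing}(M)=M\setminus\mathrm{Reg}(M)$. For $t\in(0,T)$, $\mathrm{Reg}_t(M)$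 is the set of $p\in M$ with $\int_{{}^tB_{R\sqrt{T-t}}(p)}|\mathrm{Riem}|^2(\cdot,t)\,d\mu_{g(t)}\le\varepsilon_0$. Here $R>0$ (large) and $v,\varepsilon_0>0$ (small) are constants depending only on $(M,g(0))$ and $T$, fixed with the property (such constants exist): whenever $t$ is a good time with $|T-t|\le v$ and $p\in\mathrm{Reg}_t(M)$, then all points of ${}^tB_{\frac R2\sqrt{T-t}}(p)$ lie in $\mathrm{Reg}(M)$, and on this ball, for all $r,s\in[t,T)$, $\frac12g(r)\le g(s)\le2g(r)$, $e^{-\theta}g(r)\le g(s)\le e^{\theta}g(r)$ with $\theta=8|(r-t)^{1/4}-(s-t)^{1/4}|/(T-t)^{1/4}$, and $|\nabla^j\mathrm{Riem}(\cdot,s)|^2_{g(s)}\le c_j/(T-t)^{j+2}$ for $s\in[\frac{T+t}2,T)$, with constants $c_j$. Limit space: $X=\{[x]\mid x\in M\}$, where $[x]=[y]$ iff $d(x,y,t)\to0$ as $t\nearrow T$; $d_X([x],[y])=\lim_{t\nearrow T}d(x,y,t)$ (well defined, and a metric); $f:M\to X$, $f(x)=[x]$. The points $x_1,\dots,x_L$: there are constants $J_0,J_1,J_2,w>0$ and $L_0\in\mathbb N$ such that for every good time $s$ with $T-s\le w$ there are points $p_1(s),\dots,p_{L_0}(s)\in M$ with $\mathrm{Sing}(M)\subseteq(\mathrm{Reg}_s(M))^c\subseteq\bigcup_j{}^tB_{J_0\sqrt{T-s}}(p_j(s))\subseteq\bigcup_j{}^sB_{J_1\sqrt{T-s}}(p_j(s))\subseteq\bigcup_j{}^rB_{J_2\sqrt{T-s}}(p_j(s))$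 for all $t,r\in[s,T)$. Take a sequence of good times $t_i\nearrow T$ with such points $p_j(t_i)$ and pass to a subsequence so that $f(p_j(t_i))$ converges in the compact space $(X,d_X)$ for each $j$; $x_1,\dots,x_L$ are the distinct limit points so obtained. *)

theory Defs
  imports "HOL-Analysis.Analysis"
begin

section \<open>Smooth maps on subsets of Euclidean spaces\<close>

text \<open>
  Derivatives are taken within the set, so that the definition also applies to
  (open set) \<open>\<times> [0,T)\<close>, with one-sided time derivatives at \<open>0\<close>. It is only used for open sets and
  for such products, where the derivative within the set is unique.
\<close>

primrec Ck_on :: "nat \<Rightarrow> 'e::real_normed_vector set \<Rightarrow> ('e \<Rightarrow> 'f::real_normed_vector) \<Rightarrow> bool" where
  "Ck_on 0 S f \<longleftrightarrow> continuous_on S f"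
| "Ck_on (Suc k) S f \<longleftrightarrow> (\<forall>x\<in>S. f differentiable (at x within S)) \<and>
     (\<forall>v. Ck_on k S (\<lambda>x. frechet_derivative f (at x within S) v))"

definition smooth_on :: "'e::real_normed_vector set \<Rightarrow> ('e \<Rightarrow> 'f::real_normed_vector) \<Rightarrow> bool" where
  "smooth_on S f \<longleftrightarrow> (\<forall>k. Ck_on k S f)"


section \<open>Smooth manifolds\<close>

text \<open>
  A chart is a pair of its domain and its coordinate map. A manifold is given by a topology \<open>X\<close> and a
  smooth atlas \<open>A\<close>, which need not be maximal: it stands for the smooth structure it generates.
\<close>

type_synonym ('a, 'n) chart = "'a set \<times> ('a \<Rightarrow> real^'n)"

definition chart_image :: "('a, 'n::finite) chart \<Rightarrow> (real^'n) set" where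
  "chart_image c = snd c ` fst c"

definition chart_inv :: "('a, 'n::finite) chart \<Rightarrow> real^'n \<Rightarrow> 'a" where
  "chart_inv c = inv_into (fst c) (snd c)"

definition is_chart :: "'a topology \<Rightarrow> ('a, 'n::finite) chart \<Rightarrow> bool" where
  "is_chart X c \<longleftrightarrow> openin X (fst c) \<and> open (chart_image c) \<and>
     homeomorphic_map (subtopology X (fst c)) (top_of_set (chart_image c)) (snd c)"

definition smooth_manifold :: "'a topology \<Rightarrow> ('a, 'n::finite) chart set \<Rightarrow> bool" where
  "smooth_manifold X A \<longleftrightarrow>
     Hausdorff_space X \<and> second_countable X \<and>
     (\<forall>c\<in>A. is_chart X c) \<and> topspace X = (\<Union>c\<in>A. fst c) \<and>
     (\<forall>c\<in>A. \<forall>c'\<in>A. smooth_on (snd c ` (fst c \<inter> fst c')) (snd c' \<circ> chart_inv c))"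

definition restrict_atlas :: "'a set \<Rightarrow> ('a, 'n::finite) chart set \<Rightarrow> ('a, 'n) chart set" where
  "restrict_atlas V A = (\<lambda>c. (fst c \<inter> V, snd c)) ` A"

definition smooth_map ::
  "'a topology \<Rightarrow> ('a, 'm::finite) chart set \<Rightarrow> 'b topology \<Rightarrow> ('b, 'n::finite) chart set \<Rightarrow>
   ('a \<Rightarrow> 'b) \<Rightarrow> bool" where
  "smooth_map X A Y B f \<longleftrightarrow> continuous_map X Y f \<and>
     (\<forall>c\<in>A. \<forall>c'\<in>B. smooth_on (snd c ` {p\<in>fst c. f p \<in> fst c'}) (snd c' \<circ> f \<circ> chart_inv c))"

definition diffeomorphism ::
  "'a topology \<Rightarrow> ('a, 'm::finite) chart set \<Rightarrow> 'b topology \<Rightarrow> ('b, 'n::finite) chart set \<Rightarrow>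
   ('a \<Rightarrow> 'b) \<Rightarrow> bool" where
  "diffeomorphism X A Y B f \<longleftrightarrow>
     bij_betw f (topspace X) (topspace Y) \<and>
     smooth_map X A Y B f \<and> smooth_map Y B X A (inv_into (topspace X) f)"


section \<open>Riemannian metrics\<close>

text \<open>
  A symmetric 2-tensor field is given by its component matrix in every chart of the atlas, subject
  to the transformation law.
\<close>

type_synonym ('a, 'n) metric_field = "('a, 'n) chart \<Rightarrow> 'a \<Rightarrow> real^'n^'n"

definition coord_metric :: "('a, 'n::finite) metric_field \<Rightarrow> ('a, 'n) chart \<Rightarrow> real^'n \<Rightarrow> real^'n^'n" where
  "coord_metric g c x = g c (chart_inv c x)"

definition metric_form :: "('a, 'n::finite) metric_field \<Rightarrow> ('a, 'n) chart \<Rightarrow> 'a \<Rightarrow> real^'n \<Rightarrow> real" where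
  "metric_form g c p u = u \<bullet> (g c p *v u)"

definition riemannian_metric :: "('a, 'n::finite) chart set \<Rightarrow> ('a, 'n) metric_field \<Rightarrow> bool" where
  "riemannian_metric A g \<longleftrightarrow>
     (\<forall>c\<in>A. (\<forall>p\<in>fst c. transpose (g c p) = g c p \<and> (\<forall>u. u \<noteq> 0 \<longrightarrow> 0 < metric_form g c p u)) \<and>
            smooth_on (chart_image c) (coord_metric g c)) \<and>
     (\<forall>c\<in>A. \<forall>c'\<in>A. \<forall>p\<in>fst c \<inter> fst c'.
        let J = jacobian (snd c' \<circ> chart_inv c) (at (snd c p))
        in g c p = transpose J ** g c' p ** J)"

text \<open>
  Quantities that do not depend on the choice of a chart are evaluated in an arbitrary chart
  around the point.
\<close>

definition chart_at :: "('a, 'n::finite) chart set \<Rightarrow> 'a \<Rightarrow> ('a, 'n) chart" where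
  "chart_at A p = (SOME c. c \<in> A \<and> p \<in> fst c)"

text \<open>
  Components at \<open>y \<in> fst c\<close> of \<open>F\<^sub>* g\<close>, for a diffeomorphism \<open>F\<close> from the open subset \<open>V\<close> of \<open>(X, A)\<close>
  to a manifold with chart \<open>c\<close>, that is, of the pull-back of \<open>g\<close> by the inverse of \<open>F\<close>.
\<close>

definition push_forward ::
  "('a, 'n::finite) chart set \<Rightarrow> 'a set \<Rightarrow> ('a \<Rightarrow> 'b) \<Rightarrow> ('a, 'n) metric_field \<Rightarrow> ('b, 'n) metric_field" where
  "push_forward A V F g c y =
     (let p = inv_into V F y;
          a = chart_at A p;
          J = jacobian (snd a \<circ> inv_into V F \<circ> chart_inv c) (at (snd c y))
      in transpose J ** g a p ** J)"


section \<open>Curvature in coordinates\<close>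

definition partial_deriv :: "'n::finite \<Rightarrow> (real^'n \<Rightarrow> real) \<Rightarrow> real^'n \<Rightarrow> real" where
  "partial_deriv i F x = frechet_derivative F (at x) (axis i 1)"

definition christoffel :: "(real^'n \<Rightarrow> real^'n^'n) \<Rightarrow> real^'n \<Rightarrow> 'n::finite \<Rightarrow> 'n \<Rightarrow> 'n \<Rightarrow> real" where
  \<comment> \<open>\<open>christoffel G x k i j\<close> has the upper index \<open>k\<close>\<close>
  "christoffel G x k i j = (1/2) * (\<Sum>l\<in>UNIV. matrix_inv (G x) $ k $ l *
     (partial_deriv i (\<lambda>y. G y $ j $ l) x + partial_deriv j (\<lambda>y. G y $ i $ l) x
      - partial_deriv l (\<lambda>y. G y $ i $ j) x))"

definition curvature_up ::
  "(real^'n \<Rightarrow> real^'n^'n) \<Rightarrow> real^'n \<Rightarrow> 'n::finite \<Rightarrow> 'n \<Rightarrow> 'n \<Rightarrow> 'n \<Rightarrow> real" where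
  \<comment> \<open>the \<open>l\<close>-th component of \<open>R(\<partial>\<^sub>i,\<partial>\<^sub>j)\<partial>\<^sub>k = \<nabla>\<^sub>i\<nabla>\<^sub>j\<partial>\<^sub>k - \<nabla>\<^sub>j\<nabla>\<^sub>i\<partial>\<^sub>k\<close>\<close>
  "curvature_up G x i j k l =
     partial_deriv i (\<lambda>y. christoffel G y l j k) x - partial_deriv j (\<lambda>y. christoffel G y l i k) x
     + (\<Sum>p\<in>UNIV. christoffel G x l i p * christoffel G x p j k
                 - christoffel G x l j p * christoffel G x p i k)"

definition ricci :: "(real^'n \<Rightarrow> real^'n^'n) \<Rightarrow> real^'n \<Rightarrow> real^'n::finite^'n" where
  \<comment> \<open>\<open>Ric(Y,Z)\<close> is the trace of \<open>X \<mapsto> R(X,Y)Z\<close>, so round spheres have positive Ricci curvature\<close>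
  "ricci G x = (\<chi> j k. \<Sum>i\<in>UNIV. curvature_up G x i j k i)"

definition scalar_curv :: "(real^'n \<Rightarrow> real^'n^'n) \<Rightarrow> real^'n::finite \<Rightarrow> real" where
  "scalar_curv G x = (\<Sum>j\<in>UNIV. \<Sum>k\<in>UNIV. matrix_inv (G x) $ j $ k * ricci G x $ j $ k)"

text \<open>
  The components of a covariant tensor field of order \<open>m\<close> are indexed by lists of length \<open>m\<close>; the
  values on lists of other lengths are irrelevant. The derivative index of \<open>\<nabla>S\<close> comes first.
\<close>

type_synonym 'n tensor = "real^'n \<Rightarrow> 'n list \<Rightarrow> real"

definition riem_tensor :: "(real^'n \<Rightarrow> real^'n^'n) \<Rightarrow> 'n::finite tensor" where
  "riem_tensor G x I =
     (\<Sum>m\<in>UNIV. G x $ (I ! 3) $ m * curvature_up G x (I ! 0) (I ! 1) (I ! 2) m)"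

definition ricci_tensor :: "(real^'n \<Rightarrow> real^'n^'n) \<Rightarrow> 'n::finite tensor" where
  "ricci_tensor G x I = ricci G x $ (I ! 0) $ (I ! 1)"

definition cov_deriv :: "(real^'n \<Rightarrow> real^'n^'n) \<Rightarrow> 'n::finite tensor \<Rightarrow> 'n tensor" where
  "cov_deriv G S x I =
     (case I of [] \<Rightarrow> 0
      | k # J \<Rightarrow> partial_deriv k (\<lambda>y. S y J) x
          - (\<Sum>m<length J. \<Sum>l\<in>UNIV. christoffel G x l k (J ! m) * S x (J[m := l])))"

definition tensor_norm_sq :: "(real^'n \<Rightarrow> real^'n^'n) \<Rightarrow> nat \<Rightarrow> 'n::finite tensor \<Rightarrow> real^'n \<Rightarrow> real" where
  "tensor_norm_sq G m S x =
     (\<Sum>I\<in>{I. length I = m}. \<Sum>J\<in>{J. length J = m}.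
        (\<Prod>a<m. matrix_inv (G x) $ (I ! a) $ (J ! a)) * S x I * S x J)"


subsection \<open>The corresponding functions on the manifold\<close>

definition scalar_at :: "('a, 'n::finite) chart set \<Rightarrow> ('a, 'n) metric_field \<Rightarrow> 'a \<Rightarrow> real" where
  "scalar_at A g p = (let c = chart_at A p in scalar_curv (coord_metric g c) (snd c p))"

definition ricci_norm_sq :: "('a, 'n::finite) chart set \<Rightarrow> ('a, 'n) metric_field \<Rightarrow> 'a \<Rightarrow> real" where
  "ricci_norm_sq A g p =
     (let c = chart_at A p; G = coord_metric g c in tensor_norm_sq G 2 (ricci_tensor G) (snd c p))"

definition nabla_riem_norm_sq ::
  "nat \<Rightarrow> ('a, 'n::finite) chart set \<Rightarrow> ('a, 'n) metric_field \<Rightarrow> 'a \<Rightarrow> real" where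
  "nabla_riem_norm_sq j A g p =
     (let c = chart_at A p; G = coord_metric g c
      in tensor_norm_sq G (j + 4) ((cov_deriv G ^^ j) (riem_tensor G)) (snd c p))"


section \<open>Riemannian volume and distance\<close>

text \<open>
  The Riemannian volume is the unique Borel measure that is given by the density
  \<open>sqrt (det g)\<close> in every chart.
\<close>

definition is_riem_volume ::
  "'a topology \<Rightarrow> ('a, 'n::finite) chart set \<Rightarrow> ('a, 'n) metric_field \<Rightarrow> 'a measure \<Rightarrow> bool" where
  "is_riem_volume X A g \<mu> \<longleftrightarrow>
     sets \<mu> = sigma_sets (topspace X) {U. openin X U} \<and>
     (\<forall>c\<in>A. \<forall>E\<in>sets \<mu>. E \<subseteq> fst c \<longrightarrow>
        emeasure \<mu> E = (\<integral>\<^sup>+ x \<in> snd c ` E. ennreal (sqrt (det (coord_metric g c x))) \<partial>lborel))"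

definition riem_volume ::
  "'a topology \<Rightarrow> ('a, 'n::finite) chart set \<Rightarrow> ('a, 'n) metric_field \<Rightarrow> 'a measure" where
  "riem_volume X A g = (THE \<mu>. is_riem_volume X A g \<mu>)"

text \<open>\<open>C\<^sup>1\<close> on a closed interval, including one-sided derivatives at the end points.\<close>

definition C1_curve_on :: "('a, 'n::finite) chart set \<Rightarrow> real \<Rightarrow> real \<Rightarrow> (real \<Rightarrow> 'a) \<Rightarrow> bool" where
  "C1_curve_on A a b \<gamma> \<longleftrightarrow>
     (\<forall>c\<in>A. \<exists>D. continuous_on {s\<in>{a..b}. \<gamma> s \<in> fst c} D \<and>
        (\<forall>s\<in>{a..b}. \<gamma> s \<in> fst c \<longrightarrow>
           ((snd c \<circ> \<gamma>) has_vector_derivative D s) (at s within {a..b})))"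

definition piecewise_C1_curve ::
  "'a topology \<Rightarrow> ('a, 'n::finite) chart set \<Rightarrow> (real \<Rightarrow> 'a) \<Rightarrow> bool" where
  "piecewise_C1_curve X A \<gamma> \<longleftrightarrow> pathin X \<gamma> \<and>
     (\<exists>n a. a 0 = 0 \<and> a n = 1 \<and> (\<forall>i<n. a i < a (Suc i) \<and> C1_curve_on A (a i) (a (Suc i)) \<gamma>))"

definition curve_speed ::
  "('a, 'n::finite) chart set \<Rightarrow> ('a, 'n) metric_field \<Rightarrow> (real \<Rightarrow> 'a) \<Rightarrow> real \<Rightarrow> real" where
  "curve_speed A g \<gamma> s =
     (let c = chart_at A (\<gamma> s)
      in sqrt (metric_form g c (\<gamma> s) (vector_derivative (snd c \<circ> \<gamma>) (at s))))"

definition curve_length ::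
  "('a, 'n::finite) chart set \<Rightarrow> ('a, 'n) metric_field \<Rightarrow> (real \<Rightarrow> 'a) \<Rightarrow> real" where
  \<comment> \<open>the finitely many break points do not contribute\<close>
  "curve_length A g \<gamma> = integral {0..1} (curve_speed A g \<gamma>)"

definition riem_dist ::
  "'a topology \<Rightarrow> ('a, 'n::finite) chart set \<Rightarrow> ('a, 'n) metric_field \<Rightarrow> 'a \<Rightarrow> 'a \<Rightarrow> real" where
  "riem_dist X A g x y =
     Inf {curve_length A g \<gamma> |\<gamma>. piecewise_C1_curve X A \<gamma> \<and> \<gamma> 0 = x \<and> \<gamma> 1 = y}"

definition riem_ball ::
  "'a topology \<Rightarrow> ('a, 'n::finite) chart set \<Rightarrow> ('a, 'n) metric_field \<Rightarrow> 'a \<Rightarrow> real \<Rightarrow> 'a set" where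
  "riem_ball X A g p r = {q \<in> topspace X. riem_dist X A g p q < r}"


section \<open>Ricci flow with bounded scalar curvature\<close>

definition ricci_flow ::
  "('a, 'n::finite) chart set \<Rightarrow> real \<Rightarrow> (real \<Rightarrow> ('a, 'n) metric_field) \<Rightarrow> bool" where
  "ricci_flow A T g \<longleftrightarrow>
     (\<forall>t\<in>{0..<T}. riemannian_metric A (g t)) \<and>
     (\<forall>c\<in>A. smooth_on (chart_image c \<times> {0..<T}) (\<lambda>(x, t). coord_metric (g t) c x)) \<and>
     (\<forall>c\<in>A. \<forall>p\<in>fst c. \<forall>t\<in>{0..<T}.
        ((\<lambda>s. g s c p) has_vector_derivative (- 2) *\<^sub>R ricci (coord_metric (g t) c) (snd c p))
          (at t within {0..<T}))"

definition basic_assumptions ::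
  "'a topology \<Rightarrow> ('a, 4) chart set \<Rightarrow> real \<Rightarrow> (real \<Rightarrow> ('a, 4) metric_field) \<Rightarrow> bool" where
  "basic_assumptions X A T g \<longleftrightarrow>
     smooth_manifold X A \<and> compact_space X \<and> connected_space X \<and> topspace X \<noteq> {} \<and>
     0 < T \<and> ricci_flow A T g \<and>
     (\<forall>t\<in>{0..<T}. \<forall>p\<in>topspace X. \<bar>scalar_at A (g t) p\<bar> \<le> 1)"

definition good_time ::
  "'a topology \<Rightarrow> ('a, 4) chart set \<Rightarrow> real \<Rightarrow> (real \<Rightarrow> ('a, 4) metric_field) \<Rightarrow> real \<Rightarrow> bool" where
  "good_time X A T g t \<longleftrightarrow> t \<in> {0..<T} \<and>
     (\<integral>\<^sup>+ p. ennreal ((ricci_norm_sq A (g t) p)\<^sup>2) \<partial>riem_volume X A (g t)) \<le> ennreal (1 / (T - t))"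

definition riem_energy ::
  "'a topology \<Rightarrow> ('a, 4) chart set \<Rightarrow> ('a, 4) metric_field \<Rightarrow> 'a set \<Rightarrow> ennreal" where
  "riem_energy X A h B = (\<integral>\<^sup>+ p \<in> B. ennreal (nabla_riem_norm_sq 0 A h p) \<partial>riem_volume X A h)"

definition Reg ::
  "'a topology \<Rightarrow> ('a, 4) chart set \<Rightarrow> real \<Rightarrow> (real \<Rightarrow> ('a, 4) metric_field) \<Rightarrow> real \<Rightarrow> 'a set" where
  "Reg X A T g \<epsilon>0 =
     {p \<in> topspace X. \<exists>r>0. \<forall>t\<in>{0..<T}. riem_energy X A (g t) (riem_ball X A (g t) p r) \<le> ennreal \<epsilon>0}"

definition Sing ::
  "'a topology \<Rightarrow> ('a, 4) chart set \<Rightarrow> real \<Rightarrow> (real \<Rightarrow> ('a, 4) metric_field) \<Rightarrow> real \<Rightarrow> 'a set" where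
  "Sing X A T g \<epsilon>0 = topspace X - Reg X A T g \<epsilon>0"

definition Reg_at ::
  "'a topology \<Rightarrow> ('a, 4) chart set \<Rightarrow> real \<Rightarrow> (real \<Rightarrow> ('a, 4) metric_field) \<Rightarrow> real \<Rightarrow> real \<Rightarrow>
   real \<Rightarrow> 'a set" where
  "Reg_at X A T g \<epsilon>0 R t =
     {p \<in> topspace X.
        riem_energy X A (g t) (riem_ball X A (g t) p (R * sqrt (T - t))) \<le> ennreal \<epsilon>0}"

text \<open>
  The property by which the constants \<open>R\<close>, \<open>v\<close>, \<open>\<epsilon>0\<close> and \<open>cst j\<close> are fixed. Inequalities between
  metrics are inequalities between quadratic forms.
\<close>

definition regularity_constants ::
  "'a topology \<Rightarrow> ('a, 4) chart set \<Rightarrow> real \<Rightarrow> (real \<Rightarrow> ('a, 4) metric_field) \<Rightarrow>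
   real \<Rightarrow> real \<Rightarrow> real \<Rightarrow> (nat \<Rightarrow> real) \<Rightarrow> bool" where
  "regularity_constants X A T g R v \<epsilon>0 cst \<longleftrightarrow>
     0 < R \<and> 0 < v \<and> 0 < \<epsilon>0 \<and>
     (\<forall>t p. good_time X A T g t \<and> 0 < t \<and> \<bar>T - t\<bar> \<le> v \<and> p \<in> Reg_at X A T g \<epsilon>0 R t \<longrightarrow>
        (\<forall>q\<in>riem_ball X A (g t) p (R / 2 * sqrt (T - t)).
           q \<in> Reg X A T g \<epsilon>0 \<and>
           (\<forall>r\<in>{t..<T}. \<forall>s\<in>{t..<T}. \<forall>c\<in>A. q \<in> fst c \<longrightarrow> (\<forall>u.
              let \<theta> = 8 * \<bar>root 4 (r - t) - root 4 (s - t)\<bar> / root 4 (T - t);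
                  gr = metric_form (g r) c q u;
                  gs = metric_form (g s) c q u
              in (1/2) * gr \<le> gs \<and> gs \<le> 2 * gr \<and>
                 exp (- \<theta>) * gr \<le> gs \<and> gs \<le> exp \<theta> * gr)) \<and>
           (\<forall>j. \<forall>s\<in>{(T + t) / 2..<T}.
              nabla_riem_norm_sq j A (g s) q \<le> cst j / (T - t) ^ (j + 2))))"

definition covering_points ::
  "'a topology \<Rightarrow> ('a, 4) chart set \<Rightarrow> real \<Rightarrow> (real \<Rightarrow> ('a, 4) metric_field) \<Rightarrow>
   real \<Rightarrow> real \<Rightarrow> real \<Rightarrow> real \<Rightarrow> real \<Rightarrow> nat \<Rightarrow> real \<Rightarrow> (nat \<Rightarrow> 'a) \<Rightarrow> bool" where
  "covering_points X A T g \<epsilon>0 R J0 J1 J2 L0 s p \<longleftrightarrow>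
     (\<forall>j\<in>{1..L0}. p j \<in> topspace X) \<and>
     (\<forall>t\<in>{s..<T}. \<forall>r\<in>{s..<T}.
        let B = (\<lambda>\<tau> J. \<Union>j\<in>{1..L0}. riem_ball X A (g \<tau>) (p j) (J * sqrt (T - s)))
        in Sing X A T g \<epsilon>0 \<subseteq> topspace X - Reg_at X A T g \<epsilon>0 R s \<and>
           topspace X - Reg_at X A T g \<epsilon>0 R s \<subseteq> B t J0 \<and>
           B t J0 \<subseteq> B s J1 \<and> B s J1 \<subseteq> B r J2)"


section \<open>The limit space\<close>

definition limit_class ::
  "'a topology \<Rightarrow> ('a, 4) chart set \<Rightarrow> real \<Rightarrow> (real \<Rightarrow> ('a, 4) metric_field) \<Rightarrow> 'a \<Rightarrow> 'a set" where
  \<comment> \<open>as a function of the point, this is the map \<open>f : M \<rightarrow> X\<close>\<close>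
  "limit_class X A T g x =
     {y \<in> topspace X. ((\<lambda>t. riem_dist X A (g t) x y) \<longlongrightarrow> 0) (at_left T)}"

definition limit_space ::
  "'a topology \<Rightarrow> ('a, 4) chart set \<Rightarrow> real \<Rightarrow> (real \<Rightarrow> ('a, 4) metric_field) \<Rightarrow> 'a set set" where
  "limit_space X A T g = limit_class X A T g ` topspace X"

text \<open>
  The value \<open>0\<close> outside the limit space makes the function total, as required by the locale
  \<open>Metric_space\<close>.
\<close>

definition limit_dist ::
  "'a topology \<Rightarrow> ('a, 4) chart set \<Rightarrow> real \<Rightarrow> (real \<Rightarrow> ('a, 4) metric_field) \<Rightarrow>
   'a set \<Rightarrow> 'a set \<Rightarrow> real" where
  "limit_dist X A T g a b =
     (if a \<in> limit_space X A T g \<and> b \<in> limit_space X A T g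
      then THE d. \<exists>x\<in>a. \<exists>y\<in>b. ((\<lambda>t. riem_dist X A (g t) x y) \<longlongrightarrow> d) (at_left T)
      else 0)"

definition limit_topology ::
  "'a topology \<Rightarrow> ('a, 4) chart set \<Rightarrow> real \<Rightarrow> (real \<Rightarrow> ('a, 4) metric_field) \<Rightarrow> 'a set topology" where
  "limit_topology X A T g = Metric_space.mtopology (limit_space X A T g) (limit_dist X A T g)"

end

theory Submission
  imports Defs
begin

text \<open>
  A point whose class avoids the limits of the covering centres lies in \<open>Reg_at\<close> of some good time
  \<open>\<tau> i\<close>: otherwise it would stay, for all later times, within \<open>J0 * sqrt (T - \<tau> i)\<close> of one of the
  centres. Around such a point the metrics \<open>g s\<close> are uniformly equivalent. Hence small coordinate
  segments are short and curves leaving a coordinate ball are long, uniformly in \<open>s\<close>, and \<open>f\<close> is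
  locally a homeomorphism onto its image, injective on \<open>V\<close>. The charts of \<open>N\<close> are those of \<open>V\<close>.

  For the smoothness of the limit metric, the bounds on \<open>|\<nabla>\<^sup>jRiem|\<close> become bounds on components
  in one fixed chart, because covariant derivatives are tensorial. With \<open>H = G\<^sup>-\<^sup>1\<close>, induction on \<open>k\<close>
  shows that all coordinate derivatives of \<open>G\<close>, \<open>H\<close> and \<open>\<nabla>\<^sup>jRiem\<close> of order at most \<open>k\<close> stay bounded
  up to time \<open>T\<close>: the time derivative of the Christoffel symbols \<open>\<Gamma>\<close> is an expression in \<open>H\<close> and
  \<open>\<nabla>Ric\<close> without \<open>\<Gamma>\<close>, so \<open>\<Gamma>\<close> is bounded to order \<open>k\<close>, and the first derivatives of \<open>G\<close>, \<open>H\<close> and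
  \<open>\<nabla>\<^sup>jRiem\<close> are products of quantities that are bounded to order \<open>k\<close>. Since then also \<open>\<partial>\<^sub>t G = -2 Ric\<close>
  is bounded to every order, \<open>g t\<close> converges with all its derivatives.
\<close>

section \<open>Smooth functions on open sets\<close>

text \<open>Convergence itself is cheap: a bounded time derivative makes each quantity Lipschitz in
  t, so it converges with rate T - t, uniformly in space. The work lies in bounding coordinate
  derivatives, because the hypotheses control tensor norms, taken in a chart that
  \<open>chart_at\<close> picks anew at every point, while derivatives of components make sense only
  in one chart. Two observations make the transfer possible without special coordinates. Christoffel
  symbols are no tensor, but their time derivative is one, being an infinitesimal difference of
  connections; integrating it from a time t0 at which everything is smooth on a compact set bounds
  them without any equation for their space derivatives. And the uniform equivalence of the metrics
  on a compact coordinate ball makes tensor norms and component bounds comparable up to time T. The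
  comparison of the metrics starts at a good time t1, the curvature bounds at (T + t1) / 2, which is
  therefore taken as t0. Staying away from time 0 keeps all times interior, so that two-sided time
  derivatives can be used.\<close>

lemma differentiable_imp_has_derivative:
  "f differentiable F \<Longrightarrow> (f has_derivative frechet_derivative f F) F"
  by (simp add: frechet_derivative_works)

text \<open>\<open>frechet_derivative\<close> is a choice among all derivatives, so it suffices that
  both functions have the same ones; neither needs to be differentiable.\<close>

lemma frechet_derivative_within_cong:
  assumes "\<And>y. y \<in> S \<Longrightarrow> f y = g y" "x \<in> S"
  shows "frechet_derivative f (at x within S) = frechet_derivative g (at x within S)"
proof -
  have "(f has_derivative D) (at x within S) \<longleftrightarrow> (g has_derivative D) (at x within S)" for D
    using assms has_derivative_transform[of x S f g D] has_derivative_transform[of x S g f D] by auto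
  then show ?thesis by (simp add: frechet_derivative_def)
qed

lemma Ck_on_cong:
  assumes "\<And>y. y \<in> S \<Longrightarrow> f y = g y"
  shows "Ck_on k S f \<longleftrightarrow> Ck_on k S g"
  using assms
proof (induction k arbitrary: f g)
  case 0
  then show ?case using continuous_on_cong[of S S f g] by simp
next
  case (Suc k)
  have "f differentiable (at x within S) \<longleftrightarrow> g differentiable (at x within S)" if "x \<in> S" for x
    using Suc.prems that has_derivative_transform[of x S f g] has_derivative_transform[of x S g f]
    unfolding differentiable_def by auto
  moreover have "Ck_on k S (\<lambda>x. frechet_derivative f (at x within S) v) \<longleftrightarrow>
      Ck_on k S (\<lambda>x. frechet_derivative g (at x within S) v)" for v
  proof (rule Suc.IH)
    fix y assume "y \<in> S"
    then show "frechet_derivative f (at y within S) v = frechet_derivative g (at y within S) v"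
      using frechet_derivative_within_cong[of S f g y] Suc.prems by simp
  qed
  ultimately show ?case unfolding Ck_on.simps(2) by blast
qed

text \<open>On open sets the derivative within the set is the plain one, to which the calculus rules
  apply.\<close>

lemma Ck_on_Suc_open:
  assumes "open S"
  shows "Ck_on (Suc k) S f \<longleftrightarrow> (\<forall>x\<in>S. f differentiable (at x)) \<and>
    (\<forall>v. Ck_on k S (\<lambda>x. frechet_derivative f (at x) v))"
proof -
  have at: "at x within S = at x" if "x \<in> S" for x
    using at_within_open[OF that assms] .
  have "Ck_on k S (\<lambda>x. frechet_derivative f (at x within S) v) \<longleftrightarrow>
      Ck_on k S (\<lambda>x. frechet_derivative f (at x) v)" for v
    by (rule Ck_on_cong) (simp add: at)
  then show ?thesis
    by (simp add: at)
qed

lemma Ck_on_open_subset: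
  assumes "Ck_on k S f" "open U" "U \<subseteq> S"
  shows "Ck_on k U f"
  using assms(1)
proof (induction k arbitrary: f)
  case 0
  then show ?case using assms(3) by (auto intro: continuous_on_subset)
next
  case (Suc k)
  have at: "at x within S = at x" if "x \<in> U" for x
    using assms that by (metis at_within_open_subset)
  have "f differentiable (at x)" if "x \<in> U" for x
    using Suc.prems that assms(3) at by fastforce
  moreover have "Ck_on k U (\<lambda>x. frechet_derivative f (at x) v)" for v
  proof -
    have "Ck_on k U (\<lambda>x. frechet_derivative f (at x within S) v)"
      using Suc by auto
    then show ?thesis
      by (subst (asm) Ck_on_cong) (auto simp: at)
  qed
  ultimately show ?case using assms(2) by (simp add: Ck_on_Suc_open del: Ck_on.simps)
qed

lemma Ck_on_local:
  assumes "open S" "\<And>x. x \<in> S \<Longrightarrow> \<exists>U. open U \<and> x \<in> U \<and> U \<subseteq> S \<and> Ck_on k U f"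
  shows "Ck_on k S f"
  using assms(2)
proof (induction k arbitrary: f)
  case 0
  have "isCont f x" if "x \<in> S" for x
    using 0[OF that] continuous_on_eq_continuous_at by auto
  then show ?case
    by (simp add: continuous_at_imp_continuous_on)
next
  case (Suc k)
  have *: "\<exists>U. open U \<and> x \<in> U \<and> U \<subseteq> S \<and> f differentiable (at x) \<and>
      (\<forall>v. Ck_on k U (\<lambda>x. frechet_derivative f (at x) v))" if x: "x \<in> S" for x
  proof -
    from Suc.prems[OF x] obtain U where U: "open U" "x \<in> U" "U \<subseteq> S" "Ck_on (Suc k) U f" by auto
    show ?thesis
      by (rule exI[of _ U]) (use U in \<open>simp add: Ck_on_Suc_open del: Ck_on.simps\<close>)
  qed
  have "Ck_on k S (\<lambda>x. frechet_derivative f (at x) v)" for v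
    by (rule Suc.IH) (use * in blast)
  then show ?case using assms(1) * by (simp add: Ck_on_Suc_open del: Ck_on.simps) blast
qed

lemma Ck_on_SucD: "Ck_on (Suc k) S f \<Longrightarrow> Ck_on k S f"
proof (induction k arbitrary: f)
  case 0
  then have "f differentiable (at x within S)" if "x \<in> S" for x
    using that by simp
  then show ?case
    by (simp add: continuous_on_eq_continuous_within differentiable_imp_continuous_within)
next
  case (Suc k)
  have 1: "Ck_on k S (\<lambda>x. frechet_derivative f (at x within S) v)" for v
    by (rule Suc.IH) (use Suc.prems Ck_on.simps(2)[of "Suc k" S f] in blast)
  have 2: "\<forall>x\<in>S. f differentiable (at x within S)"
    using Suc.prems Ck_on.simps(2)[of "Suc k" S f] by blast
  show ?case unfolding Ck_on.simps(2)[of k S f] using 1 2 by blast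
qed

lemma smooth_on_imp_differentiable:
  assumes "open S" "smooth_on S f" "x \<in> S"
  shows "f differentiable (at x)"
proof -
  have "Ck_on (Suc 0) S f" using assms(2) by (simp add: smooth_on_def)
  then show ?thesis using assms by (simp add: Ck_on_Suc_open del: Ck_on.simps)
qed

lemma smooth_on_imp_continuous_on: "smooth_on S f \<Longrightarrow> continuous_on S f"
  unfolding smooth_on_def by (drule spec[of _ 0]) simp

lemma smooth_on_frechet_derivative:
  assumes "open S" "smooth_on S f"
  shows "smooth_on S (\<lambda>x. frechet_derivative f (at x) v)"
  unfolding smooth_on_def
proof
  fix k
  have "Ck_on (Suc k) S f" using assms(2) by (simp add: smooth_on_def)
  then show "Ck_on k S (\<lambda>x. frechet_derivative f (at x) v)"
    using assms(1) by (simp add: Ck_on_Suc_open del: Ck_on.simps)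
qed

lemma smooth_on_cong:
  assumes "\<And>y. y \<in> S \<Longrightarrow> f y = g y"
  shows "smooth_on S f \<longleftrightarrow> smooth_on S g"
  unfolding smooth_on_def by (simp add: Ck_on_cong[OF assms])

lemma smooth_on_open_subset: "smooth_on S f \<Longrightarrow> open U \<Longrightarrow> U \<subseteq> S \<Longrightarrow> smooth_on U f"
  unfolding smooth_on_def using Ck_on_open_subset[of _ S f U] by simp

lemma smooth_on_local:
  assumes "open S" "\<And>x. x \<in> S \<Longrightarrow> \<exists>U. open U \<and> x \<in> U \<and> U \<subseteq> S \<and> smooth_on U f"
  shows "smooth_on S f"
  unfolding smooth_on_def
proof
  fix k show "Ck_on k S f"
  proof (rule Ck_on_local[OF assms(1)])
    fix x assume "x \<in> S"
    from assms(2)[OF this] obtain U where "open U" "x \<in> U" "U \<subseteq> S" "smooth_on U f" by auto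
    then show "\<exists>U. open U \<and> x \<in> U \<and> U \<subseteq> S \<and> Ck_on k U f" by (auto simp: smooth_on_def)
  qed
qed

section \<open>Algebra of smooth functions\<close>

lemma frechet_derivative_at_eq: "(f has_derivative D) (at x) \<Longrightarrow> frechet_derivative f (at x) = D"
  using frechet_derivative_at[of f D x] by simp

lemma Ck_on_const: "open S \<Longrightarrow> Ck_on k S (\<lambda>x. c)"
proof (induction k arbitrary: c)
  case (Suc k)
  then show ?case by (subst Ck_on_Suc_open) auto
qed simp

lemma Ck_on_add:
  assumes "open S" "Ck_on k S f" "Ck_on k S g"
  shows "Ck_on k S (\<lambda>x. f x + g x)"
  using assms(2,3)
proof (induction k arbitrary: f g)
  case 0
  then show ?case by (simp add: continuous_on_add)
next
  case (Suc k)
  have d: "f differentiable (at x)" "g differentiable (at x)" if "x \<in> S" for x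
    using Suc.prems that assms(1) by (simp_all add: Ck_on_Suc_open del: Ck_on.simps)
  have "Ck_on k S (\<lambda>x. frechet_derivative (\<lambda>x. f x + g x) (at x) v)" for v
  proof -
    have "Ck_on k S (\<lambda>x. frechet_derivative f (at x) v + frechet_derivative g (at x) v)"
      using Suc assms(1) by (simp add: Ck_on_Suc_open del: Ck_on.simps)
    moreover have "frechet_derivative (\<lambda>x. f x + g x) (at x) =
        (\<lambda>v. frechet_derivative f (at x) v + frechet_derivative g (at x) v)" if "x \<in> S" for x
      using d[OF that] by (intro frechet_derivative_at_eq has_derivative_add) (simp_all add: differentiable_imp_has_derivative)
    ultimately show ?thesis by (subst Ck_on_cong) auto
  qed
  then show ?case using d assms(1) by (simp add: Ck_on_Suc_open del: Ck_on.simps)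
qed

lemma Ck_on_mult:
  fixes f g :: "'a::real_normed_vector \<Rightarrow> real"
  assumes "open S" "Ck_on k S f" "Ck_on k S g"
  shows "Ck_on k S (\<lambda>x. f x * g x)"
  using assms(2,3)
proof (induction k arbitrary: f g)
  case 0
  then show ?case by (simp add: continuous_on_mult)
next
  case (Suc k)
  have d: "f differentiable (at x)" "g differentiable (at x)" if "x \<in> S" for x
    using Suc.prems that assms(1) by (simp_all add: Ck_on_Suc_open del: Ck_on.simps)
  have "Ck_on k S (\<lambda>x. frechet_derivative (\<lambda>x. f x * g x) (at x) v)" for v
  proof -
    have "Ck_on k S (\<lambda>x. f x * frechet_derivative g (at x) v + frechet_derivative f (at x) v * g x)"
      by (intro Ck_on_add assms(1) Suc.IH Suc.prems[THEN Ck_on_SucD])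
         (use Suc.prems assms(1) in \<open>simp_all add: Ck_on_Suc_open del: Ck_on.simps\<close>)
    moreover have "frechet_derivative (\<lambda>x. f x * g x) (at x) =
        (\<lambda>v. f x * frechet_derivative g (at x) v + frechet_derivative f (at x) v * g x)" if "x \<in> S" for x
      using d[OF that] by (intro frechet_derivative_at_eq has_derivative_mult) (simp_all add: differentiable_imp_has_derivative)
    ultimately show ?thesis by (subst Ck_on_cong) auto
  qed
  then show ?case using d assms(1) by (simp add: Ck_on_Suc_open del: Ck_on.simps)
qed

lemma Ck_on_bounded_linear:
  assumes "bounded_linear L" "open S" "Ck_on k S f"
  shows "Ck_on k S (\<lambda>x. L (f x))"
  using assms(3)
proof (induction k arbitrary: f)
  case 0
  then show ?case using assms(1) by (simp add: bounded_linear.continuous_on)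
next
  case (Suc k)
  have d: "((\<lambda>x. L (f x)) has_derivative (\<lambda>v. L (frechet_derivative f (at x) v))) (at x)" if "x \<in> S" for x
    using Suc.prems that assms
    by (intro bounded_linear.has_derivative[OF assms(1)]) (simp add: Ck_on_Suc_open differentiable_imp_has_derivative del: Ck_on.simps)
  have "Ck_on k S (\<lambda>x. frechet_derivative (\<lambda>x. L (f x)) (at x) v)" for v
  proof -
    have "Ck_on k S (\<lambda>x. L (frechet_derivative f (at x) v))"
      using Suc assms(2) by (simp add: Ck_on_Suc_open del: Ck_on.simps)
    then show ?thesis
      by (subst Ck_on_cong) (auto simp: frechet_derivative_at_eq[OF d])
  qed
  then show ?case using d assms(2) by (auto simp: Ck_on_Suc_open differentiable_def simp del: Ck_on.simps)
qed

text \<open>The derivative of 1/f is a polynomial in 1/f and the derivative of f, so the induction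
  on the order closes with the product rule alone.\<close>

lemma Ck_on_inverse:
  fixes f :: "'a::real_normed_vector \<Rightarrow> real"
  assumes "open S" "Ck_on k S f" "\<And>x. x \<in> S \<Longrightarrow> f x \<noteq> 0"
  shows "Ck_on k S (\<lambda>x. inverse (f x))"
  using assms(2)
proof (induction k)
  case 0
  then show ?case using assms(3) by (simp add: continuous_on_inverse)
next
  case (Suc k)
  have d: "((\<lambda>x. inverse (f x)) has_derivative
      (\<lambda>v. - (inverse (f x) * frechet_derivative f (at x) v * inverse (f x)))) (at x)" if "x \<in> S" for x
    using Suc.prems that assms
    by (intro Deriv.has_derivative_inverse) (simp_all add: Ck_on_Suc_open differentiable_imp_has_derivative del: Ck_on.simps)
  have "Ck_on k S (\<lambda>x. frechet_derivative (\<lambda>x. inverse (f x)) (at x) v)" for v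
  proof -
    have "Ck_on k S (\<lambda>x. (-1) * (inverse (f x) * frechet_derivative f (at x) v * inverse (f x)))"
      by (intro Ck_on_mult Ck_on_const assms(1) Suc.IH Ck_on_SucD[OF Suc.prems])
         (use Suc.prems assms(1) in \<open>simp_all add: Ck_on_Suc_open del: Ck_on.simps\<close>)
    then show ?thesis
      by (subst Ck_on_cong) (auto simp: frechet_derivative_at_eq[OF d])
  qed
  then show ?case using d assms(1) by (auto simp: Ck_on_Suc_open differentiable_def simp del: Ck_on.simps)
qed

lemma smooth_on_const: "open S \<Longrightarrow> smooth_on S (\<lambda>x. c)"
  by (simp add: smooth_on_def Ck_on_const)

lemma smooth_on_add: "open S \<Longrightarrow> smooth_on S f \<Longrightarrow> smooth_on S g \<Longrightarrow> smooth_on S (\<lambda>x. f x + g x)"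
  by (simp add: smooth_on_def Ck_on_add)

lemma smooth_on_mult:
  fixes f g :: "'a::real_normed_vector \<Rightarrow> real"
  shows "open S \<Longrightarrow> smooth_on S f \<Longrightarrow> smooth_on S g \<Longrightarrow> smooth_on S (\<lambda>x. f x * g x)"
  by (simp add: smooth_on_def Ck_on_mult)

lemma smooth_on_bounded_linear:
  "bounded_linear L \<Longrightarrow> open S \<Longrightarrow> smooth_on S f \<Longrightarrow> smooth_on S (\<lambda>x. L (f x))"
  by (simp add: smooth_on_def Ck_on_bounded_linear)

lemma smooth_on_minus: "open S \<Longrightarrow> smooth_on S f \<Longrightarrow> smooth_on S (\<lambda>x. - f x)"
  by (rule smooth_on_bounded_linear) (simp_all add: bounded_linear_minus bounded_linear_ident)

lemma smooth_on_diff: "open S \<Longrightarrow> smooth_on S f \<Longrightarrow> smooth_on S g \<Longrightarrow> smooth_on S (\<lambda>x. f x - g x)"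
  using smooth_on_add[of S f "\<lambda>x. - g x"] smooth_on_minus[of S g] by simp

lemma smooth_on_sum:
  "open S \<Longrightarrow> (\<And>i. i \<in> I \<Longrightarrow> smooth_on S (f i)) \<Longrightarrow> smooth_on S (\<lambda>x. \<Sum>i\<in>I. f i x)"
  by (induction I rule: infinite_finite_induct) (auto intro: smooth_on_const smooth_on_add)

lemma smooth_on_prod:
  fixes f :: "'i \<Rightarrow> 'a::real_normed_vector \<Rightarrow> real"
  shows "open S \<Longrightarrow> (\<And>i. i \<in> I \<Longrightarrow> smooth_on S (f i)) \<Longrightarrow> smooth_on S (\<lambda>x. \<Prod>i\<in>I. f i x)"
  by (induction I rule: infinite_finite_induct) (auto intro: smooth_on_const smooth_on_mult)

lemma smooth_on_inverse:
  fixes f :: "'a::real_normed_vector \<Rightarrow> real"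
  shows "open S \<Longrightarrow> smooth_on S f \<Longrightarrow> (\<And>x. x \<in> S \<Longrightarrow> f x \<noteq> 0) \<Longrightarrow> smooth_on S (\<lambda>x. inverse (f x))"
  by (simp add: smooth_on_def Ck_on_inverse)

lemma smooth_on_vec_nth: "open S \<Longrightarrow> smooth_on S f \<Longrightarrow> smooth_on S (\<lambda>x. f x $ i)"
  by (rule smooth_on_bounded_linear) (simp_all add: bounded_linear_vec_nth)

text \<open>Putting a component at place i is bounded linear, and f is the sum of its components put
  in place.\<close>

lemma smooth_on_vec_lambda:
  fixes f :: "'a::real_normed_vector \<Rightarrow> ('b::real_normed_vector)^'n::finite"
  assumes "open S" "\<And>i. smooth_on S (\<lambda>x. f x $ i)"
  shows "smooth_on S f"
proof -
  have bl: "bounded_linear (\<lambda>y::'b. axis i y :: 'b^'n)" for i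
    by (rule bounded_linear_intro[where K=1])
       (auto simp: vec_eq_iff axis_def norm_vec_def L2_set_def if_distrib if_distribR cong: if_cong)
  have "smooth_on S (\<lambda>x. \<Sum>i\<in>UNIV. axis i (f x $ i))"
    by (intro smooth_on_sum assms smooth_on_bounded_linear[OF bl])
  moreover have "(\<Sum>i\<in>UNIV. axis i (f x $ i)) = f x" for x
    by (simp add: vec_eq_iff axis_def if_distrib cong: if_cong)
  ultimately show ?thesis by simp
qed

section \<open>Symmetry of second derivatives\<close>

lemma has_real_derivative_along_line:
  fixes f :: "'a::real_normed_vector \<Rightarrow> real"
  assumes "f differentiable (at (p + s *\<^sub>R v))"
  shows "((\<lambda>s. f (p + s *\<^sub>R v)) has_real_derivative frechet_derivative f (at (p + s *\<^sub>R v)) v) (at s)"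
proof -
  have lin: "linear (frechet_derivative f (at (p + s *\<^sub>R v)))"
    by (rule linear_frechet_derivative[OF assms])
  have "((\<lambda>s. f (p + s *\<^sub>R v)) has_derivative (\<lambda>h. frechet_derivative f (at (p + s *\<^sub>R v)) (h *\<^sub>R v))) (at s)"
    by (rule has_derivative_compose[where f = "\<lambda>s. p + s *\<^sub>R v" and g = f])
       (auto intro!: derivative_eq_intros differentiable_imp_has_derivative assms)
  moreover have "(\<lambda>h. frechet_derivative f (at (p + s *\<^sub>R v)) (h *\<^sub>R v)) =
      (*) (frechet_derivative f (at (p + s *\<^sub>R v)) v)"
    by (rule ext) (simp add: linear_cmul[OF lin])
  ultimately show ?thesis by (simp add: has_field_derivative_def)
qed

text \<open>The second difference does not change when v and w are exchanged, while one mean value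
  theorem in each direction turns it into a second derivative. Doing this in both orders compares
  the two mixed derivatives.\<close>

lemma second_difference_mean_value:
  fixes f :: "'a::real_normed_vector \<Rightarrow> real"
  assumes S: "open S" "smooth_on S f" and h: "0 < h"
    and sub: "\<And>a b. 0 \<le> a \<Longrightarrow> a \<le> h \<Longrightarrow> 0 \<le> b \<Longrightarrow> b \<le> h \<Longrightarrow> x + a *\<^sub>R v + b *\<^sub>R w \<in> S"
  shows "\<exists>a b. 0 < a \<and> a < h \<and> 0 < b \<and> b < h \<and>
    f (x + h *\<^sub>R v + h *\<^sub>R w) - f (x + h *\<^sub>R v) - f (x + h *\<^sub>R w) + f x =
    h * h * frechet_derivative (\<lambda>y. frechet_derivative f (at y) v) (at (x + a *\<^sub>R v + b *\<^sub>R w)) w"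
proof -
  let ?D = "\<lambda>y. frechet_derivative f (at y) v"
  have d1: "((\<lambda>s. f (x + b *\<^sub>R w + s *\<^sub>R v)) has_real_derivative ?D (x + b *\<^sub>R w + s *\<^sub>R v)) (at s)"
    if "0 \<le> s" "s \<le> h" "0 \<le> b" "b \<le> h" for s b
  proof (rule has_real_derivative_along_line)
    have "x + b *\<^sub>R w + s *\<^sub>R v = x + s *\<^sub>R v + b *\<^sub>R w" by (simp add: algebra_simps)
    then show "f differentiable (at (x + b *\<^sub>R w + s *\<^sub>R v))"
      using smooth_on_imp_differentiable[OF S sub[OF that]] by argo
  qed
  \<comment> \<open>The mean value theorem along v is applied to the difference of f on two parallel
    lines; the summand \<open>0 *\<^sub>R w\<close> is kept so that \<open>d1\<close> covers both
    lines.\<close>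
  have "\<exists>a. 0 < a \<and> a < h \<and>
     (f (x + h *\<^sub>R w + h *\<^sub>R v) - f (x + 0 *\<^sub>R w + h *\<^sub>R v)) - (f (x + h *\<^sub>R w + 0 *\<^sub>R v) - f (x + 0 *\<^sub>R w + 0 *\<^sub>R v))
     = (h - 0) * (?D (x + h *\<^sub>R w + a *\<^sub>R v) - ?D (x + 0 *\<^sub>R w + a *\<^sub>R v))"
    by (rule MVT2[OF h, where f = "\<lambda>s. f (x + h *\<^sub>R w + s *\<^sub>R v) - f (x + 0 *\<^sub>R w + s *\<^sub>R v)"])
       (intro DERIV_diff d1, use h in auto)
  then obtain a where a: "0 < a" "a < h" and eq1:
     "f (x + h *\<^sub>R w + h *\<^sub>R v) - f (x + h *\<^sub>R v) - (f (x + h *\<^sub>R w) - f x)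
     = h * (?D (x + h *\<^sub>R w + a *\<^sub>R v) - ?D (x + a *\<^sub>R v))" by auto
  have "\<exists>b. 0 < b \<and> b < h \<and> ?D (x + a *\<^sub>R v + h *\<^sub>R w) - ?D (x + a *\<^sub>R v + 0 *\<^sub>R w) =
     (h - 0) * frechet_derivative ?D (at (x + a *\<^sub>R v + b *\<^sub>R w)) w"
    by (rule MVT2[OF h, where f = "\<lambda>r. ?D (x + a *\<^sub>R v + r *\<^sub>R w)"],
        rule has_real_derivative_along_line,
        rule smooth_on_imp_differentiable[OF S(1) smooth_on_frechet_derivative[OF S]], rule sub)
       (use a in auto)
  then obtain b where b: "0 < b" "b < h" and eq2:
    "?D (x + a *\<^sub>R v + h *\<^sub>R w) - ?D (x + a *\<^sub>R v) =
     h * frechet_derivative ?D (at (x + a *\<^sub>R v + b *\<^sub>R w)) w" by auto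
  have c: "x + h *\<^sub>R w + a *\<^sub>R v = x + a *\<^sub>R v + h *\<^sub>R w" "x + h *\<^sub>R w + h *\<^sub>R v = x + h *\<^sub>R v + h *\<^sub>R w"
    by (simp_all add: algebra_simps)
  show ?thesis
    by (rule exI[of _ a], rule exI[of _ b]) (use a b eq1 eq2 c in simp)
qed

text \<open>Both mixed derivatives, each at some point of a small parallelogram, equal the same
  second difference divided by h * h; continuity moves these points to x.\<close>

lemma second_derivative_symmetric:
  fixes f :: "'a::real_normed_vector \<Rightarrow> real"
  assumes S: "open S" "smooth_on S f" and x: "x \<in> S"
  shows "frechet_derivative (\<lambda>y. frechet_derivative f (at y) v) (at x) w =
         frechet_derivative (\<lambda>y. frechet_derivative f (at y) w) (at x) v" (is "?P x = ?Q x")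
proof -
  have cont: "continuous_on S ?P" "continuous_on S ?Q"
    using S by (auto intro!: smooth_on_imp_continuous_on smooth_on_frechet_derivative)
  have "\<bar>?P x - ?Q x\<bar> \<le> e" if "0 < e" for e
  proof -
    have e2: "0 < e / 2" using that by simp
    from cont(1) obtain d1 where d1: "0 < d1" "\<And>y. y \<in> S \<Longrightarrow> dist y x < d1 \<Longrightarrow> dist (?P y) (?P x) < e / 2"
      unfolding continuous_on_iff using x e2 by blast
    from cont(2) obtain d2 where d2: "0 < d2" "\<And>y. y \<in> S \<Longrightarrow> dist y x < d2 \<Longrightarrow> dist (?Q y) (?Q x) < e / 2"
      unfolding continuous_on_iff using x e2 by blast
    obtain d3 where d3: "0 < d3" "ball x d3 \<subseteq> S" using S(1) x open_contains_ball by blast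
    define d where "d = min d3 (min d1 d2)"
    have d: "0 < d" using d1 d2 d3 by (simp add: d_def)
    \<comment> \<open>This size keeps the parallelogram spanned by h v and h w within distance d of
      x; the summand 1 avoids a division by zero.\<close>
    define h where "h = d / (norm v + norm w + 1)"
    have pos: "0 < norm v + norm w + 1" by (smt (verit) norm_ge_zero)
    have h: "0 < h" using d pos by (simp add: h_def)
    have near: "dist (x + a *\<^sub>R v + b *\<^sub>R w) x < d" if "0 \<le> a" "a \<le> h" "0 \<le> b" "b \<le> h" for a b
    proof -
      have "dist (x + a *\<^sub>R v + b *\<^sub>R w) x = norm (a *\<^sub>R v + b *\<^sub>R w)" by (simp add: dist_norm)
      also have "\<dots> \<le> a * norm v + b * norm w"
        by (rule order_trans[OF norm_triangle_ineq]) (use that in simp)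
      also have "\<dots> \<le> h * norm v + h * norm w" using that by (intro add_mono mult_right_mono) auto
      also have "\<dots> < h * (norm v + norm w + 1)" using h by (simp add: algebra_simps)
      also have "\<dots> = d" using pos by (simp add: h_def)
      finally show ?thesis .
    qed
    have near': "dist (x + a *\<^sub>R w + b *\<^sub>R v) x < d" if "0 \<le> a" "a \<le> h" "0 \<le> b" "b \<le> h" for a b
      using near[of b a] that by (simp add: algebra_simps)
    have inS: "y \<in> S" if "dist y x < d" for y
      using d3(2) that by (auto simp: d_def dist_commute)
    obtain a b where ab: "0 < a" "a < h" "0 < b" "b < h"
      "f (x + h *\<^sub>R v + h *\<^sub>R w) - f (x + h *\<^sub>R v) - f (x + h *\<^sub>R w) + f x = h * h * ?P (x + a *\<^sub>R v + b *\<^sub>R w)"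
      using second_difference_mean_value[OF S h, of x v w] inS near by blast
    obtain a' b' where ab': "0 < a'" "a' < h" "0 < b'" "b' < h"
      "f (x + h *\<^sub>R w + h *\<^sub>R v) - f (x + h *\<^sub>R w) - f (x + h *\<^sub>R v) + f x = h * h * ?Q (x + a' *\<^sub>R w + b' *\<^sub>R v)"
      using second_difference_mean_value[OF S h, of x w v] inS near' by blast
    have sw: "x + h *\<^sub>R w + h *\<^sub>R v = x + h *\<^sub>R v + h *\<^sub>R w" by (simp add: algebra_simps)
    have "h * h * ?P (x + a *\<^sub>R v + b *\<^sub>R w) = h * h * ?Q (x + a' *\<^sub>R w + b' *\<^sub>R v)"
      using ab(5) ab'(5) unfolding sw by linarith
    then have eq: "?P (x + a *\<^sub>R v + b *\<^sub>R w) = ?Q (x + a' *\<^sub>R w + b' *\<^sub>R v)" using h by simp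
    have n1: "dist (x + a *\<^sub>R v + b *\<^sub>R w) x < d" using near ab by simp
    have n2: "dist (x + a' *\<^sub>R w + b' *\<^sub>R v) x < d" using near' ab' by simp
    have "dist (?P (x + a *\<^sub>R v + b *\<^sub>R w)) (?P x) < e / 2"
      using d1(2)[OF inS[OF n1]] n1 by (simp add: d_def)
    moreover have "dist (?Q (x + a' *\<^sub>R w + b' *\<^sub>R v)) (?Q x) < e / 2"
      using d2(2)[OF inS[OF n2]] n2 by (simp add: d_def)
    ultimately show ?thesis unfolding eq dist_real_def by linarith
  qed
  then have "\<bar>?P x - ?Q x\<bar> \<le> 0" by (rule field_le_epsilon[of _ 0, simplified]) 
  then show ?thesis by simp
qed

section \<open>Partial derivatives and the chain rule\<close>

lemma partial_deriv_cong:
  assumes "open S" "x \<in> S" "\<And>y. y \<in> S \<Longrightarrow> F y = G y"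
  shows "partial_deriv i F x = partial_deriv i G x"
proof -
  have "(F has_derivative D) (at x) \<longleftrightarrow> (G has_derivative D) (at x)" for D
    using has_derivative_transform_within_open[of F D x UNIV S G]
      has_derivative_transform_within_open[of G D x UNIV S F] assms by auto
  then show ?thesis by (simp add: partial_deriv_def frechet_derivative_def)
qed

lemma partial_deriv_eqI: "(F has_derivative D) (at x) \<Longrightarrow> partial_deriv i F x = D (axis i 1)"
  unfolding partial_deriv_def by (simp add: frechet_derivative_at_eq)

lemma partial_deriv_const [simp]: "partial_deriv i (\<lambda>x. c) x = 0"
  by (simp add: partial_deriv_def)

lemma partial_deriv_add:
  "F differentiable (at x) \<Longrightarrow> G differentiable (at x) \<Longrightarrow>
   partial_deriv i (\<lambda>y. F y + G y) x = partial_deriv i F x + partial_deriv i G x"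
  by (subst partial_deriv_eqI[OF has_derivative_add[OF differentiable_imp_has_derivative differentiable_imp_has_derivative]])
     (simp_all add: partial_deriv_def)

lemma partial_deriv_diff:
  "F differentiable (at x) \<Longrightarrow> G differentiable (at x) \<Longrightarrow>
   partial_deriv i (\<lambda>y. F y - G y) x = partial_deriv i F x - partial_deriv i G x"
  by (subst partial_deriv_eqI[OF has_derivative_diff[OF differentiable_imp_has_derivative differentiable_imp_has_derivative]])
     (simp_all add: partial_deriv_def)

lemma partial_deriv_mult:
  "F differentiable (at x) \<Longrightarrow> G differentiable (at x) \<Longrightarrow>
   partial_deriv i (\<lambda>y. F y * G y) x = partial_deriv i F x * G x + F x * partial_deriv i G x"
  by (subst partial_deriv_eqI[OF has_derivative_mult[OF differentiable_imp_has_derivative differentiable_imp_has_derivative]])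
     (simp_all add: partial_deriv_def)

lemma partial_deriv_sum:
  assumes "\<And>a. a \<in> I \<Longrightarrow> F a differentiable (at x)"
  shows "partial_deriv i (\<lambda>y. \<Sum>a\<in>I. F a y) x = (\<Sum>a\<in>I. partial_deriv i (F a) x)"
  using assms
proof (induction I rule: infinite_finite_induct)
  case (insert a I)
  then show ?case
    by (simp add: partial_deriv_add differentiable_sum)
qed simp_all

lemma partial_deriv_cmult:
  "F differentiable (at x) \<Longrightarrow> partial_deriv i (\<lambda>y. c * F y) x = c * partial_deriv i F x"
  using partial_deriv_mult[of "\<lambda>y. c" x F i] by simp

lemma smooth_on_partial_deriv:
  "open S \<Longrightarrow> smooth_on S F \<Longrightarrow> smooth_on S (partial_deriv i F)"
  unfolding partial_deriv_def by (rule smooth_on_frechet_derivative)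

lemma partial_deriv_commute:
  "open S \<Longrightarrow> smooth_on S F \<Longrightarrow> x \<in> S \<Longrightarrow>
   partial_deriv i (partial_deriv j F) x = partial_deriv j (partial_deriv i F) x"
  unfolding partial_deriv_def by (rule second_derivative_symmetric)

lemma frechet_derivative_vec_expand:
  fixes F :: "real^'n \<Rightarrow> real"
  assumes "F differentiable (at x)"
  shows "frechet_derivative F (at x) v = (\<Sum>a\<in>UNIV. v $ a * partial_deriv a F x)"
proof -
  interpret linear "frechet_derivative F (at x)"
    by (rule linear_frechet_derivative[OF assms])
  have "v = (\<Sum>a\<in>UNIV. v $ a *\<^sub>R axis a 1)"
    by (simp add: vec_eq_iff axis_def if_distrib cong: if_cong)
  then have "frechet_derivative F (at x) v = frechet_derivative F (at x) (\<Sum>a\<in>UNIV. v $ a *\<^sub>R axis a 1)"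
    by (rule arg_cong)
  also have "\<dots> = (\<Sum>a\<in>UNIV. v $ a * partial_deriv a F x)"
    by (simp add: sum scale partial_deriv_def)
  finally show ?thesis .
qed

lemma frechet_derivative_nth:
  fixes \<phi> :: "real^'n \<Rightarrow> real^'m"
  assumes "\<phi> differentiable (at x)"
  shows "frechet_derivative \<phi> (at x) v $ a = frechet_derivative (\<lambda>y. \<phi> y $ a) (at x) v"
  using frechet_derivative_at_eq[OF bounded_linear.has_derivative[OF bounded_linear_vec_nth[of a]
      differentiable_imp_has_derivative[OF assms]]] by simp

lemma jacobian_nth:
  fixes \<phi> :: "real^'n \<Rightarrow> real^'m"
  assumes "\<phi> differentiable (at x)"
  shows "jacobian \<phi> (at x) $ a $ i = partial_deriv i (\<lambda>y. \<phi> y $ a) x"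
  by (simp add: jacobian_def matrix_def frechet_derivative_nth[OF assms] partial_deriv_def)

lemma partial_deriv_compose:
  fixes \<phi> :: "real^'n \<Rightarrow> real^'m" and F :: "real^'m \<Rightarrow> real"
  assumes "\<phi> differentiable (at x)" "F differentiable (at (\<phi> x))"
  shows "partial_deriv i (\<lambda>y. F (\<phi> y)) x = (\<Sum>a\<in>UNIV. jacobian \<phi> (at x) $ a $ i * partial_deriv a F (\<phi> x))"
proof -
  have "partial_deriv i (\<lambda>y. F (\<phi> y)) x = frechet_derivative F (at (\<phi> x)) (frechet_derivative \<phi> (at x) (axis i 1))"
    by (rule partial_deriv_eqI[OF has_derivative_compose[OF differentiable_imp_has_derivative[OF assms(1)]
          differentiable_imp_has_derivative[OF assms(2)]]])
  also have "\<dots> = (\<Sum>a\<in>UNIV. jacobian \<phi> (at x) $ a $ i * partial_deriv a F (\<phi> x))"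
    by (simp add: frechet_derivative_vec_expand[OF assms(2)] jacobian_def matrix_def)
  finally show ?thesis .
qed

section \<open>Families of functions depending on time\<close>

text \<open>Smoothness is joint in space and time, so that time derivatives and space derivatives
  are directional derivatives of one function, in the directions \<open>(0, 1)\<close> and
  \<open>(axis i 1, 0)\<close>. The time set is open, which excludes the initial time 0 of a
  flow.\<close>

definition tsmooth :: "(real^'n) set \<Rightarrow> real set \<Rightarrow> (real \<Rightarrow> real^'n \<Rightarrow> real) \<Rightarrow> bool" where
  "tsmooth U I F \<longleftrightarrow> open U \<and> open I \<and> smooth_on (U \<times> I) (\<lambda>z. F (snd z) (fst z))"

lemma tsmooth_open [simp]: "tsmooth U I F \<Longrightarrow> open (U \<times> I)"
  by (simp add: tsmooth_def open_Times)

lemma tsmooth_has_derivative: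
  assumes "tsmooth U I F" "x \<in> U" "t \<in> I"
  shows "((\<lambda>z. F (snd z) (fst z)) has_derivative
    frechet_derivative (\<lambda>z. F (snd z) (fst z)) (at (x, t))) (at (x, t))"
  using assms smooth_on_imp_differentiable[OF tsmooth_open[OF assms(1)], of _ "(x, t)"]
  by (intro differentiable_imp_has_derivative) (auto simp: tsmooth_def)

lemma tsmooth_slice_has_derivative:
  assumes "tsmooth U I F" "x \<in> U" "t \<in> I"
  shows "(F t has_derivative (\<lambda>v. frechet_derivative (\<lambda>z. F (snd z) (fst z)) (at (x, t)) (v, 0))) (at x)"
proof -
  have "((\<lambda>y. (\<lambda>z. F (snd z) (fst z)) (y, t)) has_derivative
     (\<lambda>v. frechet_derivative (\<lambda>z. F (snd z) (fst z)) (at (x, t)) (v, 0))) (at x)"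
    by (rule has_derivative_compose[where f = "\<lambda>y. (y, t)" and g = "\<lambda>z. F (snd z) (fst z)"])
       (auto intro!: derivative_eq_intros tsmooth_has_derivative[OF assms])
  then show ?thesis by simp
qed

lemma tsmooth_time_has_derivative:
  assumes "tsmooth U I F" "x \<in> U" "t \<in> I"
  shows "((\<lambda>s. F s x) has_real_derivative frechet_derivative (\<lambda>z. F (snd z) (fst z)) (at (x, t)) (0, 1)) (at t)"
proof -
  have "((\<lambda>z. F (snd z) (fst z)) differentiable (at ((x, 0) + t *\<^sub>R (0, 1))))"
    using tsmooth_has_derivative[OF assms] by (auto simp: differentiable_def)
  from has_real_derivative_along_line[OF this] show ?thesis by simp
qed

lemma tsmooth_partial_deriv_eq:
  assumes "tsmooth U I F" "x \<in> U" "t \<in> I"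
  shows "partial_deriv i (F t) x = frechet_derivative (\<lambda>z. F (snd z) (fst z)) (at (x, t)) (axis i 1, 0)"
  by (rule partial_deriv_eqI[OF tsmooth_slice_has_derivative[OF assms]])

lemma tsmooth_time_deriv_eq:
  assumes "tsmooth U I F" "x \<in> U" "t \<in> I"
  shows "deriv (\<lambda>s. F s x) t = frechet_derivative (\<lambda>z. F (snd z) (fst z)) (at (x, t)) (0, 1)"
  by (rule DERIV_imp_deriv[OF tsmooth_time_has_derivative[OF assms]])

lemma tsmooth_time_DERIV:
  assumes "tsmooth U I F" "x \<in> U" "t \<in> I"
  shows "((\<lambda>s. F s x) has_real_derivative deriv (\<lambda>s. F s x) t) (at t)"
  using tsmooth_time_has_derivative[OF assms] tsmooth_time_deriv_eq[OF assms] by simp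

lemma tsmooth_differentiable:
  assumes "tsmooth U I F" "x \<in> U" "t \<in> I"
  shows "F t differentiable (at x)"
  using tsmooth_slice_has_derivative[OF assms] by (auto simp: differentiable_def)

lemma tsmooth_cong:
  assumes "\<And>x t. x \<in> U \<Longrightarrow> t \<in> I \<Longrightarrow> F t x = F' t x"
  shows "tsmooth U I F \<longleftrightarrow> tsmooth U I F'"
  unfolding tsmooth_def using smooth_on_cong[of "U \<times> I" "\<lambda>z. F (snd z) (fst z)" "\<lambda>z. F' (snd z) (fst z)"] assms
  by auto

lemma tsmooth_partial_deriv:
  assumes "tsmooth U I F"
  shows "tsmooth U I (\<lambda>t. partial_deriv i (F t))"
proof -
  have "smooth_on (U \<times> I) (\<lambda>z. frechet_derivative (\<lambda>z. F (snd z) (fst z)) (at z) (axis i 1, 0))"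
    using assms by (intro smooth_on_frechet_derivative) (auto simp: tsmooth_def open_Times)
  then have "tsmooth U I (\<lambda>t x. frechet_derivative (\<lambda>z. F (snd z) (fst z)) (at (x, t)) (axis i 1, 0))"
    using assms by (simp add: tsmooth_def)
  then show ?thesis
    by (rule tsmooth_cong[THEN iffD1, rotated]) (simp add: tsmooth_partial_deriv_eq[OF assms])
qed

lemma tsmooth_time_deriv:
  assumes "tsmooth U I F"
  shows "tsmooth U I (\<lambda>t x. deriv (\<lambda>s. F s x) t)"
proof -
  have "smooth_on (U \<times> I) (\<lambda>z. frechet_derivative (\<lambda>z. F (snd z) (fst z)) (at z) (0, 1))"
    using assms by (intro smooth_on_frechet_derivative) (auto simp: tsmooth_def open_Times)
  then have "tsmooth U I (\<lambda>t x. frechet_derivative (\<lambda>z. F (snd z) (fst z)) (at (x, t)) (0, 1))"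
    using assms by (simp add: tsmooth_def)
  then show ?thesis
    by (rule tsmooth_cong[THEN iffD1, rotated]) (simp add: tsmooth_time_deriv_eq[OF assms])
qed

lemma frechet_derivative_cong_open:
  assumes "open S" "x \<in> S" "\<And>y. y \<in> S \<Longrightarrow> F y = G y"
  shows "frechet_derivative F (at x) = frechet_derivative G (at x)"
proof -
  have "(F has_derivative D) (at x) \<longleftrightarrow> (G has_derivative D) (at x)" for D
    using has_derivative_transform_within_open[of F D x UNIV S G]
      has_derivative_transform_within_open[of G D x UNIV S F] assms by auto
  then show ?thesis by (simp add: frechet_derivative_def)
qed

text \<open>An instance of the symmetry of second derivatives, for the joint function and the
  directions \<open>(0, 1)\<close> and \<open>(axis i 1, 0)\<close>. It allows space derivatives to
  be taken of the flow equation.\<close>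

lemma tsmooth_deriv_partial_deriv_commute:
  assumes "tsmooth U I F" "x \<in> U" "t \<in> I"
  shows "deriv (\<lambda>s. partial_deriv i (F s) x) t = partial_deriv i (\<lambda>y. deriv (\<lambda>s. F s y) t) x"
proof -
  let ?F = "\<lambda>z. F (snd z) (fst z)"
  have op: "open (U \<times> I)" "(x, t) \<in> U \<times> I" using assms by simp_all
  have sm: "smooth_on (U \<times> I) ?F" using assms(1) by (simp add: tsmooth_def)
  have "deriv (\<lambda>s. partial_deriv i (F s) x) t =
     frechet_derivative (\<lambda>z. partial_deriv i (F (snd z)) (fst z)) (at (x, t)) (0, 1)"
    by (rule tsmooth_time_deriv_eq[OF tsmooth_partial_deriv[OF assms(1)] assms(2,3)])
  also have "\<dots> = frechet_derivative (\<lambda>z. frechet_derivative ?F (at z) (axis i 1, 0)) (at (x, t)) (0, 1)"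
    by (subst frechet_derivative_cong_open[OF op]) (auto simp: tsmooth_partial_deriv_eq[OF assms(1)])
  also have "\<dots> = frechet_derivative (\<lambda>z. frechet_derivative ?F (at z) (0, 1)) (at (x, t)) (axis i 1, 0)"
    by (rule second_derivative_symmetric[OF op(1) sm op(2)])
  also have "\<dots> = frechet_derivative (\<lambda>z. deriv (\<lambda>s. F s (fst z)) (snd z)) (at (x, t)) (axis i 1, 0)"
    by (subst frechet_derivative_cong_open[OF op]) (auto simp: tsmooth_time_deriv_eq[OF assms(1)])
  also have "\<dots> = partial_deriv i (\<lambda>y. deriv (\<lambda>s. F s y) t) x"
    by (rule tsmooth_partial_deriv_eq[OF tsmooth_time_deriv[OF assms(1)] assms(2,3), symmetric])
  finally show ?thesis .
qed

text \<open>The derivative of the slice in direction v is a slice of the joint derivative in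
  direction \<open>(v, 0)\<close>, so the induction over the order generalises H.\<close>

lemma Ck_on_slice:
  fixes F :: "real \<Rightarrow> real^'n \<Rightarrow> real"
  assumes "open U" "open I" "t \<in> I"
  shows "Ck_on k (U \<times> I) H \<Longrightarrow> Ck_on k U (\<lambda>x. H (x, t))"
proof (induction k arbitrary: H)
  case 0
  have "continuous_on U (H \<circ> (\<lambda>x. (x, t)))"
    by (rule continuous_on_compose) (use 0 assms(3) in \<open>auto intro!: continuous_intros intro: continuous_on_subset\<close>)
  then show ?case by (simp add: comp_def)
next
  case (Suc k)
  have op: "open (U \<times> I)" using assms by (simp add: open_Times)
  have d: "((\<lambda>x. H (x, t)) has_derivative (\<lambda>v. frechet_derivative H (at (x, t)) (v, 0))) (at x)" if "x \<in> U" for x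
    by (rule has_derivative_compose[where f = "\<lambda>y. (y, t)" and g = H])
       (use Suc.prems op that assms(3) in \<open>auto intro!: derivative_eq_intros differentiable_imp_has_derivative
          simp: Ck_on_Suc_open simp del: Ck_on.simps\<close>)
  have "Ck_on k U (\<lambda>x. frechet_derivative (\<lambda>x. H (x, t)) (at x) v)" for v
  proof -
    have "Ck_on k U (\<lambda>x. frechet_derivative H (at (x, t)) (v, 0))"
      by (rule Suc.IH) (use Suc.prems op in \<open>simp add: Ck_on_Suc_open del: Ck_on.simps\<close>)
    then show ?thesis
      by (rule Ck_on_cong[THEN iffD1, rotated]) (simp add: frechet_derivative_at_eq[OF d])
  qed
  then show ?case
    using d assms(1) by (auto simp: Ck_on_Suc_open differentiable_def simp del: Ck_on.simps)
qed

lemma tsmooth_slice: "tsmooth U I F \<Longrightarrow> t \<in> I \<Longrightarrow> smooth_on U (F t)"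
  unfolding tsmooth_def smooth_on_def using Ck_on_slice[of U I t _ "\<lambda>z. F (snd z) (fst z)"] by simp

lemma tsmooth_const: "open U \<Longrightarrow> open I \<Longrightarrow> tsmooth U I (\<lambda>t x. c)"
  by (simp add: tsmooth_def smooth_on_const open_Times)

lemma tsmooth_add: "tsmooth U I F \<Longrightarrow> tsmooth U I F' \<Longrightarrow> tsmooth U I (\<lambda>t x. F t x + F' t x)"
  by (simp add: tsmooth_def smooth_on_add open_Times)

lemma tsmooth_diff: "tsmooth U I F \<Longrightarrow> tsmooth U I F' \<Longrightarrow> tsmooth U I (\<lambda>t x. F t x - F' t x)"
  by (simp add: tsmooth_def smooth_on_diff open_Times)

lemma tsmooth_mult: "tsmooth U I F \<Longrightarrow> tsmooth U I F' \<Longrightarrow> tsmooth U I (\<lambda>t x. F t x * F' t x)"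
  by (simp add: tsmooth_def smooth_on_mult open_Times)

lemma tsmooth_sum:
  "open U \<Longrightarrow> open I \<Longrightarrow> (\<And>a. a \<in> J \<Longrightarrow> tsmooth U I (F a)) \<Longrightarrow> tsmooth U I (\<lambda>t x. \<Sum>a\<in>J. F a t x)"
  by (simp add: tsmooth_def smooth_on_sum open_Times)

text \<open>Only F loses derivatives: by the chain rule the next derivative is a finite sum of
  products of a smooth factor coming from \<phi> with a partial derivative of F composed with
  \<phi>.\<close>

lemma Ck_on_compose:
  fixes \<phi> :: "'a::real_normed_vector \<Rightarrow> real^'m" and F :: "real^'m \<Rightarrow> real"
  assumes "open S" "open S'" "\<phi> ` S \<subseteq> S'" "smooth_on S \<phi>"
  shows "Ck_on k S' F \<Longrightarrow> Ck_on k S (\<lambda>x. F (\<phi> x))"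
proof (induction k arbitrary: F)
  case 0
  have "continuous_on S \<phi>" using assms(4) by (rule smooth_on_imp_continuous_on)
  then show ?case using 0 assms(3) by (auto intro: continuous_on_compose2)
next
  case (Suc k)
  have F: "F differentiable (at (\<phi> x))" if "x \<in> S" for x
    using Suc.prems assms(2,3) that by (auto simp: Ck_on_Suc_open simp del: Ck_on.simps)
  have phi: "\<phi> differentiable (at x)" if "x \<in> S" for x
    using smooth_on_imp_differentiable[OF assms(1,4) that] .
  have d: "((\<lambda>x. F (\<phi> x)) has_derivative (\<lambda>v. frechet_derivative F (at (\<phi> x)) (frechet_derivative \<phi> (at x) v))) (at x)"
    if "x \<in> S" for x
    by (rule has_derivative_compose[OF differentiable_imp_has_derivative[OF phi[OF that]]
          differentiable_imp_has_derivative[OF F[OF that]]])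
  have "Ck_on k S (\<lambda>x. frechet_derivative (\<lambda>x. F (\<phi> x)) (at x) v)" for v
  proof -
    have "Ck_on k S' (partial_deriv a F)" for a
      using Suc.prems assms(2) unfolding partial_deriv_def by (simp add: Ck_on_Suc_open del: Ck_on.simps)
    moreover have "smooth_on S (\<lambda>x. frechet_derivative \<phi> (at x) v $ a)" for a
      by (intro smooth_on_vec_nth smooth_on_frechet_derivative assms)
    ultimately have "Ck_on k S (\<lambda>x. frechet_derivative \<phi> (at x) v $ a * partial_deriv a F (\<phi> x))" for a
      using Suc.IH unfolding smooth_on_def by (intro Ck_on_mult assms(1)) blast+
    then have "Ck_on k S (\<lambda>x. \<Sum>a\<in>A. frechet_derivative \<phi> (at x) v $ a * partial_deriv a F (\<phi> x))" for A
      by (induction A rule: infinite_finite_induct) (auto intro!: Ck_on_const Ck_on_add assms(1))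
    then show ?thesis
      by (rule Ck_on_cong[THEN iffD1, rotated])
         (simp add: frechet_derivative_at_eq[OF d] frechet_derivative_vec_expand[OF F])
  qed
  then show ?case using d assms(1) by (auto simp: Ck_on_Suc_open differentiable_def simp del: Ck_on.simps)
qed

lemma smooth_on_compose:
  fixes \<phi> :: "'a::real_normed_vector \<Rightarrow> real^'m" and F :: "real^'m \<Rightarrow> real"
  assumes "open S" "open S'" "\<phi> ` S \<subseteq> S'" "smooth_on S \<phi>" "smooth_on S' F"
  shows "smooth_on S (\<lambda>x. F (\<phi> x))"
  using Ck_on_compose[OF assms(1-4)] assms(5) by (simp add: smooth_on_def)

section \<open>Positive definite matrices and their inverses\<close>

definition pos_def :: "real^'n^'n \<Rightarrow> bool" where
  "pos_def A \<longleftrightarrow> transpose A = A \<and> (\<forall>u. u \<noteq> 0 \<longrightarrow> 0 < u \<bullet> (A *v u))"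

lemma matrix_inv_inverse:
  fixes A :: "real^'n^'n"
  assumes "invertible A"
  shows "A ** matrix_inv A = mat 1" "matrix_inv A ** A = mat 1"
  using someI_ex[OF assms[unfolded invertible_def]] by (simp_all add: matrix_inv_def)

lemma pos_def_invertible: "pos_def A \<Longrightarrow> invertible A"
  unfolding invertible_left_inverse matrix_left_invertible_ker pos_def_def
  by (metis inner_zero_right less_irrefl)

lemma transpose_eq_sym:
  assumes "transpose A = A"
  shows "A $ i $ j = A $ j $ i"
  by (subst (2) assms[symmetric]) (simp add: transpose_def)

lemma pos_def_sym: "pos_def A \<Longrightarrow> A $ i $ j = A $ j $ i"
  unfolding pos_def_def by (rule transpose_eq_sym) simp

lemma matrix_inv_transpose_sym:
  assumes "pos_def A"
  shows "transpose (matrix_inv A) = matrix_inv A"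
proof -
  note inv = matrix_inv_inverse[OF pos_def_invertible[OF assms]]
  have "transpose (matrix_inv A) ** A = mat 1"
    using inv(1) assms by (metis matrix_transpose_mul pos_def_def transpose_mat)
  then have "transpose (matrix_inv A) ** (A ** matrix_inv A) = matrix_inv A"
    by (simp add: matrix_mul_assoc)
  then show ?thesis by (simp add: inv(1))
qed

lemma matrix_inv_sym: "pos_def A \<Longrightarrow> matrix_inv A $ i $ j = matrix_inv A $ j $ i"
  by (rule transpose_eq_sym[OF matrix_inv_transpose_sym])

lemma matrix_inv_nth:
  assumes "pos_def (A :: real^'n^'n)"
  shows "(\<Sum>k\<in>UNIV. A $ i $ k * matrix_inv A $ k $ j) = (if i = j then 1 else 0)"
    "(\<Sum>k\<in>UNIV. matrix_inv A $ i $ k * A $ k $ j) = (if i = j then 1 else 0)"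
  using matrix_inv_inverse[OF pos_def_invertible[OF assms]]
  by (simp_all add: vec_eq_iff matrix_matrix_mult_def mat_def)

text \<open>Nonnegativity of the form of A at \<open>v - \<Lambda> *\<^sub>R w\<close>, where w is
  the inverse applied to v, gives the estimate without eigenvalues. It turns an upper bound for the
  metric into a lower bound for the inverse metric, through which tensor norms control
  components.\<close>

lemma matrix_inv_form_lower:
  fixes A :: "real^'n^'n"
  assumes A: "pos_def A" and up: "\<And>u. u \<bullet> (A *v u) \<le> \<Lambda> * (u \<bullet> u)" and "0 < \<Lambda>"
  shows "v \<bullet> v \<le> \<Lambda> * (v \<bullet> (matrix_inv A *v v))"
proof -
  define w where "w = matrix_inv A *v v"
  have Aw: "A *v w = v"
    using matrix_inv_inverse[OF pos_def_invertible[OF A]] by (simp add: w_def matrix_vector_mul_assoc)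
  have sym: "w \<bullet> (A *v v) = v \<bullet> (A *v w)"
    using A by (metis dot_lmul_matrix inner_commute pos_def_def transpose_matrix_vector)
  have "0 \<le> (v - \<Lambda> *\<^sub>R w) \<bullet> (A *v (v - \<Lambda> *\<^sub>R w))"
    using A unfolding pos_def_def by (metis inner_zero_left less_eq_real_def)
  also have "\<dots> = v \<bullet> (A *v v) - 2 * \<Lambda> * (v \<bullet> v) + \<Lambda> * \<Lambda> * (v \<bullet> w)"
    using sym by (simp add: matrix_vector_mult_diff_distrib matrix_vector_mult_scaleR Aw inner_diff_left inner_diff_right
        inner_commute[of w v] algebra_simps)
  also have "\<dots> \<le> \<Lambda> * (v \<bullet> v) - 2 * \<Lambda> * (v \<bullet> v) + \<Lambda> * \<Lambda> * (v \<bullet> w)"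
    using up[of v] by simp
  finally have "\<Lambda> * (v \<bullet> v) \<le> \<Lambda> * (\<Lambda> * (v \<bullet> w))" by (simp add: algebra_simps)
  then show ?thesis using \<open>0 < \<Lambda>\<close> by (simp add: w_def)
qed

text \<open>Column j of the inverse solves A w = e_j, and testing this equation with w gives l |w|^2
  \<le> w_j \<le> |w|.\<close>

lemma matrix_inv_entry_bound:
  fixes A :: "real^'n^'n"
  assumes A: "pos_def A" and low: "\<And>u. l * (u \<bullet> u) \<le> u \<bullet> (A *v u)" and "0 < l"
  shows "\<bar>matrix_inv A $ i $ j\<bar> \<le> 1 / l"
proof -
  define w where "w = matrix_inv A *v axis j 1"
  have Aw: "A *v w = axis j 1"
    using matrix_inv_inverse[OF pos_def_invertible[OF A]] by (simp add: w_def matrix_vector_mul_assoc)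
  have "l * (norm w * norm w) \<le> w \<bullet> axis j 1"
    using low[of w] by (simp add: Aw power2_norm_eq_inner[symmetric] power2_eq_square)
  also have "\<dots> \<le> norm w" using norm_cauchy_schwarz[of w "axis j (1::real)"] by simp
  finally have "norm w * (l * norm w) \<le> norm w * 1" by (simp add: algebra_simps)
  then have "l * norm w \<le> 1" using \<open>0 < l\<close> by (cases "norm w = 0") auto
  then have "norm w \<le> 1 / l" using \<open>0 < l\<close> by (simp add: field_simps)
  moreover have "matrix_inv A $ i $ j = w $ i"
    by (simp add: w_def matrix_vector_mult_def axis_def if_distrib cong: if_cong)
  ultimately show ?thesis using component_le_norm_cart[of w i] by linarith
qed

lemma smooth_on_det:
  fixes G :: "'a::real_normed_vector \<Rightarrow> real^'n^'n"
  assumes "open S" "\<And>i j. smooth_on S (\<lambda>x. G x $ i $ j)"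
  shows "smooth_on S (\<lambda>x. det (G x))"
  unfolding det_def by (intro smooth_on_sum smooth_on_mult smooth_on_const smooth_on_prod assms)

text \<open>Cramer's rule makes the entries of the inverse rational functions of the entries of A,
  from which their smoothness is read off.\<close>

lemma matrix_inv_cramer:
  fixes A :: "real^'n^'n"
  assumes "invertible A"
  shows "matrix_inv A $ k $ j =
    inverse (det A) * det (\<chi> i' j'. if j' = k then axis j 1 $ i' else A $ i' $ j')"
proof -
  have d: "det A \<noteq> 0" using assms by (simp add: invertible_det_nz)
  have "A *v (matrix_inv A *v axis j 1) = axis j 1"
    using matrix_inv_inverse[OF assms] by (simp add: matrix_vector_mul_assoc)
  then have "(matrix_inv A *v axis j 1) $ k =
      (\<chi> k. det (\<chi> i' j'. if j' = k then axis j 1 $ i' else A $ i' $ j') / det A) $ k"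
    using cramer[OF d, of "matrix_inv A *v axis j 1" "axis j 1"] by simp
  moreover have "(matrix_inv A *v axis j 1) $ k = matrix_inv A $ k $ j"
    by (simp add: matrix_vector_mult_def axis_def if_distrib cong: if_cong)
  ultimately show ?thesis by (simp add: field_simps)
qed

lemma smooth_on_matrix_inv:
  fixes G :: "'a::real_normed_vector \<Rightarrow> real^'n^'n"
  assumes "open S" "\<And>i j. smooth_on S (\<lambda>x. G x $ i $ j)" "\<And>x. x \<in> S \<Longrightarrow> invertible (G x)"
  shows "smooth_on S (\<lambda>x. matrix_inv (G x) $ k $ j)"
proof -
  have "smooth_on S (\<lambda>x. inverse (det (G x)) * det (\<chi> i' j'. if j' = k then axis j 1 $ i' else G x $ i' $ j'))"
  proof (intro smooth_on_mult smooth_on_inverse smooth_on_det assms)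
    fix x assume "x \<in> S"
    then show "det (G x) \<noteq> 0" using assms(3) by (simp add: invertible_det_nz)
  next
    fix i' j'
    show "smooth_on S (\<lambda>x. (\<chi> i' j'. if j' = k then axis j 1 $ i' else G x $ i' $ j') $ i' $ j')"
      by (cases "j' = k") (use assms in \<open>auto intro: smooth_on_const\<close>)
  qed
  then show ?thesis
    by (rule smooth_on_cong[THEN iffD1, rotated]) (simp add: matrix_inv_cramer assms(3))
qed

lemma tsmooth_matrix_inv:
  assumes "open U" "open I" "\<And>i j. tsmooth U I (\<lambda>t x. G t x $ i $ j)"
    "\<And>x t. x \<in> U \<Longrightarrow> t \<in> I \<Longrightarrow> pos_def (G t x)"
  shows "tsmooth U I (\<lambda>t x. matrix_inv (G t x) $ k $ j)"
proof -
  have "smooth_on (U \<times> I) (\<lambda>z. matrix_inv (G (snd z) (fst z)) $ k $ j)"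
    by (rule smooth_on_matrix_inv)
       (use assms in \<open>auto simp: tsmooth_def intro!: open_Times pos_def_invertible\<close>)
  then show ?thesis using assms by (simp add: tsmooth_def)
qed

section \<open>Tensors and their quadratic forms\<close>

text \<open>This and the next two functions treat one index at a time, so that their laws follow by
  induction on the index list or on the order. \<open>connection_term_eq\<close> and
  \<open>tensor_form_eq\<close> identify the latter two with the index sums in
  \<open>cov_deriv\<close> and \<open>tensor_norm_sq\<close>.\<close>

primrec pull_back :: "real^'n^'n \<Rightarrow> ('n list \<Rightarrow> real) \<Rightarrow> 'n list \<Rightarrow> real" where
  "pull_back J S [] = S []"
| "pull_back J S (i # I) = (\<Sum>a\<in>UNIV. J $ a $ i * pull_back J (\<lambda>K. S (a # K)) I)"

primrec connection_term :: "('n::finite \<Rightarrow> 'n \<Rightarrow> real) \<Rightarrow> ('n list \<Rightarrow> real) \<Rightarrow> 'n list \<Rightarrow> real" where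
  "connection_term C S [] = 0"
| "connection_term C S (i # I) = (\<Sum>l\<in>UNIV. C l i * S (l # I)) + connection_term C (\<lambda>K. S (i # K)) I"

primrec tensor_form :: "real^'n^'n \<Rightarrow> nat \<Rightarrow> ('n list \<Rightarrow> real) \<Rightarrow> ('n list \<Rightarrow> real) \<Rightarrow> real" where
  "tensor_form H 0 S T = S [] * T []"
| "tensor_form H (Suc m) S T =
    (\<Sum>i\<in>UNIV. \<Sum>j\<in>UNIV. H $ i $ j * tensor_form H m (\<lambda>K. S (i # K)) (\<lambda>K. T (j # K)))"

lemma pull_back_cong:
  "(\<And>K. length K = length I \<Longrightarrow> S K = T K) \<Longrightarrow> pull_back J S I = pull_back J T I"
proof (induction I arbitrary: S T)
  case (Cons i I)
  have "pull_back J (\<lambda>K. S (a # K)) I = pull_back J (\<lambda>K. T (a # K)) I" for a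
    by (rule Cons.IH) (simp add: Cons.prems)
  then show ?case by simp
qed simp

lemma pull_back_diff: "pull_back J (\<lambda>K. S K - T K) I = pull_back J S I - pull_back J T I"
  by (induction I arbitrary: S T) (simp_all add: right_diff_distrib sum_subtractf)

lemma pull_back_cmult: "pull_back J (\<lambda>K. c * S K) I = c * pull_back J S I"
  by (induction I arbitrary: S) (simp_all add: sum_distrib_left mult.left_commute)

lemma pull_back_sum: "pull_back J (\<lambda>K. \<Sum>l\<in>A. F l K) I = (\<Sum>l\<in>A. pull_back J (F l) I)"
proof (induction I arbitrary: F)
  case (Cons i I)
  show ?case by (simp add: Cons.IH sum_distrib_left) (rule sum.swap)
qed simp

lemma connection_term_cong:
  "(\<And>K. length K = length I \<Longrightarrow> S K = T K) \<Longrightarrow> connection_term C S I = connection_term C T I"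
proof (induction I arbitrary: S T)
  case (Cons i I)
  have "connection_term C (\<lambda>K. S (i # K)) I = connection_term C (\<lambda>K. T (i # K)) I"
    by (rule Cons.IH) (simp add: Cons.prems)
  then show ?case by (simp add: Cons.prems)
qed simp

lemma connection_term_linear:
  "connection_term C (\<lambda>K. \<Sum>a\<in>A. c a * F a K) I = (\<Sum>a\<in>A. c a * connection_term C (F a) I)"
proof (induction I arbitrary: F)
  case (Cons i I)
  have "(\<Sum>l\<in>UNIV. C l i * (\<Sum>a\<in>A. c a * F a (l # I))) = (\<Sum>a\<in>A. c a * (\<Sum>l\<in>UNIV. C l i * F a (l # I)))"
    unfolding sum_distrib_left by (subst sum.swap) (simp add: mult.left_commute)
  then show ?case by (simp add: Cons.IH sum.distrib distrib_left)
qed simp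

lemma connection_term_eq:
  "connection_term C S I = (\<Sum>m<length I. \<Sum>l\<in>UNIV. C l (I ! m) * S (I[m := l]))"
  by (induction I arbitrary: S) (simp_all add: sum.lessThan_Suc_shift del: sum.lessThan_Suc)

lemma cov_deriv_Cons:
  "cov_deriv G S x (k # I) =
   partial_deriv k (\<lambda>y. S y I) x - connection_term (\<lambda>l i. christoffel G x l k i) (S x) I"
  by (simp add: cov_deriv_def connection_term_eq)

lemma lists_length_Suc: "{I. length I = Suc m} = (\<lambda>(i, I). i # I) ` (UNIV \<times> {I. length I = m})"
  by (auto simp: length_Suc_conv image_iff)

lemma sum_lists_length_Suc:
  fixes f :: "'n::finite list \<Rightarrow> real"
  shows "(\<Sum>I\<in>{I. length I = Suc m}. f I) = (\<Sum>i\<in>UNIV. \<Sum>I\<in>{I. length I = m}. f (i # I))"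
  unfolding lists_length_Suc
  by (subst sum.reindex) (auto simp: inj_on_def sum.cartesian_product case_prod_unfold)

lemma tensor_form_eq:
  "tensor_form H m S T =
   (\<Sum>I\<in>{I. length I = m}. \<Sum>J\<in>{J. length J = m}. (\<Prod>a<m. H $ (I ! a) $ (J ! a)) * S I * T J)"
proof (induction m arbitrary: S T)
  case 0
  then show ?case by simp
next
  case (Suc m)
  have "tensor_form H (Suc m) S T =
    (\<Sum>i\<in>UNIV. \<Sum>j\<in>UNIV. \<Sum>I\<in>{I. length I = m}. \<Sum>J\<in>{J. length J = m}.
       H $ i $ j * ((\<Prod>a<m. H $ (I ! a) $ (J ! a)) * S (i # I) * T (j # J)))"
    by (simp add: Suc.IH sum_distrib_left)
  also have "\<dots> = (\<Sum>i\<in>UNIV. \<Sum>I\<in>{I. length I = m}. \<Sum>j\<in>UNIV. \<Sum>J\<in>{J. length J = m}.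
       H $ i $ j * ((\<Prod>a<m. H $ (I ! a) $ (J ! a)) * S (i # I) * T (j # J)))"
    by (subst sum.swap[of _ "{I. length I = m}"]) simp
  also have "\<dots> = (\<Sum>I\<in>{I. length I = Suc m}. \<Sum>J\<in>{J. length J = Suc m}.
      (\<Prod>a<Suc m. H $ (I ! a) $ (J ! a)) * S I * T J)"
    unfolding sum_lists_length_Suc
    by (simp add: prod.lessThan_Suc_shift mult.assoc del: prod.lessThan_Suc)
  finally show ?case .
qed

lemma tensor_norm_sq_eq: "tensor_norm_sq G m S x = tensor_form (matrix_inv (G x)) m (S x) (S x)"
  by (simp add: tensor_norm_sq_def tensor_form_eq)

lemma tensor_form_cong:
  assumes "\<And>I. length I = m \<Longrightarrow> S I = S' I" "\<And>I. length I = m \<Longrightarrow> T I = T' I"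
  shows "tensor_form H m S T = tensor_form H m S' T'"
  unfolding tensor_form_eq by (intro sum.cong refl) (simp add: assms)

lemma tensor_form_linear_left:
  "tensor_form H m (\<lambda>K. \<Sum>a\<in>A. c a * F a K) T = (\<Sum>a\<in>A. c a * tensor_form H m (F a) T)"
proof (induction m arbitrary: F T)
  case 0
  then show ?case by (simp add: sum_distrib_right mult.assoc)
next
  case (Suc m)
  have "tensor_form H (Suc m) (\<lambda>K. \<Sum>a\<in>A. c a * F a K) T =
    (\<Sum>i\<in>UNIV. \<Sum>a\<in>A. \<Sum>j\<in>UNIV. c a * (H $ i $ j * tensor_form H m (\<lambda>K. F a (i # K)) (\<lambda>K. T (j # K))))"
    by (simp add: Suc.IH sum_distrib_left mult.left_commute) (subst sum.swap, simp)
  also have "\<dots> = (\<Sum>a\<in>A. c a * tensor_form H (Suc m) (F a) T)"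
    by (subst sum.swap) (simp add: sum_distrib_left)
  finally show ?case .
qed

lemma tensor_form_linear_right:
  "tensor_form H m S (\<lambda>K. \<Sum>a\<in>A. c a * F a K) = (\<Sum>a\<in>A. c a * tensor_form H m S (F a))"
proof (induction m arbitrary: F S)
  case 0
  then show ?case by (simp add: sum_distrib_left mult.left_commute)
next
  case (Suc m)
  have "tensor_form H (Suc m) S (\<lambda>K. \<Sum>a\<in>A. c a * F a K) =
    (\<Sum>i\<in>UNIV. \<Sum>a\<in>A. \<Sum>j\<in>UNIV. c a * (H $ i $ j * tensor_form H m (\<lambda>K. S (i # K)) (\<lambda>K. F a (j # K))))"
    by (simp add: Suc.IH sum_distrib_left mult.left_commute) (subst sum.swap, simp)
  also have "\<dots> = (\<Sum>a\<in>A. c a * tensor_form H (Suc m) S (F a))"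
    by (subst sum.swap) (simp add: sum_distrib_left)
  finally show ?case .
qed

text \<open>The hypothesis reads H' = J H J^T, the transformation law of an inverse metric. Each
  slot contributes one such product once bilinearity has pulled the Jacobians out; the rest is a
  reordering of sums.\<close>

lemma tensor_form_pull_back:
  assumes "\<And>a b. (\<Sum>i\<in>UNIV. \<Sum>j\<in>UNIV. H $ i $ j * J $ a $ i * J $ b $ j) = H' $ a $ b"
  shows "tensor_form H m (pull_back J S) (pull_back J T) = tensor_form H' m S T"
proof (induction m arbitrary: S T)
  case 0
  then show ?case by simp
next
  case (Suc m)
  let ?q = "\<lambda>a b. tensor_form H' m (\<lambda>K. S (a # K)) (\<lambda>K. T (b # K))"
  have "tensor_form H (Suc m) (pull_back J S) (pull_back J T) =
     (\<Sum>i\<in>UNIV. \<Sum>j\<in>UNIV. H $ i $ j * (\<Sum>a\<in>UNIV. J $ a $ i * (\<Sum>b\<in>UNIV. J $ b $ j * ?q a b)))"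
    by (simp add: tensor_form_linear_left tensor_form_linear_right Suc.IH)
  also have "\<dots> = (\<Sum>i\<in>UNIV. \<Sum>j\<in>UNIV. \<Sum>a\<in>UNIV. \<Sum>b\<in>UNIV. H $ i $ j * J $ a $ i * J $ b $ j * ?q a b)"
    by (simp add: sum_distrib_left mult.assoc)
  also have "\<dots> = (\<Sum>i\<in>UNIV. \<Sum>a\<in>UNIV. \<Sum>j\<in>UNIV. \<Sum>b\<in>UNIV. H $ i $ j * J $ a $ i * J $ b $ j * ?q a b)"
    by (rule sum.cong[OF refl], rule sum.swap)
  also have "\<dots> = (\<Sum>a\<in>UNIV. \<Sum>i\<in>UNIV. \<Sum>j\<in>UNIV. \<Sum>b\<in>UNIV. H $ i $ j * J $ a $ i * J $ b $ j * ?q a b)"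
    by (rule sum.swap)
  also have "\<dots> = (\<Sum>a\<in>UNIV. \<Sum>i\<in>UNIV. \<Sum>b\<in>UNIV. \<Sum>j\<in>UNIV. H $ i $ j * J $ a $ i * J $ b $ j * ?q a b)"
    by (rule sum.cong[OF refl], rule sum.cong[OF refl], rule sum.swap)
  also have "\<dots> = (\<Sum>a\<in>UNIV. \<Sum>b\<in>UNIV. \<Sum>i\<in>UNIV. \<Sum>j\<in>UNIV. H $ i $ j * J $ a $ i * J $ b $ j * ?q a b)"
    by (rule sum.cong[OF refl], rule sum.swap)
  also have "\<dots> = (\<Sum>a\<in>UNIV. \<Sum>b\<in>UNIV. H' $ a $ b * ?q a b)"
    by (simp add: sum_distrib_right[symmetric] assms)
  finally show ?case by simp
qed

text \<open>Lagrange's reduction of a positive semidefinite form, one index at a time.\<close>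

lemma psd_sum_of_squares:
  fixes K :: "'i \<Rightarrow> 'i \<Rightarrow> real"
  assumes "finite F" "\<And>i j. i \<in> F \<Longrightarrow> j \<in> F \<Longrightarrow> K i j = K j i"
    "\<And>u. 0 \<le> (\<Sum>i\<in>F. \<Sum>j\<in>F. K i j * u i * u j)"
  shows "\<exists>n b. \<forall>i\<in>F. \<forall>j\<in>F. K i j = (\<Sum>r<(n::nat). b r i * b r j)"
  using assms
proof (induction F arbitrary: K rule: finite_induct)
  case empty
  then show ?case by simp
next
  case (insert k F)
  have split: "(\<Sum>i\<in>insert k F. \<Sum>j\<in>insert k F. K i j * u i * u j) =
     K k k * u k * u k + 2 * u k * (\<Sum>i\<in>F. K k i * u i) + (\<Sum>i\<in>F. \<Sum>j\<in>F. K i j * u i * u j)" for u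
  proof -
    have "(\<Sum>i\<in>F. K i k * u i * u k) = u k * (\<Sum>i\<in>F. K k i * u i)"
      unfolding sum_distrib_left by (intro sum.cong refl) (simp add: insert.prems(1)[of k] mult.commute)
    moreover have "(\<Sum>j\<in>F. K k j * u k * u j) = u k * (\<Sum>i\<in>F. K k i * u i)"
      unfolding sum_distrib_left by (intro sum.cong refl) (simp add: mult.left_commute)
    ultimately show ?thesis using insert.hyps by (simp add: sum.distrib)
  qed
  have diag: "(\<Sum>i\<in>F. K k i * (if i = j then a else 0)) = K k j * a" if "j \<in> F" for j a
    using insert.hyps that by (simp add: if_distrib[of "(*) _"] sum.delta cong: if_cong)
  have dbl: "(\<Sum>i\<in>F. \<Sum>j'\<in>F. K i j' * (if i = j then 1 else 0) * (if j' = j then 1 else 0)) = K j j" if "j \<in> F" for j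
    using insert.hyps that by (simp add: if_distrib[of "(*) _"] if_distribR sum.delta cong: if_cong)
  have psd: "0 \<le> K k k * s * s + 2 * s * (\<Sum>i\<in>F. K k i * u i) + (\<Sum>i\<in>F. \<Sum>j\<in>F. K i j * u i * u j)" for s u
  proof -
    have "(\<Sum>i\<in>F. K k i * (u(k := s)) i) = (\<Sum>i\<in>F. K k i * u i)"
      "(\<Sum>i\<in>F. \<Sum>j\<in>F. K i j * (u(k := s)) i * (u(k := s)) j) = (\<Sum>i\<in>F. \<Sum>j\<in>F. K i j * u i * u j)"
      using insert.hyps(2) by (auto intro!: sum.cong)
    then show ?thesis using insert.prems(2)[of "u(k := s)"] unfolding split by simp
  qed
  have Kkk: "0 \<le> K k k" using psd[of 1 "\<lambda>_. 0"] by simp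
  show ?case
  proof (cases "K k k = 0")
    case True
    have zero: "K k j = 0" if "j \<in> F" for j
    proof (rule ccontr)
      assume nz: "K k j \<noteq> 0"
      \<comment> \<open>If K k j were nonzero, the vector with this entry at k and 1 at j would give
        the form the value -1.\<close>
      have "0 \<le> 2 * (- (K j j + 1) / (2 * K k j)) * K k j + K j j"
        using psd[of "- (K j j + 1) / (2 * K k j)" "\<lambda>i. if i = j then 1 else 0"]
        unfolding diag[OF that] dbl[OF that] True by simp
      then show False using nz by (simp add: field_simps)
    qed
    have "\<exists>n b. \<forall>i\<in>F. \<forall>j\<in>F. K i j = (\<Sum>r<(n::nat). b r i * b r j)"
      by (rule insert.IH) (use insert.prems(1) psd[of 0] in auto)
    then obtain n b where b: "\<And>i j. i \<in> F \<Longrightarrow> j \<in> F \<Longrightarrow> K i j = (\<Sum>r<(n::nat). b r i * b r j)" by blast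
    define b' where "b' = (\<lambda>r i. if i = k then 0 else b r i)"
    have "K i j = (\<Sum>r<n. b' r i * b' r j)" if ij: "i \<in> insert k F" "j \<in> insert k F" for i j
    proof -
      have "(\<Sum>r<n. b' r i * b' r j) = (if i = k \<or> j = k then 0 else (\<Sum>r<n. b r i * b r j))"
        by (auto simp: b'_def)
      then show ?thesis
        using ij b[of i j] zero True insert.prems(1)[of i j] by auto
    qed
    then show ?thesis by blast
  next
    case False
    then have pos: "0 < K k k" using Kkk by simp
    \<comment> \<open>The Schur complement of the entry at k. It is what remains after completing
      the square in the variable of index k, and it is nonnegative because the square can be made
      zero by the choice \<open>- s / K k k\<close>.\<close>
    define K' where "K' = (\<lambda>i j. K i j - K k i * K k j / K k k)"
    have "0 \<le> (\<Sum>i\<in>F. \<Sum>j\<in>F. K' i j * u i * u j)" for u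
    proof -
      define s where "s = (\<Sum>i\<in>F. K k i * u i)"
      have "(\<Sum>i\<in>F. \<Sum>j\<in>F. K' i j * u i * u j) =
          (\<Sum>i\<in>F. \<Sum>j\<in>F. K i j * u i * u j) - (\<Sum>i\<in>F. \<Sum>j\<in>F. (K k i * u i) * (K k j * u j) / K k k)"
        unfolding sum_subtractf[symmetric] by (intro sum.cong refl) (simp add: K'_def algebra_simps)
      also have "(\<Sum>i\<in>F. \<Sum>j\<in>F. (K k i * u i) * (K k j * u j) / K k k) = s * s / K k k"
        by (simp add: s_def sum_product sum_divide_distrib)
      also have "(\<Sum>i\<in>F. \<Sum>j\<in>F. K i j * u i * u j) - s * s / K k k =
         K k k * (- s / K k k) * (- s / K k k) + 2 * (- s / K k k) * s + (\<Sum>i\<in>F. \<Sum>j\<in>F. K i j * u i * u j)"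
        using pos by (simp add: field_simps)
      finally show ?thesis using psd[of "- s / K k k" u] by (simp add: s_def)
    qed
    then have "\<exists>n b. \<forall>i\<in>F. \<forall>j\<in>F. K' i j = (\<Sum>r<(n::nat). b r i * b r j)"
      by (intro insert.IH) (auto simp: K'_def insert.prems(1))
    then obtain n b where b: "\<And>i j. i \<in> F \<Longrightarrow> j \<in> F \<Longrightarrow> K' i j = (\<Sum>r<(n::nat). b r i * b r j)" by blast
    \<comment> \<open>The completed square is appended as number n; it restores row k and the rank
      one part subtracted in K'.\<close>
    define b' where "b' = (\<lambda>r i. if r = n then K k i / sqrt (K k k) else if i = k then 0 else b r i)"
    have "K i j = (\<Sum>r<Suc n. b' r i * b' r j)" if ij: "i \<in> insert k F" "j \<in> insert k F" for i j
    proof -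
      have sq: "b' n i * b' n j = K k i * K k j / K k k"
        using pos by (simp add: b'_def field_simps)
      have rest: "(\<Sum>r<n. b' r i * b' r j) = (if i = k \<or> j = k then 0 else (\<Sum>r<n. b r i * b r j))"
        by (auto simp: b'_def)
      show ?thesis
        using ij b[of i j] insert.prems(1)[of i k] pos unfolding sum.lessThan_Suc sq rest
        by (auto simp: K'_def)
    qed
    then show ?thesis by blast
  qed
qed

text \<open>H minus l times the identity is a sum of squares b_r b_r^T, so splitting off the first
  slot writes the form as l times the diagonal forms plus the forms of the tensors contracted with
  b_r. By induction all of these are nonnegative, which is why nonnegativity is proved together with
  the component bound.\<close>

lemma tensor_form_lower_aux:
  assumes H: "\<And>i j. H $ i $ j = H $ j $ i" "\<And>v. l * (v \<bullet> v) \<le> v \<bullet> (H *v v)" and "0 \<le> l"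
  shows "0 \<le> tensor_form H m S S \<and> (\<forall>I. length I = m \<longrightarrow> l ^ m * (S I)\<^sup>2 \<le> tensor_form H m S S)"
proof -
  define K where "K = (\<lambda>i j. H $ i $ j - (if i = j then l else 0))"
  have "0 \<le> (\<Sum>i\<in>UNIV. \<Sum>j\<in>UNIV. K i j * u i * u j)" for u
  proof -
    have "(\<Sum>i\<in>UNIV. \<Sum>j\<in>UNIV. K i j * u i * u j) =
        (\<Sum>i\<in>UNIV. \<Sum>j\<in>UNIV. H $ i $ j * u i * u j) - (\<Sum>i\<in>UNIV. l * u i * u i)"
    proof -
      have "K i j * u i * u j = H $ i $ j * u i * u j - (if i = j then l * u i * u j else 0)" for i j
        by (simp add: K_def algebra_simps)
      then show ?thesis by (simp add: sum_subtractf)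
    qed
    moreover have "(\<chi> i. u i) \<bullet> (H *v (\<chi> i. u i)) = (\<Sum>i\<in>UNIV. \<Sum>j\<in>UNIV. H $ i $ j * u i * u j)"
      by (simp add: inner_vec_def matrix_vector_mult_def sum_distrib_left algebra_simps)
    moreover have "l * ((\<chi> i. u i) \<bullet> (\<chi> i. u i)) = (\<Sum>i\<in>UNIV. l * u i * u i)"
      by (simp add: inner_vec_def sum_distrib_left mult.assoc)
    ultimately show ?thesis using H(2)[of "\<chi> i. u i"] by linarith
  qed
  then have "\<exists>n b. \<forall>i\<in>UNIV. \<forall>j\<in>UNIV. K i j = (\<Sum>r<(n::nat). b r i * b r j)"
    by (intro psd_sum_of_squares) (auto simp: K_def H(1))
  then obtain n b where b: "\<And>i j. K i j = (\<Sum>r<(n::nat). b r i * b r j)" by blast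
  have Hij: "H $ i $ j = (if i = j then l else 0) + (\<Sum>r<n. b r i * b r j)" for i j
    using b[of i j] by (simp add: K_def)
  show ?thesis
  proof (induction m arbitrary: S)
    case 0
    then show ?case by (simp add: power2_eq_square)
  next
    case (Suc m)
    let ?q = "\<lambda>i j. tensor_form H m (\<lambda>K. S (i # K)) (\<lambda>K. S (j # K))"
    let ?B = "\<lambda>r K. \<Sum>i\<in>UNIV. b r i * S (i # K)"
    have "tensor_form H (Suc m) S S = (\<Sum>i\<in>UNIV. \<Sum>j\<in>UNIV. (if i = j then l else 0) * ?q i j)
        + (\<Sum>i\<in>UNIV. \<Sum>j\<in>UNIV. \<Sum>r<n. b r i * b r j * ?q i j)"
      by (simp add: Hij distrib_right sum.distrib sum_distrib_right)
    also have "(\<Sum>i\<in>UNIV. \<Sum>j\<in>UNIV. (if i = j then l else 0) * ?q i j) = l * (\<Sum>i\<in>UNIV. ?q i i)"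
      by (simp add: sum_distrib_left if_distribR sum.delta if_distrib cong: if_cong)
    also have "(\<Sum>i\<in>UNIV. \<Sum>j\<in>UNIV. \<Sum>r<n. b r i * b r j * ?q i j) =
        (\<Sum>i\<in>UNIV. \<Sum>r<n. \<Sum>j\<in>UNIV. b r i * b r j * ?q i j)"
      by (rule sum.cong[OF refl], rule sum.swap)
    also have "\<dots> = (\<Sum>r<n. \<Sum>i\<in>UNIV. \<Sum>j\<in>UNIV. b r i * b r j * ?q i j)" by (rule sum.swap)
    also have "\<dots> = (\<Sum>r<n. tensor_form H m (?B r) (?B r))"
      by (simp add: tensor_form_linear_left tensor_form_linear_right sum_distrib_left mult.assoc)
    finally have eq: "tensor_form H (Suc m) S S = l * (\<Sum>i\<in>UNIV. ?q i i) + (\<Sum>r<n. tensor_form H m (?B r) (?B r))" .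
    have ge: "l * (\<Sum>i\<in>UNIV. ?q i i) \<le> tensor_form H (Suc m) S S"
      unfolding eq using Suc.IH by (simp add: sum_nonneg)
    have "0 \<le> l * (\<Sum>i\<in>UNIV. ?q i i)" using Suc.IH \<open>0 \<le> l\<close> by (simp add: sum_nonneg)
    moreover have "l ^ Suc m * (S I)\<^sup>2 \<le> tensor_form H (Suc m) S S" if len: "length I = Suc m" for I
    proof -
      obtain i I' where I: "I = i # I'" "length I' = m" using len by (cases I) auto
      have "l ^ m * (S I)\<^sup>2 \<le> ?q i i" using Suc.IH[of "\<lambda>K. S (i # K)"] I by simp
      also have "?q i i \<le> (\<Sum>i\<in>UNIV. ?q i i)"
        by (rule member_le_sum) (use Suc.IH in auto)
      finally have "l * (l ^ m * (S I)\<^sup>2) \<le> l * (\<Sum>i\<in>UNIV. ?q i i)"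
        using \<open>0 \<le> l\<close> by (rule mult_left_mono)
      then show ?thesis using ge by (simp add: mult.assoc)
    qed
    ultimately show ?case using ge by auto
  qed
qed

lemma tensor_form_component_bound:
  assumes "\<And>i j. H $ i $ j = H $ j $ i" "\<And>v. l * (v \<bullet> v) \<le> v \<bullet> (H *v v)" "0 \<le> l" "length I = m"
  shows "l ^ m * (S I)\<^sup>2 \<le> tensor_form H m S S"
  using tensor_form_lower_aux[of H l m S] assms by blast

section \<open>Covariant derivatives and change of coordinates\<close>

locale smooth_metric =
  fixes U :: "(real^'n) set" and G :: "real^'n \<Rightarrow> real^'n^'n"
  assumes open_U: "open U"
    and smooth_G: "\<And>i j. smooth_on U (\<lambda>x. G x $ i $ j)"
    and pos_def_G: "\<And>x. x \<in> U \<Longrightarrow> pos_def (G x)"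
begin

lemma smooth_inv: "smooth_on U (\<lambda>x. matrix_inv (G x) $ i $ j)"
  by (intro smooth_on_matrix_inv open_U smooth_G pos_def_invertible pos_def_G)

lemma smooth_christoffel: "smooth_on U (\<lambda>x. christoffel G x k i j)"
  unfolding christoffel_def
  by (intro smooth_on_mult smooth_on_sum smooth_on_const smooth_inv smooth_on_add smooth_on_diff
      smooth_on_partial_deriv open_U smooth_G)

lemma smooth_curvature_up: "smooth_on U (\<lambda>x. curvature_up G x i j k l)"
  unfolding curvature_up_def
  by (intro smooth_on_mult smooth_on_sum smooth_on_add smooth_on_diff
      smooth_on_partial_deriv open_U smooth_christoffel)

lemma smooth_riem_tensor: "smooth_on U (\<lambda>x. riem_tensor G x I)"
  unfolding riem_tensor_def
  by (intro smooth_on_mult smooth_on_sum open_U smooth_G smooth_curvature_up)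

lemma smooth_connection_term:
  assumes "\<And>I. smooth_on U (\<lambda>x. S x I)"
  shows "smooth_on U (\<lambda>x. connection_term (\<lambda>l i. christoffel G x l k i) (S x) I)"
  unfolding connection_term_eq
  by (intro smooth_on_mult smooth_on_sum open_U smooth_christoffel assms)

lemma smooth_cov_deriv:
  assumes "\<And>I. smooth_on U (\<lambda>x. S x I)"
  shows "smooth_on U (\<lambda>x. cov_deriv G S x I)"
proof (cases I)
  case Nil
  then show ?thesis by (simp add: cov_deriv_def smooth_on_const open_U)
next
  case (Cons k J)
  show ?thesis unfolding Cons cov_deriv_Cons
    by (intro smooth_on_diff smooth_on_partial_deriv smooth_connection_term open_U assms)
qed

lemma smooth_cov_deriv_funpow:
  assumes "\<And>I. smooth_on U (\<lambda>x. S x I)"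
  shows "smooth_on U (\<lambda>x. (cov_deriv G ^^ j) S x I)"
  by (induction j arbitrary: I) (simp_all add: assms smooth_cov_deriv)

lemma diff: "smooth_on U f \<Longrightarrow> x \<in> U \<Longrightarrow> f differentiable (at x)"
  by (rule smooth_on_imp_differentiable[OF open_U])

lemma G_sym: "x \<in> U \<Longrightarrow> G x $ i $ j = G x $ j $ i"
  by (rule pos_def_sym[OF pos_def_G])

lemma partial_deriv_G_sym: "x \<in> U \<Longrightarrow> partial_deriv k (\<lambda>y. G y $ i $ j) x = partial_deriv k (\<lambda>y. G y $ j $ i) x"
  by (rule partial_deriv_cong[OF open_U]) (simp_all add: G_sym)

lemma christoffel_sym: "x \<in> U \<Longrightarrow> christoffel G x k i j = christoffel G x k j i"
  unfolding christoffel_def using partial_deriv_G_sym[of x _ i j] by (simp add: algebra_simps)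

text \<open>With the index lowered the inverse metric disappears and only first derivatives of G
  remain. Both the change of coordinates and the time derivative of the Christoffel symbols are
  computed in this form.\<close>

lemma lower_christoffel:
  assumes "x \<in> U"
  shows "(\<Sum>k\<in>UNIV. G x $ n $ k * christoffel G x k i j) =
    (partial_deriv i (\<lambda>y. G y $ j $ n) x + partial_deriv j (\<lambda>y. G y $ i $ n) x
      - partial_deriv n (\<lambda>y. G y $ i $ j) x) / 2"
proof -
  let ?c = "\<lambda>l. (partial_deriv i (\<lambda>y. G y $ j $ l) x + partial_deriv j (\<lambda>y. G y $ i $ l) x
      - partial_deriv l (\<lambda>y. G y $ i $ j) x) / 2"
  have "(\<Sum>k\<in>UNIV. G x $ n $ k * christoffel G x k i j) =
     (\<Sum>k\<in>UNIV. \<Sum>l\<in>UNIV. G x $ n $ k * matrix_inv (G x) $ k $ l * ?c l)"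
    by (simp add: christoffel_def sum_distrib_left mult.assoc)
  also have "\<dots> = (\<Sum>l\<in>UNIV. \<Sum>k\<in>UNIV. G x $ n $ k * matrix_inv (G x) $ k $ l * ?c l)"
    by (rule sum.swap)
  also have "\<dots> = (\<Sum>l\<in>UNIV. (if n = l then 1 else 0) * ?c l)"
    by (simp only: sum_distrib_right[symmetric] matrix_inv_nth(1)[OF pos_def_G[OF assms]])
  also have "\<dots> = ?c n" by (simp add: if_distribR if_distrib cong: if_cong)
  finally show ?thesis .
qed

text \<open>This is \<nabla>G = 0, solved for the coordinate derivative; bounds on the Christoffel
  symbols thereby become bounds on derivatives of G.\<close>

lemma metric_compatible:
  assumes "x \<in> U"
  shows "partial_deriv i (\<lambda>y. G y $ a $ b) x =
    (\<Sum>m\<in>UNIV. G x $ b $ m * christoffel G x m i a) + (\<Sum>m\<in>UNIV. G x $ a $ m * christoffel G x m i b)"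
  unfolding lower_christoffel[OF assms] using partial_deriv_G_sym[OF assms, of _ a b]
  by (simp add: field_simps)

text \<open>In the commutator the second derivatives of S cancel by symmetry, the first derivatives
  cancel in pairs, and the terms with i and j in one Christoffel symbol cancel because it is
  symmetric; what remains is the curvature. The outer derivative has the first index, and the sign
  is the one for 1-forms.\<close>

lemma ricci_identity:
  assumes S: "\<And>I. smooth_on U (\<lambda>x. S x I)" and x: "x \<in> U"
  shows "cov_deriv G (cov_deriv G S) x [i, j, k] - cov_deriv G (cov_deriv G S) x [j, i, k] =
    - (\<Sum>l\<in>UNIV. curvature_up G x i j k l * S x [l])"
proof -
  define C where "C = (\<lambda>l i j. christoffel G x l i j)"
  define dS where "dS = (\<lambda>i l. partial_deriv i (\<lambda>y. S y [l]) x)"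
  define dC where "dC = (\<lambda>i l j k. partial_deriv i (\<lambda>y. christoffel G y l j k) x)"
  define ddS where "ddS = (\<lambda>i j k. partial_deriv i (partial_deriv j (\<lambda>y. S y [k])) x)"
  define s where "s = (\<lambda>l. S x [l])"
  have one: "cov_deriv G S y [j, k] = partial_deriv j (\<lambda>y. S y [k]) y - (\<Sum>l\<in>UNIV. christoffel G y l j k * S y [l])"
    for y j k by (simp add: cov_deriv_Cons)
  have T: "cov_deriv G S x [j, k] = dS j k - (\<Sum>l\<in>UNIV. C l j k * s l)" for j k
    by (simp add: one dS_def C_def s_def)
  note smooth = open_U smooth_christoffel S smooth_on_partial_deriv smooth_on_mult smooth_on_sum
  have dT: "partial_deriv i (\<lambda>y. cov_deriv G S y [j, k]) x =
      ddS i j k - (\<Sum>l\<in>UNIV. dC i l j k * s l + C l j k * dS i l)" for i j k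
  proof -
    have "partial_deriv i (\<lambda>y. cov_deriv G S y [j, k]) x =
       partial_deriv i (partial_deriv j (\<lambda>y. S y [k])) x - partial_deriv i (\<lambda>y. \<Sum>l\<in>UNIV. christoffel G y l j k * S y [l]) x"
      unfolding one by (rule partial_deriv_diff) (intro diff x smooth)+
    also have "partial_deriv i (\<lambda>y. \<Sum>l\<in>UNIV. christoffel G y l j k * S y [l]) x =
       (\<Sum>l\<in>UNIV. partial_deriv i (\<lambda>y. christoffel G y l j k * S y [l]) x)"
      by (rule partial_deriv_sum) (intro diff x smooth)
    also have "\<dots> = (\<Sum>l\<in>UNIV. dC i l j k * s l + C l j k * dS i l)"
      unfolding dC_def s_def C_def dS_def
      by (rule sum.cong[OF refl], rule partial_deriv_mult) (intro diff x smooth)+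
    finally show ?thesis by (simp add: ddS_def)
  qed
  have two: "cov_deriv G (cov_deriv G S) x [i, j, k] = ddS i j k - (\<Sum>l\<in>UNIV. dC i l j k * s l + C l j k * dS i l)
     - (\<Sum>l\<in>UNIV. C l i j * (dS l k - (\<Sum>m\<in>UNIV. C m l k * s m)))
     - (\<Sum>l\<in>UNIV. C l i k * (dS j l - (\<Sum>m\<in>UNIV. C m j l * s m)))" for i j k
    by (subst cov_deriv_Cons) (simp add: dT T C_def[symmetric])
  have sym: "C l i j = C l j i" for l by (simp add: C_def christoffel_sym[OF x, of l i j])
  have dd: "ddS i j k = ddS j i k" unfolding ddS_def
    by (rule partial_deriv_commute[OF open_U S x])
  have exp: "(\<Sum>l\<in>UNIV. C l i k * (dS j l - (\<Sum>m\<in>UNIV. C m j l * s m))) =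
     (\<Sum>l\<in>UNIV. C l i k * dS j l) - (\<Sum>m\<in>UNIV. (\<Sum>l\<in>UNIV. C m j l * C l i k) * s m)" for i j
  proof -
    have "(\<Sum>l\<in>UNIV. C l i k * (\<Sum>m\<in>UNIV. C m j l * s m)) = (\<Sum>l\<in>UNIV. \<Sum>m\<in>UNIV. C m j l * C l i k * s m)"
      by (simp add: sum_distrib_left mult_ac)
    also have "\<dots> = (\<Sum>m\<in>UNIV. (\<Sum>l\<in>UNIV. C m j l * C l i k) * s m)"
      by (subst sum.swap) (simp add: sum_distrib_right)
    finally show ?thesis by (simp add: right_diff_distrib sum_subtractf)
  qed
  have "(\<Sum>l\<in>UNIV. curvature_up G x i j k l * S x [l]) =
     (\<Sum>l\<in>UNIV. dC i l j k * s l) - (\<Sum>l\<in>UNIV. dC j l i k * s l)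
     + ((\<Sum>m\<in>UNIV. (\<Sum>l\<in>UNIV. C m i l * C l j k) * s m) - (\<Sum>m\<in>UNIV. (\<Sum>l\<in>UNIV. C m j l * C l i k) * s m))"
  proof -
    have "curvature_up G x i j k l = dC i l j k - dC j l i k
        + ((\<Sum>p\<in>UNIV. C l i p * C p j k) - (\<Sum>p\<in>UNIV. C l j p * C p i k))" for l
      by (simp add: curvature_up_def dC_def C_def sum_subtractf)
    moreover have "S x [l] = s l" for l by (simp add: s_def)
    ultimately show ?thesis
      by (simp add: distrib_right left_diff_distrib sum.distrib sum_subtractf)
  qed
  then show ?thesis
    unfolding two exp by (simp add: sym dd sum.distrib)
qed

end

lemma cov_deriv_cong:
  assumes "open U" "x \<in> U" "\<And>y K. y \<in> U \<Longrightarrow> length K = length I \<Longrightarrow> S y K = T y K"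
  shows "cov_deriv G S x (k # I) = cov_deriv G T x (k # I)"
  unfolding cov_deriv_Cons
  using partial_deriv_cong[OF assms(1,2), of "\<lambda>y. S y I" "\<lambda>y. T y I" k]
    connection_term_cong[of I "S x" "T x"] assms by simp

locale chart_change =
  M: smooth_metric U G + M': smooth_metric U' G'
  for U U' :: "(real^'n) set" and G G' :: "real^'n \<Rightarrow> real^'n^'n" +
  fixes \<phi> :: "real^'n \<Rightarrow> real^'n"
  assumes smooth_phi: "smooth_on U \<phi>"
    and phi_in: "\<And>x. x \<in> U \<Longrightarrow> \<phi> x \<in> U'"
    and G_transform: "\<And>x. x \<in> U \<Longrightarrow>
      G x = transpose (jacobian \<phi> (at x)) ** G' (\<phi> x) ** jacobian \<phi> (at x)"
begin

definition J :: "'n \<Rightarrow> 'n \<Rightarrow> real^'n \<Rightarrow> real" where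
  "J a i x = jacobian \<phi> (at x) $ a $ i"

lemma phi_diff: "x \<in> U \<Longrightarrow> \<phi> differentiable (at x)"
  by (rule smooth_on_imp_differentiable[OF M.open_U smooth_phi])

lemma J_eq: "x \<in> U \<Longrightarrow> J a i x = partial_deriv i (\<lambda>y. \<phi> y $ a) x"
  by (simp add: J_def jacobian_nth phi_diff)

lemma smooth_phi_nth: "smooth_on U (\<lambda>y. \<phi> y $ a)"
  by (rule smooth_on_vec_nth[OF M.open_U smooth_phi])

lemma smooth_J: "smooth_on U (J a i)"
  by (rule smooth_on_cong[THEN iffD1, OF _ smooth_on_partial_deriv[OF M.open_U smooth_phi_nth[of a], of i]])
     (simp add: J_eq)

lemma J_diff: "x \<in> U \<Longrightarrow> J a i differentiable (at x)"
  by (rule M.diff[OF smooth_J])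

lemma partial_J_sym: "x \<in> U \<Longrightarrow> partial_deriv k (J a i) x = partial_deriv i (J a k) x"
  using partial_deriv_commute[OF M.open_U smooth_phi_nth, of x k i a]
    partial_deriv_cong[OF M.open_U, of x "J a i" "partial_deriv i (\<lambda>y. \<phi> y $ a)" k]
    partial_deriv_cong[OF M.open_U, of x "J a k" "partial_deriv k (\<lambda>y. \<phi> y $ a)" i]
  by (simp add: J_eq)

lemma G_eq: "x \<in> U \<Longrightarrow> G x $ i $ j = (\<Sum>a\<in>UNIV. \<Sum>b\<in>UNIV. J a i x * G' (\<phi> x) $ a $ b * J b j x)"
  unfolding G_transform J_def
  by (simp add: matrix_matrix_mult_def transpose_def sum_distrib_right) (rule sum.swap)

lemma chain:
  assumes "x \<in> U" "F differentiable (at (\<phi> x))"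
  shows "partial_deriv k (\<lambda>y. F (\<phi> y)) x = (\<Sum>c\<in>UNIV. J c k x * partial_deriv c F (\<phi> x))"
  unfolding J_def by (rule partial_deriv_compose[OF phi_diff[OF assms(1)] assms(2)])

lemma compose_diff: "x \<in> U \<Longrightarrow> F differentiable (at (\<phi> x)) \<Longrightarrow> (\<lambda>y. F (\<phi> y)) differentiable (at x)"
  using differentiable_chain_at[OF phi_diff, of x F] by (simp add: comp_def)

lemma G'_diff: "x \<in> U \<Longrightarrow> (\<lambda>y. G' y $ a $ b) differentiable (at (\<phi> x))"
  by (rule M'.diff[OF M'.smooth_G phi_in])

text \<open>The determinant of the positive definite matrix G contains that of the Jacobian as a
  factor, so \<phi> itself need not be assumed invertible.\<close>

lemma invertible_J: "x \<in> U \<Longrightarrow> invertible (jacobian \<phi> (at x))"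
  using pos_def_invertible[OF M.pos_def_G, of x] G_transform[of x]
  by (simp add: invertible_det_nz det_mul)

text \<open>In the second sum the roles of i and n are exchanged by the symmetry of G', so that both
  terms with second derivatives of \<phi> have the same shape.\<close>

lemma partial_deriv_G:
  assumes x: "x \<in> U"
  shows "partial_deriv k (\<lambda>y. G y $ i $ n) x =
     (\<Sum>a\<in>UNIV. \<Sum>b\<in>UNIV. partial_deriv k (J a i) x * G' (\<phi> x) $ a $ b * J b n x)
   + (\<Sum>a\<in>UNIV. \<Sum>b\<in>UNIV. partial_deriv k (J a n) x * G' (\<phi> x) $ a $ b * J b i x)
   + (\<Sum>a\<in>UNIV. \<Sum>b\<in>UNIV. \<Sum>c\<in>UNIV. J a i x * J b n x * J c k x * partial_deriv c (\<lambda>y. G' y $ a $ b) (\<phi> x))"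
proof -
  note d = J_diff[OF x] compose_diff[OF x G'_diff[OF x]]
  have "partial_deriv k (\<lambda>y. G y $ i $ n) x =
      partial_deriv k (\<lambda>y. \<Sum>a\<in>UNIV. \<Sum>b\<in>UNIV. J a i y * G' (\<phi> y) $ a $ b * J b n y) x"
    by (rule partial_deriv_cong[OF M.open_U x G_eq])
  also have "\<dots> = (\<Sum>a\<in>UNIV. \<Sum>b\<in>UNIV. partial_deriv k (\<lambda>y. J a i y * G' (\<phi> y) $ a $ b * J b n y) x)"
    by (simp add: partial_deriv_sum differentiable_sum differentiable_mult d)
  also have "\<dots> = (\<Sum>a\<in>UNIV. \<Sum>b\<in>UNIV. partial_deriv k (J a i) x * G' (\<phi> x) $ a $ b * J b n x
       + J a i x * G' (\<phi> x) $ a $ b * partial_deriv k (J b n) x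
       + (\<Sum>c\<in>UNIV. J a i x * J b n x * J c k x * partial_deriv c (\<lambda>y. G' y $ a $ b) (\<phi> x)))"
    by (simp add: partial_deriv_mult differentiable_mult d chain[OF x G'_diff[OF x]] algebra_simps sum_distrib_left)
  also have "\<dots> = (\<Sum>a\<in>UNIV. \<Sum>b\<in>UNIV. partial_deriv k (J a i) x * G' (\<phi> x) $ a $ b * J b n x)
       + (\<Sum>a\<in>UNIV. \<Sum>b\<in>UNIV. J a i x * G' (\<phi> x) $ a $ b * partial_deriv k (J b n) x)
       + (\<Sum>a\<in>UNIV. \<Sum>b\<in>UNIV. \<Sum>c\<in>UNIV. J a i x * J b n x * J c k x * partial_deriv c (\<lambda>y. G' y $ a $ b) (\<phi> x))"
    by (simp add: sum.distrib)
  also have "(\<Sum>a\<in>UNIV. \<Sum>b\<in>UNIV. J a i x * G' (\<phi> x) $ a $ b * partial_deriv k (J b n) x) =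
     (\<Sum>a\<in>UNIV. \<Sum>b\<in>UNIV. partial_deriv k (J a n) x * G' (\<phi> x) $ a $ b * J b i x)"
    by (subst sum.swap, intro sum.cong refl) (simp add: M'.G_sym[OF phi_in[OF x]] mult_ac)
  finally show ?thesis .
qed

text \<open>The lowered Christoffel symbols of G, computed from \<open>partial_deriv_G\<close>,
  split into second derivatives of \<phi>, collected in P, and derivatives of G', collected in Q. In
  the alternating combination of three derivatives of the metric the former reduce by symmetry to a
  single term, and the latter give the pulled back symbols of G'.\<close>

lemma christoffel_transform:
  assumes x: "x \<in> U"
  shows "partial_deriv k (J a i) x = (\<Sum>l\<in>UNIV. J a l x * christoffel G x l k i)
    - (\<Sum>b\<in>UNIV. \<Sum>c\<in>UNIV. christoffel G' (\<phi> x) a b c * J b k x * J c i x)"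
proof -
  define P where "P = (\<lambda>k i n. \<Sum>a\<in>UNIV. \<Sum>b\<in>UNIV. partial_deriv k (J a i) x * G' (\<phi> x) $ a $ b * J b n x)"
  define Q where "Q = (\<lambda>k i n. \<Sum>a\<in>UNIV. \<Sum>b\<in>UNIV. \<Sum>c\<in>UNIV. J a i x * J b n x * J c k x * partial_deriv c (\<lambda>y. G' y $ a $ b) (\<phi> x))"
  have dG: "partial_deriv k (\<lambda>y. G y $ i $ n) x = P k i n + P k n i + Q k i n" for k i n
    unfolding P_def Q_def by (rule partial_deriv_G[OF x])
  have Psym: "P k i n = P i k n" for k i n unfolding P_def by (simp add: partial_J_sym[OF x, of k _ i])
  \<comment> \<open>The defect of the claimed identity. It vanishes as soon as its lowered and
    pulled back components do, because G' and the Jacobian are invertible.\<close>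
  define E where "E = (\<lambda>a. (\<Sum>l\<in>UNIV. J a l x * christoffel G x l k i)
    - (\<Sum>b\<in>UNIV. \<Sum>c\<in>UNIV. christoffel G' (\<phi> x) a b c * J b k x * J c i x) - partial_deriv k (J a i) x)"
  have zero: "(\<Sum>d\<in>UNIV. J d n x * (\<Sum>a\<in>UNIV. G' (\<phi> x) $ d $ a * E a)) = 0" for n
  proof -
    have 1: "(\<Sum>d\<in>UNIV. J d n x * (\<Sum>a\<in>UNIV. G' (\<phi> x) $ d $ a * (\<Sum>l\<in>UNIV. J a l x * christoffel G x l k i))) =
       (2 * P k i n + Q k i n + Q i k n - Q n k i) / 2"
    proof -
      have "(\<Sum>d\<in>UNIV. J d n x * (\<Sum>a\<in>UNIV. G' (\<phi> x) $ d $ a * (\<Sum>l\<in>UNIV. J a l x * christoffel G x l k i))) =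
        (\<Sum>d\<in>UNIV. \<Sum>a\<in>UNIV. \<Sum>l\<in>UNIV. J d n x * G' (\<phi> x) $ d $ a * J a l x * christoffel G x l k i)"
        by (simp add: sum_distrib_left mult.assoc)
      also have "\<dots> = (\<Sum>d\<in>UNIV. \<Sum>l\<in>UNIV. \<Sum>a\<in>UNIV. J d n x * G' (\<phi> x) $ d $ a * J a l x * christoffel G x l k i)"
        by (rule sum.cong[OF refl], rule sum.swap)
      also have "\<dots> = (\<Sum>l\<in>UNIV. \<Sum>d\<in>UNIV. \<Sum>a\<in>UNIV. J d n x * G' (\<phi> x) $ d $ a * J a l x * christoffel G x l k i)"
        by (rule sum.swap)
      also have "\<dots> = (\<Sum>l\<in>UNIV. G x $ n $ l * christoffel G x l k i)"
        by (simp add: G_eq[OF x] sum_distrib_right)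
      also have "\<dots> = (partial_deriv k (\<lambda>y. G y $ i $ n) x + partial_deriv i (\<lambda>y. G y $ k $ n) x
        - partial_deriv n (\<lambda>y. G y $ k $ i) x) / 2" by (rule M.lower_christoffel[OF x])
      also have "\<dots> = (2 * P k i n + Q k i n + Q i k n - Q n k i) / 2"
        unfolding dG using Psym[of k i n] Psym[of n k i] Psym[of n i k] by simp
      finally show ?thesis .
    qed
    have 2: "(\<Sum>d\<in>UNIV. J d n x * (\<Sum>a\<in>UNIV. G' (\<phi> x) $ d $ a *
        (\<Sum>b\<in>UNIV. \<Sum>c\<in>UNIV. christoffel G' (\<phi> x) a b c * J b k x * J c i x))) = (Q k i n + Q i k n - Q n k i) / 2"
    proof -
      let ?g = "\<lambda>c a b. partial_deriv c (\<lambda>y. G' y $ a $ b) (\<phi> x)"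
      have low: "(\<Sum>a\<in>UNIV. G' (\<phi> x) $ d $ a * (\<Sum>b\<in>UNIV. \<Sum>c\<in>UNIV. christoffel G' (\<phi> x) a b c * J b k x * J c i x)) =
         (\<Sum>b\<in>UNIV. \<Sum>c\<in>UNIV. (?g b c d + ?g c b d - ?g d b c) / 2 * (J b k x * J c i x))" for d
      proof -
        have "(\<Sum>a\<in>UNIV. G' (\<phi> x) $ d $ a * (\<Sum>b\<in>UNIV. \<Sum>c\<in>UNIV. christoffel G' (\<phi> x) a b c * J b k x * J c i x)) =
          (\<Sum>a\<in>UNIV. \<Sum>b\<in>UNIV. \<Sum>c\<in>UNIV. G' (\<phi> x) $ d $ a * christoffel G' (\<phi> x) a b c * (J b k x * J c i x))"
          by (simp add: sum_distrib_left mult.assoc)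
        also have "\<dots> = (\<Sum>b\<in>UNIV. \<Sum>a\<in>UNIV. \<Sum>c\<in>UNIV. G' (\<phi> x) $ d $ a * christoffel G' (\<phi> x) a b c * (J b k x * J c i x))"
          by (rule sum.swap)
        also have "\<dots> = (\<Sum>b\<in>UNIV. \<Sum>c\<in>UNIV. \<Sum>a\<in>UNIV. G' (\<phi> x) $ d $ a * christoffel G' (\<phi> x) a b c * (J b k x * J c i x))"
          by (rule sum.cong[OF refl], rule sum.swap)
        also have "\<dots> = (\<Sum>b\<in>UNIV. \<Sum>c\<in>UNIV. (?g b c d + ?g c b d - ?g d b c) / 2 * (J b k x * J c i x))"
          by (simp only: sum_distrib_right[symmetric] M'.lower_christoffel[OF phi_in[OF x]])
        finally show ?thesis .
      qed
      have "(\<Sum>d\<in>UNIV. J d n x * (\<Sum>a\<in>UNIV. G' (\<phi> x) $ d $ a *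
        (\<Sum>b\<in>UNIV. \<Sum>c\<in>UNIV. christoffel G' (\<phi> x) a b c * J b k x * J c i x))) =
        ((\<Sum>d\<in>UNIV. \<Sum>b\<in>UNIV. \<Sum>c\<in>UNIV. J d n x * J b k x * J c i x * ?g b c d)
         + (\<Sum>d\<in>UNIV. \<Sum>b\<in>UNIV. \<Sum>c\<in>UNIV. J d n x * J b k x * J c i x * ?g c b d)
         - (\<Sum>d\<in>UNIV. \<Sum>b\<in>UNIV. \<Sum>c\<in>UNIV. J d n x * J b k x * J c i x * ?g d b c)) / 2"
      proof -
        have "J d n x * ((?g b c d + ?g c b d - ?g d b c) / 2 * (J b k x * J c i x)) =
          (J d n x * J b k x * J c i x * ?g b c d + J d n x * J b k x * J c i x * ?g c b d
            - J d n x * J b k x * J c i x * ?g d b c) / 2" for d b c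
          by (simp add: field_simps)
        then show ?thesis
          unfolding low by (simp only: sum_distrib_left sum_divide_distrib[symmetric] sum.distrib sum_subtractf)
      qed
      also have "(\<Sum>d\<in>UNIV. \<Sum>b\<in>UNIV. \<Sum>c\<in>UNIV. J d n x * J b k x * J c i x * ?g c b d) = Q i k n"
        unfolding Q_def by (subst sum.swap) (simp add: mult_ac)
      also have "(\<Sum>d\<in>UNIV. \<Sum>b\<in>UNIV. \<Sum>c\<in>UNIV. J d n x * J b k x * J c i x * ?g b c d) = Q k i n"
      proof -
        have "(\<Sum>d\<in>UNIV. \<Sum>b\<in>UNIV. \<Sum>c\<in>UNIV. J d n x * J b k x * J c i x * ?g b c d) =
          (\<Sum>d\<in>UNIV. \<Sum>c\<in>UNIV. \<Sum>b\<in>UNIV. J d n x * J b k x * J c i x * ?g b c d)"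
          by (rule sum.cong[OF refl], rule sum.swap)
        also have "\<dots> = (\<Sum>c\<in>UNIV. \<Sum>d\<in>UNIV. \<Sum>b\<in>UNIV. J d n x * J b k x * J c i x * ?g b c d)"
          by (rule sum.swap)
        finally show ?thesis unfolding Q_def by (simp add: mult_ac)
      qed
      also have "(\<Sum>d\<in>UNIV. \<Sum>b\<in>UNIV. \<Sum>c\<in>UNIV. J d n x * J b k x * J c i x * ?g d b c) = Q n k i"
      proof -
        have "(\<Sum>d\<in>UNIV. \<Sum>b\<in>UNIV. \<Sum>c\<in>UNIV. J d n x * J b k x * J c i x * ?g d b c) =
          (\<Sum>b\<in>UNIV. \<Sum>d\<in>UNIV. \<Sum>c\<in>UNIV. J d n x * J b k x * J c i x * ?g d b c)"
          by (rule sum.swap)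
        also have "\<dots> = (\<Sum>b\<in>UNIV. \<Sum>c\<in>UNIV. \<Sum>d\<in>UNIV. J d n x * J b k x * J c i x * ?g d b c)"
          by (rule sum.cong[OF refl], rule sum.swap)
        finally show ?thesis unfolding Q_def by (simp add: mult_ac)
      qed
      finally show ?thesis .
    qed
    have 3: "(\<Sum>d\<in>UNIV. J d n x * (\<Sum>a\<in>UNIV. G' (\<phi> x) $ d $ a * partial_deriv k (J a i) x)) = P k i n"
      unfolding P_def sum_distrib_left
      by (subst sum.swap, intro sum.cong refl) (simp add: M'.G_sym[OF phi_in[OF x]] mult_ac)
    show ?thesis
      unfolding E_def right_diff_distrib sum_subtractf 1 2 3 by (simp add: field_simps)
  qed
  have "transpose (jacobian \<phi> (at x)) *v (G' (\<phi> x) *v (\<chi> a. E a)) = 0"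
    using zero by (simp add: vec_eq_iff matrix_vector_mult_def transpose_def J_def)
  then have "G' (\<phi> x) *v (\<chi> a. E a) = 0"
    using invertible_J[OF x] by (metis invertible_def invertible_det_nz det_transpose matrix_vector_mul_assoc
        matrix_vector_mul_lid matrix_vector_mult_0_right)
  then have "(\<chi> a. E a) = 0"
    using pos_def_invertible[OF M'.pos_def_G[OF phi_in[OF x]]]
    by (metis invertible_def matrix_vector_mul_assoc matrix_vector_mul_lid matrix_vector_mult_0_right)
  then have "E a = 0" by (simp add: vec_eq_iff)
  then show ?thesis by (simp add: E_def)
qed

end

section \<open>Tensoriality of the covariant derivative and of the curvature\<close>

context chart_change
begin

abbreviation "jac x \<equiv> jacobian \<phi> (at x)"
abbreviation "\<Gamma> x k \<equiv> (\<lambda>l i. christoffel G x l k i)"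
abbreviation "\<Gamma>' x k \<equiv> (\<lambda>l i. christoffel G' x l k i)"

lemma jac_J: "jac x $ a $ i = J a i x"
  by (simp add: J_def)

lemma smooth_compose:
  fixes F :: "real^'n \<Rightarrow> real"
  shows "smooth_on U' F \<Longrightarrow> smooth_on U (\<lambda>y. F (\<phi> y))"
  by (rule smooth_on_compose[OF M.open_U M'.open_U _ smooth_phi]) (auto simp: phi_in)

lemma smooth_pull_back:
  assumes "\<And>K. smooth_on U' (\<lambda>y. S y K)"
  shows "smooth_on U (\<lambda>y. pull_back (jac y) (S (\<phi> y)) I)"
  using assms
proof (induction I arbitrary: S)
  case Nil
  show ?case using smooth_compose[OF Nil[of "[]"]] by simp
next
  case (Cons i I)
  have "smooth_on U (\<lambda>y. pull_back (jac y) (\<lambda>K. S (\<phi> y) (a # K)) I)" for a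
    by (rule Cons.IH) (rule Cons.prems)
  then show ?case
    unfolding pull_back.simps jac_J by (intro smooth_on_sum smooth_on_mult smooth_J M.open_U)
qed

text \<open>Differentiating a Jacobian factor produces second derivatives of \<phi>. By
  \<open>christoffel_transform\<close> these combine with the connection term of that slot in the
  first chart to the connection term of the second chart, so that slot by slot the covariant
  derivative commutes with pulling back.\<close>

lemma pull_back_covariant:
  assumes "\<And>K. smooth_on U' (\<lambda>y. S y K)" and x: "x \<in> U"
  shows "partial_deriv k (\<lambda>y. pull_back (jac y) (S (\<phi> y)) I) x
      - connection_term (\<Gamma> x k) (pull_back (jac x) (S (\<phi> x))) I
    = (\<Sum>b\<in>UNIV. J b k x * pull_back (jac x)
         (\<lambda>K. partial_deriv b (\<lambda>y. S y K) (\<phi> x) - connection_term (\<Gamma>' (\<phi> x) b) (S (\<phi> x)) K) I)"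
  using assms(1)
proof (induction I arbitrary: S)
  case Nil
  show ?case using chain[OF x M'.diff[OF Nil[of "[]"] phi_in[OF x]]] by simp
next
  case (Cons i I)
  \<comment> \<open>P and D are the pulled back components and the covariant derivative with the
    first index fixed to a. D omits the connection term of that first slot, which is restored at the
    end.\<close>
  define P where "P = (\<lambda>a y. pull_back (jac y) (\<lambda>K. S (\<phi> y) (a # K)) I)"
  define D where "D = (\<lambda>a b K. partial_deriv b (\<lambda>y. S y (a # K)) (\<phi> x) - connection_term (\<Gamma>' (\<phi> x) b) (\<lambda>K. S (\<phi> x) (a # K)) K)"
  have Pd: "P a differentiable (at x)" for a
    unfolding P_def by (rule M.diff[OF smooth_pull_back x]) (rule Cons.prems)
  have IH: "partial_deriv k (P a) x - connection_term (\<Gamma> x k) (pull_back (jac x) (\<lambda>K. S (\<phi> x) (a # K))) I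
     = (\<Sum>b\<in>UNIV. J b k x * pull_back (jac x) (D a b) I)" for a
    unfolding P_def D_def by (rule Cons.IH) (rule Cons.prems)
  have "partial_deriv k (\<lambda>y. pull_back (jac y) (S (\<phi> y)) (i # I)) x =
      partial_deriv k (\<lambda>y. \<Sum>a\<in>UNIV. J a i y * P a y) x"
    by (simp add: P_def jac_J)
  also have "\<dots> = (\<Sum>a\<in>UNIV. partial_deriv k (J a i) x * P a x + J a i x * partial_deriv k (P a) x)"
    by (simp add: partial_deriv_sum partial_deriv_mult differentiable_mult J_diff[OF x] Pd)
  finally have 1: "partial_deriv k (\<lambda>y. pull_back (jac y) (S (\<phi> y)) (i # I)) x =
     (\<Sum>a\<in>UNIV. partial_deriv k (J a i) x * P a x) + (\<Sum>a\<in>UNIV. J a i x * partial_deriv k (P a) x)"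
    by (simp add: sum.distrib)
  have "(\<Sum>l\<in>UNIV. christoffel G x l k i * (\<Sum>a\<in>UNIV. J a l x * P a x)) =
      (\<Sum>l\<in>UNIV. \<Sum>a\<in>UNIV. J a l x * christoffel G x l k i * P a x)"
    by (simp add: sum_distrib_left mult_ac)
  also have "\<dots> = (\<Sum>a\<in>UNIV. (\<Sum>l\<in>UNIV. J a l x * christoffel G x l k i) * P a x)"
    by (subst sum.swap) (simp add: sum_distrib_right)
  finally have 2: "connection_term (\<Gamma> x k) (pull_back (jac x) (S (\<phi> x))) (i # I) =
      (\<Sum>a\<in>UNIV. (\<Sum>l\<in>UNIV. J a l x * christoffel G x l k i) * P a x)
    + (\<Sum>a\<in>UNIV. J a i x * connection_term (\<Gamma> x k) (pull_back (jac x) (\<lambda>K. S (\<phi> x) (a # K))) I)"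
    by (simp add: P_def jac_J connection_term_linear)
  have "(\<Sum>a\<in>UNIV. (\<Sum>b\<in>UNIV. \<Sum>c\<in>UNIV. christoffel G' (\<phi> x) a b c * J b k x * J c i x) * P a x)
     = (\<Sum>a\<in>UNIV. \<Sum>b\<in>UNIV. \<Sum>c\<in>UNIV. J b k x * (J c i x * (christoffel G' (\<phi> x) a b c * P a x)))"
    by (simp add: sum_distrib_left sum_distrib_right mult_ac)
  also have "\<dots> = (\<Sum>b\<in>UNIV. \<Sum>a\<in>UNIV. \<Sum>c\<in>UNIV. J b k x * (J c i x * (christoffel G' (\<phi> x) a b c * P a x)))"
    by (rule sum.swap)
  also have "\<dots> = (\<Sum>b\<in>UNIV. \<Sum>c\<in>UNIV. \<Sum>a\<in>UNIV. J b k x * (J c i x * (christoffel G' (\<phi> x) a b c * P a x)))"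
    by (rule sum.cong[OF refl], rule sum.swap)
  also have "\<dots> = (\<Sum>b\<in>UNIV. J b k x * (\<Sum>c\<in>UNIV. J c i x * (\<Sum>a\<in>UNIV. christoffel G' (\<phi> x) a b c * P a x)))"
    by (simp add: sum_distrib_left)
  finally have 3: "(\<Sum>a\<in>UNIV. (\<Sum>b\<in>UNIV. \<Sum>c\<in>UNIV. christoffel G' (\<phi> x) a b c * J b k x * J c i x) * P a x) =
     (\<Sum>b\<in>UNIV. J b k x * (\<Sum>c\<in>UNIV. J c i x * (\<Sum>a\<in>UNIV. christoffel G' (\<phi> x) a b c * P a x)))" .
  have 4: "(\<Sum>a\<in>UNIV. J a i x * (\<Sum>b\<in>UNIV. J b k x * pull_back (jac x) (D a b) I)) =
     (\<Sum>b\<in>UNIV. J b k x * (\<Sum>a\<in>UNIV. J a i x * pull_back (jac x) (D a b) I))"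
    unfolding sum_distrib_left by (subst sum.swap) (simp add: mult_ac)
  have "partial_deriv k (\<lambda>y. pull_back (jac y) (S (\<phi> y)) (i # I)) x
      - connection_term (\<Gamma> x k) (pull_back (jac x) (S (\<phi> x))) (i # I)
    = (\<Sum>a\<in>UNIV. (partial_deriv k (J a i) x - (\<Sum>l\<in>UNIV. J a l x * christoffel G x l k i)) * P a x)
      + (\<Sum>a\<in>UNIV. J a i x * (partial_deriv k (P a) x
           - connection_term (\<Gamma> x k) (pull_back (jac x) (\<lambda>K. S (\<phi> x) (a # K))) I))"
    unfolding 1 2 by (simp add: left_diff_distrib right_diff_distrib sum_subtractf)
  also have "\<dots> = (\<Sum>b\<in>UNIV. J b k x * (\<Sum>a\<in>UNIV. J a i x * pull_back (jac x) (D a b) I))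
     - (\<Sum>a\<in>UNIV. (\<Sum>b\<in>UNIV. \<Sum>c\<in>UNIV. christoffel G' (\<phi> x) a b c * J b k x * J c i x) * P a x)"
    unfolding IH 4 christoffel_transform[OF x] by (simp add: sum_negf)
  also have "\<dots> = (\<Sum>b\<in>UNIV. J b k x * (\<Sum>a\<in>UNIV. J a i x *
       (pull_back (jac x) (D a b) I - (\<Sum>l\<in>UNIV. christoffel G' (\<phi> x) l b a * P l x))))"
    unfolding 3 by (simp add: right_diff_distrib sum_subtractf)
  also have "\<dots> = (\<Sum>b\<in>UNIV. J b k x * pull_back (jac x)
         (\<lambda>K. partial_deriv b (\<lambda>y. S y K) (\<phi> x) - connection_term (\<Gamma>' (\<phi> x) b) (S (\<phi> x)) K) (i # I))"
  proof -
    have "pull_back (jac x) (D a b) I - (\<Sum>l\<in>UNIV. christoffel G' (\<phi> x) l b a * P l x) =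
      pull_back (jac x) (\<lambda>K. partial_deriv b (\<lambda>y. S y (a # K)) (\<phi> x) -
          connection_term (\<Gamma>' (\<phi> x) b) (S (\<phi> x)) (a # K)) I" for a b
    proof -
      have "(\<lambda>K. partial_deriv b (\<lambda>y. S y (a # K)) (\<phi> x) - connection_term (\<Gamma>' (\<phi> x) b) (S (\<phi> x)) (a # K))
         = (\<lambda>K. D a b K - (\<Sum>l\<in>UNIV. christoffel G' (\<phi> x) l b a * S (\<phi> x) (l # K)))"
        by (simp add: D_def fun_eq_iff)
      then show ?thesis by (simp only: pull_back_diff pull_back_sum pull_back_cmult P_def)
    qed
    then show ?thesis by (simp add: jac_J)
  qed
  finally show ?case .
qed

text \<open>The restriction to length m matters: the values on lists of other lengths are arbitrary
  and need not transform.\<close>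

definition related :: "nat \<Rightarrow> 'n tensor \<Rightarrow> 'n tensor \<Rightarrow> bool" where
  "related m S S' \<longleftrightarrow> (\<forall>x\<in>U. \<forall>I. length I = m \<longrightarrow> S x I = pull_back (jac x) (S' (\<phi> x)) I)"

lemma related_cov_deriv:
  assumes "related m S S'" and S': "\<And>K. smooth_on U' (\<lambda>y. S' y K)"
  shows "related (Suc m) (cov_deriv G S) (cov_deriv G' S')"
  unfolding related_def
proof (intro ballI allI impI)
  fix x and I :: "'n list"
  assume x: "x \<in> U" and "length I = Suc m"
  then obtain k L where I: "I = k # L" "length L = m" by (cases I) auto
  have "cov_deriv G S x I = cov_deriv G (\<lambda>y. pull_back (jac y) (S' (\<phi> y))) x (k # L)"
    unfolding I(1) by (rule cov_deriv_cong[OF M.open_U x]) (use assms(1) I(2) in \<open>simp add: related_def\<close>)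
  also have "\<dots> = pull_back (jac x) (cov_deriv G' S' (\<phi> x)) I"
    unfolding cov_deriv_Cons pull_back_covariant[OF S' x] I by (simp add: cov_deriv_Cons jac_J)
  finally show "cov_deriv G S x I = pull_back (jac x) (cov_deriv G' S' (\<phi> x)) I" .
qed

lemma related_cov_deriv_funpow:
  assumes "related m S S'" "\<And>K. smooth_on U' (\<lambda>y. S' y K)"
  shows "related (j + m) ((cov_deriv G ^^ j) S) ((cov_deriv G' ^^ j) S')"
  by (induction j) (use assms in \<open>auto intro!: related_cov_deriv M'.smooth_cov_deriv_funpow\<close>)

text \<open>
  The Ricci identity for the 1-forms whose components in the second chart are the rows of \<open>G'\<close>
  turns the tensoriality of the covariant derivative into that of the curvature tensor.
\<close>

lemma related_riem_tensor: "related 4 (riem_tensor G) (riem_tensor G')"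
  unfolding related_def
proof (intro ballI allI impI)
  fix x and I :: "'n list"
  assume x: "x \<in> U" and "length I = 4"
  then obtain i j k n where I: "I = [i, j, k, n]"
    by (auto simp: numeral_eq_Suc length_Suc_conv)
  \<comment> \<open>The a-th 1-form: row a of G' in the second chart; S a is its pull back to the
    first.\<close>
  define S' where "S' = (\<lambda>a y K. G' y $ a $ (hd K))"
  define S where "S = (\<lambda>a y. pull_back (jac y) (S' a (\<phi> y)))"
  have S'_smooth: "smooth_on U' (\<lambda>y. S' a y K)" for a K
    unfolding S'_def by (rule M'.smooth_G)
  have S_smooth: "smooth_on U (\<lambda>y. S a y K)" for a K
    unfolding S_def by (rule smooth_pull_back[OF S'_smooth])
  have "related 1 (S a) (S' a)" for a by (simp add: related_def S_def)
  then have rel: "related (Suc (Suc 1)) (cov_deriv G (cov_deriv G (S a))) (cov_deriv G' (cov_deriv G' (S' a)))" for a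
    by (intro related_cov_deriv M'.smooth_cov_deriv S'_smooth)
  define R' where "R' = (\<lambda>a K. \<Sum>e\<in>UNIV. curvature_up G' (\<phi> x) (K ! 0) (K ! 1) (K ! 2) e * G' (\<phi> x) $ a $ e)"
  \<comment> \<open>Exchanging the two derivative indices commutes with pulling back, so the
    commutators in the two charts correspond.\<close>
  have swap: "pull_back (jac x) F [j, i, k] = pull_back (jac x) (\<lambda>K. F [K ! 1, K ! 0, K ! 2]) [i, j, k]" for F
  proof -
    have "pull_back (jac x) F [j, i, k] =
      (\<Sum>b\<in>UNIV. \<Sum>c\<in>UNIV. J b j x * (J c i x * (\<Sum>d\<in>UNIV. J d k x * F [b, c, d])))"
      by (simp add: jac_J sum_distrib_left)
    also have "\<dots> = (\<Sum>c\<in>UNIV. \<Sum>b\<in>UNIV. J b j x * (J c i x * (\<Sum>d\<in>UNIV. J d k x * F [b, c, d])))"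
      by (rule sum.swap)
    finally show ?thesis
      by (simp add: jac_J sum_distrib_left mult.left_commute)
  qed
  have curv: "(\<Sum>l\<in>UNIV. curvature_up G x i j k l * S a x [l]) = pull_back (jac x) (R' a) [i, j, k]" for a
  proof -
    let ?C = "cov_deriv G' (cov_deriv G' (S' a)) (\<phi> x)"
    have "- (\<Sum>l\<in>UNIV. curvature_up G x i j k l * S a x [l]) =
        pull_back (jac x) ?C [i, j, k] - pull_back (jac x) ?C [j, i, k]"
      using M.ricci_identity[where S = "S a" and i = i and j = j and k = k, OF S_smooth x] rel[of a] x by (simp add: related_def)
    also have "\<dots> = pull_back (jac x) (\<lambda>K. ?C K - ?C [K ! 1, K ! 0, K ! 2]) [i, j, k]"
      by (simp only: swap pull_back_diff)
    also have "\<dots> = pull_back (jac x) (\<lambda>K. (- 1) * R' a K) [i, j, k]"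
    proof (rule pull_back_cong)
      fix K :: "'n list" assume "length K = length [i, j, k]"
      then obtain b c d where K: "K = [b, c, d]" by (auto simp: length_Suc_conv)
      show "?C K - ?C [K ! 1, K ! 0, K ! 2] = (- 1) * R' a K"
        using M'.ricci_identity[where S = "S' a" and i = b and j = c and k = d, OF S'_smooth phi_in[OF x]]
        by (simp add: K R'_def S'_def)
    qed
    also have "\<dots> = - pull_back (jac x) (R' a) [i, j, k]" by (simp only: pull_back_cmult)
    finally show ?thesis by simp
  qed
  \<comment> \<open>The metric that lowers the last index of the curvature is a combination of the
    forms S a with Jacobian coefficients; these coefficients become the Jacobian of the fourth
    slot.\<close>
  have "riem_tensor G x I = (\<Sum>m\<in>UNIV. (\<Sum>a\<in>UNIV. J a n x * S a x [m]) * curvature_up G x i j k m)"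
    by (simp add: riem_tensor_def I G_eq[OF x] S_def S'_def jac_J sum_distrib_left mult_ac numeral_3_eq_3)
  also have "\<dots> = (\<Sum>m\<in>UNIV. \<Sum>a\<in>UNIV. J a n x * (curvature_up G x i j k m * S a x [m]))"
    by (simp add: sum_distrib_left sum_distrib_right mult_ac)
  also have "\<dots> = (\<Sum>a\<in>UNIV. J a n x * (\<Sum>m\<in>UNIV. curvature_up G x i j k m * S a x [m]))"
    by (subst sum.swap) (simp add: sum_distrib_left)
  also have "\<dots> = pull_back (jac x) (\<lambda>K. \<Sum>a\<in>UNIV. J a n x * R' a K) [i, j, k]"
    by (simp only: curv pull_back_sum pull_back_cmult)
  also have "\<dots> = pull_back (jac x) (riem_tensor G' (\<phi> x)) I"
    by (simp add: I R'_def riem_tensor_def jac_J mult_ac numeral_3_eq_3 numeral_2_eq_2)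
  finally show "riem_tensor G x I = pull_back (jac x) (riem_tensor G' (\<phi> x)) I" .
qed

text \<open>Inverting G = J^T G' J gives J G^-1 J^T = G'^-1, which is the hypothesis of
  \<open>tensor_form_pull_back\<close>.\<close>

lemma tensor_norm_sq_related:
  assumes "related m S S'" "x \<in> U"
  shows "tensor_norm_sq G m S x = tensor_norm_sq G' m S' (\<phi> x)"
proof -
  let ?H = "matrix_inv (G x)"
  note invG = matrix_inv_inverse[OF pos_def_invertible[OF M.pos_def_G[OF assms(2)]]]
  note invG' = matrix_inv_inverse[OF pos_def_invertible[OF M'.pos_def_G[OF phi_in[OF assms(2)]]]]
  note invJ = matrix_inv_inverse[OF invertible_J[OF assms(2)]]
  have "jac x ** ?H ** transpose (jac x) ** G' (\<phi> x) ** (jac x ** matrix_inv (jac x)) =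
      jac x ** (?H ** (transpose (jac x) ** G' (\<phi> x) ** jac x)) ** matrix_inv (jac x)"
    by (simp only: matrix_mul_assoc)
  also have "\<dots> = mat 1"
    unfolding G_transform[OF assms(2), symmetric] invG by (simp add: invJ)
  finally have "(jac x ** ?H ** transpose (jac x)) ** G' (\<phi> x) = mat 1"
    by (simp add: invJ)
  then have "(jac x ** ?H ** transpose (jac x)) ** (G' (\<phi> x) ** matrix_inv (G' (\<phi> x))) = matrix_inv (G' (\<phi> x))"
    by (simp add: matrix_mul_assoc)
  then have eq: "jac x ** ?H ** transpose (jac x) = matrix_inv (G' (\<phi> x))"
    by (simp add: invG')
  have "(\<Sum>i\<in>UNIV. \<Sum>j\<in>UNIV. ?H $ i $ j * jac x $ a $ i * jac x $ b $ j) = matrix_inv (G' (\<phi> x)) $ a $ b" for a b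
    unfolding eq[symmetric]
    by (simp add: matrix_matrix_mult_def transpose_def sum_distrib_left sum_distrib_right mult_ac) (rule sum.swap)
  then have "tensor_form ?H m (pull_back (jac x) (S' (\<phi> x))) (pull_back (jac x) (S' (\<phi> x))) =
      tensor_form (matrix_inv (G' (\<phi> x))) m (S' (\<phi> x)) (S' (\<phi> x))"
    by (rule tensor_form_pull_back)
  moreover have "tensor_form ?H m (S x) (S x) =
      tensor_form ?H m (pull_back (jac x) (S' (\<phi> x))) (pull_back (jac x) (S' (\<phi> x)))"
    by (rule tensor_form_cong) (use assms in \<open>simp_all add: related_def\<close>)
  ultimately show ?thesis by (simp add: tensor_norm_sq_eq)
qed

lemma nabla_riem_norm_invariant:
  "x \<in> U \<Longrightarrow> tensor_norm_sq G (j + 4) ((cov_deriv G ^^ j) (riem_tensor G)) x =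
    tensor_norm_sq G' (j + 4) ((cov_deriv G' ^^ j) (riem_tensor G')) (\<phi> x)"
  by (intro tensor_norm_sq_related related_cov_deriv_funpow related_riem_tensor M'.smooth_riem_tensor)

end

section \<open>Contractions with the inverse metric\<close>

lemma matrix_inv_cancel:
  fixes A :: "real^'n^'n"
  assumes "pos_def A"
  shows "(\<Sum>c\<in>UNIV. (\<Sum>b\<in>UNIV. v b * A $ b $ c) * matrix_inv A $ c $ n) = v n"
    "(\<Sum>c\<in>UNIV. matrix_inv A $ n $ c * (\<Sum>b\<in>UNIV. A $ c $ b * v b)) = v n"
proof -
  have "(\<Sum>c\<in>UNIV. (\<Sum>b\<in>UNIV. v b * A $ b $ c) * matrix_inv A $ c $ n) =
      (\<Sum>b\<in>UNIV. \<Sum>c\<in>UNIV. v b * (A $ b $ c * matrix_inv A $ c $ n))"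
    by (subst sum.swap) (simp add: sum_distrib_right mult.assoc)
  also have "\<dots> = (\<Sum>b\<in>UNIV. v b * (if b = n then 1 else 0))"
    by (simp only: sum_distrib_left[symmetric] matrix_inv_nth[OF assms])
  finally show "(\<Sum>c\<in>UNIV. (\<Sum>b\<in>UNIV. v b * A $ b $ c) * matrix_inv A $ c $ n) = v n"
    by (simp add: if_distrib cong: if_cong)
  have "(\<Sum>c\<in>UNIV. matrix_inv A $ n $ c * (\<Sum>b\<in>UNIV. A $ c $ b * v b)) =
      (\<Sum>b\<in>UNIV. \<Sum>c\<in>UNIV. (matrix_inv A $ n $ c * A $ c $ b) * v b)"
    by (subst sum.swap) (simp add: sum_distrib_left mult.assoc)
  also have "\<dots> = (\<Sum>b\<in>UNIV. (if n = b then 1 else 0) * v b)"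
    by (simp only: sum_distrib_right[symmetric] matrix_inv_nth[OF assms])
  finally show "(\<Sum>c\<in>UNIV. matrix_inv A $ n $ c * (\<Sum>b\<in>UNIV. A $ c $ b * v b)) = v n"
    by (simp add: if_distribR if_distrib cong: if_cong)
qed

context smooth_metric
begin

text \<open>This is \<nabla>G^-1 = 0, solved for the coordinate derivative. It comes from
  differentiating G^-1 G = 1, inserting \<open>metric_compatible\<close>, and multiplying by the
  inverse once more.\<close>

lemma partial_deriv_inv:
  assumes x: "x \<in> U"
  shows "partial_deriv a (\<lambda>y. matrix_inv (G y) $ i $ n) x =
    - (\<Sum>m\<in>UNIV. christoffel G x i a m * matrix_inv (G x) $ m $ n)
    - (\<Sum>m\<in>UNIV. matrix_inv (G x) $ i $ m * christoffel G x n a m)"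
proof -
  let ?H = "matrix_inv (G x)"
  let ?dH = "\<lambda>b. partial_deriv a (\<lambda>y. matrix_inv (G y) $ i $ b) x"
  note pd = pos_def_G[OF x]
  note d = diff[OF smooth_inv x] diff[OF smooth_G x]
  have prod: "(\<Sum>b\<in>UNIV. ?dH b * G x $ b $ c) = - christoffel G x i a c - (\<Sum>b\<in>UNIV. ?H $ i $ b * (\<Sum>m\<in>UNIV. G x $ c $ m * christoffel G x m a b))" for c
  proof -
    have "0 = partial_deriv a (\<lambda>y. if i = c then 1 else 0) x" by simp
    also have "\<dots> = partial_deriv a (\<lambda>y. \<Sum>b\<in>UNIV. matrix_inv (G y) $ i $ b * G y $ b $ c) x"
      by (rule partial_deriv_cong[OF open_U x]) (simp add: matrix_inv_nth pos_def_G)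
    also have "\<dots> = (\<Sum>b\<in>UNIV. ?dH b * G x $ b $ c) + (\<Sum>b\<in>UNIV. ?H $ i $ b * partial_deriv a (\<lambda>y. G y $ b $ c) x)"
      by (simp add: partial_deriv_sum partial_deriv_mult differentiable_mult d sum.distrib)
    also have "(\<Sum>b\<in>UNIV. ?H $ i $ b * partial_deriv a (\<lambda>y. G y $ b $ c) x) =
       (\<Sum>b\<in>UNIV. ?H $ i $ b * (\<Sum>m\<in>UNIV. G x $ c $ m * christoffel G x m a b))
       + (\<Sum>b\<in>UNIV. ?H $ i $ b * (\<Sum>m\<in>UNIV. G x $ b $ m * christoffel G x m a c))"
      unfolding metric_compatible[OF x] by (simp add: distrib_left sum.distrib)
    also have "(\<Sum>b\<in>UNIV. ?H $ i $ b * (\<Sum>m\<in>UNIV. G x $ b $ m * christoffel G x m a c)) = christoffel G x i a c"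
      by (rule matrix_inv_cancel(2)[OF pd])
    finally show ?thesis by linarith
  qed
  have "partial_deriv a (\<lambda>y. matrix_inv (G y) $ i $ n) x =
      (\<Sum>c\<in>UNIV. (\<Sum>b\<in>UNIV. ?dH b * G x $ b $ c) * ?H $ c $ n)"
    using matrix_inv_cancel(1)[OF pd, of ?dH n] by simp
  also have "\<dots> = - (\<Sum>c\<in>UNIV. christoffel G x i a c * ?H $ c $ n) -
      (\<Sum>c\<in>UNIV. (\<Sum>b\<in>UNIV. ?H $ i $ b * (\<Sum>m\<in>UNIV. G x $ c $ m * christoffel G x m a b)) * ?H $ c $ n)"
    unfolding prod by (simp add: left_diff_distrib sum_subtractf sum_negf)
  also have "(\<Sum>c\<in>UNIV. (\<Sum>b\<in>UNIV. ?H $ i $ b * (\<Sum>m\<in>UNIV. G x $ c $ m * christoffel G x m a b)) * ?H $ c $ n) =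
     (\<Sum>b\<in>UNIV. \<Sum>c\<in>UNIV. ?H $ i $ b * (?H $ n $ c * (\<Sum>m\<in>UNIV. G x $ c $ m * christoffel G x m a b)))"
  proof -
    have "(\<Sum>c\<in>UNIV. (\<Sum>b\<in>UNIV. ?H $ i $ b * X c b) * ?H $ c $ n) =
        (\<Sum>b\<in>UNIV. \<Sum>c\<in>UNIV. ?H $ i $ b * (?H $ n $ c * X c b))" for X :: "'n \<Rightarrow> 'n \<Rightarrow> real"
      by (subst sum.swap) (simp add: sum_distrib_left matrix_inv_sym[OF pd, of _ n] mult_ac)
    then show ?thesis .
  qed
  also have "\<dots> = (\<Sum>b\<in>UNIV. ?H $ i $ b * christoffel G x n a b)"
    by (simp only: sum_distrib_left[symmetric] matrix_inv_cancel(2)[OF pd])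
  finally show ?thesis .
qed

text \<open>Raising the index that \<open>riem_tensor\<close> lowers turns the trace into a
  contraction with the inverse metric; the bounds along the flow are those of the lowered
  tensor.\<close>

lemma ricci_eq_riem:
  assumes x: "x \<in> U"
  shows "ricci G x $ j $ k = (\<Sum>i\<in>UNIV. \<Sum>n\<in>UNIV. matrix_inv (G x) $ i $ n * riem_tensor G x [i, j, k, n])"
proof -
  have "(\<Sum>n\<in>UNIV. matrix_inv (G x) $ i $ n * riem_tensor G x [i, j, k, n]) = curvature_up G x i j k i" for i
    using matrix_inv_cancel(2)[OF pos_def_G[OF x], where n = i and v = "\<lambda>m. curvature_up G x i j k m"]
    by (simp add: riem_tensor_def numeral_3_eq_3 numeral_2_eq_2)
  then show ?thesis by (simp add: ricci_def)
qed

lemma smooth_ricci: "smooth_on U (\<lambda>x. ricci G x $ j $ k)"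
  unfolding ricci_def by (simp add: smooth_on_sum open_U smooth_curvature_up)

text \<open>Contraction commutes with \<nabla> because \<nabla>G^-1 = 0: the derivative of the
  inverse metric cancels the connection terms of the first and the last slot of Riem, and those of
  the middle slots become the connection terms of Ric. Bounds on \<nabla>Riem thus bound
  \<nabla>Ric.\<close>

lemma nabla_ricci:
  assumes x: "x \<in> U"
  shows "cov_deriv G (ricci_tensor G) x [a, j, k] =
    (\<Sum>i\<in>UNIV. \<Sum>n\<in>UNIV. matrix_inv (G x) $ i $ n * cov_deriv G (riem_tensor G) x [a, i, j, k, n])"
proof -
  define H where "H = (\<lambda>i n. matrix_inv (G x) $ i $ n)"
  define C where "C = (\<lambda>m i. christoffel G x m a i)"
  define Rm where "Rm = (\<lambda>i j k n. riem_tensor G x [i, j, k, n])"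
  define dRm where "dRm = (\<lambda>i j k n. partial_deriv a (\<lambda>y. riem_tensor G y [i, j, k, n]) x)"
  define Rc where "Rc = (\<lambda>j k. \<Sum>i\<in>UNIV. \<Sum>n\<in>UNIV. H i n * Rm i j k n)"
  have ric: "ricci G x $ j $ k = Rc j k" for j k
    by (simp add: ricci_eq_riem[OF x] Rc_def H_def Rm_def)
  have dH: "partial_deriv a (\<lambda>y. matrix_inv (G y) $ i $ n) x =
      - (\<Sum>m\<in>UNIV. C i m * H m n) - (\<Sum>m\<in>UNIV. H i m * C n m)" for i n
    by (simp add: partial_deriv_inv[OF x] C_def H_def)
  have "partial_deriv a (\<lambda>y. ricci G y $ j $ k) x =
     partial_deriv a (\<lambda>y. \<Sum>i\<in>UNIV. \<Sum>n\<in>UNIV. matrix_inv (G y) $ i $ n * riem_tensor G y [i, j, k, n]) x"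
    by (rule partial_deriv_cong[OF open_U x ricci_eq_riem])
  also have "\<dots> = (\<Sum>i\<in>UNIV. \<Sum>n\<in>UNIV. (- (\<Sum>m\<in>UNIV. C i m * H m n) - (\<Sum>m\<in>UNIV. H i m * C n m)) * Rm i j k n + H i n * dRm i j k n)"
    by (simp add: partial_deriv_sum partial_deriv_mult differentiable_mult differentiable_sum
        diff[OF smooth_inv x] diff[OF smooth_riem_tensor x] dH H_def Rm_def dRm_def)
  finally have dric: "partial_deriv a (\<lambda>y. ricci G y $ j $ k) x =
     (\<Sum>i\<in>UNIV. \<Sum>n\<in>UNIV. H i n * dRm i j k n) - (\<Sum>i\<in>UNIV. \<Sum>n\<in>UNIV. \<Sum>m\<in>UNIV. C i m * H m n * Rm i j k n)
     - (\<Sum>i\<in>UNIV. \<Sum>n\<in>UNIV. \<Sum>m\<in>UNIV. H i m * C n m * Rm i j k n)"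
    by (simp add: left_diff_distrib distrib_right sum.distrib sum_subtractf sum_negf sum_distrib_right)
  have nab: "cov_deriv G (riem_tensor G) x [a, i, j, k, n] = dRm i j k n
     - ((\<Sum>m\<in>UNIV. C m i * Rm m j k n) + (\<Sum>m\<in>UNIV. C m j * Rm i m k n) + (\<Sum>m\<in>UNIV. C m k * Rm i j m n)
        + (\<Sum>m\<in>UNIV. C m n * Rm i j k m))" for i n
    by (simp add: cov_deriv_Cons dRm_def C_def Rm_def)
  have e1: "(\<Sum>i\<in>UNIV. \<Sum>n\<in>UNIV. H i n * (\<Sum>m\<in>UNIV. C m i * Rm m j k n)) =
      (\<Sum>i\<in>UNIV. \<Sum>n\<in>UNIV. \<Sum>m\<in>UNIV. C i m * H m n * Rm i j k n)"
  proof -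
    have "(\<Sum>i\<in>UNIV. \<Sum>n\<in>UNIV. \<Sum>m\<in>UNIV. C i m * H m n * Rm i j k n) =
        (\<Sum>i\<in>UNIV. \<Sum>m\<in>UNIV. \<Sum>n\<in>UNIV. C i m * H m n * Rm i j k n)"
      by (rule sum.cong[OF refl], rule sum.swap)
    also have "\<dots> = (\<Sum>m\<in>UNIV. \<Sum>i\<in>UNIV. \<Sum>n\<in>UNIV. C i m * H m n * Rm i j k n)" by (rule sum.swap)
    also have "\<dots> = (\<Sum>m\<in>UNIV. \<Sum>n\<in>UNIV. \<Sum>i\<in>UNIV. C i m * H m n * Rm i j k n)"
      by (rule sum.cong[OF refl], rule sum.swap)
    finally show ?thesis by (simp add: sum_distrib_left mult_ac)
  qed
  have e2: "(\<Sum>i\<in>UNIV. \<Sum>n\<in>UNIV. H i n * (\<Sum>m\<in>UNIV. C m n * Rm i j k m)) =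
      (\<Sum>i\<in>UNIV. \<Sum>n\<in>UNIV. \<Sum>m\<in>UNIV. H i m * C n m * Rm i j k n)"
  proof -
    have "(\<Sum>i\<in>UNIV. \<Sum>n\<in>UNIV. \<Sum>m\<in>UNIV. H i m * C n m * Rm i j k n) =
        (\<Sum>i\<in>UNIV. \<Sum>m\<in>UNIV. \<Sum>n\<in>UNIV. H i m * C n m * Rm i j k n)"
      by (rule sum.cong[OF refl], rule sum.swap)
    then show ?thesis by (simp add: sum_distrib_left mult_ac)
  qed
  \<comment> \<open>The connection terms of the slots j and k do not meet the contracted indices and
    pass through the contraction.\<close>
  have pull: "(\<Sum>i\<in>UNIV. \<Sum>n\<in>UNIV. H i n * (\<Sum>m\<in>UNIV. c m * F i m n)) =
      (\<Sum>m\<in>UNIV. c m * (\<Sum>i\<in>UNIV. \<Sum>n\<in>UNIV. H i n * F i m n))" for c F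
  proof -
    have "(\<Sum>i\<in>UNIV. \<Sum>n\<in>UNIV. H i n * (\<Sum>m\<in>UNIV. c m * F i m n)) =
        (\<Sum>i\<in>UNIV. \<Sum>n\<in>UNIV. \<Sum>m\<in>UNIV. c m * (H i n * F i m n))"
      by (simp add: sum_distrib_left mult_ac)
    also have "\<dots> = (\<Sum>i\<in>UNIV. \<Sum>m\<in>UNIV. \<Sum>n\<in>UNIV. c m * (H i n * F i m n))"
      by (rule sum.cong[OF refl], rule sum.swap)
    also have "\<dots> = (\<Sum>m\<in>UNIV. \<Sum>i\<in>UNIV. \<Sum>n\<in>UNIV. c m * (H i n * F i m n))" by (rule sum.swap)
    finally show ?thesis by (simp add: sum_distrib_left)
  qed
  have "(\<Sum>i\<in>UNIV. \<Sum>n\<in>UNIV. H i n * cov_deriv G (riem_tensor G) x [a, i, j, k, n]) =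
     (\<Sum>i\<in>UNIV. \<Sum>n\<in>UNIV. H i n * dRm i j k n)
     - ((\<Sum>i\<in>UNIV. \<Sum>n\<in>UNIV. H i n * (\<Sum>m\<in>UNIV. C m i * Rm m j k n))
       + (\<Sum>i\<in>UNIV. \<Sum>n\<in>UNIV. H i n * (\<Sum>m\<in>UNIV. C m j * Rm i m k n))
       + (\<Sum>i\<in>UNIV. \<Sum>n\<in>UNIV. H i n * (\<Sum>m\<in>UNIV. C m k * Rm i j m n))
       + (\<Sum>i\<in>UNIV. \<Sum>n\<in>UNIV. H i n * (\<Sum>m\<in>UNIV. C m n * Rm i j k m)))"
    unfolding nab by (simp only: right_diff_distrib distrib_left sum.distrib sum_subtractf)
  also have "\<dots> = partial_deriv a (\<lambda>y. ricci G y $ j $ k) x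
       - ((\<Sum>m\<in>UNIV. C m j * Rc m k) + (\<Sum>m\<in>UNIV. C m k * Rc j m))"
    unfolding dric e1 e2 pull Rc_def by simp
  also have "\<dots> = cov_deriv G (ricci_tensor G) x [a, j, k]"
    by (simp add: cov_deriv_Cons ricci_tensor_def C_def ric)
  finally show ?thesis by (simp add: H_def)
qed

end

section \<open>Derivative estimates along the flow\<close>

text \<open>Only space derivatives are counted, and the bounds are uniform over the times in
  I.\<close>

primrec bounded_Ck :: "(real^'n::finite) set \<Rightarrow> real set \<Rightarrow> nat \<Rightarrow> (real \<Rightarrow> real^'n \<Rightarrow> real) \<Rightarrow> bool" where
  "bounded_Ck K I 0 F \<longleftrightarrow> (\<exists>C. \<forall>x\<in>K. \<forall>t\<in>I. \<bar>F t x\<bar> \<le> C)"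
| "bounded_Ck K I (Suc k) F \<longleftrightarrow> (\<exists>C. \<forall>x\<in>K. \<forall>t\<in>I. \<bar>F t x\<bar> \<le> C) \<and>
     (\<forall>i. bounded_Ck K I k (\<lambda>t. partial_deriv i (F t)))"

lemma bounded_Ck_0D: "bounded_Ck K I k F \<Longrightarrow> \<exists>C. \<forall>x\<in>K. \<forall>t\<in>I. \<bar>F t x\<bar> \<le> C"
  by (cases k) simp_all

lemma bounded_Ck_SucI:
  "bounded_Ck K I 0 F \<Longrightarrow> (\<And>i. bounded_Ck K I k (\<lambda>t. partial_deriv i (F t))) \<Longrightarrow> bounded_Ck K I (Suc k) F"
  by simp

lemma bounded_Ck_cong:
  assumes "open K" "\<And>x t. x \<in> K \<Longrightarrow> t \<in> I \<Longrightarrow> F t x = F' t x"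
  shows "bounded_Ck K I k F \<longleftrightarrow> bounded_Ck K I k F'"
  using assms(2)
proof (induction k arbitrary: F F')
  case 0
  then show ?case by simp
next
  case (Suc k)
  have "bounded_Ck K I k (\<lambda>t. partial_deriv i (F t)) \<longleftrightarrow> bounded_Ck K I k (\<lambda>t. partial_deriv i (F' t))" for i
  proof (rule Suc.IH)
    fix x t assume "x \<in> K" "t \<in> I"
    then show "partial_deriv i (F t) x = partial_deriv i (F' t) x"
      using Suc.prems by (intro partial_deriv_cong[OF assms(1)])
  qed
  then show ?case using Suc.prems by simp
qed

lemma bounded_Ck_SucD: "bounded_Ck K I (Suc k) F \<Longrightarrow> bounded_Ck K I k F"
proof (induction k arbitrary: F)
  case (Suc k)
  have "bounded_Ck K I k (\<lambda>t. partial_deriv i (F t))" for i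
    using Suc.prems by (intro Suc.IH) (simp only: bounded_Ck.simps(2)[of K I "Suc k"])
  then show ?case using Suc.prems by simp
qed simp

text \<open>Smoothness is required on U and the open time interval, bounds are sought on the smaller
  K from t0 on. As t0 belongs to the range of the bounds, it serves as initial time when time
  derivatives are integrated.\<close>

locale space_time_region =
  fixes U K :: "(real^'n) set" and T t0 :: real
  assumes open_U: "open U" and open_K: "open K" and K_sub: "K \<subseteq> U"
    and t0: "0 < t0" "t0 < T"
begin

abbreviation "sm \<equiv> tsmooth U {0<..<T}"
abbreviation "bd \<equiv> bounded_Ck K {t0..<T}"

lemma tI: "t \<in> {t0..<T} \<Longrightarrow> t \<in> {0<..<T}"
  using t0 by auto

lemma sm_diff: "sm F \<Longrightarrow> x \<in> K \<Longrightarrow> t \<in> {t0..<T} \<Longrightarrow> F t differentiable (at x)"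
  using tsmooth_differentiable[of U "{0<..<T}" F x t] K_sub tI by blast

lemma bd_const: "bd k (\<lambda>t x. c)"
proof (induction k arbitrary: c)
  case (Suc k)
  have "bd k (\<lambda>t. partial_deriv i (\<lambda>x. c))" for i
    using Suc[of 0] by (rule bounded_Ck_cong[OF open_K, THEN iffD1, rotated]) simp
  then show ?case by auto
qed auto

lemma bd_add:
  "sm F \<Longrightarrow> sm F' \<Longrightarrow> bd k F \<Longrightarrow> bd k F' \<Longrightarrow> bd k (\<lambda>t x. F t x + F' t x)"
proof (induction k arbitrary: F F')
  case 0
  from 0(3,4) obtain C C' where "\<forall>x\<in>K. \<forall>t\<in>{t0..<T}. \<bar>F t x\<bar> \<le> C" "\<forall>x\<in>K. \<forall>t\<in>{t0..<T}. \<bar>F' t x\<bar> \<le> C'"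
    by auto
  then have "\<forall>x\<in>K. \<forall>t\<in>{t0..<T}. \<bar>F t x + F' t x\<bar> \<le> C + C'"
    by (fastforce intro: order_trans[OF abs_triangle_ineq] add_mono)
  then show ?case by auto
next
  case (Suc k)
  have "bd k (\<lambda>t. partial_deriv i (\<lambda>x. F t x + F' t x))" for i
  proof -
    have "bd k (\<lambda>t x. partial_deriv i (F t) x + partial_deriv i (F' t) x)"
      by (rule Suc.IH) (use Suc.prems in \<open>simp_all add: tsmooth_partial_deriv\<close>)
    then show ?thesis
      by (rule bounded_Ck_cong[OF open_K, THEN iffD1, rotated])
         (simp add: partial_deriv_add sm_diff Suc.prems)
  qed
  moreover have "bd 0 (\<lambda>t x. F t x + F' t x)"
  proof -
    from bounded_Ck_0D[OF Suc.prems(3)] bounded_Ck_0D[OF Suc.prems(4)]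
    obtain C C' where "\<forall>x\<in>K. \<forall>t\<in>{t0..<T}. \<bar>F t x\<bar> \<le> C" "\<forall>x\<in>K. \<forall>t\<in>{t0..<T}. \<bar>F' t x\<bar> \<le> C'"
      by blast
    then have "\<forall>x\<in>K. \<forall>t\<in>{t0..<T}. \<bar>F t x + F' t x\<bar> \<le> C + C'"
      by (fastforce intro: order_trans[OF abs_triangle_ineq] add_mono)
    then show ?thesis by auto
  qed
  ultimately show ?case by (intro bounded_Ck_SucI)
qed

lemma bd_mult:
  "sm F \<Longrightarrow> sm F' \<Longrightarrow> bd k F \<Longrightarrow> bd k F' \<Longrightarrow> bd k (\<lambda>t x. F t x * F' t x)"
proof (induction k arbitrary: F F')
  case 0
  from 0(3,4) obtain C C' where "\<forall>x\<in>K. \<forall>t\<in>{t0..<T}. \<bar>F t x\<bar> \<le> C" "\<forall>x\<in>K. \<forall>t\<in>{t0..<T}. \<bar>F' t x\<bar> \<le> C'"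
    by auto
  then have "\<forall>x\<in>K. \<forall>t\<in>{t0..<T}. \<bar>F t x * F' t x\<bar> \<le> \<bar>C\<bar> * C'"
    by (fastforce simp: abs_mult intro: mult_mono)
  then show ?case by auto
next
  case (Suc k)
  have "bd k (\<lambda>t. partial_deriv i (\<lambda>x. F t x * F' t x))" for i
  proof -
    have "bd k (\<lambda>t x. partial_deriv i (F t) x * F' t x + F t x * partial_deriv i (F' t) x)"
      by (intro bd_add Suc.IH tsmooth_mult tsmooth_partial_deriv Suc.prems Suc.prems(3,4)[THEN bounded_Ck_SucD])
         (use Suc.prems in simp_all)
    then show ?thesis
      by (rule bounded_Ck_cong[OF open_K, THEN iffD1, rotated])
         (simp add: partial_deriv_mult sm_diff Suc.prems)
  qed
  moreover have "bd 0 (\<lambda>t x. F t x * F' t x)"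
  proof -
    from bounded_Ck_0D[OF Suc.prems(3)] bounded_Ck_0D[OF Suc.prems(4)]
    obtain C C' where "\<forall>x\<in>K. \<forall>t\<in>{t0..<T}. \<bar>F t x\<bar> \<le> C" "\<forall>x\<in>K. \<forall>t\<in>{t0..<T}. \<bar>F' t x\<bar> \<le> C'"
      by blast
    then have "\<forall>x\<in>K. \<forall>t\<in>{t0..<T}. \<bar>F t x * F' t x\<bar> \<le> \<bar>C\<bar> * C'"
      by (fastforce simp: abs_mult intro: mult_mono)
    then show ?thesis by auto
  qed
  ultimately show ?case by (intro bounded_Ck_SucI)
qed

lemma sm_const: "sm (\<lambda>t x. c)"
  by (simp add: tsmooth_const open_U)

lemma sm_sum: "(\<And>a. a \<in> J \<Longrightarrow> sm (F a)) \<Longrightarrow> sm (\<lambda>t x. \<Sum>a\<in>J. F a t x)"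
  by (intro tsmooth_sum open_U) simp_all

lemma bd_sum:
  "(\<And>a. a \<in> J \<Longrightarrow> sm (F a)) \<Longrightarrow> (\<And>a. a \<in> J \<Longrightarrow> bd k (F a)) \<Longrightarrow> bd k (\<lambda>t x. \<Sum>a\<in>J. F a t x)"
  by (induction J rule: infinite_finite_induct) (simp_all add: bd_const bd_add sm_sum)

lemma bd_minus: "sm F \<Longrightarrow> bd k F \<Longrightarrow> bd k (\<lambda>t x. - F t x)"
  using bd_mult[OF sm_const _ bd_const, of F k "-1"] by simp

lemma bd_diff: "sm F \<Longrightarrow> sm F' \<Longrightarrow> bd k F \<Longrightarrow> bd k F' \<Longrightarrow> bd k (\<lambda>t x. F t x - F' t x)"
  using bd_add[of F "\<lambda>t x. - F' t x" k] bd_minus[of F' k] tsmooth_diff[OF sm_const, of F' 0] by simp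

text \<open>The initial values at time \<open>t0\<close> are controlled because \<open>K\<close> is relatively compact in \<open>U\<close>.\<close>

lemma bd_time_integral:
  assumes "compact C" "K \<subseteq> C" "C \<subseteq> U"
  shows "sm F \<Longrightarrow> bd k (\<lambda>t x. deriv (\<lambda>s. F s x) t) \<Longrightarrow> bd k F"
proof (induction k arbitrary: F)
  case 0
  have "continuous_on C (F t0)"
    using smooth_on_imp_continuous_on[OF tsmooth_slice[OF 0(1)]] t0 assms(3)
    by (auto intro: continuous_on_subset)
  then have "bounded (F t0 ` C)"
    using assms(1) by (intro compact_imp_bounded compact_continuous_image)
  then obtain B where B: "\<And>x. x \<in> C \<Longrightarrow> \<bar>F t0 x\<bar> \<le> B" by (auto simp: bounded_iff)
  from 0(2) obtain D where D: "\<forall>x\<in>K. \<forall>t\<in>{t0..<T}. \<bar>deriv (\<lambda>s. F s x) t\<bar> \<le> D" by auto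
  have "\<bar>F t x\<bar> \<le> B + \<bar>D\<bar> * (T - t0)" if x: "x \<in> K" and t: "t \<in> {t0..<T}" for x t
  proof (cases "t = t0")
    case True
    then show ?thesis using B[of x] x assms(2) t0 by (smt (verit) in_mono mult_nonneg_nonneg abs_ge_zero)
  next
    case False
    then have "t0 < t" using t by simp
    moreover have "((\<lambda>s. F s x) has_real_derivative deriv (\<lambda>s. F s x) s) (at s)" if "t0 \<le> s" "s \<le> t" for s
      using that t t0 x K_sub by (intro tsmooth_time_DERIV[OF 0(1)]) auto
    ultimately obtain z where z: "t0 < z" "z < t" "F t x - F t0 x = (t - t0) * deriv (\<lambda>s. F s x) z"
      using MVT2[of t0 t "\<lambda>s. F s x" "\<lambda>z. deriv (\<lambda>s. F s x) z"] by auto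
    have "\<bar>F t x - F t0 x\<bar> \<le> (T - t0) * \<bar>D\<bar>"
      unfolding z(3) abs_mult
    proof (rule mult_mono)
      have "z \<in> {t0..<T}" using z t by simp
      then have "\<bar>deriv (\<lambda>s. F s x) z\<bar> \<le> D" using D x by blast
      then show "\<bar>deriv (\<lambda>s. F s x) z\<bar> \<le> \<bar>D\<bar>" by linarith
    qed (use z t t0 in auto)
    then show ?thesis using B[of x] x assms(2) by (auto simp: mult.commute)
  qed
  then show ?case unfolding bounded_Ck.simps(1) by blast
next
  case (Suc k)
  have "bd k (\<lambda>t x. deriv (\<lambda>s. partial_deriv i (F s) x) t)" for i
  proof -
    have "bd k (\<lambda>t. partial_deriv i (\<lambda>x. deriv (\<lambda>s. F s x) t))" using Suc.prems(2) by simp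
    then show ?thesis
    proof (rule bounded_Ck_cong[OF open_K, THEN iffD1, rotated])
      fix x t assume "x \<in> K" "t \<in> {t0..<T}"
      then have xt: "x \<in> U" "t \<in> {0<..<T}" using K_sub t0 by auto
      from tsmooth_deriv_partial_deriv_commute[OF Suc.prems(1) xt, of i]
      show "partial_deriv i (\<lambda>x. deriv (\<lambda>s. F s x) t) x = deriv (\<lambda>s. partial_deriv i (F s) x) t"
        by (rule sym)
    qed
  qed
  then have "bd k (\<lambda>t. partial_deriv i (F t))" for i
    by (rule Suc.IH[OF tsmooth_partial_deriv[OF Suc.prems(1)]])
  moreover have "bd k F"
    using Suc.IH[OF Suc.prems(1) bounded_Ck_SucD[OF Suc.prems(2)]] .
  ultimately show ?case using bounded_Ck_0D[of K "{t0..<T}" k F] by simp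
qed

end

text \<open>What the estimates need to know about the flow, in one fixed chart: constants for the
  quadratic forms that do not depend on time, and component bounds for every \<nabla>^jRiem. The
  compact set C between K and U controls the values at the initial time.\<close>

locale flow_region = space_time_region U K T t0 for U K :: "(real^'n) set" and T t0 :: real +
  fixes G :: "real \<Rightarrow> real^'n \<Rightarrow> real^'n^'n" and C :: "(real^'n) set" and l \<Lambda> :: real
  assumes comp: "compact C" "K \<subseteq> C" "C \<subseteq> U"
    and sm_G: "\<And>i j. sm (\<lambda>t x. G t x $ i $ j)"
    and pd: "\<And>x t. x \<in> U \<Longrightarrow> t \<in> {0<..<T} \<Longrightarrow> pos_def (G t x)"
    and flow: "\<And>x t i j. x \<in> U \<Longrightarrow> t \<in> {0<..<T} \<Longrightarrow>
      ((\<lambda>s. G s x $ i $ j) has_real_derivative (- 2) * ricci (G t) x $ i $ j) (at t)"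
    and l_pos: "0 < l"
    and low: "\<And>x t u. x \<in> K \<Longrightarrow> t \<in> {t0..<T} \<Longrightarrow> l * (u \<bullet> u) \<le> u \<bullet> (G t x *v u)"
    and up: "\<And>x t i j. x \<in> K \<Longrightarrow> t \<in> {t0..<T} \<Longrightarrow> \<bar>G t x $ i $ j\<bar> \<le> \<Lambda>"
    and nabla_bd: "\<And>j. \<exists>B. \<forall>x\<in>K. \<forall>t\<in>{t0..<T}. \<forall>I. length I = j + 4 \<longrightarrow>
      \<bar>(cov_deriv (G t) ^^ j) (riem_tensor (G t)) x I\<bar> \<le> B"
begin

lemma smooth_metric: "t \<in> {0<..<T} \<Longrightarrow> smooth_metric U (G t)"
  by unfold_locales (auto simp: open_U pd tsmooth_slice[OF sm_G])

lemma sm_inv: "sm (\<lambda>t x. matrix_inv (G t x) $ i $ j)"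
  by (rule tsmooth_matrix_inv) (simp_all add: open_U sm_G pd)

lemma sm_christoffel: "sm (\<lambda>t x. christoffel (G t) x k i j)"
  unfolding christoffel_def
  by (intro tsmooth_mult sm_sum sm_const sm_inv tsmooth_add tsmooth_diff tsmooth_partial_deriv sm_G)

lemma sm_curvature_up: "sm (\<lambda>t x. curvature_up (G t) x i j k m)"
  unfolding curvature_up_def
  by (intro tsmooth_mult sm_sum tsmooth_add tsmooth_diff tsmooth_partial_deriv sm_christoffel)

lemma sm_riem: "sm (\<lambda>t x. riem_tensor (G t) x I)"
  unfolding riem_tensor_def by (intro tsmooth_mult sm_sum sm_G sm_curvature_up)

lemma sm_ricci: "sm (\<lambda>t x. ricci (G t) x $ i $ j)"
  unfolding ricci_def by (simp add: sm_sum sm_curvature_up)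

lemma sm_cov_deriv:
  assumes "\<And>I. sm (\<lambda>t x. S t x I)"
  shows "sm (\<lambda>t x. cov_deriv (G t) (S t) x I)"
proof (cases I)
  case Nil
  then show ?thesis by (simp add: cov_deriv_def sm_const)
next
  case (Cons k J)
  show ?thesis unfolding Cons cov_deriv_Cons connection_term_eq
    by (intro tsmooth_diff tsmooth_partial_deriv sm_sum tsmooth_mult sm_christoffel assms)
qed

definition Rm :: "nat \<Rightarrow> 'n list \<Rightarrow> real \<Rightarrow> real^'n \<Rightarrow> real" where
  "Rm j I t x = (cov_deriv (G t) ^^ j) (riem_tensor (G t)) x I"

lemma sm_Rm: "sm (Rm j I)"
proof (induction j arbitrary: I)
  case 0
  have "Rm 0 I = (\<lambda>t x. riem_tensor (G t) x I)" by (simp add: Rm_def fun_eq_iff)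
  then show ?case by (simp add: sm_riem)
next
  case (Suc j)
  have "(\<lambda>t x. (cov_deriv (G t) ^^ j) (riem_tensor (G t)) x J) = Rm j J" for J
    by (simp add: Rm_def fun_eq_iff)
  then have "sm (\<lambda>t x. cov_deriv (G t) ((cov_deriv (G t) ^^ j) (riem_tensor (G t))) x I)"
    using Suc by (intro sm_cov_deriv) simp
  moreover have "Rm (Suc j) I = (\<lambda>t x. cov_deriv (G t) ((cov_deriv (G t) ^^ j) (riem_tensor (G t))) x I)"
    by (simp add: Rm_def fun_eq_iff)
  ultimately show ?case by simp
qed

text \<open>Up to the factor -2, Ric is the time derivative of the symmetric matrix G, so the flow
  equation itself gives the symmetry and the Bianchi identity is avoided.\<close>

lemma ricci_sym:
  assumes "x \<in> U" "t \<in> {0<..<T}"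
  shows "ricci (G t) x $ i $ j = ricci (G t) x $ j $ i"
proof -
  have "((\<lambda>s. G s x $ j $ i) has_real_derivative (- 2) * ricci (G t) x $ i $ j) (at t)"
    by (rule has_field_derivative_transform_within_open[OF flow[OF assms, of i j], of "{0<..<T}"])
       (use assms in \<open>auto simp: pos_def_sym[OF pd[OF assms(1)], of _ i j]\<close>)
  from DERIV_unique[OF this flow[OF assms, of j i]] show ?thesis by simp
qed

text \<open>Differentiating \<open>lower_christoffel\<close> in time gives first derivatives of Ric
  on the right, and products of Ric with Christoffel symbols from the product rule on the left.
  These products are exactly the connection terms that complete the coordinate derivatives to
  \<nabla>Ric, so no separate Christoffel symbol survives.\<close>

lemma deriv_lower_christoffel:
  assumes x: "x \<in> U" and t: "t \<in> {0<..<T}"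
  shows "(\<Sum>k\<in>UNIV. G t x $ n $ k * deriv (\<lambda>s. christoffel (G s) x k i j) t) =
    - (cov_deriv (G t) (ricci_tensor (G t)) x [i, j, n] + cov_deriv (G t) (ricci_tensor (G t)) x [j, i, n]
       - cov_deriv (G t) (ricci_tensor (G t)) x [n, i, j])"
proof -
  interpret smooth_metric U "G t" by (rule smooth_metric[OF t])
  define Rc where "Rc = (\<lambda>i j. ricci (G t) x $ i $ j)"
  define Ch where "Ch = (\<lambda>k i j. christoffel (G t) x k i j)"
  define dCh where "dCh = (\<lambda>k. deriv (\<lambda>s. christoffel (G s) x k i j) t)"
  define dR where "dR = (\<lambda>a i j. partial_deriv a (\<lambda>y. ricci (G t) y $ i $ j) x)"
  have dG: "((\<lambda>s. partial_deriv a (\<lambda>y. G s y $ b $ c) x) has_real_derivative (- 2) * dR a b c) (at t)" for a b c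
  proof -
    have "deriv (\<lambda>s. partial_deriv a (\<lambda>y. G s y $ b $ c) x) t = partial_deriv a (\<lambda>y. deriv (\<lambda>s. G s y $ b $ c) t) x"
      by (rule tsmooth_deriv_partial_deriv_commute[OF sm_G x t])
    also have "\<dots> = partial_deriv a (\<lambda>y. (- 2) * ricci (G t) y $ b $ c) x"
      by (rule partial_deriv_cong[OF open_U x]) (rule DERIV_imp_deriv[OF flow[OF _ t]])
    also have "\<dots> = (- 2) * dR a b c"
      unfolding dR_def by (rule partial_deriv_cmult[OF diff[OF smooth_ricci x]])
    finally show ?thesis
      using tsmooth_time_DERIV[OF tsmooth_partial_deriv[OF sm_G[of b c], of a] x t] by simp
  qed
  have "((\<lambda>s. \<Sum>k\<in>UNIV. G s x $ n $ k * christoffel (G s) x k i j) has_real_derivative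
      (\<Sum>k\<in>UNIV. G t x $ n $ k * dCh k + (- 2) * Rc n k * Ch k i j)) (at t)"
    unfolding dCh_def Rc_def Ch_def
    by (intro DERIV_sum DERIV_mult' flow[OF x t] tsmooth_time_DERIV[OF sm_christoffel x t])
  moreover have "((\<lambda>s. \<Sum>k\<in>UNIV. G s x $ n $ k * christoffel (G s) x k i j) has_real_derivative
      ((- 2) * dR i j n + (- 2) * dR j i n - (- 2) * dR n i j) / 2) (at t)"
  proof (rule has_field_derivative_transform_within_open)
    show "((\<lambda>s. (partial_deriv i (\<lambda>y. G s y $ j $ n) x + partial_deriv j (\<lambda>y. G s y $ i $ n) x
       - partial_deriv n (\<lambda>y. G s y $ i $ j) x) / 2) has_real_derivative
      ((- 2) * dR i j n + (- 2) * dR j i n - (- 2) * dR n i j) / 2) (at t)"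
      by (intro DERIV_cdivide DERIV_add DERIV_diff dG)
  next
    fix s assume "s \<in> {0<..<T}"
    then show "(partial_deriv i (\<lambda>y. G s y $ j $ n) x + partial_deriv j (\<lambda>y. G s y $ i $ n) x
       - partial_deriv n (\<lambda>y. G s y $ i $ j) x) / 2 = (\<Sum>k\<in>UNIV. G s x $ n $ k * christoffel (G s) x k i j)"
      using smooth_metric.lower_christoffel[OF smooth_metric x] by simp
  qed (use t in simp_all)
  ultimately have eq: "(\<Sum>k\<in>UNIV. G t x $ n $ k * dCh k + (- 2) * Rc n k * Ch k i j) =
      ((- 2) * dR i j n + (- 2) * dR j i n - (- 2) * dR n i j) / 2"
    by (rule DERIV_unique)
  then have main: "(\<Sum>k\<in>UNIV. G t x $ n $ k * dCh k) = 2 * (\<Sum>k\<in>UNIV. Ch k i j * Rc k n)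
      - (dR i j n + dR j i n - dR n i j)"
  proof -
    have "(- 2) * Rc n k * Ch k i j = - (2 * (Ch k i j * Rc k n))" for k
      unfolding Rc_def ricci_sym[OF x t, of n k] by simp
    then have "(\<Sum>k\<in>UNIV. G t x $ n $ k * dCh k + (- 2) * Rc n k * Ch k i j) =
      (\<Sum>k\<in>UNIV. G t x $ n $ k * dCh k) - 2 * (\<Sum>k\<in>UNIV. Ch k i j * Rc k n)" (is "?l = ?r")
      by (simp only: sum.distrib sum_negf sum_distrib_left)
    moreover have "?l = - (dR i j n + dR j i n - dR n i j)"
      unfolding eq by simp
    ultimately show ?thesis by linarith
  qed
  \<comment> \<open>Of the six connection terms in the combination, four cancel by the symmetry of
    the Christoffel symbols; the two with lower indices i and j are those in
    \<open>main\<close>.\<close>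
  have nab: "cov_deriv (G t) (ricci_tensor (G t)) x [a, b, c] =
     dR a b c - ((\<Sum>m\<in>UNIV. Ch m a b * Rc m c) + (\<Sum>m\<in>UNIV. Ch m a c * Rc m b))" for a b c
    using ricci_sym[OF x t, of b] by (simp add: cov_deriv_Cons ricci_tensor_def dR_def Rc_def Ch_def)
  have Csym: "Ch m a b = Ch m b a" for m a b
    unfolding Ch_def by (rule christoffel_sym[OF x])
  show ?thesis
    unfolding nab main[unfolded dCh_def] Csym[of _ j i] Csym[of _ n i] Csym[of _ n j] by simp
qed

lemma deriv_christoffel:
  assumes x: "x \<in> U" and t: "t \<in> {0<..<T}"
  shows "deriv (\<lambda>s. christoffel (G s) x k i j) t =
    (\<Sum>n\<in>UNIV. matrix_inv (G t x) $ k $ n * (cov_deriv (G t) (ricci_tensor (G t)) x [n, i, j]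
      - cov_deriv (G t) (ricci_tensor (G t)) x [i, j, n] - cov_deriv (G t) (ricci_tensor (G t)) x [j, i, n]))"
  using matrix_inv_cancel(2)[OF pd[OF x t], where n = k and v = "\<lambda>k. deriv (\<lambda>s. christoffel (G s) x k i j) t"]
  unfolding deriv_lower_christoffel[OF x t] by (simp add: algebra_simps)

end

section \<open>Induction on the order of the coordinate derivatives\<close>

context flow_region
begin

lemma bd_congI:
  "bd k F \<Longrightarrow> (\<And>x t. x \<in> K \<Longrightarrow> t \<in> {t0..<T} \<Longrightarrow> F' t x = F t x) \<Longrightarrow> bd k F'"
  using bounded_Ck_cong[OF open_K, of "{t0..<T}" F F' k] by simp

lemma metric_at: "t \<in> {t0..<T} \<Longrightarrow> smooth_metric U (G t)"
  by (rule smooth_metric[OF tI])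

lemma in_U: "x \<in> K \<Longrightarrow> x \<in> U"
  using K_sub by blast

text \<open>All j occur at once: a coordinate derivative of \<nabla>^jRiem involves
  \<nabla>^(j+1)Riem, so no finite range of j would survive the induction over k.\<close>

definition order_bounded :: "nat \<Rightarrow> bool" where
  "order_bounded k \<longleftrightarrow> (\<forall>i j. bd k (\<lambda>t x. G t x $ i $ j)) \<and> (\<forall>i j. bd k (\<lambda>t x. matrix_inv (G t x) $ i $ j)) \<and>
    (\<forall>j I. length I = j + 4 \<longrightarrow> bd k (Rm j I))"

lemma order_bounded_0: "order_bounded 0"
proof -
  have "\<bar>matrix_inv (G t x) $ i $ j\<bar> \<le> 1 / l" if "x \<in> K" "t \<in> {t0..<T}" for x t i j
    using matrix_inv_entry_bound[OF pd[OF in_U[OF that(1)] tI[OF that(2)]] low[OF that] l_pos] .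
  then have "\<exists>C. \<forall>x\<in>K. \<forall>t\<in>{t0..<T}. \<bar>matrix_inv (G t x) $ i $ j\<bar> \<le> C" for i j by blast
  moreover have "\<exists>C. \<forall>x\<in>K. \<forall>t\<in>{t0..<T}. \<bar>Rm j I t x\<bar> \<le> C" if "length I = j + 4" for j I
    using nabla_bd[of j] that unfolding Rm_def by blast
  moreover have "\<exists>C. \<forall>x\<in>K. \<forall>t\<in>{t0..<T}. \<bar>G t x $ i $ j\<bar> \<le> C" for i j
    using up by blast
  ultimately show ?thesis by (simp add: order_bounded_def)
qed

lemma bd_ricci:
  assumes "order_bounded k"
  shows "bd k (\<lambda>t x. ricci (G t) x $ i $ j)"
proof (rule bd_congI)
  show "bd k (\<lambda>t x. \<Sum>a\<in>UNIV. \<Sum>n\<in>UNIV. matrix_inv (G t x) $ a $ n * Rm 0 [a, i, j, n] t x)"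
    by (intro bd_sum bd_mult sm_sum tsmooth_mult sm_inv sm_Rm)
       (use assms in \<open>auto simp: order_bounded_def\<close>)
next
  fix x t assume "x \<in> K" "t \<in> {t0..<T}"
  then show "ricci (G t) x $ i $ j = (\<Sum>a\<in>UNIV. \<Sum>n\<in>UNIV. matrix_inv (G t x) $ a $ n * Rm 0 [a, i, j, n] t x)"
    using smooth_metric.ricci_eq_riem[OF metric_at in_U] by (simp add: Rm_def)
qed

lemma bd_deriv_christoffel:
  assumes "order_bounded k"
  shows "bd k (\<lambda>t x. deriv (\<lambda>s. christoffel (G s) x a i j) t)"
proof (rule bd_congI)
  let ?D = "\<lambda>a j k t x. \<Sum>i\<in>UNIV. \<Sum>n\<in>UNIV. matrix_inv (G t x) $ i $ n * Rm 1 [a, i, j, k, n] t x"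
  show "bd k (\<lambda>t x. \<Sum>n\<in>UNIV. matrix_inv (G t x) $ a $ n * (?D n i j t x - ?D i j n t x - ?D j i n t x))"
    by (intro bd_sum bd_mult bd_diff sm_sum tsmooth_mult tsmooth_diff sm_inv sm_Rm)
       (use assms in \<open>auto simp: order_bounded_def\<close>)
next
  let ?D = "\<lambda>a j k t x. \<Sum>i\<in>UNIV. \<Sum>n\<in>UNIV. matrix_inv (G t x) $ i $ n * Rm 1 [a, i, j, k, n] t x"
  fix x t assume xt: "x \<in> K" "t \<in> {t0..<T}"
  have "cov_deriv (G t) (ricci_tensor (G t)) x [a, j, k] = ?D a j k t x" for a j k
    using smooth_metric.nabla_ricci[OF metric_at[OF xt(2)] in_U[OF xt(1)]] by (simp add: Rm_def)
  then show "deriv (\<lambda>s. christoffel (G s) x a i j) t =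
      (\<Sum>n\<in>UNIV. matrix_inv (G t x) $ a $ n * (?D n i j t x - ?D i j n t x - ?D j i n t x))"
    using deriv_christoffel[OF in_U[OF xt(1)] tI[OF xt(2)]] by simp
qed

lemma bd_christoffel:
  assumes "order_bounded k"
  shows "bd k (\<lambda>t x. christoffel (G t) x a i j)"
  by (rule bd_time_integral[OF comp sm_christoffel bd_deriv_christoffel[OF assms]])

lemma order_bounded_Suc:
  assumes k: "order_bounded k"
  shows "order_bounded (Suc k)"
proof -
  note Ch = bd_christoffel[OF k]
  have ob: "bd k (\<lambda>t x. G t x $ i $ j)" "bd k (\<lambda>t x. matrix_inv (G t x) $ i $ j)"
    "length I = j' + 4 \<Longrightarrow> bd k (Rm j' I)" for i j j' I
    using k by (auto simp: order_bounded_def)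
  note ob0 = order_bounded_0[unfolded order_bounded_def]
  have "bd (Suc k) (\<lambda>t x. G t x $ i $ j)" for i j
  proof (rule bounded_Ck_SucI)
    show "bd 0 (\<lambda>t x. G t x $ i $ j)" using ob0 by blast
    fix a
    show "bd k (\<lambda>t. partial_deriv a (\<lambda>x. G t x $ i $ j))"
    proof (rule bd_congI)
      show "bd k (\<lambda>t x. (\<Sum>m\<in>UNIV. G t x $ j $ m * christoffel (G t) x m a i)
          + (\<Sum>m\<in>UNIV. G t x $ i $ m * christoffel (G t) x m a j))"
        by (intro bd_add bd_sum bd_mult sm_sum tsmooth_mult sm_G sm_christoffel ob Ch)
    qed (use smooth_metric.metric_compatible[OF metric_at in_U] in blast)
  qed
  moreover have "bd (Suc k) (\<lambda>t x. matrix_inv (G t x) $ i $ j)" for i j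
  proof (rule bounded_Ck_SucI)
    show "bd 0 (\<lambda>t x. matrix_inv (G t x) $ i $ j)" using ob0 by blast
    fix a
    show "bd k (\<lambda>t. partial_deriv a (\<lambda>x. matrix_inv (G t x) $ i $ j))"
    proof (rule bd_congI)
      show "bd k (\<lambda>t x. - (\<Sum>m\<in>UNIV. christoffel (G t) x i a m * matrix_inv (G t x) $ m $ j)
          - (\<Sum>m\<in>UNIV. matrix_inv (G t x) $ i $ m * christoffel (G t) x j a m))"
        \<comment> \<open>The last rule is the smoothness of a negative, obtained as a difference
          from the constant 0.\<close>
        by (intro bd_diff bd_minus bd_sum bd_mult sm_sum tsmooth_mult sm_inv sm_christoffel ob Ch
            tsmooth_diff[OF sm_const, of _ 0, simplified])
    qed (use smooth_metric.partial_deriv_inv[OF metric_at in_U] in blast)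
  qed
  moreover have "bd (Suc k) (Rm j I)" if len: "length I = j + 4" for j I
  proof (rule bounded_Ck_SucI)
    show "bd 0 (Rm j I)" using ob0 len by blast
    fix a
    show "bd k (\<lambda>t. partial_deriv a (Rm j I t))"
    proof (rule bd_congI)
      \<comment> \<open>This is the definition of \<nabla>, solved for the coordinate
        derivative.\<close>
      show "bd k (\<lambda>t x. Rm (Suc j) (a # I) t x +
          (\<Sum>m<length I. \<Sum>l\<in>UNIV. christoffel (G t) x l a (I ! m) * Rm j (I[m := l]) t x))"
        by (intro bd_add bd_sum bd_mult sm_sum tsmooth_mult sm_Rm sm_christoffel ob Ch)
           (use len in simp_all)
    next
      fix x t assume "x \<in> K" "t \<in> {t0..<T}"
      have "Rm j J t = (\<lambda>x. (cov_deriv (G t) ^^ j) (riem_tensor (G t)) x J)" for J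
        by (simp add: Rm_def fun_eq_iff)
      then show "partial_deriv a (Rm j I t) x = Rm (Suc j) (a # I) t x +
          (\<Sum>m<length I. \<Sum>l\<in>UNIV. christoffel (G t) x l a (I ! m) * Rm j (I[m := l]) t x)"
        by (simp add: Rm_def cov_deriv_Cons connection_term_eq)
    qed
  qed
  ultimately show ?thesis by (simp add: order_bounded_def del: bounded_Ck.simps)
qed

lemma order_bounded: "order_bounded k"
  by (induction k) (simp_all add: order_bounded_0 order_bounded_Suc)

lemma metric_bounded: "bd k (\<lambda>t x. G t x $ i $ j)"
  using order_bounded by (auto simp: order_bounded_def)

lemma metric_deriv_bounded: "bd k (\<lambda>t x. deriv (\<lambda>s. G s x $ i $ j) t)"
proof (rule bd_congI)
  show "bd k (\<lambda>t x. (- 2) * ricci (G t) x $ i $ j)"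
    by (intro bd_mult bd_const sm_const sm_ricci bd_ricci order_bounded)
qed (use DERIV_imp_deriv[OF flow] in_U tI in blast)

end

section \<open>Convergence with all derivatives as t tends to T\<close>

context space_time_region
begin

text \<open>The bounds on the time derivative force convergence as t tends to T; demanding them to
  every order makes the class closed under space derivatives.\<close>

definition limit_class_fun :: "(real \<Rightarrow> real^'n \<Rightarrow> real) \<Rightarrow> bool" where
  "limit_class_fun F \<longleftrightarrow> sm F \<and> (\<forall>k. bd k F) \<and> (\<forall>k. bd k (\<lambda>t x. deriv (\<lambda>s. F s x) t))"

lemma limit_class_fun_partial:
  assumes "limit_class_fun F"
  shows "limit_class_fun (\<lambda>t. partial_deriv i (F t))"
proof -
  have sm: "sm F" using assms by (simp add: limit_class_fun_def)
  have "bd (Suc k) F" "bd (Suc k) (\<lambda>t x. deriv (\<lambda>s. F s x) t)" for k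
    using assms unfolding limit_class_fun_def by blast+
  then have "bd k (\<lambda>t. partial_deriv i (F t))" "bd k (\<lambda>t. partial_deriv i (\<lambda>x. deriv (\<lambda>s. F s x) t))" for k
    by simp_all
  moreover from this(2) have "bd k (\<lambda>t x. deriv (\<lambda>s. partial_deriv i (F s) x) t)" for k
  proof (rule bounded_Ck_cong[OF open_K, THEN iffD1, rotated])
    fix x t assume "x \<in> K" "t \<in> {t0..<T}"
    then have xt: "x \<in> U" "t \<in> {0<..<T}" using K_sub t0 by auto
    from tsmooth_deriv_partial_deriv_commute[OF sm xt, of i]
    show "partial_deriv i (\<lambda>x. deriv (\<lambda>s. F s x) t) x = deriv (\<lambda>s. partial_deriv i (F s) x) t"
      by (rule sym)
  qed
  ultimately show ?thesis using tsmooth_partial_deriv[OF sm] by (simp add: limit_class_fun_def)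
qed

text \<open>The bound D on the time derivative makes F Lipschitz in t, with the same constant at all
  points. The explicit rate is recorded because it makes the convergence uniform in x, as the
  differentiation of the limit requires.\<close>

lemma limit_class_fun_limit:
  assumes "limit_class_fun F"
  shows "\<exists>D f. 0 \<le> D \<and> (\<forall>x\<in>K. \<forall>t\<in>{t0..<T}. \<bar>F t x - f x\<bar> \<le> D * (T - t))"
proof -
  have sm: "sm F" and "bd 0 (\<lambda>t x. deriv (\<lambda>s. F s x) t)"
    using assms unfolding limit_class_fun_def by blast+
  then obtain D0 where "\<forall>x\<in>K. \<forall>t\<in>{t0..<T}. \<bar>deriv (\<lambda>s. F s x) t\<bar> \<le> D0" by auto
  define D where "D = \<bar>D0\<bar>"
  have D: "\<bar>deriv (\<lambda>s. F s x) t\<bar> \<le> D" if "x \<in> K" "t \<in> {t0..<T}" for x t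
    using \<open>\<forall>x\<in>K. _\<close> that unfolding D_def by (meson abs_ge_self order_trans)
  have lip: "\<bar>F t x - F s x\<bar> \<le> D * (t - s)" if x: "x \<in> K" and st: "t0 \<le> s" "s \<le> t" "t < T" for x s t
  proof (cases "s = t")
    case False
    have "((\<lambda>s. F s x) has_real_derivative deriv (\<lambda>s. F s x) r) (at r)" if "s \<le> r" "r \<le> t" for r
      using that st t0 x K_sub by (intro tsmooth_time_DERIV[OF sm]) auto
    then obtain z where z: "s < z" "z < t" "F t x - F s x = (t - s) * deriv (\<lambda>s. F s x) z"
      using MVT2[of s t "\<lambda>s. F s x" "\<lambda>z. deriv (\<lambda>s. F s x) z"] st False by auto
    have "\<bar>F t x - F s x\<bar> \<le> (t - s) * D"
      unfolding z(3) abs_mult by (rule mult_mono) (use z st D[OF x, of z] in \<open>auto simp: D_def\<close>)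
    then show ?thesis by (simp add: mult.commute)
  qed simp
  have "\<exists>L. \<forall>t\<in>{t0..<T}. \<bar>F t x - L\<bar> \<le> D * (T - t)" if x: "x \<in> K" for x
  proof -
    \<comment> \<open>This sequence starts at t0 and increases to T.\<close>
    define \<tau> where "\<tau> = (\<lambda>n. T - (T - t0) / real (Suc n))"
    have \<tau>: "t0 \<le> \<tau> n" "\<tau> n < T" for n
      using t0 mult_right_mono[of t0 T "real n"] by (auto simp: \<tau>_def field_simps)
    have lim: "\<tau> \<longlonglongrightarrow> T"
    proof -
      have "(\<lambda>n. T - (T - t0) * inverse (real (Suc n))) \<longlonglongrightarrow> T - (T - t0) * 0"
        by (intro tendsto_intros LIMSEQ_inverse_real_of_nat)
      then show ?thesis by (simp add: \<tau>_def divide_inverse)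
    qed
    have lip2: "\<bar>F s x - F t x\<bar> \<le> D * \<bar>s - t\<bar>" if "s \<in> {t0..<T}" "t \<in> {t0..<T}" for s t
      using lip[OF x, of s t] lip[OF x, of t s] that by (cases "s \<le> t") (auto simp: abs_minus_commute)
    have "Cauchy (\<lambda>n. F (\<tau> n) x)"
    proof (rule metric_CauchyI)
      fix e :: real assume e: "0 < e"
      have "Cauchy \<tau>" using lim by (rule LIMSEQ_imp_Cauchy)
      \<comment> \<open>D may be 0, hence the divisor D + 1.\<close>
      moreover have pos: "0 < D + 1" by (simp add: D_def add_nonneg_pos)
      ultimately obtain N where N: "\<And>m n. m \<ge> N \<Longrightarrow> n \<ge> N \<Longrightarrow> dist (\<tau> m) (\<tau> n) < e / (D + 1)"
        using e by (meson divide_pos_pos metric_CauchyD)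
      show "\<exists>N. \<forall>m\<ge>N. \<forall>n\<ge>N. dist (F (\<tau> m) x) (F (\<tau> n) x) < e"
      proof (intro exI allI impI)
        fix m n assume mn: "N \<le> m" "N \<le> n"
        have "dist (F (\<tau> m) x) (F (\<tau> n) x) \<le> D * \<bar>\<tau> m - \<tau> n\<bar>"
          using lip2[of "\<tau> m" "\<tau> n"] \<tau> by (simp add: dist_real_def)
        also have "\<dots> \<le> (D + 1) * \<bar>\<tau> m - \<tau> n\<bar>" by (intro mult_right_mono) auto
        also have "\<dots> < e" using N[OF mn] pos by (simp add: dist_real_def pos_less_divide_eq mult.commute)
        finally show "dist (F (\<tau> m) x) (F (\<tau> n) x) < e" .
      qed
    qed
    then obtain L where L: "(\<lambda>n. F (\<tau> n) x) \<longlonglongrightarrow> L"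
      using Cauchy_convergent_iff convergent_def by blast
    have "\<bar>F t x - L\<bar> \<le> D * (T - t)" if t: "t \<in> {t0..<T}" for t
    proof -
      have "(\<lambda>n. \<bar>F t x - F (\<tau> n) x\<bar>) \<longlonglongrightarrow> \<bar>F t x - L\<bar>"
        by (intro tendsto_intros L)
      moreover have "(\<lambda>n. D * \<bar>t - \<tau> n\<bar>) \<longlonglongrightarrow> D * \<bar>t - T\<bar>"
        by (intro tendsto_intros lim)
      moreover have "\<bar>F t x - F (\<tau> n) x\<bar> \<le> D * \<bar>t - \<tau> n\<bar>" for n
        using lip2[OF t, of "\<tau> n"] \<tau> by simp
      ultimately have "\<bar>F t x - L\<bar> \<le> D * \<bar>t - T\<bar>" by (intro LIMSEQ_le) auto
      then show ?thesis using t by simp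
    qed
    then show ?thesis by blast
  qed
  then obtain f where "\<And>x. x \<in> K \<Longrightarrow> \<forall>t\<in>{t0..<T}. \<bar>F t x - f x\<bar> \<le> D * (T - t)" by metis
  moreover have "0 \<le> D" by (simp add: D_def)
  ultimately show ?thesis by blast
qed

lemma limit_from_bound:
  assumes "\<And>t. t \<in> {t0..<T} \<Longrightarrow> \<bar>h t - L\<bar> \<le> D * (T - t)"
  shows "(h \<longlongrightarrow> L) (at_left T)"
proof -
  have "((\<lambda>t. D * (T - t)) \<longlongrightarrow> D * (T - T)) (at_left T)"
    by (intro tendsto_intros)
  then have lim: "((\<lambda>t. D * (T - t)) \<longlongrightarrow> 0) (at_left T)" by simp
  have bound: "\<forall>\<^sub>F t in at_left T. norm (h t - L) \<le> D * (T - t)"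
  proof (rule eventually_mono[OF eventually_at_left_real[OF t0(2)]])
    fix t assume "t \<in> {t0<..<T}"
    then have "t \<in> {t0..<T}" by simp
    from assms[OF this] show "norm (h t - L) \<le> D * (T - t)" by simp
  qed
  show ?thesis by (rule Lim_null[THEN iffD2, OF Lim_null_comparison[OF bound lim]])
qed

text \<open>The partial derivatives converge uniformly in x, at the rate T - t, so the theorem on
  derivatives of sequences applies along a sequence of times tending to T. Convexity of K is what
  its mean value inequality requires.\<close>

lemma limit_has_derivative:
  assumes F: "limit_class_fun F" and "convex K"
    and lim: "\<And>x. x \<in> K \<Longrightarrow> ((\<lambda>t. F t x) \<longlongrightarrow> f x) (at_left T)"
    and lim': "\<And>x i. x \<in> K \<Longrightarrow> ((\<lambda>t. partial_deriv i (F t) x) \<longlongrightarrow> f' i x) (at_left T)"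
    and x: "x \<in> K"
  shows "(f has_derivative (\<lambda>h. \<Sum>i\<in>UNIV. h $ i * f' i x)) (at x)"
proof -
  have sm: "sm F" using F by (simp add: limit_class_fun_def)
  have nontriv: "at_left T \<noteq> bot" by simp
  have "\<exists>D. 0 \<le> D \<and> (\<forall>x\<in>K. \<forall>t\<in>{t0..<T}. \<bar>partial_deriv i (F t) x - f' i x\<bar> \<le> D * (T - t))" for i
  proof -
    obtain D p where D: "0 \<le> D" "\<And>x t. x \<in> K \<Longrightarrow> t \<in> {t0..<T} \<Longrightarrow> \<bar>partial_deriv i (F t) x - p x\<bar> \<le> D * (T - t)"
      using limit_class_fun_limit[OF limit_class_fun_partial[OF F]] by blast
    \<comment> \<open>The limit that comes with a uniform rate is the prescribed one, by uniqueness
      of limits.\<close>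
    have "p x = f' i x" if "x \<in> K" for x
      by (rule tendsto_unique[OF nontriv limit_from_bound lim'[OF that]]) (rule D(2)[OF that])
    then show ?thesis using D by auto
  qed
  then obtain D where D: "\<And>i. 0 \<le> D i"
    "\<And>i x t. x \<in> K \<Longrightarrow> t \<in> {t0..<T} \<Longrightarrow> \<bar>partial_deriv i (F t) x - f' i x\<bar> \<le> D i * (T - t)"
    by metis
  define \<tau> where "\<tau> = (\<lambda>n. T - (T - t0) / real (Suc n))"
  have \<tau>: "\<tau> n \<in> {t0..<T}" for n
    using t0 mult_right_mono[of t0 T "real n"] by (auto simp: \<tau>_def field_simps)
  have \<tau>lim: "\<tau> \<longlonglongrightarrow> T"
  proof -
    have "(\<lambda>n. T - (T - t0) * inverse (real (Suc n))) \<longlonglongrightarrow> T - (T - t0) * 0"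
      by (intro tendsto_intros LIMSEQ_inverse_real_of_nat)
    then show ?thesis by (simp add: \<tau>_def divide_inverse)
  qed
  then have \<tau>left: "filterlim \<tau> (at_left T) sequentially"
    using \<tau> by (intro filterlim_at_withinI) (auto simp: less_imp_neq)
  have limn: "(\<lambda>n. F (\<tau> n) x) \<longlonglongrightarrow> f x" if "x \<in> K" for x
    using filterlim_compose[OF lim[OF that] \<tau>left] .
  have "\<exists>g. \<forall>x\<in>K. (\<lambda>n. F (\<tau> n) x) \<longlonglongrightarrow> g x \<and>
      (g has_derivative (\<lambda>h. \<Sum>i\<in>UNIV. h $ i * f' i x)) (at x within K)"
  proof (rule has_derivative_sequence[where f = "\<lambda>n. F (\<tau> n)" and l = "f x", OF \<open>convex K\<close> _ _ x])
    fix n y assume y: "y \<in> K"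
    show "(F (\<tau> n) has_derivative frechet_derivative (F (\<tau> n)) (at y)) (at y within K)"
      by (rule has_derivative_at_withinI[OF differentiable_imp_has_derivative[OF sm_diff[OF sm y \<tau>]]])
  next
    fix e :: real assume e: "0 < e"
    have "(\<lambda>n. (\<Sum>i\<in>UNIV. D i) * (T - \<tau> n)) \<longlonglongrightarrow> (\<Sum>i\<in>UNIV. D i) * (T - T)"
      by (intro tendsto_intros \<tau>lim)
    then have "\<forall>\<^sub>F n in sequentially. (\<Sum>i\<in>UNIV. D i) * (T - \<tau> n) < e"
      using e by (intro order_tendstoD(2)) simp_all
    then show "\<forall>\<^sub>F n in sequentially. \<forall>y\<in>K. \<forall>h. norm (frechet_derivative (F (\<tau> n)) (at y) h
        - (\<Sum>i\<in>UNIV. h $ i * f' i y)) \<le> e * norm h"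
    proof (rule eventually_mono, intro ballI allI)
      fix n y and h :: "real^'n"
      assume n: "(\<Sum>i\<in>UNIV. D i) * (T - \<tau> n) < e" and y: "y \<in> K"
      have "frechet_derivative (F (\<tau> n)) (at y) h - (\<Sum>i\<in>UNIV. h $ i * f' i y) =
          (\<Sum>i\<in>UNIV. h $ i * (partial_deriv i (F (\<tau> n)) y - f' i y))"
        by (simp add: frechet_derivative_vec_expand[OF sm_diff[OF sm y \<tau>]] right_diff_distrib sum_subtractf)
      also have "norm \<dots> \<le> (\<Sum>i\<in>UNIV. norm h * (D i * (T - \<tau> n)))"
      proof (rule order_trans[OF norm_sum], rule sum_mono)
        fix i
        show "norm (h $ i * (partial_deriv i (F (\<tau> n)) y - f' i y)) \<le> norm h * (D i * (T - \<tau> n))"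
          unfolding norm_mult using D(2)[OF y \<tau>, of i n] component_le_norm_cart[of h i]
          by (intro mult_mono) auto
      qed
      also have "\<dots> = norm h * ((\<Sum>i\<in>UNIV. D i) * (T - \<tau> n))"
        by (simp add: sum_distrib_left sum_distrib_right)
      also have "\<dots> \<le> norm h * e" using n by (intro mult_left_mono) auto
      finally show "norm (frechet_derivative (F (\<tau> n)) (at y) h - (\<Sum>i\<in>UNIV. h $ i * f' i y)) \<le> e * norm h"
        by (simp add: mult.commute)
    qed
  qed (rule limn[OF x])
  then obtain g where g: "\<And>x. x \<in> K \<Longrightarrow> (\<lambda>n. F (\<tau> n) x) \<longlonglongrightarrow> g x"
    "\<And>x. x \<in> K \<Longrightarrow> (g has_derivative (\<lambda>h. \<Sum>i\<in>UNIV. h $ i * f' i x)) (at x within K)" by blast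
  have "(g has_derivative (\<lambda>h. \<Sum>i\<in>UNIV. h $ i * f' i x)) (at x)"
    using g(2)[OF x] at_within_open[OF x open_K] by simp
  then show ?thesis
    by (rule has_derivative_transform_within_open[OF _ open_K x])
       (use LIMSEQ_unique[OF g(1) limn] in blast)
qed

text \<open>The derivative of the limit has as coefficients the limits of the partial derivatives,
  which belong to the same class, so the induction continues with them.\<close>

lemma limit_Ck_on:
  assumes "limit_class_fun F" and "convex K"
    and "\<And>x. x \<in> K \<Longrightarrow> ((\<lambda>t. F t x) \<longlongrightarrow> f x) (at_left T)"
  shows "Ck_on k K f"
  using assms(1,3)
proof (induction k arbitrary: F f)
  case (0 F f)
  have "\<exists>f'. \<forall>x\<in>K. ((\<lambda>t. partial_deriv i (F t) x) \<longlongrightarrow> f' x) (at_left T)" for i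
    using limit_class_fun_limit[OF limit_class_fun_partial[OF 0(1)]] limit_from_bound by meson
  then obtain f' where f': "\<And>i x. x \<in> K \<Longrightarrow> ((\<lambda>t. partial_deriv i (F t) x) \<longlongrightarrow> f' i x) (at_left T)" by metis
  have "(f has_derivative (\<lambda>h. \<Sum>i\<in>UNIV. h $ i * f' i x)) (at x)" if "x \<in> K" for x
    by (rule limit_has_derivative[OF 0(1) assms(2) _ _ that]) (fact 0(2), fact f')
  then have "f differentiable (at x)" if "x \<in> K" for x using that by (auto simp: differentiable_def)
  then show ?case
    by (simp add: continuous_at_imp_continuous_on differentiable_imp_continuous_within)
next
  case (Suc k F f)
  have "\<exists>f'. \<forall>x\<in>K. ((\<lambda>t. partial_deriv i (F t) x) \<longlongrightarrow> f' x) (at_left T)" for i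
    using limit_class_fun_limit[OF limit_class_fun_partial[OF Suc.prems(1)]] limit_from_bound by meson
  then obtain f' where f': "\<And>i x. x \<in> K \<Longrightarrow> ((\<lambda>t. partial_deriv i (F t) x) \<longlongrightarrow> f' i x) (at_left T)" by metis
  have d: "(f has_derivative (\<lambda>h. \<Sum>i\<in>UNIV. h $ i * f' i x)) (at x)" if "x \<in> K" for x
    by (rule limit_has_derivative[OF Suc.prems(1) assms(2) _ _ that]) (fact Suc.prems(2), fact f')
  have "Ck_on k K (f' i)" for i
    by (rule Suc.IH[OF limit_class_fun_partial[OF Suc.prems(1)] f'])
  then have "Ck_on k K (\<lambda>x. \<Sum>i\<in>A. v $ i * f' i x)" for A v
    by (induction A rule: infinite_finite_induct) (auto intro!: Ck_on_const Ck_on_add Ck_on_mult open_K)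
  then have "Ck_on k K (\<lambda>x. frechet_derivative f (at x) v)" for v
    by (rule Ck_on_cong[THEN iffD1, rotated]) (simp add: frechet_derivative_at_eq[OF d])
  moreover have "f differentiable (at x)" if "x \<in> K" for x
    using d[OF that] by (auto simp: differentiable_def)
  ultimately show ?case using open_K by (simp add: Ck_on_Suc_open del: Ck_on.simps)
qed

end

lemma (in flow_region) limit_metric_smooth:
  assumes "convex K" "\<And>x i j. x \<in> K \<Longrightarrow> ((\<lambda>t. G t x $ i $ j) \<longlongrightarrow> f x $ i $ j) (at_left T)"
  shows "smooth_on K f"
proof (intro smooth_on_vec_lambda open_K)
  fix i j
  have "limit_class_fun (\<lambda>t x. G t x $ i $ j)"
    unfolding limit_class_fun_def using sm_G metric_bounded metric_deriv_bounded by blast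
  then have "Ck_on k K (\<lambda>x. f x $ i $ j)" for k
    by (rule limit_Ck_on[OF _ assms(1)]) (rule assms(2))
  then show "smooth_on K (\<lambda>x. f x $ i $ j)" by (simp add: smooth_on_def)
qed

section \<open>Charts and Riemannian metrics on a manifold\<close>

lemma smooth_on_Times_restrict:
  assumes "smooth_on (U \<times> {0..<T}) F" "open U"
  shows "smooth_on (U \<times> {0<..<(T::real)}) F"
  by (rule smooth_on_open_subset[OF assms(1)]) (auto simp: assms(2) open_Times)

locale atlas =
  fixes X :: "'a topology" and A :: "('a, 'n::finite) chart set"
  assumes manifold: "smooth_manifold X A"
begin

lemma hausdorff: "Hausdorff_space X"
  using manifold by (simp add: smooth_manifold_def)

lemma topspace_eq: "topspace X = (\<Union>c\<in>A. fst c)"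
  using manifold by (simp add: smooth_manifold_def)

lemma chart_ex: "p \<in> topspace X \<Longrightarrow> \<exists>c\<in>A. p \<in> fst c"
  using topspace_eq by blast

lemma chart_at:
  assumes "p \<in> topspace X"
  shows "chart_at A p \<in> A" "p \<in> fst (chart_at A p)"
proof -
  from chart_ex[OF assms] have "\<exists>c. c \<in> A \<and> p \<in> fst c" by blast
  from someI_ex[OF this] show "chart_at A p \<in> A" "p \<in> fst (chart_at A p)"
    by (simp_all add: chart_at_def)
qed

context
  fixes c :: "('a, 'n) chart"
  assumes c: "c \<in> A"
begin

lemma is_chart: "is_chart X c"
  using manifold c by (simp add: smooth_manifold_def)

lemma chart_openin: "openin X (fst c)"
  using is_chart by (simp add: is_chart_def)

lemma chart_sub: "fst c \<subseteq> topspace X"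
  using chart_openin by (rule openin_subset)

lemma chart_image_open: "open (chart_image c)"
  using is_chart by (simp add: is_chart_def)

lemma chart_homeo: "homeomorphic_map (subtopology X (fst c)) (top_of_set (chart_image c)) (snd c)"
  using is_chart by (simp add: is_chart_def)

lemma chart_inj: "inj_on (snd c) (fst c)"
  using homeomorphic_imp_injective_map[OF chart_homeo] chart_sub
  by (simp add: Int_absorb1)

lemma chart_inv_left [simp]: "p \<in> fst c \<Longrightarrow> chart_inv c (snd c p) = p"
  unfolding chart_inv_def by (rule inv_into_f_f[OF chart_inj])

lemma chart_image_mem: "p \<in> fst c \<Longrightarrow> snd c p \<in> chart_image c"
  by (simp add: chart_image_def)

lemma chart_inv_right [simp]: "x \<in> chart_image c \<Longrightarrow> snd c (chart_inv c x) = x"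
  unfolding chart_inv_def chart_image_def by (rule f_inv_into_f)

lemma chart_inv_mem: "x \<in> chart_image c \<Longrightarrow> chart_inv c x \<in> fst c"
  unfolding chart_inv_def chart_image_def by (rule inv_into_into)

lemma chart_continuous: "continuous_map (subtopology X (fst c)) euclidean (snd c)"
  using homeomorphic_imp_continuous_map[OF chart_homeo] by (simp add: continuous_map_in_subtopology)

lemma chart_preimage_openin: "open B \<Longrightarrow> openin X {p \<in> fst c. snd c p \<in> B}"
proof -
  assume "open B"
  then have "openin (subtopology X (fst c)) {p \<in> topspace (subtopology X (fst c)). snd c p \<in> B}"
    using chart_continuous openin_continuous_map_preimage by fastforce
  moreover have "topspace (subtopology X (fst c)) = fst c"
    using chart_sub by auto
  ultimately show ?thesis using openin_trans_full chart_openin by metis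
qed

lemma chart_image_openin: "openin X W \<Longrightarrow> open (snd c ` (fst c \<inter> W))"
proof -
  assume W: "openin X W"
  have "openin (subtopology X (fst c)) (fst c \<inter> W)"
    using W openin_subtopology_Int2 by blast
  then have "openin (top_of_set (chart_image c)) (snd c ` (fst c \<inter> W))"
    using homeomorphic_imp_open_map[OF chart_homeo] by (simp add: open_map_def)
  then show ?thesis using chart_image_open openin_open_trans by blast
qed

lemma chart_inv_continuous: "continuous_map (top_of_set (chart_image c)) X (chart_inv c)"
proof -
  obtain g where g: "homeomorphic_maps (subtopology X (fst c)) (top_of_set (chart_image c)) (snd c) g"
    using chart_homeo homeomorphic_map_maps by blast
  have "continuous_map (top_of_set (chart_image c)) X g"
    using g unfolding homeomorphic_maps_def by (metis continuous_map_in_subtopology)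
  moreover have "g x = chart_inv c x" if x: "x \<in> chart_image c" for x
  proof -
    have "snd c (g x) = x" using g x unfolding homeomorphic_maps_def by simp
    moreover have "g x \<in> fst c"
      using g x unfolding homeomorphic_maps_def continuous_map_def by auto
    ultimately show ?thesis using chart_inv_left by metis
  qed
  ultimately show ?thesis
    by (metis (no_types, lifting) continuous_map_eq topspace_euclidean_subtopology)
qed

end

definition transition :: "('a, 'n) chart \<Rightarrow> ('a, 'n) chart \<Rightarrow> real^'n \<Rightarrow> real^'n" where
  "transition c c' = snd c' \<circ> chart_inv c"

definition overlap :: "('a, 'n) chart \<Rightarrow> ('a, 'n) chart \<Rightarrow> (real^'n) set" where
  "overlap c c' = snd c ` (fst c \<inter> fst c')"

lemma overlap_open: "c \<in> A \<Longrightarrow> c' \<in> A \<Longrightarrow> open (overlap c c')"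
  unfolding overlap_def by (intro chart_image_openin chart_openin)

lemma overlap_sub: "overlap c c' \<subseteq> chart_image c"
  by (auto simp: overlap_def chart_image_def)

lemma transition_smooth: "c \<in> A \<Longrightarrow> c' \<in> A \<Longrightarrow> smooth_on (overlap c c') (transition c c')"
  using manifold by (simp add: smooth_manifold_def transition_def overlap_def)

lemma transition_apply: "c \<in> A \<Longrightarrow> p \<in> fst c \<Longrightarrow> transition c c' (snd c p) = snd c' p"
  by (simp add: transition_def)

lemma transition_mem: "c \<in> A \<Longrightarrow> x \<in> overlap c c' \<Longrightarrow> transition c c' x \<in> chart_image c'"
  by (auto simp: overlap_def transition_apply chart_image_def)

end

section \<open>Metric components and curvature norms under change of chart\<close>

locale riem_atlas = atlas X A for X :: "'a topology" and A :: "('a, 'n::finite) chart set" +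
  fixes h :: "('a, 'n) metric_field"
  assumes metric: "riemannian_metric A h"
begin

lemma metric_pos_def: "c \<in> A \<Longrightarrow> p \<in> fst c \<Longrightarrow> pos_def (h c p)"
proof -
  assume "c \<in> A" "p \<in> fst c"
  then have "transpose (h c p) = h c p \<and> (\<forall>u. u \<noteq> 0 \<longrightarrow> 0 < metric_form h c p u)"
    using metric[unfolded riemannian_metric_def, THEN conjunct1] by blast
  then show ?thesis unfolding pos_def_def metric_form_def .
qed

lemma coord_pos_def: "c \<in> A \<Longrightarrow> x \<in> chart_image c \<Longrightarrow> pos_def (coord_metric h c x)"
  unfolding coord_metric_def by (intro metric_pos_def chart_inv_mem)

lemma coord_smooth: "c \<in> A \<Longrightarrow> smooth_on (chart_image c) (coord_metric h c)"
  using metric[unfolded riemannian_metric_def, THEN conjunct1] by blast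

lemma coord_smooth_nth: "c \<in> A \<Longrightarrow> smooth_on (chart_image c) (\<lambda>x. coord_metric h c x $ i $ j)"
  by (intro smooth_on_vec_nth chart_image_open coord_smooth)

lemma metric_transform:
  assumes "c \<in> A" "c' \<in> A" "p \<in> fst c" "p \<in> fst c'"
  shows "h c p = transpose (jacobian (transition c c') (at (snd c p))) ** h c' p ** jacobian (transition c c') (at (snd c p))"
  using metric[unfolded riemannian_metric_def Let_def, THEN conjunct2] assms unfolding transition_def by blast

lemma chart_change:
  assumes "c \<in> A" "c' \<in> A"
  shows "chart_change (overlap c c') (chart_image c') (coord_metric h c) (coord_metric h c') (transition c c')"
proof unfold_locales
  show "open (overlap c c')" by (rule overlap_open[OF assms])
  show "smooth_on (overlap c c') (\<lambda>x. coord_metric h c x $ i $ j)" for i j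
    by (rule smooth_on_open_subset[OF coord_smooth_nth[OF assms(1)] overlap_open[OF assms] overlap_sub])
  show "pos_def (coord_metric h c x)" if "x \<in> overlap c c'" for x
    by (rule coord_pos_def[OF assms(1) subsetD[OF overlap_sub that]])
  show "open (chart_image c')" by (rule chart_image_open[OF assms(2)])
  show "smooth_on (chart_image c') (\<lambda>x. coord_metric h c' x $ i $ j)" for i j
    by (rule coord_smooth_nth[OF assms(2)])
  show "pos_def (coord_metric h c' x)" if "x \<in> chart_image c'" for x
    by (rule coord_pos_def[OF assms(2) that])
  show "smooth_on (overlap c c') (transition c c')" by (rule transition_smooth[OF assms])
  show "transition c c' x \<in> chart_image c'" if "x \<in> overlap c c'" for x
    by (rule transition_mem[OF assms(1) that])
  show "coord_metric h c x = transpose (jacobian (transition c c') (at x)) ** coord_metric h c' (transition c c' x) **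
      jacobian (transition c c') (at x)" if "x \<in> overlap c c'" for x
  proof -
    from that obtain p where p: "p \<in> fst c" "p \<in> fst c'" "x = snd c p" by (auto simp: overlap_def)
    show ?thesis
      using metric_transform[OF assms p(1,2)] p assms by (simp add: coord_metric_def transition_apply)
  qed
qed

text \<open>The definition uses the chart picked by \<open>chart_at\<close>, which may jump from
  point to point. Invariance under change of chart lets the same number be read in one chart on its
  whole domain.\<close>

lemma nabla_riem_norm_sq_chart:
  assumes "c \<in> A" "p \<in> fst c"
  shows "nabla_riem_norm_sq j A h p =
    tensor_norm_sq (coord_metric h c) (j + 4) ((cov_deriv (coord_metric h c) ^^ j) (riem_tensor (coord_metric h c))) (snd c p)"
proof -
  have p: "p \<in> topspace X" using assms chart_sub by blast
  note ca = chart_at[OF p]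
  have "snd (chart_at A p) p \<in> overlap (chart_at A p) c" using ca assms by (simp add: overlap_def)
  from chart_change.nabla_riem_norm_invariant[OF chart_change[OF ca(1) assms(1)] this, of j]
  show ?thesis using ca by (simp add: nabla_riem_norm_sq_def Let_def transition_apply)
qed

lemma metric_form_transform:
  assumes "c \<in> A" "c' \<in> A" "p \<in> fst c" "p \<in> fst c'"
  shows "metric_form h c p u = metric_form h c' p (frechet_derivative (transition c c') (at (snd c p)) u)"
proof -
  let ?J = "jacobian (transition c c') (at (snd c p))"
  have "snd c p \<in> overlap c c'" using assms by (simp add: overlap_def)
  then have "transition c c' differentiable (at (snd c p))"
    by (rule smooth_on_imp_differentiable[OF overlap_open[OF assms(1,2)] transition_smooth[OF assms(1,2)]])
  then have "frechet_derivative (transition c c') (at (snd c p)) u = ?J *v u"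
    unfolding jacobian_def by (simp add: matrix_works linear_frechet_derivative)
  moreover have "metric_form h c p u = (?J *v u) \<bullet> (h c' p *v (?J *v u))"
  proof -
    have "u \<bullet> (transpose ?J *v v) = (?J *v u) \<bullet> v" for v
      by (metis dot_lmul_matrix inner_commute transpose_matrix_vector)
    then show ?thesis
      unfolding metric_form_def metric_transform[OF assms] by (simp only: matrix_vector_mul_assoc[symmetric])
  qed
  ultimately show ?thesis by (simp add: metric_form_def)
qed

lemma metric_form_nonneg: "c \<in> A \<Longrightarrow> p \<in> fst c \<Longrightarrow> 0 \<le> metric_form h c p u"
  using metric_pos_def[of c p] unfolding pos_def_def metric_form_def
  by (cases "u = 0") (auto simp: less_imp_le)

end

section \<open>Curves, length and distance\<close>

text \<open>An inductive form of the partition in \<open>piecewise_C1_curve\<close>, on arbitrary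
  intervals, so that scaling, reversal and joining are proved one piece at a time.\<close>

inductive pw_C1 :: "('a, 'n::finite) chart set \<Rightarrow> (real \<Rightarrow> 'a) \<Rightarrow> real \<Rightarrow> real \<Rightarrow> bool"
  for A \<gamma> where
  pw_refl: "pw_C1 A \<gamma> u u"
| pw_step: "pw_C1 A \<gamma> u v \<Longrightarrow> v < w \<Longrightarrow> C1_curve_on A v w \<gamma> \<Longrightarrow> pw_C1 A \<gamma> u w"

lemma pw_C1_iff:
  "pw_C1 A \<gamma> u v \<longleftrightarrow>
   (\<exists>n a. a 0 = u \<and> a n = v \<and> (\<forall>i<n. a i < a (Suc i) \<and> C1_curve_on A (a i) (a (Suc i)) \<gamma>))"
proof
  assume "pw_C1 A \<gamma> u v"
  then show "\<exists>n a. a 0 = u \<and> a n = v \<and> (\<forall>i<n. a i < a (Suc i) \<and> C1_curve_on A (a i) (a (Suc i)) \<gamma>)"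
  proof induction
    case (pw_refl u)
    show ?case by (rule exI[of _ 0], rule exI[of _ "\<lambda>_. u"]) simp
  next
    case (pw_step u v w)
    then obtain n a where a: "a 0 = u" "a n = v" "\<And>i. i < n \<Longrightarrow> a i < a (Suc i) \<and> C1_curve_on A (a i) (a (Suc i)) \<gamma>"
      by blast
    show ?case
      by (rule exI[of _ "Suc n"], rule exI[of _ "a(Suc n := w)"])
         (use a pw_step in \<open>auto simp: less_Suc_eq\<close>)
  qed
next
  assume "\<exists>n a. a 0 = u \<and> a n = v \<and> (\<forall>i<n. a i < a (Suc i) \<and> C1_curve_on A (a i) (a (Suc i)) \<gamma>)"
  then obtain n a where a: "a 0 = u" "a n = v" "\<And>i. i < n \<Longrightarrow> a i < a (Suc i) \<and> C1_curve_on A (a i) (a (Suc i)) \<gamma>"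
    by blast
  have "m \<le> n \<Longrightarrow> pw_C1 A \<gamma> u (a m)" for m
  proof (induction m)
    case 0
    then show ?case using a(1) pw_refl by metis
  next
    case (Suc m)
    then have "pw_C1 A \<gamma> u (a m)" "a m < a (Suc m) \<and> C1_curve_on A (a m) (a (Suc m)) \<gamma>"
      using a(3)[of m] by simp_all
    then show ?case using pw_step by blast
  qed
  from this[of n] show "pw_C1 A \<gamma> u v" using a(2) by simp
qed

lemma piecewise_C1_curve_iff: "piecewise_C1_curve X A \<gamma> \<longleftrightarrow> pathin X \<gamma> \<and> pw_C1 A \<gamma> 0 1"
  by (simp add: piecewise_C1_curve_def pw_C1_iff)

lemma pw_C1_le: "pw_C1 A \<gamma> u v \<Longrightarrow> u \<le> v"
  by (induction rule: pw_C1.induct) auto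

lemma pw_C1_trans:
  assumes "pw_C1 A \<gamma> u v" "pw_C1 A \<gamma> v w"
  shows "pw_C1 A \<gamma> u w"
  using assms(2,1) by (induction rule: pw_C1.induct) (auto intro: pw_step)

lemma pw_C1_single: "u < v \<Longrightarrow> C1_curve_on A u v \<gamma> \<Longrightarrow> pw_C1 A \<gamma> u v"
  by (rule pw_step[OF pw_refl])

text \<open>Derivatives are taken within the interval, so \<delta> need agree with the substituted
  curve only there. One lemma thus covers a change outside the interval (m = 1), rescaling, and
  reversal (m = -1).\<close>

lemma C1_curve_on_reparam:
  assumes \<gamma>: "C1_curve_on A a b \<gamma>" and sub: "\<And>s. s \<in> {a'..b'} \<Longrightarrow> m * s + k \<in> {a..b}"
    and eq: "\<And>s. s \<in> {a'..b'} \<Longrightarrow> \<delta> s = \<gamma> (m * s + k)"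
  shows "C1_curve_on A a' b' \<delta>"
  unfolding C1_curve_on_def
proof
  fix c assume "c \<in> A"
  then obtain D where D: "continuous_on {s \<in> {a..b}. \<gamma> s \<in> fst c} D"
    "\<And>s. s \<in> {a..b} \<Longrightarrow> \<gamma> s \<in> fst c \<Longrightarrow> ((snd c \<circ> \<gamma>) has_vector_derivative D s) (at s within {a..b})"
    using \<gamma> unfolding C1_curve_on_def by blast
  have "continuous_on {s \<in> {a'..b'}. \<delta> s \<in> fst c} (\<lambda>s. m *\<^sub>R D (m * s + k))"
    by (intro continuous_intros continuous_on_compose2[OF D(1)])
       (use sub eq in auto)
  moreover have "((snd c \<circ> \<delta>) has_vector_derivative m *\<^sub>R D (m * s + k)) (at s within {a'..b'})"
    if s: "s \<in> {a'..b'}" "\<delta> s \<in> fst c" for s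
  proof -
    have aff: "((\<lambda>s. m * s + k) has_vector_derivative m) (at s within {a'..b'})"
      by (auto intro!: derivative_eq_intros)
    have "((snd c \<circ> \<gamma>) has_vector_derivative D (m * s + k)) (at (m * s + k) within (\<lambda>s. m * s + k) ` {a'..b'})"
      by (rule has_vector_derivative_within_subset[OF D(2)]) (use sub eq s in auto)
    from vector_diff_chain_within[OF aff this]
    have "((snd c \<circ> \<gamma>) \<circ> (\<lambda>s. m * s + k) has_vector_derivative m *\<^sub>R D (m * s + k)) (at s within {a'..b'})" .
    then show ?thesis
      by (rule has_vector_derivative_transform_within[OF _ zero_less_one s(1)]) (simp add: eq)
  qed
  ultimately show "\<exists>D. continuous_on {s \<in> {a'..b'}. \<delta> s \<in> fst c} D \<and>
      (\<forall>s\<in>{a'..b'}. \<delta> s \<in> fst c \<longrightarrow> ((snd c \<circ> \<delta>) has_vector_derivative D s) (at s within {a'..b'}))"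
    by blast
qed

lemma pw_C1_cong:
  assumes "pw_C1 A \<gamma> u v" "\<And>s. s \<in> {u..v} \<Longrightarrow> \<delta> s = \<gamma> s"
  shows "pw_C1 A \<delta> u v"
  using assms
proof (induction rule: pw_C1.induct)
  case (pw_step u v w)
  have le: "u \<le> v" using pw_step.hyps by (rule_tac pw_C1_le)
  have "pw_C1 A \<delta> u v" using pw_step by simp
  moreover have "C1_curve_on A v w \<delta>"
    by (rule C1_curve_on_reparam[OF pw_step.hyps(3), where m = 1 and k = 0]) (use pw_step.prems le in auto)
  ultimately show ?case using pw_step.hyps pw_C1.pw_step by blast
qed (rule pw_refl)

lemma pw_C1_scale:
  assumes "pw_C1 A \<gamma> u v" "0 < m"
  shows "pw_C1 A (\<lambda>s. \<gamma> (m * s + k)) ((u - k) / m) ((v - k) / m)"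
  using assms
proof (induction rule: pw_C1.induct)
  case (pw_step u v w)
  have "C1_curve_on A ((v - k) / m) ((w - k) / m) (\<lambda>s. \<gamma> (m * s + k))"
    by (rule C1_curve_on_reparam[OF pw_step.hyps(3), where m = m and k = k])
       (use pw_step in \<open>auto simp: field_simps\<close>)
  moreover have "(v - k) / m < (w - k) / m" using pw_step by (simp add: divide_strict_right_mono)
  ultimately show ?case using pw_step.IH[OF pw_step.prems] pw_C1.pw_step by blast
qed (rule pw_refl)

lemma pw_C1_reverse:
  assumes "pw_C1 A \<gamma> u v"
  shows "pw_C1 A (\<lambda>s. \<gamma> (k - s)) (k - v) (k - u)"
  using assms
proof (induction rule: pw_C1.induct)
  case (pw_step u v w)
  have "C1_curve_on A (k - w) (k - v) (\<lambda>s. \<gamma> (k - s))"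
    by (rule C1_curve_on_reparam[OF pw_step.hyps(3), where m = "-1" and k = k]) auto
  then have "pw_C1 A (\<lambda>s. \<gamma> (k - s)) (k - w) (k - v)" using pw_step by (intro pw_C1_single) auto
  then show ?case using pw_step.IH pw_C1_trans by blast
qed (rule pw_refl)

lemma curve_speed_cong:
  assumes "open S" "s \<in> S" "\<And>r. r \<in> S \<Longrightarrow> \<gamma> r = \<delta> r"
  shows "curve_speed A h \<gamma> s = curve_speed A h \<delta> s"
proof -
  have "((f \<circ> \<gamma>) has_vector_derivative D) (at s) \<longleftrightarrow> ((f \<circ> \<delta>) has_vector_derivative D) (at s)"
    for f :: "'a \<Rightarrow> real^'b" and D
    using has_vector_derivative_transform_within_open[of "f \<circ> \<gamma>" D s S "f \<circ> \<delta>"]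
      has_vector_derivative_transform_within_open[of "f \<circ> \<delta>" D s S "f \<circ> \<gamma>"] assms by auto
  then have "vector_derivative (f \<circ> \<gamma>) (at s) = vector_derivative (f \<circ> \<delta>) (at s)" for f :: "'a \<Rightarrow> real^'b"
    by (simp add: vector_derivative_def)
  then show ?thesis using assms(3)[OF assms(2)] by (simp add: curve_speed_def)
qed

lemma metric_form_scale: "metric_form h c p (m *\<^sub>R u) = m\<^sup>2 * metric_form h c p u"
  by (simp add: metric_form_def matrix_vector_mult_scaleR power2_eq_square)

lemma metric_form_sum:
  "metric_form h c p u = (\<Sum>i\<in>UNIV. \<Sum>j\<in>UNIV. u $ i * h c p $ i $ j * u $ j)"
  by (simp add: metric_form_def inner_vec_def matrix_vector_mult_def sum_distrib_left mult.assoc)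

context atlas
begin

lemma curve_preimage:
  assumes \<gamma>: "continuous_map (top_of_set {a..b}) X \<gamma>" and "openin X W"
  shows "\<exists>O'. open O' \<and> {s \<in> {a..b}. \<gamma> s \<in> W} = {a..b} \<inter> O'"
  using openin_continuous_map_preimage[OF assms] by (auto simp: openin_open)

lemma curve_derivative_transition:
  assumes \<gamma>: "continuous_map (top_of_set {a..b}) X \<gamma>"
    and c: "c \<in> A" "c' \<in> A" and s: "s \<in> {a..b}" "\<gamma> s \<in> fst c" "\<gamma> s \<in> fst c'"
    and D: "((snd c \<circ> \<gamma>) has_vector_derivative D) (at s within {a..b})"
  shows "((snd c' \<circ> \<gamma>) has_vector_derivative
    frechet_derivative (transition c c') (at (snd c (\<gamma> s))) D) (at s within {a..b})"
proof -
  have "snd c (\<gamma> s) \<in> overlap c c'" using s by (simp add: overlap_def)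
  then have diff: "transition c c' differentiable (at (snd c (\<gamma> s)))"
    by (rule smooth_on_imp_differentiable[OF overlap_open[OF c] transition_smooth[OF c]])
  have lin: "linear (frechet_derivative (transition c c') (at (snd c (\<gamma> s))))"
    by (rule linear_frechet_derivative[OF diff])
  have "((\<lambda>r. transition c c' ((snd c \<circ> \<gamma>) r)) has_derivative
     (\<lambda>r. frechet_derivative (transition c c') (at (snd c (\<gamma> s))) (r *\<^sub>R D))) (at s within {a..b})"
    by (rule has_derivative_compose[OF D[unfolded has_vector_derivative_def], of "transition c c'"
          "frechet_derivative (transition c c') (at (snd c (\<gamma> s)))"])
       (simp add: differentiable_imp_has_derivative[OF diff])
  then have *: "((\<lambda>r. transition c c' ((snd c \<circ> \<gamma>) r)) has_vector_derivative
     frechet_derivative (transition c c') (at (snd c (\<gamma> s))) D) (at s within {a..b})"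
    by (simp add: has_vector_derivative_def linear_cmul[OF lin])
  from curve_preimage[OF \<gamma> openin_Int[OF chart_openin[OF c(1)] chart_openin[OF c(2)]]]
  obtain O' where O': "open O'" "{s \<in> {a..b}. \<gamma> s \<in> fst c \<inter> fst c'} = {a..b} \<inter> O'" by blast
  have "s \<in> O'" using O'(2) s by blast
  then obtain d where d: "0 < d" "ball s d \<subseteq> O'" using O'(1) open_contains_ball by blast
  show ?thesis
  proof (rule has_vector_derivative_transform_within[OF * d(1) s(1)])
    fix r assume "r \<in> {a..b}" "dist r s < d"
    then have "\<gamma> r \<in> fst c" using d(2) O'(2) by (force simp: dist_commute)
    then show "transition c c' ((snd c \<circ> \<gamma>) r) = (snd c' \<circ> \<gamma>) r" by (simp add: transition_apply[OF c(1)])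
  qed
qed

end

context riem_atlas
begin

text \<open>The transition map relates the two velocities and preserves the form. The velocities are
  determined also at the end points, by one-sided derivatives, because the interval is
  nondegenerate.\<close>

lemma speed_invariant:
  assumes \<gamma>: "continuous_map (top_of_set {a..b}) X \<gamma>" and ab: "a < b"
    and c: "c \<in> A" "c' \<in> A" and s: "s \<in> {a..b}" "\<gamma> s \<in> fst c" "\<gamma> s \<in> fst c'"
    and D: "((snd c \<circ> \<gamma>) has_vector_derivative D) (at s within {a..b})"
    and D': "((snd c' \<circ> \<gamma>) has_vector_derivative D') (at s within {a..b})"
  shows "metric_form h c (\<gamma> s) D = metric_form h c' (\<gamma> s) D'"
proof -
  have "D' = frechet_derivative (transition c c') (at (snd c (\<gamma> s))) D"
    by (rule vector_derivative_unique_within_closed_interval[OF ab, of s])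
       (use curve_derivative_transition[OF \<gamma> c s D] D' s in simp_all)
  then show ?thesis using metric_form_transform[OF c s(2,3)] by simp
qed

text \<open>\<open>curve_speed\<close> measures in the chart picked by \<open>chart_at\<close>;
  invariance permits any other. The parameter is interior because the definition takes the two-sided
  derivative.\<close>

lemma curve_speed_eq:
  assumes \<gamma>: "continuous_map (top_of_set {a..b}) X \<gamma>" and s: "s \<in> {a<..<b}"
    and c: "c \<in> A" "\<gamma> s \<in> fst c" and D: "((snd c \<circ> \<gamma>) has_vector_derivative D) (at s)"
  shows "curve_speed A h \<gamma> s = sqrt (metric_form h c (\<gamma> s) D)"
proof -
  have p: "\<gamma> s \<in> topspace X" using chart_sub[OF c(1)] c(2) by blast
  have at: "at s within {a..b} = at s"
    by (rule at_within_interior) (use s in simp)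
  have D'': "((snd c \<circ> \<gamma>) has_vector_derivative D) (at s within {a..b})"
    using D at by simp
  have s': "s \<in> {a..b}" "a < b" using s by auto
  from curve_derivative_transition[OF \<gamma> c(1) chart_at(1)[OF p] s'(1) c(2) chart_at(2)[OF p] D'']
  have D': "((snd (chart_at A (\<gamma> s)) \<circ> \<gamma>) has_vector_derivative
      vector_derivative (snd (chart_at A (\<gamma> s)) \<circ> \<gamma>) (at s)) (at s within {a..b})"
    unfolding at using vector_derivative_works differentiableI_vector by blast
  show ?thesis
    using speed_invariant[OF \<gamma> s'(2) c(1) chart_at(1)[OF p] s'(1) c(2) chart_at(2)[OF p] D'' D']
    by (simp add: curve_speed_def Let_def)
qed

lemma curve_speed_nonneg: "\<gamma> s \<in> topspace X \<Longrightarrow> 0 \<le> curve_speed A h \<gamma> s"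
  using chart_at[of "\<gamma> s"] by (simp add: curve_speed_def Let_def metric_form_nonneg)

lemma coord_metric_continuous:
  assumes "c \<in> A" "continuous_map (top_of_set {a..b}) X \<gamma>" "continuous_on {s \<in> {a..b}. \<gamma> s \<in> fst c} D"
  shows "continuous_on {s \<in> {a..b}. \<gamma> s \<in> fst c} (\<lambda>s. sqrt (metric_form h c (\<gamma> s) (D s)))"
proof -
  let ?S = "{s \<in> {a..b}. \<gamma> s \<in> fst c}"
  have "continuous_map (top_of_set ?S) X \<gamma>"
    by (rule continuous_map_from_subtopology_mono[OF assms(2)]) auto
  then have "continuous_map (top_of_set ?S) (subtopology X (fst c)) \<gamma>"
    unfolding continuous_map_in_subtopology by auto
  from continuous_map_compose[OF this chart_continuous[OF assms(1)]]
  have x: "continuous_on ?S (\<lambda>s. snd c (\<gamma> s))" by (simp add: comp_def)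
  have "continuous_on ?S (\<lambda>s. coord_metric h c (snd c (\<gamma> s)))"
    by (rule continuous_on_compose2[OF smooth_on_imp_continuous_on[OF coord_smooth[OF assms(1)]] x])
       (auto simp: chart_image_def)
  then have "continuous_on ?S (\<lambda>s. h c (\<gamma> s))"
    by (rule continuous_on_eq) (simp add: coord_metric_def assms(1))
  then show ?thesis unfolding metric_form_sum
    by (intro continuous_intros assms(3))
qed

text \<open>The chart used by \<open>curve_speed\<close> may jump along the curve, so continuity is
  not visible from the definition. Near each parameter the chart-independent value can be computed
  in one chart, where it is continuous; only at the two end points may \<open>curve_speed\<close>
  differ from it.\<close>

lemma curve_speed_integrable_piece:
  assumes \<gamma>: "continuous_map (top_of_set {a..b}) X \<gamma>" and C1: "C1_curve_on A a b \<gamma>" and ab: "a < b"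
  shows "curve_speed A h \<gamma> integrable_on {a..b}"
proof -
  have top: "\<gamma> s \<in> topspace X" if "s \<in> {a..b}" for s
    using \<gamma> that by (auto simp: continuous_map_def)
  from bchoice[OF C1[unfolded C1_curve_on_def]]
  obtain D where "\<forall>c\<in>A. continuous_on {s \<in> {a..b}. \<gamma> s \<in> fst c} (D c) \<and>
     (\<forall>s\<in>{a..b}. \<gamma> s \<in> fst c \<longrightarrow> ((snd c \<circ> \<gamma>) has_vector_derivative D c s) (at s within {a..b}))"
    by blast
  then have D: "\<And>c. c \<in> A \<Longrightarrow> continuous_on {s \<in> {a..b}. \<gamma> s \<in> fst c} (D c)"
    "\<And>c s. c \<in> A \<Longrightarrow> s \<in> {a..b} \<Longrightarrow> \<gamma> s \<in> fst c \<Longrightarrow> ((snd c \<circ> \<gamma>) has_vector_derivative D c s) (at s within {a..b})"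
    by blast+
  define sp where "sp = (\<lambda>s. sqrt (metric_form h (chart_at A (\<gamma> s)) (\<gamma> s) (D (chart_at A (\<gamma> s)) s)))"
  have sp: "sp s = sqrt (metric_form h c (\<gamma> s) (D c s))" if "c \<in> A" "s \<in> {a..b}" "\<gamma> s \<in> fst c" for c s
  proof -
    note ca = chart_at[OF top[OF that(2)]]
    show ?thesis
      unfolding sp_def
      by (rule arg_cong[of _ _ sqrt], rule speed_invariant[OF \<gamma> ab ca(1) that(1,2) ca(2) that(3)
            D(2)[OF ca(1) that(2) ca(2)] D(2)[OF that]])
  qed
  have "continuous (at s within {a..b}) sp" if s: "s \<in> {a..b}" for s
  proof -
    let ?c = "chart_at A (\<gamma> s)"
    let ?S = "{s \<in> {a..b}. \<gamma> s \<in> fst ?c}"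
    have cA: "?c \<in> A" and s': "s \<in> ?S" using chart_at[OF top[OF s]] s by auto
    have "continuous_on ?S sp"
      by (rule continuous_on_eq[OF coord_metric_continuous[OF cA \<gamma> D(1)[OF cA]]]) (use sp[OF cA] in auto)
    then have 1: "continuous (at s within ?S) sp" using s' continuous_on_eq_continuous_within by blast
    obtain O' where O': "open O'" "?S = {a..b} \<inter> O'"
      using curve_preimage[OF \<gamma> chart_openin[OF cA]] by blast
    have "at s within ?S = at s within {a..b}"
      by (rule at_within_nhd[of s O']) (use O' s' in auto)
    then show ?thesis using 1 by simp
  qed
  then have "continuous_on {a..b} sp" by (simp add: continuous_on_eq_continuous_within)
  then have "sp integrable_on {a..b}" by (rule integrable_continuous_real)
  moreover have "curve_speed A h \<gamma> s = sp s" if "s \<in> {a..b} - {a, b}" for s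
  proof -
    have s: "s \<in> {a..b}" "s \<in> {a<..<b}" using that by auto
    note ca = chart_at[OF top[OF s(1)]]
    have "at s within {a..b} = at s" by (rule at_within_interior) (use s in simp)
    then have "((snd (chart_at A (\<gamma> s)) \<circ> \<gamma>) has_vector_derivative D (chart_at A (\<gamma> s)) s) (at s)"
      using D(2)[OF ca(1) s(1) ca(2)] by simp
    from curve_speed_eq[OF \<gamma> s(2) ca this] show ?thesis by (simp add: sp_def)
  qed
  ultimately show ?thesis
    by (intro integrable_spike_finite[of "{a, b}" "{a..b}" "curve_speed A h \<gamma>" sp]) simp_all
qed

lemma curve_speed_integrable:
  assumes "pw_C1 A \<gamma> u v" "continuous_map (top_of_set {u..v}) X \<gamma>"
  shows "curve_speed A h \<gamma> integrable_on {u..v}"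
  using assms
proof (induction rule: pw_C1.induct)
  case (pw_refl u)
  then show ?case by (simp add: integrable_on_refl[of _ u, simplified])
next
  case (pw_step u v w)
  have le: "u \<le> v" by (rule pw_C1_le[OF pw_step.hyps(1)])
  have c1: "continuous_map (top_of_set {u..v}) X \<gamma>" "continuous_map (top_of_set {v..w}) X \<gamma>"
    by (rule continuous_map_from_subtopology_mono[OF pw_step.prems], use pw_step.hyps(2) le in simp)+
  show ?case
    by (rule Henstock_Kurzweil_Integration.integrable_combine[OF le less_imp_le[OF pw_step.hyps(2)]
          pw_step.IH[OF c1(1)] curve_speed_integrable_piece[OF c1(2) pw_step.hyps(3,2)]])
qed

end

text \<open>The exceptional set collects the break points, where only one-sided derivatives are
  known.\<close>

lemma pw_C1_differentiable:
  assumes "pw_C1 A \<gamma> u v"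
  shows "\<exists>F. finite F \<and> (\<forall>s\<in>{u<..<v} - F. \<forall>c\<in>A. \<gamma> s \<in> fst c \<longrightarrow>
    (\<exists>D. ((snd c \<circ> \<gamma>) has_vector_derivative D) (at s)))"
  using assms
proof (induction rule: pw_C1.induct)
  case (pw_refl u)
  then show ?case by auto
next
  case (pw_step u v w)
  then obtain F where F: "finite F" "\<And>s c. s \<in> {u<..<v} - F \<Longrightarrow> c \<in> A \<Longrightarrow> \<gamma> s \<in> fst c \<Longrightarrow>
    \<exists>D. ((snd c \<circ> \<gamma>) has_vector_derivative D) (at s)" by blast
  have *: "\<exists>D. ((snd c \<circ> \<gamma>) has_vector_derivative D) (at s)"
    if s: "s \<in> {u<..<w} - insert v F" "c \<in> A" "\<gamma> s \<in> fst c" for s c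
  proof (cases "s < v")
    case True
    then show ?thesis using F(2)[of s c] s by auto
  next
    case False
    then have s': "s \<in> {v<..<w}" using s by auto
    then have at: "at s within {v..w} = at s" by (intro at_within_interior) simp
    obtain D where "((snd c \<circ> \<gamma>) has_vector_derivative D s) (at s within {v..w})"
      using pw_step.hyps(3) s s' unfolding C1_curve_on_def by force
    then show ?thesis using at by auto
  qed
  show ?case by (rule exI[of _ "insert v F"]) (use F(1) * in blast)
qed

section \<open>Length of reversed and joined curves, and lengths in a coordinate ball\<close>

context riem_atlas
begin

lemma curve_top: "pathin X \<gamma> \<Longrightarrow> s \<in> {0..1} \<Longrightarrow> \<gamma> s \<in> topspace X"
  by (auto simp: pathin_def continuous_map_def)

lemma curve_length_has_integral:
  assumes "piecewise_C1_curve X A \<gamma>"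
  shows "(curve_speed A h \<gamma> has_integral curve_length A h \<gamma>) {0..1}"
  using assms curve_speed_integrable[of \<gamma> 0 1]
  by (simp add: piecewise_C1_curve_iff pathin_def curve_length_def integrable_integral)

lemma curve_length_nonneg:
  assumes "piecewise_C1_curve X A \<gamma>"
  shows "0 \<le> curve_length A h \<gamma>"
proof (rule has_integral_nonneg[OF curve_length_has_integral[OF assms]])
  fix s :: real assume "s \<in> {0..1}"
  then show "0 \<le> curve_speed A h \<gamma> s"
    using assms curve_top by (intro curve_speed_nonneg) (simp add: piecewise_C1_curve_iff)
qed

lemma curve_speed_affine:
  assumes top: "\<gamma> (m * s + k) \<in> topspace X"
    and diff: "\<And>c. c \<in> A \<Longrightarrow> \<gamma> (m * s + k) \<in> fst c \<Longrightarrow> \<exists>D. ((snd c \<circ> \<gamma>) has_vector_derivative D) (at (m * s + k))"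
  shows "curve_speed A h (\<lambda>r. \<gamma> (m * r + k)) s = \<bar>m\<bar> * curve_speed A h \<gamma> (m * s + k)"
proof -
  let ?c = "chart_at A (\<gamma> (m * s + k))"
  obtain D where D: "((snd ?c \<circ> \<gamma>) has_vector_derivative D) (at (m * s + k))"
    using diff[OF chart_at[OF top]] by blast
  have "((\<lambda>r. m * r + k) has_vector_derivative m) (at s)"
    by (auto intro!: derivative_eq_intros)
  from vector_diff_chain_at[OF this D]
  have "((snd ?c \<circ> (\<lambda>r. \<gamma> (m * r + k))) has_vector_derivative m *\<^sub>R D) (at s)" by (simp add: comp_def)
  then show ?thesis
    using D by (simp add: curve_speed_def Let_def vector_derivative_at metric_form_scale real_sqrt_mult)
qed

lemma piecewise_C1_curve_reverse:
  assumes \<gamma>: "piecewise_C1_curve X A \<gamma>"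
  shows "piecewise_C1_curve X A (\<lambda>s. \<gamma> (1 - s))" "curve_length A h (\<lambda>s. \<gamma> (1 - s)) = curve_length A h \<gamma>"
proof -
  have p: "pathin X \<gamma>" "pw_C1 A \<gamma> 0 1" using \<gamma> by (simp_all add: piecewise_C1_curve_iff)
  have "continuous_map (top_of_set {0..1}) (top_of_set {0..1}) (\<lambda>s::real. 1 - s)"
    by (auto intro!: continuous_intros)
  from continuous_map_compose[OF this p(1)[unfolded pathin_def]]
  have "pathin X (\<lambda>s. \<gamma> (1 - s))" by (simp add: pathin_def comp_def)
  then show pw: "piecewise_C1_curve X A (\<lambda>s. \<gamma> (1 - s))"
    using pw_C1_reverse[OF p(2), of 1] by (simp add: piecewise_C1_curve_iff)
  obtain F where F: "finite F" "\<And>s c. s \<in> {0<..<1} - F \<Longrightarrow> c \<in> A \<Longrightarrow> \<gamma> s \<in> fst c \<Longrightarrow>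
      \<exists>D. ((snd c \<circ> \<gamma>) has_vector_derivative D) (at s)"
    using pw_C1_differentiable[OF p(2)] by blast
  have "((\<lambda>x. curve_speed A h \<gamma> (- x + 1)) has_integral curve_length A h \<gamma>) {0..1}"
    using has_integral_affinity[OF curve_length_has_integral[OF \<gamma>, folded cbox_interval], of "-1" 1]
    by (simp add: image_affinity_cbox[of "-1::real" 1, simplified] cbox_interval)
  note int = this
  \<comment> \<open>Excluded are the end points and the reflected break points, a finite set that
    the integral ignores.\<close>
  have sp: "curve_speed A h (\<lambda>s. \<gamma> (1 - s)) s = curve_speed A h \<gamma> (- s + 1)"
    if "s \<in> {0..1} - ({0, 1} \<union> (\<lambda>s. 1 - s) ` F)" for s
  proof -
    have "1 - s \<notin> F" using that by (force simp: image_iff)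
    then have "1 - s \<in> {0<..<1} - F" using that by auto
    from curve_speed_affine[of \<gamma> "-1" s 1] F(2)[OF this] curve_top[OF p(1), of "1 - s"] that
    show ?thesis by simp
  qed
  have "(curve_speed A h (\<lambda>s. \<gamma> (1 - s)) has_integral curve_length A h \<gamma>) {0..1}"
    by (rule has_integral_spike_finite[where S = "{0, 1} \<union> (\<lambda>s. 1 - s) ` F", OF _ _ int], simp add: F(1), rule sp)
  then show "curve_length A h (\<lambda>s. \<gamma> (1 - s)) = curve_length A h \<gamma>"
    unfolding curve_length_def[of A h "\<lambda>s. \<gamma> (1 - s)"] by (rule integral_unique)
qed

text \<open>Each curve is run through at double speed in half the time, so its contribution to the
  length is unchanged.\<close>

lemma piecewise_C1_curve_join:
  assumes \<gamma>: "piecewise_C1_curve X A \<gamma>" and \<delta>: "piecewise_C1_curve X A \<delta>" and eq: "\<gamma> 1 = \<delta> 0"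
  defines "\<eta> \<equiv> (\<lambda>s. if s \<le> 1 / 2 then \<gamma> (2 * s) else \<delta> (2 * s - 1))"
  shows "piecewise_C1_curve X A \<eta>" "curve_length A h \<eta> = curve_length A h \<gamma> + curve_length A h \<delta>"
proof -
  have p: "pathin X \<gamma>" "pw_C1 A \<gamma> 0 1" using \<gamma> by (simp_all add: piecewise_C1_curve_iff)
  have q: "pathin X \<delta>" "pw_C1 A \<delta> 0 1" using \<delta> by (simp_all add: piecewise_C1_curve_iff)
  have path: "pathin X \<eta>"
    unfolding pathin_def
  proof -
    let ?T01 = "top_of_set {0..1::real}"
    let ?g = "\<lambda>x. if x \<le> 1/2 then (\<gamma> \<circ> (\<lambda>t. 2 * t)) x else (\<delta> \<circ> (\<lambda>t. 2 * t - 1)) x"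
    have "continuous_map ?T01 X ?g"
    proof (intro continuous_map_cases_le continuous_map_compose, force, force)
      show "continuous_map (subtopology ?T01 {x \<in> topspace ?T01. x \<le> 1/2}) ?T01 ((*) 2)"
        by (auto simp: continuous_map_in_subtopology continuous_map_from_subtopology)
      have "continuous_map (subtopology (top_of_set {0..1}) {x. 0 \<le> x \<and> x \<le> 1 \<and> 1 \<le> x * 2})
             euclideanreal (\<lambda>t. 2 * t - 1)"
        by (intro continuous_intros) (force intro: continuous_map_from_subtopology)
      then show "continuous_map (subtopology ?T01 {x \<in> topspace ?T01. 1/2 \<le> x}) ?T01 (\<lambda>t. 2 * t - 1)"
        by (force simp: continuous_map_in_subtopology)
      show "(\<gamma> \<circ> (*) 2) x = (\<delta> \<circ> (\<lambda>t. 2 * t - 1)) x" if "x \<in> topspace ?T01" "x = 1/2" for x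
        using eq unfolding that(2) comp_def by simp
    qed (use p(1) q(1) in \<open>simp_all add: pathin_def\<close>)
    then show "continuous_map ?T01 X \<eta>" unfolding \<eta>_def comp_def .
  qed
  have "pw_C1 A (\<lambda>s. \<gamma> (2 * s + 0)) ((0 - 0) / 2) ((1 - 0) / 2)"
    by (rule pw_C1_scale[OF p(2)]) simp
  then have "pw_C1 A (\<lambda>s. \<gamma> (2 * s + 0)) 0 (1 / 2)" by simp
  then have half: "pw_C1 A \<eta> 0 (1 / 2)"
    by (rule pw_C1_cong) (simp add: \<eta>_def)
  have "pw_C1 A (\<lambda>s. \<delta> (2 * s + (- 1))) ((0 - (- 1)) / 2) ((1 - (- 1)) / 2)"
    by (rule pw_C1_scale[OF q(2)]) simp
  then have "pw_C1 A (\<lambda>s. \<delta> (2 * s + (- 1))) (1 / 2) 1" by simp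
  then have half': "pw_C1 A \<eta> (1 / 2) 1"
  proof (rule pw_C1_cong)
    fix s :: real assume s: "s \<in> {1/2..1}"
    show "\<eta> s = \<delta> (2 * s + (- 1))"
    proof (cases "s = 1/2")
      case True
      show ?thesis unfolding True using eq by (simp add: \<eta>_def)
    qed (use s in \<open>simp add: \<eta>_def\<close>)
  qed
  show pw: "piecewise_C1_curve X A \<eta>"
    using path pw_C1_trans[OF half half'] by (simp add: piecewise_C1_curve_iff)
  obtain F where F: "finite F" "\<And>s c. s \<in> {0<..<1} - F \<Longrightarrow> c \<in> A \<Longrightarrow> \<gamma> s \<in> fst c \<Longrightarrow>
      \<exists>D. ((snd c \<circ> \<gamma>) has_vector_derivative D) (at s)"
    using pw_C1_differentiable[OF p(2)] by blast
  obtain F' where F': "finite F'" "\<And>s c. s \<in> {0<..<1} - F' \<Longrightarrow> c \<in> A \<Longrightarrow> \<delta> s \<in> fst c \<Longrightarrow>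
      \<exists>D. ((snd c \<circ> \<delta>) has_vector_derivative D) (at s)"
    using pw_C1_differentiable[OF q(2)] by blast
  have "((\<lambda>x. 2 * curve_speed A h \<gamma> (2 * x + 0)) has_integral 2 * (curve_length A h \<gamma> / 2)) {0..1/2}"
    using has_integral_affinity'[OF curve_length_has_integral[OF \<gamma>, folded cbox_interval], of 2 0]
    by (intro has_integral_mult_right) (simp add: cbox_interval field_simps)
  note int = this
  have sp: "curve_speed A h \<eta> s = 2 * curve_speed A h \<gamma> (2 * s + 0)"
    if "s \<in> {0..1/2} - ({0, 1/2} \<union> (\<lambda>s. s / 2) ` F)" for s
  proof -
    have "2 * s \<notin> F"
    proof
      assume "2 * s \<in> F"
      then have "2 * s / 2 \<in> (\<lambda>s. s / 2) ` F" by (rule imageI)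
      then show False using that by simp
    qed
    then have "2 * s \<in> {0<..<1} - F" using that by auto
    then have "curve_speed A h (\<lambda>r. \<gamma> (2 * r + 0)) s = \<bar>2\<bar> * curve_speed A h \<gamma> (2 * s + 0)"
      using F(2)[of "2 * s"] curve_top[OF p(1), of "2 * s"] by (intro curve_speed_affine) auto
    moreover have "curve_speed A h \<eta> s = curve_speed A h (\<lambda>r. \<gamma> (2 * r + 0)) s"
      by (rule curve_speed_cong[of "{..<1/2}"]) (use that in \<open>auto simp: \<eta>_def\<close>)
    ultimately show ?thesis by simp
  qed
  have 1: "(curve_speed A h \<eta> has_integral 2 * (curve_length A h \<gamma> / 2)) {0..1/2}"
    by (rule has_integral_spike_finite[where S = "{0, 1/2} \<union> (\<lambda>s. s / 2) ` F", OF _ _ int], simp add: F(1), rule sp)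
  have "((\<lambda>x. 2 * curve_speed A h \<delta> (2 * x + (- 1))) has_integral 2 * (curve_length A h \<delta> / 2)) {1/2..1}"
    using has_integral_affinity'[OF curve_length_has_integral[OF \<delta>, folded cbox_interval], of 2 "-1"]
    by (intro has_integral_mult_right) (simp add: cbox_interval field_simps)
  note int' = this
  have sp': "curve_speed A h \<eta> s = 2 * curve_speed A h \<delta> (2 * s + (- 1))"
    if "s \<in> {1/2..1} - ({1/2, 1} \<union> (\<lambda>s. (s + 1) / 2) ` F')" for s
  proof -
    have "2 * s + (- 1) \<notin> F'"
    proof
      assume "2 * s + (- 1) \<in> F'"
      then have "(2 * s + (- 1) + 1) / 2 \<in> (\<lambda>s. (s + 1) / 2) ` F'" by (rule imageI)
      then show False using that by simp
    qed
    then have "2 * s + (- 1) \<in> {0<..<1} - F'" using that by auto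
    then have "curve_speed A h (\<lambda>r. \<delta> (2 * r + (- 1))) s = \<bar>2\<bar> * curve_speed A h \<delta> (2 * s + (- 1))"
      using F'(2)[of "2 * s + (- 1)"] curve_top[OF q(1), of "2 * s + (- 1)"] by (intro curve_speed_affine) auto
    moreover have "curve_speed A h \<eta> s = curve_speed A h (\<lambda>r. \<delta> (2 * r + (- 1))) s"
      by (rule curve_speed_cong[of "{1/2<..}"]) (use that in \<open>auto simp: \<eta>_def\<close>)
    ultimately show ?thesis by simp
  qed
  have 2: "(curve_speed A h \<eta> has_integral 2 * (curve_length A h \<delta> / 2)) {1/2..1}"
    by (rule has_integral_spike_finite[where S = "{1/2, 1} \<union> (\<lambda>s. (s + 1) / 2) ` F'", OF _ _ int'], simp add: F'(1), rule sp')
  show "curve_length A h \<eta> = curve_length A h \<gamma> + curve_length A h \<delta>"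
    unfolding curve_length_def[of A h \<eta>]
    using integral_unique[OF has_integral_combine[OF _ _ 1 2]] by simp
qed

text \<open>A straight segment has constant coordinate velocity u, so a bound for the quadratic form
  at u along it bounds its length. This is the source of all upper estimates for distances.\<close>

lemma chart_segment:
  assumes c: "c \<in> A" and seg: "\<And>s. s \<in> {0..1} \<Longrightarrow> x0 + s *\<^sub>R u \<in> chart_image c"
    and bound: "\<And>s. s \<in> {0..1} \<Longrightarrow> metric_form h c (chart_inv c (x0 + s *\<^sub>R u)) u \<le> B\<^sup>2" and "0 \<le> B"
  defines "\<gamma> \<equiv> (\<lambda>s. chart_inv c (x0 + s *\<^sub>R u))"
  shows "piecewise_C1_curve X A \<gamma>" "curve_length A h \<gamma> \<le> B"
proof -
  have cont: "continuous_map (top_of_set {0..1}) (top_of_set (chart_image c)) (\<lambda>s. x0 + s *\<^sub>R u)"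
    using seg by (auto intro!: continuous_intros)
  have path: "pathin X \<gamma>"
    unfolding pathin_def \<gamma>_def using continuous_map_compose[OF cont chart_inv_continuous[OF c]]
    by (simp add: comp_def)
  have C1: "C1_curve_on A 0 1 \<gamma>"
    unfolding C1_curve_on_def
  proof
    fix c' assume c': "c' \<in> A"
    let ?D = "\<lambda>s. frechet_derivative (transition c c') (at (x0 + s *\<^sub>R u)) u"
    have mem: "x0 + s *\<^sub>R u \<in> overlap c c'" if "s \<in> {0..1}" "\<gamma> s \<in> fst c'" for s
      unfolding overlap_def
      by (rule image_eqI[of _ _ "\<gamma> s"]) (use that seg chart_inv_mem[OF c] chart_inv_right[OF c] in \<open>auto simp: \<gamma>_def\<close>)
    have "continuous_on {s \<in> {0..1}. \<gamma> s \<in> fst c'} ?D"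
      by (rule continuous_on_compose2[OF smooth_on_imp_continuous_on[OF
              smooth_on_frechet_derivative[OF overlap_open[OF c c'] transition_smooth[OF c c']]]])
         (auto intro!: continuous_intros mem)
    moreover have "((snd c' \<circ> \<gamma>) has_vector_derivative ?D s) (at s within {0..1})"
      if "s \<in> {0..1}" "\<gamma> s \<in> fst c'" for s
    proof -
      have diff: "transition c c' differentiable (at (x0 + s *\<^sub>R u))"
        by (rule smooth_on_imp_differentiable[OF overlap_open[OF c c'] transition_smooth[OF c c'] mem[OF that]])
      have "((\<lambda>s. transition c c' (x0 + s *\<^sub>R u)) has_derivative
          (\<lambda>r. frechet_derivative (transition c c') (at (x0 + s *\<^sub>R u)) (r *\<^sub>R u))) (at s within {0..1})"
        by (rule has_derivative_compose[where f = "\<lambda>s. x0 + s *\<^sub>R u" and g = "transition c c'"])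
           (auto intro!: derivative_eq_intros differentiable_imp_has_derivative[OF diff])
      then have "((\<lambda>s. transition c c' (x0 + s *\<^sub>R u)) has_vector_derivative ?D s) (at s within {0..1})"
        by (simp add: has_vector_derivative_def linear_cmul[OF linear_frechet_derivative[OF diff]])
      then show ?thesis by (simp add: transition_def \<gamma>_def comp_def)
    qed
    ultimately show "\<exists>D. continuous_on {s \<in> {0..1}. \<gamma> s \<in> fst c'} D \<and>
        (\<forall>s\<in>{0..1}. \<gamma> s \<in> fst c' \<longrightarrow> ((snd c' \<circ> \<gamma>) has_vector_derivative D s) (at s within {0..1}))"
      by blast
  qed
  show pw: "piecewise_C1_curve X A \<gamma>"
    using path pw_C1_single[OF zero_less_one C1] by (simp add: piecewise_C1_curve_iff)
  have speed: "curve_speed A h \<gamma> s \<le> B" if s: "s \<in> {0<..<1}" for s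
  proof -
    have eq: "snd c (\<gamma> r) = x0 + r *\<^sub>R u" if "r \<in> {0<..<1}" for r
      using seg[of r] that chart_inv_right[OF c] by (simp add: \<gamma>_def)
    have "((\<lambda>s. x0 + s *\<^sub>R u) has_vector_derivative u) (at s)"
      by (auto intro!: derivative_eq_intros)
    then have "((snd c \<circ> \<gamma>) has_vector_derivative u) (at s)"
      by (rule has_vector_derivative_transform_within_open[of _ _ _ "{0<..<1}"]) (use s eq in auto)
    then have "curve_speed A h \<gamma> s = sqrt (metric_form h c (\<gamma> s) u)"
      using curve_speed_eq[OF path[unfolded pathin_def] s c] chart_inv_mem[OF c seg[of s]] s
      by (simp add: \<gamma>_def)
    also have "\<dots> \<le> sqrt (B\<^sup>2)"
      unfolding \<gamma>_def by (rule real_sqrt_le_mono[OF bound]) (use s in simp)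
    finally show ?thesis using \<open>0 \<le> B\<close> by simp
  qed
  have "((\<lambda>s. B) has_integral B) {0..1::real}" using has_integral_const_real[of B 0 1] by simp
  \<comment> \<open>At 0 and 1 the two-sided velocity is not controlled, so the constant B is
    replaced there by the speed itself.\<close>
  then have "((\<lambda>s. if s \<in> {0<..<1} then B else curve_speed A h \<gamma> s) has_integral B) {0..1::real}"
    by (rule has_integral_spike_finite[of "{0, 1}", rotated 2]) auto
  then show "curve_length A h \<gamma> \<le> B"
    by (rule has_integral_le[OF curve_length_has_integral[OF pw]]) (use speed in auto)
qed

text \<open>At its first exit time from the ball, a curve of length \<open>L < sqrt l * \<rho>\<close> would still lie in the
  smaller ball of radius \<open>L / sqrt l\<close>, whose closure is compact in the chart and hence closed in \<open>X\<close>.\<close>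

lemma chart_ball_length_lower:
  assumes c: "c \<in> A" and ball: "cball (snd c z) \<rho> \<subseteq> chart_image c" and z: "z \<in> fst c"
    and l: "0 < l" "\<And>x u. x \<in> ball (snd c z) \<rho> \<Longrightarrow> l * (u \<bullet> u) \<le> metric_form h c (chart_inv c x) u"
    and \<gamma>: "piecewise_C1_curve X A \<gamma>" "\<gamma> 0 = z" and len: "curve_length A h \<gamma> < sqrt l * \<rho>"
  shows "\<gamma> 1 \<in> fst c" "sqrt l * dist (snd c z) (snd c (\<gamma> 1)) \<le> curve_length A h \<gamma>"
proof -
  let ?L = "curve_length A h \<gamma>"
  let ?O = "{p \<in> fst c. snd c p \<in> ball (snd c z) \<rho>}"
  have p: "pathin X \<gamma>" "pw_C1 A \<gamma> 0 1" using \<gamma> by (simp_all add: piecewise_C1_curve_iff)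
  have cont: "continuous_map (top_of_set {0..1}) X \<gamma>" using p(1) by (simp add: pathin_def)
  have L0: "0 \<le> ?L" by (rule curve_length_nonneg[OF \<gamma>(1)])
  have sl: "0 < sqrt l" using l(1) by simp
  have \<rho>: "0 < \<rho>" using len L0 sl by (smt (verit) mult_nonneg_nonpos)
  obtain F where F: "finite F" "\<And>s c. s \<in> {0<..<1} - F \<Longrightarrow> c \<in> A \<Longrightarrow> \<gamma> s \<in> fst c \<Longrightarrow>
      \<exists>D. ((snd c \<circ> \<gamma>) has_vector_derivative D) (at s)"
    using pw_C1_differentiable[OF p(2)] by blast
  \<comment> \<open>While the curve stays in the ball, its coordinate displacement is the integral
    of its coordinate velocity, and sqrt l times the norm of the latter is at most the
    speed.\<close>
  have est: "sqrt l * dist (snd c z) (snd c (\<gamma> s)) \<le> ?L"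
    if s: "s \<in> {0..1}" and inO: "\<And>r. r \<in> {0..s} \<Longrightarrow> \<gamma> r \<in> ?O" for s
  proof -
    \<comment> \<open>The value 0 at break points and end points makes the comparison with the speed
      hold on the whole interval.\<close>
    define D where "D = (\<lambda>r. if r \<in> {0<..<s} - F then vector_derivative (snd c \<circ> \<gamma>) (at r) else 0)"
    have der: "((snd c \<circ> \<gamma>) has_vector_derivative D r) (at r)" if "r \<in> {0<..<s} - F" for r
      using F(2)[of r c] that s c inO[of r] by (auto simp: D_def vector_derivative_at)
    have "continuous_map (top_of_set {0..s}) X \<gamma>"
      by (rule continuous_map_from_subtopology_mono[OF cont]) (use s in auto)
    then have "continuous_map (top_of_set {0..s}) (subtopology X (fst c)) \<gamma>"
      using inO by (auto simp: continuous_map_in_subtopology)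
    from continuous_map_compose[OF this chart_continuous[OF c]]
    have "continuous_on {0..s} (snd c \<circ> \<gamma>)" by simp
    then have int: "(D has_integral ((snd c \<circ> \<gamma>) s - (snd c \<circ> \<gamma>) 0)) {0..s}"
      by (intro fundamental_theorem_of_calculus_interior_strong[OF F(1)] der) (use s in auto)
    have speed: "sqrt l * norm (D r) \<le> curve_speed A h \<gamma> r" if r: "r \<in> {0..s}" for r
    proof (cases "r \<in> {0<..<s} - F")
      case True
      then have "r \<in> {0<..<1}" using s by auto
      from curve_speed_eq[OF cont this c _ der[OF True]] inO[OF r]
      have "curve_speed A h \<gamma> r = sqrt (metric_form h c (\<gamma> r) (D r))" by simp
      moreover have "l * (D r \<bullet> D r) \<le> metric_form h c (\<gamma> r) (D r)"
        using l(2)[of "snd c (\<gamma> r)" "D r"] inO[OF r] chart_inv_left[OF c] by simp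
      then have "sqrt (l * (D r \<bullet> D r)) \<le> sqrt (metric_form h c (\<gamma> r) (D r))" by simp
      ultimately show ?thesis by (simp add: real_sqrt_mult norm_eq_sqrt_inner)
    next
      case False
      then show ?thesis using curve_speed_nonneg[of \<gamma> r] curve_top[OF p(1), of r] r s by (auto simp: D_def)
    qed
    have si: "curve_speed A h \<gamma> integrable_on {0..1}"
      using curve_length_has_integral[OF \<gamma>(1)] by blast
    then have si': "curve_speed A h \<gamma> integrable_on {0..s}"
      by (rule integrable_on_subinterval) (use s in auto)
    have "norm (integral {0..s} D) \<le> integral {0..s} (\<lambda>r. curve_speed A h \<gamma> r / sqrt l)"
    proof (rule Henstock_Kurzweil_Integration.integral_norm_bound_integral)
      show "D integrable_on {0..s}" using int by blast
      show "(\<lambda>r. curve_speed A h \<gamma> r / sqrt l) integrable_on {0..s}"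
        using integrable_on_mult_left[OF si', of "inverse (sqrt l)"] by (simp add: divide_inverse)
      show "norm (D r) \<le> curve_speed A h \<gamma> r / sqrt l" if "r \<in> {0..s}" for r
        using speed[OF that] sl by (simp add: pos_le_divide_eq mult.commute)
    qed
    also have "\<dots> = integral {0..s} (curve_speed A h \<gamma>) / sqrt l"
      by (simp add: integral_divide)
    also have "integral {0..s} (curve_speed A h \<gamma>) \<le> ?L"
      unfolding curve_length_def
      by (rule integral_subset_le[OF _ si' si]) (use s curve_speed_nonneg curve_top[OF p(1)] in auto)
    finally have "norm (integral {0..s} D) \<le> ?L / sqrt l" using sl by (simp add: divide_right_mono)
    then show ?thesis
      unfolding integral_unique[OF int] using sl \<gamma>(2) by (simp add: dist_norm norm_minus_commute pos_le_divide_eq mult.commute)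
  qed
  have Oopen: "openin X ?O" by (rule chart_preimage_openin[OF c open_ball])
  obtain W where W: "open W" "{s \<in> {0..1}. \<gamma> s \<in> ?O} = {0..1} \<inter> W"
    using curve_preimage[OF cont Oopen] by blast
  have all: "\<gamma> s \<in> ?O" if "s \<in> {0..1}" for s
  proof (rule ccontr)
    assume "\<gamma> s \<notin> ?O"
    \<comment> \<open>The parameters at which the curve is outside the ball. They form a closed set
      because the ball is open, so the first exit time belongs to it.\<close>
    define E where "E = {0..1} - W"
    have E: "E = {s \<in> {0..1}. \<gamma> s \<notin> ?O}" unfolding E_def using W(2) by blast
    have "closed E" unfolding E_def using W(1) by (intro closed_Diff) auto
    moreover have "E \<noteq> {}" using \<open>\<gamma> s \<notin> ?O\<close> that E by blast
    moreover have bdd: "bdd_below E" by (rule bdd_belowI[of _ 0]) (simp add: E_def)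
    ultimately have inf: "Inf E \<in> E" by (intro closed_contains_Inf)
    define e where "e = Inf E"
    have e: "e \<in> {0..1}" "\<gamma> e \<notin> ?O" using inf E by (auto simp: e_def)
    have before: "\<gamma> r \<in> ?O" if "r \<in> {0..<e}" for r
    proof (rule ccontr)
      assume "\<gamma> r \<notin> ?O"
      then have "r \<in> E" using that e(1) E by auto
      then have "e \<le> r" unfolding e_def by (rule cInf_lower[OF _ bdd])
      then show False using that by simp
    qed
    have "\<gamma> 0 \<in> ?O" using \<gamma>(2) z \<rho> by simp
    then have e0: "0 < e" using e by (cases "e = 0") auto
    let ?Q = "chart_inv c ` cball (snd c z) (?L / sqrt l)"
    have r: "?L / sqrt l < \<rho>" using len sl by (simp add: pos_divide_less_eq mult.commute)
    then have sub: "cball (snd c z) (?L / sqrt l) \<subseteq> chart_image c"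
      using ball by (meson order_trans subset_cball less_imp_le)
    have "continuous_map (top_of_set (cball (snd c z) (?L / sqrt l))) X (chart_inv c)"
      by (rule continuous_map_from_subtopology_mono[OF chart_inv_continuous[OF c] sub])
    then have "compactin X ?Q"
      by (intro image_compactin[of "top_of_set (cball (snd c z) (?L / sqrt l))"]) (auto simp: compactin_subtopology)
    then have closed: "closedin X ?Q" using hausdorff compactin_imp_closedin by blast
    have inQ: "\<gamma> r \<in> ?Q" if "r \<in> {0..<e}" for r
    proof (rule image_eqI[of _ _ "snd c (\<gamma> r)"])
      show "\<gamma> r = chart_inv c (snd c (\<gamma> r))" using before[OF that] chart_inv_left[OF c] by simp
      have "sqrt l * dist (snd c z) (snd c (\<gamma> r)) \<le> ?L"
        by (rule est) (use that e before in auto)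
      then show "snd c (\<gamma> r) \<in> cball (snd c z) (?L / sqrt l)" using sl by (simp add: pos_le_divide_eq mult.commute)
    qed
    have "closedin (top_of_set {0..1}) {s \<in> topspace (top_of_set {0..1}). \<gamma> s \<in> ?Q}"
      by (rule closedin_continuous_map_preimage[OF cont closed])
    then have "closedin (top_of_set {0..1}) {s \<in> {0..1}. \<gamma> s \<in> ?Q}" by simp
    then have cl: "closed {s \<in> {0..1}. \<gamma> s \<in> ?Q}" using closedin_closed_trans closed_atLeastAtMost by blast
    have "{0..<e} \<subseteq> {s \<in> {0..1}. \<gamma> s \<in> ?Q}" using inQ e(1) by auto
    then have "closure {0..<e} \<subseteq> {s \<in> {0..1}. \<gamma> s \<in> ?Q}" by (rule closure_minimal[OF _ cl])
    moreover have "e \<in> closure {0..<e}" using e0 closure_atLeastLessThan[of 0 e] by simp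
    ultimately have "\<gamma> e \<in> ?Q" by blast
    then obtain y where y: "y \<in> cball (snd c z) (?L / sqrt l)" "\<gamma> e = chart_inv c y" by blast
    have "y \<in> chart_image c" using y sub by blast
    then have "\<gamma> e \<in> ?O" using y r chart_inv_mem[OF c] chart_inv_right[OF c] by auto
    then show False using e(2) by blast
  qed
  show "\<gamma> 1 \<in> fst c" using all[of 1] by simp
  show "sqrt l * dist (snd c z) (snd c (\<gamma> 1)) \<le> ?L" by (rule est) (use all in auto)
qed

end

section \<open>Bounds for quadratic forms and local joining curves\<close>

lemma quadratic_form_le:
  fixes B :: "real^'n^'n"
  assumes "\<And>i j. \<bar>B $ i $ j\<bar> \<le> \<Lambda>"
  shows "u \<bullet> (B *v u) \<le> (\<Lambda> * real CARD('n) * real CARD('n)) * (u \<bullet> u)"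
proof -
  have "u \<bullet> (B *v u) = (\<Sum>i\<in>UNIV. \<Sum>j\<in>UNIV. u $ i * B $ i $ j * u $ j)"
    by (simp add: inner_vec_def matrix_vector_mult_def sum_distrib_left mult.assoc)
  also have "\<dots> \<le> (\<Sum>i\<in>(UNIV::'n set). \<Sum>j\<in>(UNIV::'n set). \<Lambda> * (norm u * norm u))"
  proof (intro sum_mono)
    fix i j
    have "u $ i * B $ i $ j * u $ j \<le> \<bar>B $ i $ j\<bar> * (\<bar>u $ i\<bar> * \<bar>u $ j\<bar>)"
      by (simp add: abs_mult[symmetric] mult_ac)
    also have "\<dots> \<le> \<Lambda> * (norm u * norm u)"
      using assms[of i j] component_le_norm_cart[of u i] component_le_norm_cart[of u j]
      by (intro mult_mono) auto
    finally show "u $ i * B $ i $ j * u $ j \<le> \<Lambda> * (norm u * norm u)" .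
  qed
  also have "\<dots> = (\<Lambda> * real CARD('n) * real CARD('n)) * (u \<bullet> u)"
    by (simp add: power2_norm_eq_inner[symmetric] power2_eq_square)
  finally show ?thesis .
qed

text \<open>The form attains a positive minimum on the product of C with the unit sphere;
  homogeneity extends the estimate to all vectors.\<close>

lemma quadratic_form_lower_bound:
  fixes G :: "real^'n \<Rightarrow> real^'n^'n"
  assumes "compact C" "continuous_on C G" "\<And>x. x \<in> C \<Longrightarrow> pos_def (G x)"
  shows "\<exists>l>0. \<forall>x\<in>C. \<forall>u. l * (u \<bullet> u) \<le> u \<bullet> (G x *v u)"
proof (cases "C = {}")
  case True
  then show ?thesis by (intro exI[of _ 1]) simp
next
  case False
  let ?S = "sphere (0::real^'n) 1"
  let ?f = "\<lambda>p. snd p \<bullet> (G (fst p) *v snd p)"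
  have ne: "C \<times> ?S \<noteq> {}"
    using False vector_choose_size[of 1] by (auto simp: dist_norm)
  have "continuous_on (C \<times> ?S) (\<lambda>p. G (fst p))"
    by (rule continuous_on_compose2[OF assms(2)]) (auto intro!: continuous_intros)
  then have "continuous_on (C \<times> ?S) (\<lambda>p. \<Sum>i\<in>UNIV. \<Sum>j\<in>UNIV. snd p $ i * G (fst p) $ i $ j * snd p $ j)"
    by (intro continuous_intros)
  then have "continuous_on (C \<times> ?S) ?f"
    by (simp add: inner_vec_def matrix_vector_mult_def sum_distrib_left mult.assoc)
  then obtain p where p: "p \<in> C \<times> ?S" "\<And>q. q \<in> C \<times> ?S \<Longrightarrow> ?f p \<le> ?f q"
    using continuous_attains_inf[OF compact_Times[OF assms(1) compact_sphere] ne] by blast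
  have pos: "0 < ?f p"
  proof -
    have "fst p \<in> C" "norm (snd p) = 1" using p(1) by (auto simp: mem_Times_iff)
    moreover from this(2) have "snd p \<noteq> 0" by auto
    ultimately show ?thesis using assms(3)[of "fst p"] unfolding pos_def_def by blast
  qed
  have "?f p * (u \<bullet> u) \<le> u \<bullet> (G x *v u)" if "x \<in> C" for x u
  proof (cases "u = 0")
    case False
    define w where "w = inverse (norm u) *\<^sub>R u"
    have "u = norm u *\<^sub>R w" "w \<in> ?S" using False by (simp_all add: w_def)
    moreover have "?f p \<le> w \<bullet> (G x *v w)" using p(2)[of "(x, w)"] that calculation(2) by simp
    then have "norm u * norm u * ?f p \<le> norm u * norm u * (w \<bullet> (G x *v w))"
      by (intro mult_left_mono) auto
    moreover have "(norm u *\<^sub>R w) \<bullet> (G x *v (norm u *\<^sub>R w)) = norm u * norm u * (w \<bullet> (G x *v w))"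
      by (simp add: matrix_vector_mult_scaleR)
    ultimately show ?thesis
      by (metis mult.commute power2_eq_square power2_norm_eq_inner)
  qed simp
  then show ?thesis using pos by blast
qed

lemma continuous_bounded_components:
  fixes G :: "real^'n \<Rightarrow> real^'n^'n"
  assumes "compact C" "continuous_on C G"
  shows "\<exists>\<Lambda>\<ge>0. \<forall>x\<in>C. \<forall>i j. \<bar>G x $ i $ j\<bar> \<le> \<Lambda>"
proof -
  have "bounded (G ` C)" by (intro compact_imp_bounded compact_continuous_image assms)
  then obtain B where B: "\<And>x. x \<in> C \<Longrightarrow> norm (G x) \<le> B" by (auto simp: bounded_iff)
  have "\<bar>G x $ i $ j\<bar> \<le> \<bar>B\<bar>" if "x \<in> C" for x i j
    using component_le_norm_cart[of "G x $ i" j] Finite_Cartesian_Product.norm_nth_le[of "G x" i] B[OF that] by linarith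
  then show ?thesis by (intro exI[of _ "\<bar>B\<bar>"]) auto
qed

context riem_atlas
begin

lemma metric_form_coord:
  "c \<in> A \<Longrightarrow> metric_form h c (chart_inv c x) u = u \<bullet> (coord_metric h c x *v u)"
  by (simp add: metric_form_def coord_metric_def)

lemma coord_bounds:
  assumes "c \<in> A" "compact C" "C \<subseteq> chart_image c"
  shows "\<exists>l B. 0 < l \<and> 0 \<le> B \<and> (\<forall>x\<in>C. \<forall>u. l * (u \<bullet> u) \<le> metric_form h c (chart_inv c x) u \<and>
     metric_form h c (chart_inv c x) u \<le> B * (u \<bullet> u))"
proof -
  have cont: "continuous_on C (coord_metric h c)"
    using smooth_on_imp_continuous_on[OF coord_smooth[OF assms(1)]] assms(3) by (rule continuous_on_subset)
  obtain l where l: "0 < l" "\<And>x u. x \<in> C \<Longrightarrow> l * (u \<bullet> u) \<le> u \<bullet> (coord_metric h c x *v u)"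
    using quadratic_form_lower_bound[OF assms(2) cont] coord_pos_def[OF assms(1)] assms(3) by blast
  obtain \<Lambda> where L: "0 \<le> \<Lambda>" "\<And>x i j. x \<in> C \<Longrightarrow> \<bar>coord_metric h c x $ i $ j\<bar> \<le> \<Lambda>"
    using continuous_bounded_components[OF assms(2) cont] by blast
  show ?thesis
    by (rule exI[of _ l], rule exI[of _ "\<Lambda> * real CARD('n) * real CARD('n)"])
       (use l L quadratic_form_le[OF L(2)] in \<open>simp add: metric_form_coord[OF assms(1)]\<close>)
qed

lemma chart_ball_curve:
  assumes c: "c \<in> A" and z: "z \<in> fst c" and ball: "ball (snd c z) \<rho> \<subseteq> chart_image c"
    and B: "0 \<le> B" "\<And>x u. x \<in> ball (snd c z) \<rho> \<Longrightarrow> metric_form h c (chart_inv c x) u \<le> B * (u \<bullet> u)"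
    and q: "q \<in> fst c" "snd c q \<in> ball (snd c z) \<rho>"
  shows "\<exists>\<gamma>. piecewise_C1_curve X A \<gamma> \<and> \<gamma> 0 = z \<and> \<gamma> 1 = q \<and>
    curve_length A h \<gamma> \<le> sqrt B * dist (snd c z) (snd c q)"
proof -
  let ?u = "snd c q - snd c z"
  have mem: "snd c z + s *\<^sub>R ?u \<in> ball (snd c z) \<rho>" if "s \<in> {0..1}" for s
  proof -
    have "snd c z \<in> ball (snd c z) \<rho>" using q(2) by (auto intro: le_less_trans[OF zero_le_dist])
    then have "(1 - s) *\<^sub>R snd c z + s *\<^sub>R snd c q \<in> ball (snd c z) \<rho>"
      using convexD_alt[OF convex_ball _ q(2)] that by auto
    then show ?thesis by (simp add: algebra_simps)
  qed
  have 2: "metric_form h c (chart_inv c (snd c z + s *\<^sub>R ?u)) ?u \<le> (sqrt B * norm ?u)\<^sup>2" if "s \<in> {0..1}" for s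
    using B(2)[OF mem[OF that], of ?u] B(1) by (simp add: power_mult_distrib power2_norm_eq_inner)
  note seg = chart_segment[OF c subsetD[OF ball mem] 2]
  show ?thesis
    by (rule exI[of _ "\<lambda>s. chart_inv c (snd c z + s *\<^sub>R ?u)"])
       (use seg B(1) chart_inv_left[OF c] z q in \<open>simp add: dist_norm norm_minus_commute\<close>)
qed

lemma local_curves:
  assumes "z \<in> topspace X"
  shows "\<exists>W. openin X W \<and> z \<in> W \<and> (\<forall>q\<in>W. \<exists>\<gamma>. piecewise_C1_curve X A \<gamma> \<and> \<gamma> 0 = z \<and> \<gamma> 1 = q)"
proof -
  let ?c = "chart_at A z"
  note c = chart_at[OF assms]
  obtain \<rho> where \<rho>: "0 < \<rho>" "cball (snd ?c z) \<rho> \<subseteq> chart_image ?c"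
    using chart_image_open[OF c(1)] chart_image_mem[OF c(1) c(2)] open_contains_cball by blast
  obtain l B where B: "0 \<le> B" "\<And>x u. x \<in> cball (snd ?c z) \<rho> \<Longrightarrow> metric_form h ?c (chart_inv ?c x) u \<le> B * (u \<bullet> u)"
    using coord_bounds[OF c(1) compact_cball \<rho>(2)] by blast
  have sub: "ball (snd ?c z) \<rho> \<subseteq> cball (snd ?c z) \<rho>" by (rule ball_subset_cball)
  show ?thesis
  proof (intro exI[of _ "{p \<in> fst ?c. snd ?c p \<in> ball (snd ?c z) \<rho>}"] conjI ballI)
    show "openin X {p \<in> fst ?c. snd ?c p \<in> ball (snd ?c z) \<rho>}"
      by (rule chart_preimage_openin[OF c(1) open_ball])
    show "z \<in> {p \<in> fst ?c. snd ?c p \<in> ball (snd ?c z) \<rho>}" using c \<rho> by simp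
    fix q assume "q \<in> {p \<in> fst ?c. snd ?c p \<in> ball (snd ?c z) \<rho>}"
    then have q: "q \<in> fst ?c" "snd ?c q \<in> ball (snd ?c z) \<rho>" by auto
    show "\<exists>\<gamma>. piecewise_C1_curve X A \<gamma> \<and> \<gamma> 0 = z \<and> \<gamma> 1 = q"
      using chart_ball_curve[OF c order_trans[OF sub \<rho>(2)] B(1) B(2)[OF subsetD[OF sub]] q] by blast
  qed
qed

end

section \<open>The Riemannian distance\<close>

locale riem_space = riem_atlas X A h for X :: "'a topology" and A :: "('a, 'n::finite) chart set" and h +
  assumes connected: "connected_space X"
begin

text \<open>By \<open>local_curves\<close> the points that can be joined to x form an open set, and
  so do those that cannot; connectedness rules out the second kind. Without a joining curve the
  infimum in \<open>riem_dist\<close> would range over the empty set.\<close>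

lemma curves_exist:
  assumes x: "x \<in> topspace X" and y: "y \<in> topspace X"
  shows "\<exists>\<gamma>. piecewise_C1_curve X A \<gamma> \<and> \<gamma> 0 = x \<and> \<gamma> 1 = y"
proof -
  define joined where "joined = (\<lambda>x y. \<exists>\<gamma>. piecewise_C1_curve X A \<gamma> \<and> \<gamma> 0 = x \<and> \<gamma> 1 = y)"
  have sym: "joined y x" if joined: "joined x y" for x y
  proof -
    obtain \<gamma> where "piecewise_C1_curve X A \<gamma>" "\<gamma> 0 = x" "\<gamma> 1 = y" using joined unfolding joined_def by blast
    then show ?thesis unfolding joined_def
      by (intro exI[of _ "\<lambda>s. \<gamma> (1 - s)"]) (simp add: piecewise_C1_curve_reverse)
  qed
  have trans: "joined x z" if jt: "joined x y" "joined y z" for x y z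
  proof -
    obtain \<gamma> where g: "piecewise_C1_curve X A \<gamma>" "\<gamma> 0 = x" "\<gamma> 1 = y"
      using jt(1) unfolding joined_def by blast
    obtain \<delta> where d: "piecewise_C1_curve X A \<delta>" "\<delta> 0 = y" "\<delta> 1 = z"
      using jt(2) unfolding joined_def by blast
    note gd = g d
    then have "\<gamma> 1 = \<delta> 0" by simp
    from piecewise_C1_curve_join(1)[OF gd(1,4) this] gd show ?thesis unfolding joined_def
      by (intro exI[of _ "\<lambda>s. if s \<le> 1 / 2 then \<gamma> (2 * s) else \<delta> (2 * s - 1)"]) simp
  qed
  obtain N where N: "\<And>z. z \<in> topspace X \<Longrightarrow> openin X (N z) \<and> z \<in> N z \<and> (\<forall>q\<in>N z. joined z q)"
    using local_curves unfolding joined_def by metis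
  define E where "E = {q \<in> topspace X. joined x q}"
  have "openin X E"
    unfolding openin_subopen[of X E]
  proof
    fix q assume q: "q \<in> E"
    then have "N q \<subseteq> E" using N[of q] trans openin_subset[of X "N q"] unfolding E_def by blast
    then show "\<exists>T. openin X T \<and> q \<in> T \<and> T \<subseteq> E" using N[of q] q unfolding E_def by blast
  qed
  moreover have "openin X (topspace X - E)"
    unfolding openin_subopen[of X "topspace X - E"]
  proof
    fix q assume q: "q \<in> topspace X - E"
    have "r \<notin> E" if "r \<in> N q" for r
      using N[of q] q that sym trans unfolding E_def by blast
    then have "N q \<subseteq> topspace X - E" using N[of q] q openin_subset[of X "N q"] by blast
    then show "\<exists>T. openin X T \<and> q \<in> T \<and> T \<subseteq> topspace X - E" using N[of q] q by blast
  qed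
  ultimately have "E = {} \<or> E = topspace X"
    using connected unfolding connected_space_clopen_in closedin_def by (auto simp: E_def)
  moreover have "x \<in> E" using N[OF x] x unfolding E_def by blast
  ultimately show ?thesis using y unfolding E_def joined_def by blast
qed

lemma riem_dist_le:
  assumes "piecewise_C1_curve X A \<gamma>" "\<gamma> 0 = x" "\<gamma> 1 = y"
  shows "riem_dist X A h x y \<le> curve_length A h \<gamma>"
  unfolding riem_dist_def
  by (rule cInf_lower) (use assms curve_length_nonneg in \<open>auto intro!: bdd_belowI[of _ 0]\<close>)

lemma riem_dist_approx:
  assumes "x \<in> topspace X" "y \<in> topspace X" "riem_dist X A h x y < b"
  shows "\<exists>\<gamma>. piecewise_C1_curve X A \<gamma> \<and> \<gamma> 0 = x \<and> \<gamma> 1 = y \<and> curve_length A h \<gamma> < b"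
proof -
  have "{curve_length A h \<gamma> |\<gamma>. piecewise_C1_curve X A \<gamma> \<and> \<gamma> 0 = x \<and> \<gamma> 1 = y} \<noteq> {}"
    using curves_exist[OF assms(1,2)] by blast
  from cInf_lessD[OF this assms(3)[unfolded riem_dist_def]] show ?thesis by blast
qed

lemma riem_dist_nonneg:
  assumes "x \<in> topspace X" "y \<in> topspace X"
  shows "0 \<le> riem_dist X A h x y"
proof (rule ccontr)
  assume "\<not> 0 \<le> riem_dist X A h x y"
  then obtain \<gamma> where "piecewise_C1_curve X A \<gamma>" "curve_length A h \<gamma> < 0"
    using riem_dist_approx[OF assms, of 0] by force
  then show False using curve_length_nonneg by force
qed

lemma riem_dist_sym_le:
  assumes "x \<in> topspace X" "y \<in> topspace X"
  shows "riem_dist X A h y x \<le> riem_dist X A h x y"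
proof (rule field_le_epsilon)
  fix e :: real assume "0 < e"
  then obtain \<gamma> where \<gamma>: "piecewise_C1_curve X A \<gamma>" "\<gamma> 0 = x" "\<gamma> 1 = y" "curve_length A h \<gamma> < riem_dist X A h x y + e"
    using riem_dist_approx[OF assms, of "riem_dist X A h x y + e"] by auto
  have "riem_dist X A h y x \<le> curve_length A h (\<lambda>s. \<gamma> (1 - s))"
    by (rule riem_dist_le) (use \<gamma> piecewise_C1_curve_reverse in auto)
  then show "riem_dist X A h y x \<le> riem_dist X A h x y + e"
    using \<gamma> piecewise_C1_curve_reverse(2)[OF \<gamma>(1)] by simp
qed

lemma riem_dist_sym:
  "x \<in> topspace X \<Longrightarrow> y \<in> topspace X \<Longrightarrow> riem_dist X A h x y = riem_dist X A h y x"
  using riem_dist_sym_le[of x y] riem_dist_sym_le[of y x] by linarith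

lemma riem_dist_triangle:
  assumes "x \<in> topspace X" "y \<in> topspace X" "z \<in> topspace X"
  shows "riem_dist X A h x z \<le> riem_dist X A h x y + riem_dist X A h y z"
proof (rule field_le_epsilon)
  fix e :: real assume "0 < e"
  then obtain \<gamma> \<delta> where \<gamma>: "piecewise_C1_curve X A \<gamma>" "\<gamma> 0 = x" "\<gamma> 1 = y" "curve_length A h \<gamma> < riem_dist X A h x y + e / 2"
    and \<delta>: "piecewise_C1_curve X A \<delta>" "\<delta> 0 = y" "\<delta> 1 = z" "curve_length A h \<delta> < riem_dist X A h y z + e / 2"
    using riem_dist_approx[OF assms(1,2), of "riem_dist X A h x y + e / 2"]
      riem_dist_approx[OF assms(2,3), of "riem_dist X A h y z + e / 2"] by auto
  have eq: "\<gamma> 1 = \<delta> 0" using \<gamma> \<delta> by simp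
  note j = piecewise_C1_curve_join[OF \<gamma>(1) \<delta>(1) eq]
  have "riem_dist X A h x z \<le> curve_length A h (\<lambda>s. if s \<le> 1 / 2 then \<gamma> (2 * s) else \<delta> (2 * s - 1))"
    by (rule riem_dist_le[OF j(1)]) (use \<gamma> \<delta> in simp_all)
  then show "riem_dist X A h x z \<le> riem_dist X A h x y + riem_dist X A h y z + e"
    using j(2) \<gamma>(4) \<delta>(4) by simp
qed

lemma riem_dist_upper:
  assumes c: "c \<in> A" and z: "z \<in> fst c" and ball: "ball (snd c z) \<rho> \<subseteq> chart_image c"
    and B: "0 \<le> B" "\<And>x u. x \<in> ball (snd c z) \<rho> \<Longrightarrow> metric_form h c (chart_inv c x) u \<le> B * (u \<bullet> u)"
    and q: "q \<in> fst c" "snd c q \<in> ball (snd c z) \<rho>"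
  shows "riem_dist X A h z q \<le> sqrt B * dist (snd c z) (snd c q)"
  using chart_ball_curve[OF assms] riem_dist_le order_trans by blast

text \<open>Nearly minimising curves are already shorter than \<open>sqrt l * \<rho>\<close>, so
  \<open>chart_ball_length_lower\<close> confines them to the chart. The point q may lie anywhere:
  its closeness alone puts it into the chart.\<close>

lemma riem_dist_lower:
  assumes c: "c \<in> A" and ball: "cball (snd c z) \<rho> \<subseteq> chart_image c" and z: "z \<in> fst c"
    and l: "0 < l" "\<And>x u. x \<in> ball (snd c z) \<rho> \<Longrightarrow> l * (u \<bullet> u) \<le> metric_form h c (chart_inv c x) u"
    and q: "q \<in> topspace X" and less: "riem_dist X A h z q < sqrt l * \<rho>"
  shows "q \<in> fst c" "sqrt l * dist (snd c z) (snd c q) \<le> riem_dist X A h z q"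
proof -
  have zt: "z \<in> topspace X" using chart_sub[OF c] z by blast
  show "q \<in> fst c"
    using riem_dist_approx[OF zt q less] chart_ball_length_lower(1)[OF c ball z l] by blast
  show "sqrt l * dist (snd c z) (snd c q) \<le> riem_dist X A h z q"
  proof (rule field_le_epsilon)
    fix e :: real assume "0 < e"
    then have "riem_dist X A h z q < min (sqrt l * \<rho>) (riem_dist X A h z q + e)" using less by simp
    from riem_dist_approx[OF zt q this] obtain \<gamma> where \<gamma>: "piecewise_C1_curve X A \<gamma>" "\<gamma> 0 = z" "\<gamma> 1 = q"
      "curve_length A h \<gamma> < sqrt l * \<rho>" "curve_length A h \<gamma> < riem_dist X A h z q + e" by auto
    from chart_ball_length_lower(2)[OF c ball z l \<gamma>(1,2,4)] \<gamma>(3,5)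
    show "sqrt l * dist (snd c z) (snd c q) \<le> riem_dist X A h z q + e" by simp
  qed
qed

text \<open>Coordinate segments show that a small coordinate ball lies in the metric ball;
  statements about metric balls thereby become statements on open sets.\<close>

lemma riem_ball_nhd:
  assumes z: "z \<in> topspace X" and r: "0 < r"
  shows "\<exists>W. openin X W \<and> z \<in> W \<and> W \<subseteq> riem_ball X A h z r"
proof -
  let ?c = "chart_at A z"
  note c = chart_at[OF z]
  obtain \<rho> where \<rho>: "0 < \<rho>" "cball (snd ?c z) \<rho> \<subseteq> chart_image ?c"
    using chart_image_open[OF c(1)] chart_image_mem[OF c(1) c(2)] open_contains_cball by blast
  obtain l B where B: "0 \<le> B" "\<And>x u. x \<in> cball (snd ?c z) \<rho> \<Longrightarrow> metric_form h ?c (chart_inv ?c x) u \<le> B * (u \<bullet> u)"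
    using coord_bounds[OF c(1) compact_cball \<rho>(2)] by blast
  \<comment> \<open>The divisor \<open>sqrt B + 1\<close> in place of \<open>sqrt B\<close> also
    covers B = 0.\<close>
  define e where "e = min \<rho> (r / (sqrt B + 1))"
  have pos: "0 < sqrt B + 1" using B(1) by (simp add: add_nonneg_pos)
  have e: "0 < e" "e \<le> \<rho>" "e \<le> r / (sqrt B + 1)" using \<rho>(1) r pos by (simp_all add: e_def)
  have sub: "ball (snd ?c z) \<rho> \<subseteq> cball (snd ?c z) \<rho>" by (rule ball_subset_cball)
  show ?thesis
  proof (intro exI conjI subsetI)
    show "openin X {p \<in> fst ?c. snd ?c p \<in> ball (snd ?c z) e}"
      by (rule chart_preimage_openin[OF c(1) open_ball])
    show "z \<in> {p \<in> fst ?c. snd ?c p \<in> ball (snd ?c z) e}" using c e by simp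
    fix q assume "q \<in> {p \<in> fst ?c. snd ?c p \<in> ball (snd ?c z) e}"
    then have q: "q \<in> fst ?c" "dist (snd ?c z) (snd ?c q) < e" by auto
    then have "snd ?c q \<in> ball (snd ?c z) \<rho>" using e by simp
    from riem_dist_upper[OF c order_trans[OF sub \<rho>(2)] B(1) B(2)[OF subsetD[OF sub]] q(1) this]
    have "riem_dist X A h z q \<le> sqrt B * dist (snd ?c z) (snd ?c q)" by simp
    also have "\<dots> \<le> (sqrt B + 1) * dist (snd ?c z) (snd ?c q)" by (intro mult_right_mono) auto
    also have "\<dots> < (sqrt B + 1) * (r / (sqrt B + 1))" using q(2) e(3) pos by (intro mult_strict_left_mono) auto
    also have "\<dots> = r" using pos by simp
    finally show "q \<in> riem_ball X A h z r" using chart_sub[OF c(1)] q(1) by (auto simp: riem_ball_def)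
  qed
qed

lemma riem_dist_refl:
  assumes "z \<in> topspace X"
  shows "riem_dist X A h z z = 0"
proof -
  have "riem_dist X A h z z < r" if "0 < r" for r
    using riem_ball_nhd[OF assms that] by (auto simp: riem_ball_def)
  then show ?thesis using riem_dist_nonneg[OF assms assms] by (meson less_irrefl not_le order.antisym)
qed

end

section \<open>Points with controlled geometry\<close>

text \<open>Polarisation with e_i + e_j and e_i - e_j: both squared norms are at most 4, also for i
  = j, and the diagonal entries are nonnegative.\<close>

lemma entry_bound_of_form_bound:
  fixes B :: "real^'n^'n"
  assumes B: "pos_def B" and up: "\<And>u. u \<bullet> (B *v u) \<le> F * (u \<bullet> u)"
  shows "\<bar>B $ i $ j\<bar> \<le> 2 * F"
proof -
  let ?e = "\<lambda>i. axis i (1::real) :: real^'n"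
  have entry: "?e i \<bullet> (B *v ?e j) = B $ i $ j" for i j
  proof -
    have "(B *v ?e j) $ i = B $ i $ j"
      by (simp add: matrix_vector_mult_def axis_def if_distrib cong: if_cong)
    then show ?thesis by (simp add: inner_axis')
  qed
  have nonneg: "0 \<le> B $ i $ i" for i
    using B entry[of i i] unfolding pos_def_def by (metis axis_eq_0_iff less_eq_real_def zero_neq_one)
  have F: "0 \<le> F" using up[of "?e i"] nonneg[of i] entry[of i i] by simp
  have plus: "(?e i + ?e j) \<bullet> (B *v (?e i + ?e j)) = B $ i $ i + B $ j $ j + 2 * B $ i $ j"
    by (simp add: matrix_vector_right_distrib inner_add_left inner_add_right entry pos_def_sym[OF B, of j i])
  have minus: "(?e i - ?e j) \<bullet> (B *v (?e i - ?e j)) = B $ i $ i + B $ j $ j - 2 * B $ i $ j"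
    by (simp add: matrix_vector_mult_diff_distrib inner_diff_left inner_diff_right entry pos_def_sym[OF B, of j i])
  have sum: "(?e i + ?e j) \<bullet> (?e i + ?e j) + (?e i - ?e j) \<bullet> (?e i - ?e j) = 4"
    by (simp add: inner_add_left inner_add_right inner_diff_left inner_diff_right)
  have "(?e i + ?e j) \<bullet> (?e i + ?e j) \<le> 4" "(?e i - ?e j) \<bullet> (?e i - ?e j) \<le> 4"
    using sum inner_ge_zero[of "?e i + ?e j"] inner_ge_zero[of "?e i - ?e j"] by linarith+
  then have "F * ((?e i + ?e j) \<bullet> (?e i + ?e j)) \<le> F * 4" "F * ((?e i - ?e j) \<bullet> (?e i - ?e j)) \<le> F * 4"
    using F by (auto intro: mult_left_mono)
  then have "B $ i $ i + B $ j $ j + 2 * B $ i $ j \<le> F * 4" "B $ i $ i + B $ j $ j - 2 * B $ i $ j \<le> F * 4"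
    using up[of "?e i + ?e j"] up[of "?e i - ?e j"] plus minus by linarith+
  then show ?thesis using nonneg[of i] nonneg[of j] by linarith
qed

lemma abs_le_square_plus_one: "\<bar>x\<bar> \<le> x\<^sup>2 + (1::real)"
proof -
  have "0 \<le> (\<bar>x\<bar> - 1)\<^sup>2" by simp
  then have "2 * \<bar>x\<bar> \<le> x\<^sup>2 + 1" by (simp add: power2_diff)
  then show ?thesis by simp
qed

locale ricci_flow_space =
  fixes M :: "'a topology" and A :: "('a, 4) chart set" and T :: real and g :: "real \<Rightarrow> ('a, 4) metric_field"
  assumes basic: "basic_assumptions M A T g"
begin

sublocale atlas M A
  by unfold_locales (use basic in \<open>simp add: basic_assumptions_def\<close>)

lemma T_pos: "0 < T"
  using basic by (simp add: basic_assumptions_def)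

lemma space_at:
  assumes "t \<in> {0..<T}"
  shows "riem_space M A (g t)"
proof unfold_locales
  show "riemannian_metric A (g t)"
    using basic assms unfolding basic_assumptions_def ricci_flow_def by blast
  show "connected_space M" using basic unfolding basic_assumptions_def by blast
qed

lemma atlas_at: "t \<in> {0..<T} \<Longrightarrow> riem_atlas M A (g t)"
  using space_at riem_space.axioms(1) by blast

text \<open>What \<open>regularity_constants\<close> yields at a good time t1, recorded on an open
  set: comparison with the single metric at t1, and bounds b j that absorb the powers of T - t1,
  since t1 is now fixed.\<close>

definition controlled :: "real \<Rightarrow> 'a set \<Rightarrow> (nat \<Rightarrow> real) \<Rightarrow> bool" where
  "controlled t1 W b \<longleftrightarrow> 0 < t1 \<and> t1 < T \<and> openin M W \<and>
    (\<forall>q\<in>W. \<forall>s\<in>{t1..<T}. \<forall>c\<in>A. q \<in> fst c \<longrightarrow> (\<forall>u.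
       (1/2) * metric_form (g t1) c q u \<le> metric_form (g s) c q u \<and>
       metric_form (g s) c q u \<le> 2 * metric_form (g t1) c q u)) \<and>
    (\<forall>q\<in>W. \<forall>j. \<forall>s\<in>{(T + t1) / 2..<T}. nabla_riem_norm_sq j A (g s) q \<le> b j)"

text \<open>Compactness of a coordinate ball gives constants for the one metric at t1; comparison by
  the factor 2 then halves the lower and doubles the upper one, for all later times at once.\<close>

lemma controlled_chart_ball:
  assumes W: "controlled t1 W b" and z: "z \<in> W" and c: "c \<in> A" "z \<in> fst c"
  shows "\<exists>\<rho> l B. 0 < \<rho> \<and> 0 < l \<and> 0 \<le> B \<and> cball (snd c z) \<rho> \<subseteq> chart_image c \<and>
    (\<forall>x\<in>cball (snd c z) \<rho>. chart_inv c x \<in> W \<and> (\<forall>s\<in>{t1..<T}. \<forall>u.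
       l * (u \<bullet> u) \<le> metric_form (g s) c (chart_inv c x) u \<and>
       metric_form (g s) c (chart_inv c x) u \<le> B * (u \<bullet> u)))"
proof -
  have t1: "0 < t1" "t1 < T" and Wo: "openin M W" using W by (simp_all add: controlled_def)
  have "open (snd c ` (fst c \<inter> W))" by (rule chart_image_openin[OF c(1) Wo])
  moreover have "snd c z \<in> snd c ` (fst c \<inter> W)" using z c by simp
  ultimately obtain \<rho> where \<rho>: "0 < \<rho>" "cball (snd c z) \<rho> \<subseteq> snd c ` (fst c \<inter> W)"
    using open_contains_cball by blast
  have sub: "cball (snd c z) \<rho> \<subseteq> chart_image c"
    using \<rho>(2) by (auto simp: chart_image_def)
  have inW: "chart_inv c x \<in> W" if "x \<in> cball (snd c z) \<rho>" for x
  proof -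
    have "x \<in> snd c ` (fst c \<inter> W)" using \<rho>(2) that by blast
    then show ?thesis using chart_inv_left[OF c(1)] by auto
  qed
  have "t1 \<in> {0..<T}" using t1 by simp
  from riem_atlas.coord_bounds[OF atlas_at[OF this] c(1) compact_cball sub]
  obtain l B where lB: "0 < l" "0 \<le> B"
    "\<And>x u. x \<in> cball (snd c z) \<rho> \<Longrightarrow> l * (u \<bullet> u) \<le> metric_form (g t1) c (chart_inv c x) u"
    "\<And>x u. x \<in> cball (snd c z) \<rho> \<Longrightarrow> metric_form (g t1) c (chart_inv c x) u \<le> B * (u \<bullet> u)"
    by blast
  have comp: "(1/2) * metric_form (g t1) c (chart_inv c x) u \<le> metric_form (g s) c (chart_inv c x) u \<and>
       metric_form (g s) c (chart_inv c x) u \<le> 2 * metric_form (g t1) c (chart_inv c x) u"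
    if x: "x \<in> cball (snd c z) \<rho>" and s: "s \<in> {t1..<T}" for x s u
    using W inW[OF x] s c(1) chart_inv_mem[OF c(1) subsetD[OF sub x]] unfolding controlled_def by blast
  show ?thesis
  proof (rule exI[of _ \<rho>], rule exI[of _ "l / 2"], rule exI[of _ "2 * B"], intro conjI ballI allI)
    fix x s u assume x: "x \<in> cball (snd c z) \<rho>" and s: "s \<in> {t1..<T}"
    show "l / 2 * (u \<bullet> u) \<le> metric_form (g s) c (chart_inv c x) u"
      using comp[OF x s, of u] lB(3)[OF x, of u] by simp
    show "metric_form (g s) c (chart_inv c x) u \<le> 2 * B * (u \<bullet> u)"
      using comp[OF x s, of u] lB(4)[OF x, of u] by simp
  qed (use \<rho> sub lB inW in auto)
qed

text \<open>The initial time \<open>(T + t1) / 2\<close> is where the bounds on \<nabla>^jRiem in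
  \<open>controlled\<close> begin, and the entry bound \<open>2 * (B + 1)\<close> comes from
  polarisation.\<close>

lemma controlled_flow_region:
  assumes W: "controlled t1 W b" and c: "c \<in> A" "z \<in> fst c"
    and ball: "0 < \<rho>" "cball (snd c z) \<rho> \<subseteq> chart_image c" "0 < l" "0 \<le> B"
    and inW: "\<And>x. x \<in> cball (snd c z) \<rho> \<Longrightarrow> chart_inv c x \<in> W"
    and lB: "\<And>x s u. x \<in> cball (snd c z) \<rho> \<Longrightarrow> s \<in> {t1..<T} \<Longrightarrow>
       l * (u \<bullet> u) \<le> metric_form (g s) c (chart_inv c x) u \<and>
       metric_form (g s) c (chart_inv c x) u \<le> B * (u \<bullet> u)"
  shows "flow_region (chart_image c) (ball (snd c z) \<rho>) T ((T + t1) / 2)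
     (\<lambda>t. coord_metric (g t) c) (cball (snd c z) \<rho>) l (2 * (B + 1))"
proof
  have t1: "0 < t1" "t1 < T" using W by (simp_all add: controlled_def)
  let ?t0 = "(T + t1) / 2"
  \<comment> \<open>One more than B, so that it is positive and can be inverted.\<close>
  let ?F = "B + 1"
  have F: "0 < ?F" using ball by simp
  show "open (chart_image c)" by (rule chart_image_open[OF c(1)])
  show "open (ball (snd c z) \<rho>)" by simp
  show "ball (snd c z) \<rho> \<subseteq> chart_image c" using ball(2) ball_subset_cball by blast
  show "0 < ?t0" "?t0 < T" using t1 by simp_all
  show "compact (cball (snd c z) \<rho>)" "ball (snd c z) \<rho> \<subseteq> cball (snd c z) \<rho>" "cball (snd c z) \<rho> \<subseteq> chart_image c"
    using ball by auto
  have rf: "ricci_flow A T g" using basic unfolding basic_assumptions_def by blast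
  show "tsmooth (chart_image c) {0<..<T} (\<lambda>t x. coord_metric (g t) c x $ i $ j)" for i j
  proof -
    have op: "open (chart_image c \<times> {0<..<T})" by (intro open_Times chart_image_open[OF c(1)]) simp
    have "smooth_on (chart_image c \<times> {0..<T}) (\<lambda>(x, t). coord_metric (g t) c x)"
      using rf c(1) unfolding ricci_flow_def by blast
    from smooth_on_Times_restrict[OF this chart_image_open[OF c(1)]]
    have "smooth_on (chart_image c \<times> {0<..<T}) (\<lambda>z. coord_metric (g (snd z)) c (fst z))"
      by (simp add: case_prod_unfold)
    then have "smooth_on (chart_image c \<times> {0<..<T}) (\<lambda>z. coord_metric (g (snd z)) c (fst z) $ i $ j)"
      by (intro smooth_on_vec_nth op)
    then show ?thesis unfolding tsmooth_def using chart_image_open[OF c(1)] by simp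
  qed
  show pd: "pos_def (coord_metric (g t) c x)" if "x \<in> chart_image c" "t \<in> {0<..<T}" for x t
    by (rule riem_atlas.coord_pos_def[OF atlas_at c(1) that(1)]) (use that in simp)
  show "((\<lambda>s. coord_metric (g s) c x $ i $ j) has_real_derivative (- 2) * ricci (coord_metric (g t) c) x $ i $ j) (at t)"
    if x: "x \<in> chart_image c" and t: "t \<in> {0<..<T}" for x t i j
  proof -
    have "t \<in> {0..<T}" using t by simp
    then have "((\<lambda>s. g s c (chart_inv c x)) has_vector_derivative
        (- 2) *\<^sub>R ricci (coord_metric (g t) c) (snd c (chart_inv c x))) (at t within {0..<T})"
      using rf c(1) chart_inv_mem[OF c(1) x] unfolding ricci_flow_def by blast
    moreover have "at t within {0..<T} = at t" by (rule at_within_interior) (use t in simp)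
    ultimately have d: "((\<lambda>s. coord_metric (g s) c x) has_vector_derivative
        (- 2) *\<^sub>R ricci (coord_metric (g t) c) x) (at t)"
      using chart_inv_right[OF c(1) x] by (simp add: coord_metric_def)
    have "bounded_linear (\<lambda>B::real^4^4. B $ i $ j)"
      by (rule bounded_linear_compose[OF bounded_linear_vec_nth[of j] bounded_linear_vec_nth[of i]])
    from bounded_linear.has_vector_derivative[OF this d]
    show ?thesis by (simp add: has_real_derivative_iff_has_vector_derivative)
  qed
  show "0 < l" by (rule ball(3))
  have dom: "x \<in> cball (snd c z) \<rho>" "t \<in> {t1..<T}" "x \<in> chart_image c" "t \<in> {0<..<T}" "t \<in> {0..<T}"
    if "x \<in> ball (snd c z) \<rho>" "t \<in> {?t0..<T}" for x t
    using that t1 ball(2) by auto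
  have form: "metric_form (g t) c (chart_inv c x) u = u \<bullet> (coord_metric (g t) c x *v u)" for t x u
    by (simp add: metric_form_def coord_metric_def)
  show "l * (u \<bullet> u) \<le> u \<bullet> (coord_metric (g t) c x *v u)"
    if "x \<in> ball (snd c z) \<rho>" "t \<in> {?t0..<T}" for x t u
    using lB[OF dom(1,2)[OF that], of u] form by simp
  have up: "u \<bullet> (coord_metric (g t) c x *v u) \<le> ?F * (u \<bullet> u)"
    if "x \<in> ball (snd c z) \<rho>" "t \<in> {?t0..<T}" for x t u
    using lB[OF dom(1,2)[OF that], of u] inner_ge_zero[of u] unfolding form distrib_right by linarith
  show "\<bar>coord_metric (g t) c x $ i $ j\<bar> \<le> 2 * (B + 1)"
    if "x \<in> ball (snd c z) \<rho>" "t \<in> {?t0..<T}" for x t i j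
    by (rule entry_bound_of_form_bound[OF pd[OF dom(3,4)[OF that]] up[OF that]])
  show "\<exists>D. \<forall>x\<in>ball (snd c z) \<rho>. \<forall>t\<in>{?t0..<T}. \<forall>I. length I = j + 4 \<longrightarrow>
      \<bar>(cov_deriv (coord_metric (g t) c) ^^ j) (riem_tensor (coord_metric (g t) c)) x I\<bar> \<le> D" for j
  proof (intro exI ballI allI impI)
    fix x t and I :: "4 list"
    assume xt: "x \<in> ball (snd c z) \<rho>" "t \<in> {?t0..<T}" and len: "length I = j + 4"
    let ?G = "coord_metric (g t) c"
    let ?S = "(cov_deriv ?G ^^ j) (riem_tensor ?G)"
    note d = dom[OF xt]
    interpret riem_atlas M A "g t" by (rule atlas_at[OF d(5)])
    \<comment> \<open>The form of the inverse metric is at least 1 / F times the Euclidean one, and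
      each of the j + 4 indices costs one such factor when a component is estimated by the invariant
      norm.\<close>
    have "(1 / ?F) ^ (j + 4) * (?S x I)\<^sup>2 \<le> tensor_form (matrix_inv (?G x)) (j + 4) (?S x) (?S x)"
    proof (rule tensor_form_component_bound[OF _ _ _ len])
      show "matrix_inv (?G x) $ i $ k = matrix_inv (?G x) $ k $ i" for i k
        by (rule matrix_inv_sym[OF pd[OF d(3,4)]])
      show "1 / ?F * (v \<bullet> v) \<le> v \<bullet> (matrix_inv (?G x) *v v)" for v
        using matrix_inv_form_lower[OF pd[OF d(3,4)] up[OF xt] F, of v] F by (simp add: field_simps)
      show "0 \<le> 1 / ?F" using F by simp
    qed
    also have "\<dots> = nabla_riem_norm_sq j A (g t) (chart_inv c x)"
      using nabla_riem_norm_sq_chart[OF c(1) chart_inv_mem[OF c(1) d(3)], of j] chart_inv_right[OF c(1) d(3)]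
      by (simp add: tensor_norm_sq_eq)
    also have "\<dots> \<le> b j"
      using W inW[OF d(1)] xt(2) unfolding controlled_def by blast
    finally have "(?S x I)\<^sup>2 \<le> b j * ?F ^ (j + 4)"
      using F by (simp add: power_one_over divide_le_eq)
    then show "\<bar>?S x I\<bar> \<le> b j * ?F ^ (j + 4) + 1"
      using abs_le_square_plus_one[of "?S x I"] by linarith
  qed
qed

text \<open>Positive definiteness survives the limit because the lower bound l for the quadratic
  forms does not depend on time.\<close>

lemma controlled_limit_metric:
  assumes W: "controlled t1 W b" and z: "z \<in> W" and c: "c \<in> A" "z \<in> fst c"
  shows "\<exists>\<rho> f. 0 < \<rho> \<and> ball (snd c z) \<rho> \<subseteq> chart_image c \<and> smooth_on (ball (snd c z) \<rho>) f \<and>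
    (\<forall>x\<in>ball (snd c z) \<rho>. ((\<lambda>t. coord_metric (g t) c x) \<longlongrightarrow> f x) (at_left T) \<and> pos_def (f x))"
proof -
  from controlled_chart_ball[OF assms] obtain \<rho> l B where ball: "0 < \<rho>" "cball (snd c z) \<rho> \<subseteq> chart_image c" "0 < l" "0 \<le> B"
    and inW: "\<And>x. x \<in> cball (snd c z) \<rho> \<Longrightarrow> chart_inv c x \<in> W"
    and lB: "\<And>x s u. x \<in> cball (snd c z) \<rho> \<Longrightarrow> s \<in> {t1..<T} \<Longrightarrow>
       l * (u \<bullet> u) \<le> metric_form (g s) c (chart_inv c x) u \<and>
       metric_form (g s) c (chart_inv c x) u \<le> B * (u \<bullet> u)" by blast
  interpret flow_region "chart_image c" "ball (snd c z) \<rho>" T "(T + t1) / 2"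
    "\<lambda>t. coord_metric (g t) c" "cball (snd c z) \<rho>" l "2 * (B + 1)"
    by (rule controlled_flow_region[OF W c ball inW lB])
  have "limit_class_fun (\<lambda>t x. coord_metric (g t) c x $ i $ j)" for i j
    unfolding limit_class_fun_def using sm_G metric_bounded metric_deriv_bounded by blast
  then have "\<exists>D f. 0 \<le> D \<and> (\<forall>x\<in>ball (snd c z) \<rho>. \<forall>t\<in>{(T + t1) / 2..<T}. \<bar>coord_metric (g t) c x $ i $ j - f x\<bar> \<le> D * (T - t))" for i j
    by (rule limit_class_fun_limit)
  then have "\<exists>f. \<forall>x\<in>ball (snd c z) \<rho>. ((\<lambda>t. coord_metric (g t) c x $ i $ j) \<longlongrightarrow> f x) (at_left T)" for i j
    using limit_from_bound by meson
  then obtain f0 where f0: "\<And>i j x. x \<in> ball (snd c z) \<rho> \<Longrightarrow> ((\<lambda>t. coord_metric (g t) c x $ i $ j) \<longlongrightarrow> f0 i j x) (at_left T)"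
    by metis
  define f where "f = (\<lambda>x. \<chi> i j. f0 i j x)"
  have lim: "((\<lambda>t. coord_metric (g t) c x) \<longlongrightarrow> f x) (at_left T)" if "x \<in> ball (snd c z) \<rho>" for x
    by (intro vec_tendstoI) (simp add: f_def f0[OF that])
  have "smooth_on (ball (snd c z) \<rho>) f"
    by (rule limit_metric_smooth[OF convex_ball]) (simp add: f_def f0)
  moreover have "pos_def (f x)" if x: "x \<in> ball (snd c z) \<rho>" for x
    unfolding pos_def_def
  proof (intro conjI allI impI)
    have ev: "\<forall>\<^sub>F t in at_left T. t \<in> {(T + t1) / 2<..<T}"
      by (rule eventually_at_left_real[OF t0(2)])
    have U: "x \<in> chart_image c" using x K_sub by blast
    have "((\<lambda>t. coord_metric (g t) c x $ j $ i) \<longlongrightarrow> f x $ i $ j) (at_left T)" for i j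
    proof (rule Lim_transform_eventually)
      show "((\<lambda>t. coord_metric (g t) c x $ i $ j) \<longlongrightarrow> f x $ i $ j) (at_left T)"
        using f0[OF x] by (simp add: f_def)
      show "\<forall>\<^sub>F t in at_left T. coord_metric (g t) c x $ i $ j = coord_metric (g t) c x $ j $ i"
      proof (rule eventually_mono[OF ev])
        fix t assume "t \<in> {(T + t1) / 2<..<T}"
        then have "t \<in> {0<..<T}" using t0 by simp
        from pos_def_sym[OF pd[OF U this]] show "coord_metric (g t) c x $ i $ j = coord_metric (g t) c x $ j $ i" .
      qed
    qed
    from tendsto_unique[OF _ this f0[OF x]] have "f x $ i $ j = f x $ j $ i" for i j by (simp add: f_def)
    then show "Finite_Cartesian_Product.transpose (f x) = f x" by (simp add: vec_eq_iff transpose_def)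
    fix u :: "real^4" assume u: "u \<noteq> 0"
    have "((\<lambda>t. u \<bullet> (coord_metric (g t) c x *v u)) \<longlongrightarrow> u \<bullet> (f x *v u)) (at_left T)"
      unfolding inner_vec_def matrix_vector_mult_def
      by (auto intro!: tendsto_intros lim[OF x])
    moreover have "\<forall>\<^sub>F t in at_left T. l * (u \<bullet> u) \<le> u \<bullet> (coord_metric (g t) c x *v u)"
      by (rule eventually_mono[OF ev]) (use low[OF x] in auto)
    ultimately have "l * (u \<bullet> u) \<le> u \<bullet> (f x *v u)"
      by (intro tendsto_lowerbound) auto
    moreover have "0 < l * (u \<bullet> u)" using u l_pos by simp
    ultimately show "0 < u \<bullet> (f x *v u)" by linarith
  qed
  ultimately show ?thesis using ball(1) K_sub lim by blast
qed

text \<open>The constants do not depend on s, so both estimates can pass to the limit. They are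
  square roots of those for the quadratic forms, which measure squared speeds.\<close>

lemma controlled_dist:
  assumes W: "controlled t1 W b" and z: "z \<in> W" and c: "c \<in> A" "z \<in> fst c"
  shows "\<exists>\<rho> l B. 0 < \<rho> \<and> 0 < l \<and> 0 \<le> B \<and> cball (snd c z) \<rho> \<subseteq> chart_image c \<and> (\<forall>s\<in>{t1..<T}.
     (\<forall>q\<in>fst c. snd c q \<in> ball (snd c z) \<rho> \<longrightarrow> riem_dist M A (g s) z q \<le> B * dist (snd c z) (snd c q)) \<and>
     (\<forall>q\<in>topspace M. riem_dist M A (g s) z q < l * \<rho> \<longrightarrow>
        q \<in> fst c \<and> l * dist (snd c z) (snd c q) \<le> riem_dist M A (g s) z q))"
proof -
  from controlled_chart_ball[OF assms] obtain \<rho> l B where ball: "0 < \<rho>" "cball (snd c z) \<rho> \<subseteq> chart_image c" "0 < l" "0 \<le> B"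
    and lB: "\<And>x s u. x \<in> cball (snd c z) \<rho> \<Longrightarrow> s \<in> {t1..<T} \<Longrightarrow>
       l * (u \<bullet> u) \<le> metric_form (g s) c (chart_inv c x) u \<and>
       metric_form (g s) c (chart_inv c x) u \<le> B * (u \<bullet> u)" by blast
  have t1: "0 < t1" using W by (simp add: controlled_def)
  have sub: "ball (snd c z) \<rho> \<subseteq> cball (snd c z) \<rho>" by (rule ball_subset_cball)
  show ?thesis
  proof (rule exI[of _ \<rho>], rule exI[of _ "sqrt l"], rule exI[of _ "sqrt B"], intro conjI ballI impI)
    fix s assume s: "s \<in> {t1..<T}"
    then have "s \<in> {0..<T}" using t1 by simp
    then interpret riem_space M A "g s" by (rule space_at)
    show "riem_dist M A (g s) z q \<le> sqrt B * dist (snd c z) (snd c q)"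
      if "q \<in> fst c" "snd c q \<in> ball (snd c z) \<rho>" for q
      by (rule riem_dist_upper[OF c order_trans[OF sub ball(2)] ball(4) _ that])
         (use lB[OF subsetD[OF sub] s] in blast)
    show "q \<in> fst c" "sqrt l * dist (snd c z) (snd c q) \<le> riem_dist M A (g s) z q"
      if "q \<in> topspace M" "riem_dist M A (g s) z q < sqrt l * \<rho>" for q
      using riem_dist_lower[OF c(1) ball(2) c(2) ball(3) _ that] lB[OF subsetD[OF sub] s] by blast+
  qed (use ball in auto)
qed

lemma controlled_nhd:
  assumes const: "regularity_constants M A T g R v \<epsilon>0 cst"
    and t: "good_time M A T g t1" "0 < t1" "\<bar>T - t1\<bar> \<le> v" and z: "z \<in> Reg_at M A T g \<epsilon>0 R t1"
  shows "\<exists>W b. controlled t1 W b \<and> z \<in> W"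
proof -
  have t1: "t1 \<in> {0..<T}" using t(1) by (simp add: good_time_def)
  have R: "0 < R / 2 * sqrt (T - t1)" using const t1 by (simp add: regularity_constants_def)
  have zM: "z \<in> topspace M" using z by (simp add: Reg_at_def)
  obtain W where W: "openin M W" "z \<in> W" "W \<subseteq> riem_ball M A (g t1) z (R / 2 * sqrt (T - t1))"
    using riem_space.riem_ball_nhd[OF space_at[OF t1] zM R] by blast
  have reg: "(\<forall>r\<in>{t1..<T}. \<forall>s\<in>{t1..<T}. \<forall>c\<in>A. q \<in> fst c \<longrightarrow> (\<forall>u.
              let \<theta> = 8 * \<bar>root 4 (r - t1) - root 4 (s - t1)\<bar> / root 4 (T - t1);
                  gr = metric_form (g r) c q u;
                  gs = metric_form (g s) c q u
              in (1/2) * gr \<le> gs \<and> gs \<le> 2 * gr \<and>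
                 exp (- \<theta>) * gr \<le> gs \<and> gs \<le> exp \<theta> * gr)) \<and>
           (\<forall>j. \<forall>s\<in>{(T + t1) / 2..<T}.
              nabla_riem_norm_sq j A (g s) q \<le> cst j / (T - t1) ^ (j + 2))" if "q \<in> W" for q
    using const t z W(3) that unfolding regularity_constants_def by blast
  have "t1 \<in> {t1..<T}" using t1 by simp
  then have "controlled t1 W (\<lambda>j. cst j / (T - t1) ^ (j + 2))"
    unfolding controlled_def using W(1) t(2) t1 reg[unfolded Let_def] by (intro conjI) (simp, simp, simp, blast+)
  then show ?thesis using W(2) by blast
qed

end

section \<open>The limit space\<close>

locale limit_flow = ricci_flow_space M A T g
  for M :: "'a topology" and A :: "('a, 4) chart set" and T :: real and g :: "real \<Rightarrow> ('a, 4) metric_field" +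
  assumes limit_dist_exists: "\<And>q q'. q \<in> topspace M \<Longrightarrow> q' \<in> topspace M \<Longrightarrow>
         \<exists>d. ((\<lambda>t. riem_dist M A (g t) q q') \<longlongrightarrow> d) (at_left T)"
begin

text \<open>A pseudometric on M itself. By \<open>class_eq\<close> and \<open>LD_class\<close> the
  limit space is its quotient by distance 0, so that estimates can be made for points in place of
  classes.\<close>

definition \<delta> :: "'a \<Rightarrow> 'a \<Rightarrow> real" where
  "\<delta> x y = Lim (at_left T) (\<lambda>t. riem_dist M A (g t) x y)"

abbreviation "cls \<equiv> limit_class M A T g"
abbreviation "LS \<equiv> limit_space M A T g"
abbreviation "LD \<equiv> limit_dist M A T g"

lemma delta_tendsto:
  assumes "x \<in> topspace M" "y \<in> topspace M"
  shows "((\<lambda>t. riem_dist M A (g t) x y) \<longlongrightarrow> \<delta> x y) (at_left T)"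
proof -
  obtain d where d: "((\<lambda>t. riem_dist M A (g t) x y) \<longlongrightarrow> d) (at_left T)"
    using limit_dist_exists[OF assms] by blast
  have "\<delta> x y = d" unfolding \<delta>_def by (rule tendsto_Lim[OF _ d]) simp
  then show ?thesis using d by simp
qed

lemma delta_unique:
  assumes "x \<in> topspace M" "y \<in> topspace M" "((\<lambda>t. riem_dist M A (g t) x y) \<longlongrightarrow> d) (at_left T)"
  shows "\<delta> x y = d"
  by (rule tendsto_unique[OF _ delta_tendsto[OF assms(1,2)] assms(3)]) simp

lemma ev_time: "0 \<le> a \<Longrightarrow> a < T \<Longrightarrow> (\<And>t. t \<in> {a..<T} \<Longrightarrow> P t) \<Longrightarrow> \<forall>\<^sub>F t in at_left T. P t"
  by (rule eventually_mono[OF eventually_at_left_real[of a T]]) auto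

lemma delta_nonneg:
  assumes "x \<in> topspace M" "y \<in> topspace M"
  shows "0 \<le> \<delta> x y"
  by (rule tendsto_lowerbound[OF delta_tendsto[OF assms]], rule ev_time[OF order_refl T_pos])
     (use riem_space.riem_dist_nonneg[OF space_at assms] in auto)

lemma delta_sym:
  assumes "x \<in> topspace M" "y \<in> topspace M"
  shows "\<delta> x y = \<delta> y x"
proof (rule delta_unique[OF assms])
  show "((\<lambda>t. riem_dist M A (g t) x y) \<longlongrightarrow> \<delta> y x) (at_left T)"
    by (rule Lim_transform_eventually[OF delta_tendsto[OF assms(2,1)]], rule ev_time[OF order_refl T_pos])
       (rule riem_space.riem_dist_sym[OF space_at assms(2,1)])
qed

lemma delta_refl:
  assumes "x \<in> topspace M"
  shows "\<delta> x x = 0"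
proof (rule delta_unique[OF assms assms])
  have "\<forall>\<^sub>F t in at_left T. 0 = riem_dist M A (g t) x x"
    by (rule ev_time[OF order_refl T_pos]) (use riem_space.riem_dist_refl[OF space_at assms] in auto)
  then show "((\<lambda>t. riem_dist M A (g t) x x) \<longlongrightarrow> 0) (at_left T)"
    by (rule Lim_transform_eventually[OF tendsto_const])
qed

lemma delta_triangle:
  assumes "x \<in> topspace M" "y \<in> topspace M" "z \<in> topspace M"
  shows "\<delta> x z \<le> \<delta> x y + \<delta> y z"
proof (rule tendsto_le[OF _ tendsto_add[OF delta_tendsto[OF assms(1,2)] delta_tendsto[OF assms(2,3)]] delta_tendsto[OF assms(1,3)]])
  show "\<forall>\<^sub>F t in at_left T. riem_dist M A (g t) x z \<le> riem_dist M A (g t) x y + riem_dist M A (g t) y z"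
    by (rule ev_time[OF order_refl T_pos]) (rule riem_space.riem_dist_triangle[OF space_at assms])
qed simp

lemma class_mem: "x \<in> topspace M \<Longrightarrow> y \<in> cls x \<longleftrightarrow> y \<in> topspace M \<and> \<delta> x y = 0"
  using delta_tendsto[of x y] delta_unique[of x y 0] by (auto simp: limit_class_def)

lemma class_eq:
  assumes "x \<in> topspace M" "y \<in> topspace M"
  shows "cls x = cls y \<longleftrightarrow> \<delta> x y = 0"
proof
  assume "cls x = cls y"
  moreover have "y \<in> cls y" using assms(2) by (simp add: class_mem delta_refl)
  ultimately show "\<delta> x y = 0" using assms(1) class_mem by blast
next
  assume 0: "\<delta> x y = 0"
  have "\<delta> x w = 0 \<longleftrightarrow> \<delta> y w = 0" if "w \<in> topspace M" for w
    using delta_triangle[OF assms that] delta_triangle[OF assms(2,1) that] delta_sym[OF assms] 0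
      delta_nonneg[OF assms(1) that] delta_nonneg[OF assms(2) that] by auto
  then show "cls x = cls y" using assms class_mem by blast
qed

lemma LS_eq: "LS = cls ` topspace M"
  by (simp add: limit_space_def)

lemma class_in: "x \<in> topspace M \<Longrightarrow> cls x \<in> LS"
  by (simp add: LS_eq)

lemma delta_cong:
  assumes "x \<in> topspace M" "x' \<in> topspace M" "y \<in> topspace M" "y' \<in> topspace M" "\<delta> x x' = 0" "\<delta> y y' = 0"
  shows "\<delta> x y = \<delta> x' y'"
proof -
  have "\<delta> x y \<le> \<delta> x' y'"
    using delta_triangle[OF assms(1,2,3)] delta_triangle[OF assms(2,4,3)] delta_sym[OF assms(3,4)] assms(5,6) by linarith
  moreover have "\<delta> x' y' \<le> \<delta> x y"
    using delta_triangle[OF assms(2,1,4)] delta_triangle[OF assms(1,3,4)] delta_sym[OF assms(1,2)] assms(5,6) by linarith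
  ultimately show ?thesis by linarith
qed

text \<open>By \<open>delta_cong\<close> all representatives give the same limit, so the definite
  description in \<open>limit_dist\<close> is proper.\<close>

lemma LD_class:
  assumes x: "x \<in> topspace M" and y: "y \<in> topspace M"
  shows "LD (cls x) (cls y) = \<delta> x y"
proof -
  let ?P = "\<lambda>d. \<exists>x'\<in>cls x. \<exists>y'\<in>cls y. ((\<lambda>t. riem_dist M A (g t) x' y') \<longlongrightarrow> d) (at_left T)"
  have "(THE d. ?P d) = \<delta> x y"
  proof (rule the_equality)
    have "x \<in> cls x" "y \<in> cls y" using x y by (simp_all add: class_mem delta_refl)
    then show "?P (\<delta> x y)" using delta_tendsto[OF x y] by blast
    fix d assume "?P d"
    then obtain x' y' where xy: "x' \<in> cls x" "y' \<in> cls y" "((\<lambda>t. riem_dist M A (g t) x' y') \<longlongrightarrow> d) (at_left T)" by blast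
    then have m: "x' \<in> topspace M" "\<delta> x x' = 0" "y' \<in> topspace M" "\<delta> y y' = 0"
      using class_mem[OF x] class_mem[OF y] by auto
    show "d = \<delta> x y" using delta_unique[OF m(1,3) xy(3)] delta_cong[OF x m(1) y m(3,2,4)] by simp
  qed
  then show ?thesis using class_in[OF x] class_in[OF y] by (simp add: limit_dist_def)
qed

lemma limit_metric_space: "Metric_space LS LD"
proof
  show "0 \<le> LD a b" for a b
  proof (cases "a \<in> LS \<and> b \<in> LS")
    case True
    then obtain x y where "x \<in> topspace M" "y \<in> topspace M" "a = cls x" "b = cls y" by (auto simp: LS_eq)
    then show ?thesis by (simp add: LD_class delta_nonneg)
  qed (auto simp: limit_dist_def)
  show "LD a b = LD b a" for a b
  proof (cases "a \<in> LS \<and> b \<in> LS")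
    case True
    then obtain x y where "x \<in> topspace M" "y \<in> topspace M" "a = cls x" "b = cls y" by (auto simp: LS_eq)
    then show ?thesis by (simp add: LD_class delta_sym[of x y])
  qed (auto simp: limit_dist_def)
  show "LD a b = 0 \<longleftrightarrow> a = b" if ab: "a \<in> LS" "b \<in> LS" for a b
  proof -
    obtain x y where "x \<in> topspace M" "y \<in> topspace M" "a = cls x" "b = cls y" using ab unfolding LS_eq by blast
    then show ?thesis using class_eq[of x y] LD_class[of x y] by simp
  qed
  show "LD a c \<le> LD a b + LD b c" if abc: "a \<in> LS" "b \<in> LS" "c \<in> LS" for a b c
  proof -
    obtain x y z where "x \<in> topspace M" "y \<in> topspace M" "z \<in> topspace M" "a = cls x" "b = cls y" "c = cls z"
      using abc unfolding LS_eq by blast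
    then show ?thesis using delta_triangle[of x y z] LD_class by simp
  qed
qed

sublocale L: Metric_space LS LD
  by (rule limit_metric_space)

lemma controlled_delta:
  assumes W: "controlled t1 W b" and z: "z \<in> W" and c: "c \<in> A" "z \<in> fst c"
  shows "\<exists>\<rho> l B. 0 < \<rho> \<and> 0 < l \<and> 0 \<le> B \<and> cball (snd c z) \<rho> \<subseteq> chart_image c \<and>
     (\<forall>q\<in>fst c. snd c q \<in> ball (snd c z) \<rho> \<longrightarrow> \<delta> z q \<le> B * dist (snd c z) (snd c q)) \<and>
     (\<forall>q\<in>topspace M. \<delta> z q < l * \<rho> \<longrightarrow> q \<in> fst c \<and> l * dist (snd c z) (snd c q) \<le> \<delta> z q)"
proof -
  have t1: "0 \<le> t1" "t1 < T" using W by (simp_all add: controlled_def)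
  have zM: "z \<in> topspace M" using c chart_sub by blast
  from controlled_dist[OF assms] obtain \<rho> l B where *: "0 < \<rho>" "0 < l" "0 \<le> B" "cball (snd c z) \<rho> \<subseteq> chart_image c"
    and up: "\<And>s q. s \<in> {t1..<T} \<Longrightarrow> q \<in> fst c \<Longrightarrow> snd c q \<in> ball (snd c z) \<rho> \<Longrightarrow>
        riem_dist M A (g s) z q \<le> B * dist (snd c z) (snd c q)"
    and low: "\<And>s q. s \<in> {t1..<T} \<Longrightarrow> q \<in> topspace M \<Longrightarrow> riem_dist M A (g s) z q < l * \<rho> \<Longrightarrow>
        q \<in> fst c \<and> l * dist (snd c z) (snd c q) \<le> riem_dist M A (g s) z q" by blast
  have "\<delta> z q \<le> B * dist (snd c z) (snd c q)" if q: "q \<in> fst c" "snd c q \<in> ball (snd c z) \<rho>" for q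
  proof -
    have "q \<in> topspace M" using c q chart_sub by blast
    then show ?thesis
      by (intro tendsto_upperbound[OF delta_tendsto[OF zM]] ev_time[OF t1]) (use up q in auto)
  qed
  moreover have "q \<in> fst c \<and> l * dist (snd c z) (snd c q) \<le> \<delta> z q" if q: "q \<in> topspace M" "\<delta> z q < l * \<rho>" for q
  proof -
    \<comment> \<open>A strict inequality for the limit holds at all times near T, so the lower
      estimate is available there and passes to the limit.\<close>
    have "\<forall>\<^sub>F s in at_left T. riem_dist M A (g s) z q < l * \<rho>"
      by (rule order_tendstoD(2)[OF delta_tendsto[OF zM q(1)] q(2)])
    moreover have "\<forall>\<^sub>F s in at_left T. s \<in> {t1..<T}" by (rule ev_time[OF t1])
    ultimately have ev: "\<forall>\<^sub>F s in at_left T. q \<in> fst c \<and> l * dist (snd c z) (snd c q) \<le> riem_dist M A (g s) z q"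
      by eventually_elim (rule low[OF _ q(1)])
    have "q \<in> fst c" using eventually_happens'[OF _ ev] by simp
    moreover have "l * dist (snd c z) (snd c q) \<le> \<delta> z q"
      by (rule tendsto_lowerbound[OF delta_tendsto[OF zM q(1)]]) (use ev in \<open>auto elim: eventually_mono\<close>)
    ultimately show ?thesis by blast
  qed
  ultimately show ?thesis using * by blast
qed

section \<open>Regular points and their images in the limit space\<close>

definition regular :: "'a \<Rightarrow> bool" where
  "regular z \<longleftrightarrow> (\<exists>t1 W b. controlled t1 W b \<and> z \<in> W)"

lemma regular_top: "regular z \<Longrightarrow> z \<in> topspace M"
  unfolding regular_def controlled_def using openin_subset by blast

lemma regular_chart:
  assumes "regular z" "c \<in> A" "z \<in> fst c"
  shows "\<exists>\<rho> l B. 0 < \<rho> \<and> 0 < l \<and> 0 \<le> B \<and> cball (snd c z) \<rho> \<subseteq> chart_image c \<and>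
     (\<forall>q\<in>fst c. snd c q \<in> ball (snd c z) \<rho> \<longrightarrow> \<delta> z q \<le> B * dist (snd c z) (snd c q)) \<and>
     (\<forall>q\<in>topspace M. \<delta> z q < l * \<rho> \<longrightarrow> q \<in> fst c \<and> l * dist (snd c z) (snd c q) \<le> \<delta> z q)"
  using assms controlled_delta unfolding regular_def by blast

text \<open>Together with \<open>regular_delta_ball\<close> this says that \<delta> induces the
  manifold topology near a regular point. Here the upper estimate for \<delta> is used.\<close>

lemma regular_delta_nhd:
  assumes z: "regular z" and e: "0 < e"
  shows "\<exists>W. openin M W \<and> z \<in> W \<and> (\<forall>q\<in>W. \<delta> z q < e)"
proof -
  let ?c = "chart_at A z"
  note c = chart_at[OF regular_top[OF z]]
  obtain \<rho> B where B: "0 < \<rho>" "0 \<le> B"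
    "\<And>q. q \<in> fst ?c \<Longrightarrow> snd ?c q \<in> ball (snd ?c z) \<rho> \<Longrightarrow> \<delta> z q \<le> B * dist (snd ?c z) (snd ?c q)"
    using regular_chart[OF z c] by blast
  have pos: "0 < B + 1" using B(2) by simp
  define r where "r = min \<rho> (e / (B + 1))"
  have r: "0 < r" "r \<le> \<rho>" "r \<le> e / (B + 1)" using B(1) e pos by (simp_all add: r_def)
  show ?thesis
  proof (rule exI[of _ "{p \<in> fst ?c. snd ?c p \<in> ball (snd ?c z) r}"], intro conjI ballI)
    show "openin M {p \<in> fst ?c. snd ?c p \<in> ball (snd ?c z) r}"
      by (rule chart_preimage_openin[OF c(1) open_ball])
    show "z \<in> {p \<in> fst ?c. snd ?c p \<in> ball (snd ?c z) r}" using c r by simp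
    fix q assume "q \<in> {p \<in> fst ?c. snd ?c p \<in> ball (snd ?c z) r}"
    then have q: "q \<in> fst ?c" "dist (snd ?c z) (snd ?c q) < r" by auto
    have "\<delta> z q \<le> B * dist (snd ?c z) (snd ?c q)" using B(3)[OF q(1)] q(2) r(2) by simp
    also have "\<dots> \<le> (B + 1) * dist (snd ?c z) (snd ?c q)" by (intro mult_right_mono) auto
    also have "\<dots> < (B + 1) * (e / (B + 1))" using q(2) r(3) pos by (intro mult_strict_left_mono) auto
    also have "\<dots> = e" using pos by simp
    finally show "\<delta> z q < e" .
  qed
qed

text \<open>The lower estimate holds for all points of M, so no remote point can come close to z in
  the limit.\<close>

lemma regular_delta_ball:
  assumes z: "regular z" and W: "openin M W" "z \<in> W"
  shows "\<exists>e>0. \<forall>q\<in>topspace M. \<delta> z q < e \<longrightarrow> q \<in> W"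
proof -
  let ?c = "chart_at A z"
  note c = chart_at[OF regular_top[OF z]]
  obtain \<rho> l where l: "0 < \<rho>" "0 < l"
    "\<And>q. q \<in> topspace M \<Longrightarrow> \<delta> z q < l * \<rho> \<Longrightarrow> q \<in> fst ?c \<and> l * dist (snd ?c z) (snd ?c q) \<le> \<delta> z q"
    using regular_chart[OF z c] by blast
  have "open (snd ?c ` (fst ?c \<inter> W))" by (rule chart_image_openin[OF c(1) W(1)])
  moreover have "snd ?c z \<in> snd ?c ` (fst ?c \<inter> W)" using c W by simp
  ultimately obtain r where r: "0 < r" "ball (snd ?c z) r \<subseteq> snd ?c ` (fst ?c \<inter> W)"
    using open_contains_ball by blast
  show ?thesis
  \<comment> \<open>Below l \<rho> the point q is in the chart, and below l r its coordinates lie in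
    the ball chosen inside the image of W.\<close>
  proof (intro exI[of _ "l * min r \<rho>"] conjI ballI impI)
    show "0 < l * min r \<rho>" using l r by simp
    fix q assume q: "q \<in> topspace M" "\<delta> z q < l * min r \<rho>"
    have "l * min r \<rho> \<le> l * \<rho>" "l * min r \<rho> \<le> l * r" using l by simp_all
    then have *: "q \<in> fst ?c" "l * dist (snd ?c z) (snd ?c q) \<le> \<delta> z q" "\<delta> z q < l * r"
      using l(3)[OF q(1)] q(2) by auto
    then have "dist (snd ?c z) (snd ?c q) < r" using l(2) by (meson le_less_trans mult_less_cancel_left_pos)
    then have "snd ?c q \<in> snd ?c ` (fst ?c \<inter> W)" using r(2) by auto
    then obtain q' where "q' \<in> fst ?c" "q' \<in> W" "snd ?c q = snd ?c q'" by blast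
    then show "q \<in> W" using chart_inj[OF c(1)] *(1) by (metis inj_onD)
  qed
qed

text \<open>Limit distance 0 lies below the threshold, so it puts q into the chart at z and then
  forces equal coordinates. Only z is assumed regular: its class contains no other point of M at
  all.\<close>

lemma regular_inj:
  assumes z: "regular z" and q: "q \<in> topspace M" and eq: "cls z = cls q"
  shows "q = z"
proof -
  let ?c = "chart_at A z"
  note c = chart_at[OF regular_top[OF z]]
  obtain \<rho> l where l: "0 < \<rho>" "0 < l"
    "\<And>q. q \<in> topspace M \<Longrightarrow> \<delta> z q < l * \<rho> \<Longrightarrow> q \<in> fst ?c \<and> l * dist (snd ?c z) (snd ?c q) \<le> \<delta> z q"
    using regular_chart[OF z c] by blast
  have "\<delta> z q = 0" using class_eq[OF regular_top[OF z] q] eq by simp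
  then have "q \<in> fst ?c" "l * dist (snd ?c z) (snd ?c q) \<le> 0" using l(3)[OF q] l(1,2) by auto
  then have "snd ?c z = snd ?c q" using l(2) by (simp add: mult_le_0_iff)
  then show ?thesis using chart_inj[OF c(1)] c(2) \<open>q \<in> fst ?c\<close> by (metis inj_onD)
qed

lemma regular_limit_metric:
  assumes "regular z" "c \<in> A" "z \<in> fst c"
  shows "\<exists>\<rho> f. 0 < \<rho> \<and> ball (snd c z) \<rho> \<subseteq> chart_image c \<and> smooth_on (ball (snd c z) \<rho>) f \<and>
    (\<forall>x\<in>ball (snd c z) \<rho>. ((\<lambda>t. coord_metric (g t) c x) \<longlongrightarrow> f x) (at_left T) \<and> pos_def (f x))"
  using assms controlled_limit_metric unfolding regular_def by blast

text \<open>A point whose class is no limit of the covering centres is eventually at a definite distance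
  from all centres, hence outside the balls covering the complement of \<open>Reg_at\<close>.\<close>

lemma regular_away_from_limits:
  assumes const: "regularity_constants M A T g R v \<epsilon>0 cst"
    and times: "\<And>i. good_time M A T g (\<tau> i)" "\<And>i. 0 < \<tau> i" "\<tau> \<longlonglongrightarrow> T"
    and points: "\<And>i. covering_points M A T g \<epsilon>0 R J0 J1 J2 L0 (\<tau> i) (p i)"
    and limits: "\<And>j. j \<in> {1..L0} \<Longrightarrow> limitin (limit_topology M A T g) (\<lambda>i. cls (p i j)) (y j) sequentially"
    and z: "z \<in> topspace M" "cls z \<notin> y ` {1..L0}"
  shows "regular z"
proof -
  have tau: "\<tau> i < T" "0 \<le> \<tau> i" for i using times(1)[of i] by (simp_all add: good_time_def)
  have pM: "p i j \<in> topspace M" if "j \<in> {1..L0}" for i j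
    using points[of i] that by (simp add: covering_points_def)
  have yL: "y j \<in> LS" if "j \<in> {1..L0}" for j
    using limitin_topspace[OF limits[OF that]] by (simp add: limit_topology_def L.topspace_mtopology)
  \<comment> \<open>A positive lower bound for the distances from the class of z to the limit
    points; the entry 1 covers the case L0 = 0.\<close>
  define e where "e = Min (insert 1 ((\<lambda>j. LD (cls z) (y j)) ` {1..L0}))"
  have "0 < LD (cls z) (y j)" if "j \<in> {1..L0}" for j
    using L.mdist_pos_eq[OF class_in[OF z(1)] yL[OF that]] z(2) that by auto
  then have e: "0 < e" by (auto simp: e_def)
  have ele: "e \<le> LD (cls z) (y j)" if "j \<in> {1..L0}" for j
    unfolding e_def by (rule Min_le) (use that in auto)
  have "\<forall>\<^sub>F i in sequentially. LD (cls (p i j)) (y j) < e / 2" if j: "j \<in> {1..L0}" for j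
  proof -
    have "\<forall>\<^sub>F i in sequentially. cls (p i j) \<in> LS \<and> LD (cls (p i j)) (y j) < e / 2"
      using limits[OF j] half_gt_zero[OF e] unfolding limit_topology_def L.limitin_metric by blast
    then show ?thesis by eventually_elim simp
  qed
  then have "\<forall>\<^sub>F i in sequentially. \<forall>j\<in>{1..L0}. LD (cls (p i j)) (y j) < e / 2"
    by (intro eventually_ball_finite) auto
  moreover have "\<forall>\<^sub>F i in sequentially. J0 * sqrt (T - \<tau> i) < e / 2"
  proof -
    have "(\<lambda>i. J0 * sqrt (T - \<tau> i)) \<longlonglongrightarrow> J0 * sqrt (T - T)" by (intro tendsto_intros times(3))
    then show ?thesis using e by (intro order_tendstoD(2)) auto
  qed
  moreover have "\<forall>\<^sub>F i in sequentially. \<bar>T - \<tau> i\<bar> < v"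
  proof -
    have "(\<lambda>i. \<bar>T - \<tau> i\<bar>) \<longlonglongrightarrow> \<bar>T - T\<bar>" by (intro tendsto_intros times(3))
    moreover have "0 < v" using const unfolding regularity_constants_def by blast
    ultimately show ?thesis by (intro order_tendstoD(2)) auto
  qed
  ultimately have "\<forall>\<^sub>F i in sequentially. (\<forall>j\<in>{1..L0}. LD (cls (p i j)) (y j) < e / 2) \<and>
      J0 * sqrt (T - \<tau> i) < e / 2 \<and> \<bar>T - \<tau> i\<bar> < v"
    by eventually_elim simp
  then obtain i where i: "\<And>j. j \<in> {1..L0} \<Longrightarrow> LD (cls (p i j)) (y j) < e / 2"
    "J0 * sqrt (T - \<tau> i) < e / 2" "\<bar>T - \<tau> i\<bar> < v"
    using eventually_happens'[OF sequentially_bot] by blast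
  have far: "e / 2 < \<delta> (p i j) z" if j: "j \<in> {1..L0}" for j
  proof -
    have "LD (cls z) (y j) \<le> LD (cls z) (cls (p i j)) + LD (cls (p i j)) (y j)"
      by (rule L.triangle[OF class_in[OF z(1)] class_in[OF pM[OF j]] yL[OF j]])
    then show ?thesis
      using ele[OF j] i(1)[OF j] by (simp add: LD_class[OF z(1) pM[OF j]] delta_sym[OF pM[OF j] z(1)])
  qed
  have "z \<in> Reg_at M A T g \<epsilon>0 R (\<tau> i)"
  proof (rule ccontr)
    assume "z \<notin> Reg_at M A T g \<epsilon>0 R (\<tau> i)"
    then have zc: "z \<in> topspace M - Reg_at M A T g \<epsilon>0 R (\<tau> i)" using z(1) by blast
    \<comment> \<open>The radius is fixed by \<tau> i, but the balls may be taken with the metric of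
      any later time t; this is what allows the comparison with limit distances.\<close>
    have near: "\<exists>j\<in>{1..L0}. riem_dist M A (g t) (p i j) z < J0 * sqrt (T - \<tau> i)" if t: "t \<in> {\<tau> i..<T}" for t
    proof -
      have "topspace M - Reg_at M A T g \<epsilon>0 R (\<tau> i) \<subseteq> (\<Union>j\<in>{1..L0}. riem_ball M A (g t) (p i j) (J0 * sqrt (T - \<tau> i)))"
        using points[of i] t unfolding covering_points_def Let_def by blast
      then show ?thesis using zc unfolding riem_ball_def by blast
    qed
    have "\<forall>\<^sub>F t in at_left T. \<forall>j\<in>{1..L0}. e / 2 < riem_dist M A (g t) (p i j) z"
      by (intro eventually_ball_finite ballI order_tendstoD(1)[OF delta_tendsto[OF pM z(1)] far]) auto
    moreover have "\<forall>\<^sub>F t in at_left T. t \<in> {\<tau> i..<T}" by (rule ev_time[OF tau(2,1)])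
    ultimately have "\<forall>\<^sub>F t in at_left T. (\<forall>j\<in>{1..L0}. e / 2 < riem_dist M A (g t) (p i j) z) \<and> t \<in> {\<tau> i..<T}"
      by (rule eventually_conj)
    then obtain t where "\<forall>j\<in>{1..L0}. e / 2 < riem_dist M A (g t) (p i j) z" "t \<in> {\<tau> i..<T}"
      using eventually_happens'[of "at_left T"] by auto
    with near[OF this(2)] i(2) show False by force
  qed
  then show ?thesis
    using controlled_nhd[OF const times(1,2) less_imp_le[OF i(3)]] unfolding regular_def by blast
qed

end

section \<open>The smooth structure and the limit metric\<close>

locale regular_part = limit_flow M A T g
  for M :: "'a topology" and A :: "('a, 4) chart set" and T :: real and g :: "real \<Rightarrow> ('a, 4) metric_field" +
  fixes Y :: "'a set set"
  assumes finite_Y: "finite Y" and Y_sub: "Y \<subseteq> LS"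
    and regular_off: "\<And>z. z \<in> topspace M \<Longrightarrow> cls z \<notin> Y \<Longrightarrow> regular z"
begin

definition N :: "'a set set" where "N = LS - Y"
definition V :: "'a set" where "V = {q \<in> topspace M. cls q \<in> N}"
abbreviation "NT \<equiv> subtopology (limit_topology M A T g) N"

lemma V_regular: "z \<in> V \<Longrightarrow> regular z"
  using regular_off by (auto simp: V_def N_def)

lemma V_top: "z \<in> V \<Longrightarrow> z \<in> topspace M"
  by (simp add: V_def)

text \<open>Y is finite, so the class of a point of V has positive distance from it, and by
  \<open>regular_delta_nhd\<close> nearby points of M have nearby classes.\<close>

lemma V_open: "openin M V"
  unfolding openin_subopen[of M V]
proof
  fix z assume z: "z \<in> V"
  define e where "e = Min (insert 1 (LD (cls z) ` Y))"
  have "0 < LD (cls z) y" if "y \<in> Y" for y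
    using L.mdist_pos_eq[OF class_in[OF V_top[OF z]] subsetD[OF Y_sub that]] z that by (auto simp: V_def N_def)
  then have e: "0 < e" using finite_Y by (auto simp: e_def)
  have ele: "e \<le> LD (cls z) y" if "y \<in> Y" for y
    unfolding e_def by (rule Min_le) (use that finite_Y in auto)
  obtain W where W: "openin M W" "z \<in> W" "\<And>q. q \<in> W \<Longrightarrow> \<delta> z q < e"
    using regular_delta_nhd[OF V_regular[OF z] e] by blast
  have "W \<subseteq> V"
  proof
    fix q assume q: "q \<in> W"
    have qM: "q \<in> topspace M" using W(1) q openin_subset by blast
    have "cls q \<notin> Y"
    proof
      assume "cls q \<in> Y"
      from ele[OF this] W(3)[OF q] show False by (simp add: LD_class[OF V_top[OF z] qM])
    qed
    then show "q \<in> V" using qM class_in by (simp add: V_def N_def)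
  qed
  then show "\<exists>W. openin M W \<and> z \<in> W \<and> W \<subseteq> V" using W by blast
qed

lemma cls_inj: "inj_on cls V"
  by (rule inj_onI) (metis V_regular V_top regular_inj)

lemma cls_image: "cls ` V = N"
  by (auto simp: V_def N_def LS_eq)

lemma topspace_M_V: "topspace (subtopology M V) = V"
  using V_top by auto

lemma topspace_NT: "topspace NT = N"
  by (auto simp: limit_topology_def L.topspace_mtopology N_def)

lemma cls_continuous: "continuous_map (subtopology M V) NT cls"
proof -
  have "continuous_map (subtopology M V) L.mtopology cls"
    unfolding L.continuous_map_to_metric
  proof (intro ballI allI impI)
    fix z and e :: real assume "z \<in> topspace (subtopology M V)" and e: "0 < e"
    then have z: "z \<in> V" using topspace_M_V by simp
    obtain W where W: "openin M W" "z \<in> W" "\<And>q. q \<in> W \<Longrightarrow> \<delta> z q < e"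
      using regular_delta_nhd[OF V_regular[OF z] e] by blast
    have "cls q \<in> L.mball (cls z) e" if "q \<in> W \<inter> V" for q
      using W(3)[of q] that by (simp add: LD_class V_top z class_in)
    moreover have "openin (subtopology M V) (W \<inter> V)"
      using W(1) openin_subtopology_Int by blast
    ultimately show "\<exists>U. openin (subtopology M V) U \<and> z \<in> U \<and> (\<forall>q\<in>U. cls q \<in> L.mball (cls z) e)"
      using W(2) z by blast
  qed
  then show ?thesis
    unfolding limit_topology_def continuous_map_in_subtopology topspace_M_V
    using cls_image by auto
qed

text \<open>By \<open>regular_delta_ball\<close> each point of W has a \<delta>-ball, taken among
  all points of M, inside W; its image is a metric ball of the limit space.\<close>

lemma cls_open:
  assumes W: "openin M W" "W \<subseteq> V"
  shows "openin NT (cls ` W)"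
proof -
  have sub: "cls ` W \<subseteq> LS" using W(2) V_top class_in by blast
  have "openin L.mtopology (cls ` W)"
    unfolding L.openin_mtopology
  proof (intro conjI allI impI sub)
    fix a assume "a \<in> cls ` W"
    then obtain z where z: "z \<in> W" "a = cls z" by blast
    have zV: "z \<in> V" using z W(2) by blast
    obtain e where e: "0 < e" "\<And>q. q \<in> topspace M \<Longrightarrow> \<delta> z q < e \<Longrightarrow> q \<in> W"
      using regular_delta_ball[OF V_regular[OF zV] W(1) z(1)] by blast
    have "L.mball a e \<subseteq> cls ` W"
    proof
      fix b assume "b \<in> L.mball a e"
      then have b: "b \<in> LS" "LD a b < e" by auto
      then obtain q where q: "q \<in> topspace M" "b = cls q" by (auto simp: LS_eq)
      then have "\<delta> z q < e" using b(2) z(2) LD_class[OF V_top[OF zV] q(1)] by simp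
      then show "b \<in> cls ` W" using e(2)[OF q(1)] q(2) by blast
    qed
    then show "\<exists>r>0. L.mball a r \<subseteq> cls ` W" using e(1) by blast
  qed
  moreover have "cls ` W \<subseteq> N" using W(2) cls_image by blast
  ultimately show ?thesis
    unfolding limit_topology_def by (metis openin_subset openin_subtopology_Int2 inf.absorb_iff2 inf_commute)
qed

lemma cls_homeo: "homeomorphic_map (subtopology M V) NT cls"
proof (rule bijective_open_imp_homeomorphic_map[OF cls_continuous])
  show "open_map (subtopology M V) NT cls"
    unfolding open_map_def using openin_open_subtopology[OF V_open] cls_open by blast
  show "cls ` topspace (subtopology M V) = topspace NT"
    by (simp only: topspace_M_V topspace_NT cls_image)
  show "inj_on cls (topspace (subtopology M V))"
    by (simp only: topspace_M_V cls_inj)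
qed

section \<open>Charts of the limit manifold\<close>

definition finv :: "'a set \<Rightarrow> 'a" where "finv = inv_into V cls"

lemma finv_cls [simp]: "q \<in> V \<Longrightarrow> finv (cls q) = q"
  unfolding finv_def by (rule inv_into_f_f[OF cls_inj])

text \<open>The charts of V transported by \<open>cls\<close>, so that \<open>cls\<close> is the
  identity in coordinates and all coordinate changes are restrictions of those of M.\<close>

definition pchart :: "('a, 4) chart \<Rightarrow> ('a set, 4) chart" where
  "pchart c = (cls ` (fst c \<inter> V), snd c \<circ> finv)"

definition AN :: "('a set, 4) chart set" where "AN = pchart ` A"

lemma pchart_simps: "fst (pchart c) = cls ` (fst c \<inter> V)" "snd (pchart c) = snd c \<circ> finv"
  by (simp_all add: pchart_def)

lemma pchart_image: "chart_image (pchart c) = snd c ` (fst c \<inter> V)"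
  unfolding chart_image_def pchart_simps image_image by (rule image_cong) auto

lemma pchart_inv:
  assumes "c \<in> A" "p \<in> fst c \<inter> V"
  shows "chart_inv (pchart c) (snd c p) = cls p"
proof -
  have "inj_on (snd c \<circ> finv) (cls ` (fst c \<inter> V))"
    using chart_inj[OF assms(1)] by (auto simp: inj_on_def)
  from inv_into_f_f[OF this, of "cls p"] show ?thesis
    using assms(2) by (simp add: chart_inv_def pchart_simps)
qed

lemma restricted_chart_inv:
  assumes "c \<in> A" "p \<in> fst c \<inter> V"
  shows "chart_inv (fst c \<inter> V, snd c) (snd c p) = p"
proof -
  have "inj_on (snd c) (fst c \<inter> V)" using chart_inj[OF assms(1)] by (rule inj_on_subset) simp
  from inv_into_f_f[OF this assms(2)] show ?thesis by (simp add: chart_inv_def)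
qed

text \<open>The coordinate expressions of the chart changes on N, of \<open>cls\<close> and of its
  inverse all agree with a chart change of M on the same open set; this lemma serves all
  three.\<close>

lemma smooth_transition:
  assumes "c \<in> A" "c' \<in> A" "S = snd c ` (fst c \<inter> fst c' \<inter> V)"
    and eq: "\<And>p. p \<in> fst c \<Longrightarrow> p \<in> fst c' \<Longrightarrow> p \<in> V \<Longrightarrow> F (snd c p) = snd c' p"
  shows "smooth_on S F"
proof -
  have "open S" unfolding assms(3) Int_assoc
    by (intro chart_image_openin[OF assms(1)] openin_Int chart_openin[OF assms(2)] V_open)
  moreover have "S \<subseteq> overlap c c'" by (auto simp: assms(3) overlap_def)
  ultimately have "smooth_on S (transition c c')"
    using smooth_on_open_subset[OF transition_smooth[OF assms(1,2)]] by blast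
  then show ?thesis
    by (rule smooth_on_cong[THEN iffD1, rotated]) (auto simp: assms(1,3) transition_apply eq)
qed

text \<open>The coordinate map is a composite of two restricted homeomorphisms, the inverse of
  \<open>cls\<close> and the original coordinates.\<close>

lemma pchart_is_chart:
  assumes c: "c \<in> A"
  shows "is_chart NT (pchart c)"
proof -
  have op: "openin M (fst c \<inter> V)" by (intro openin_Int chart_openin[OF c] V_open)
  have 1: "openin NT (fst (pchart c))"
    unfolding pchart_simps by (rule cls_open[OF op]) simp
  have 2: "open (chart_image (pchart c))"
    unfolding pchart_image by (rule chart_image_openin[OF c V_open])
  have maps: "homeomorphic_maps (subtopology M V) NT cls finv"
  proof -
    obtain k where k: "homeomorphic_maps (subtopology M V) NT cls k"
      using cls_homeo homeomorphic_map_maps by blast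
    have keq: "k z = finv z" if z: "z \<in> topspace NT" for z
    proof -
      obtain q where q: "q \<in> V" "z = cls q" using z cls_image unfolding topspace_NT by blast
      then have "k z = q" using k unfolding homeomorphic_maps_def topspace_M_V by blast
      then show ?thesis using q by simp
    qed
    show ?thesis by (rule homeomorphic_maps_eq[OF k]) (simp_all add: keq)
  qed
  then have "homeomorphic_map NT (subtopology M V) finv"
    using homeomorphic_maps_map by blast
  then have "homeomorphic_map (subtopology NT (cls ` (fst c \<inter> V))) (subtopology (subtopology M V) (fst c \<inter> V)) finv"
  proof (rule homeomorphic_map_subtopologies)
    show "finv ` (topspace NT \<inter> cls ` (fst c \<inter> V)) = topspace (subtopology M V) \<inter> (fst c \<inter> V)"
    proof -
      have "N \<inter> cls ` (fst c \<inter> V) = cls ` (fst c \<inter> V)" using cls_image by blast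
      moreover have "finv ` cls ` (fst c \<inter> V) = (\<lambda>q. q) ` (fst c \<inter> V)"
        unfolding image_image by (rule image_cong) auto
      ultimately show ?thesis unfolding topspace_NT topspace_M_V by auto
    qed
  qed
  then have h1: "homeomorphic_map (subtopology NT (cls ` (fst c \<inter> V))) (subtopology M (fst c \<inter> V)) finv"
  proof -
    have "V \<inter> (fst c \<inter> V) = fst c \<inter> V" by blast
    with \<open>homeomorphic_map (subtopology NT _) _ _\<close> show ?thesis by (simp add: subtopology_subtopology)
  qed
  have "homeomorphic_map (subtopology (subtopology M (fst c)) (fst c \<inter> V))
      (subtopology (top_of_set (chart_image c)) (snd c ` (fst c \<inter> V))) (snd c)"
  proof (rule homeomorphic_map_subtopologies[OF chart_homeo[OF c]])
    show "snd c ` (topspace (subtopology M (fst c)) \<inter> (fst c \<inter> V)) =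
        topspace (top_of_set (chart_image c)) \<inter> snd c ` (fst c \<inter> V)"
      using chart_sub[OF c] by (auto simp: chart_image_def)
  qed
  moreover have "chart_image c \<inter> snd c ` (fst c \<inter> V) = snd c ` (fst c \<inter> V)" by (auto simp: chart_image_def)
  ultimately have h2: "homeomorphic_map (subtopology M (fst c \<inter> V)) (top_of_set (snd c ` (fst c \<inter> V))) (snd c)"
    by (simp add: subtopology_subtopology)
  have 3: "homeomorphic_map (subtopology NT (fst (pchart c))) (top_of_set (chart_image (pchart c))) (snd (pchart c))"
    unfolding pchart_image pchart_simps by (rule homeomorphic_map_compose[OF h1 h2])
  show ?thesis using 1 2 3 unfolding is_chart_def by blast
qed

lemma AN_manifold: "smooth_manifold NT AN"
  unfolding smooth_manifold_def
proof (intro conjI ballI)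
  show "Hausdorff_space NT"
    unfolding limit_topology_def by (intro Hausdorff_space_subtopology L.Hausdorff_space_mtopology)
  have "second_countable M" using manifold unfolding smooth_manifold_def by blast
  then have "second_countable (subtopology M V)" by (rule second_countable_subtopology)
  then show "second_countable NT"
    using homeomorphic_map_imp_homeomorphic_space[OF cls_homeo] homeomorphic_space_second_countability by blast
  show "is_chart NT c" if "c \<in> AN" for c
    using that pchart_is_chart by (auto simp: AN_def)
  have "(\<Union>c\<in>A. fst c \<inter> V) = V" using V_top topspace_eq by blast
  then have "N = (\<Union>c\<in>A. cls ` (fst c \<inter> V))"
    unfolding image_UN[symmetric] cls_image[symmetric] by (rule arg_cong[OF sym])
  then show "topspace NT = (\<Union>c\<in>AN. fst c)" unfolding topspace_NT by (simp add: AN_def pchart_simps)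
  fix d d' assume "d \<in> AN" "d' \<in> AN"
  then obtain c c' where c: "c \<in> A" "c' \<in> A" "d = pchart c" "d' = pchart c'" by (auto simp: AN_def)
  show "smooth_on (snd d ` (fst d \<inter> fst d')) (snd d' \<circ> chart_inv d)"
  proof (rule smooth_transition[OF c(1,2)])
    have "cls ` (fst c \<inter> V) \<inter> cls ` (fst c' \<inter> V) = cls ` (fst c \<inter> fst c' \<inter> V)"
      using cls_inj by (auto simp: inj_on_def)
    then have "snd d ` (fst d \<inter> fst d') = (snd c \<circ> finv) ` cls ` (fst c \<inter> fst c' \<inter> V)"
      by (simp add: c pchart_simps)
    also have "\<dots> = snd c ` (fst c \<inter> fst c' \<inter> V)"
      unfolding image_image by (rule image_cong) auto
    finally show "snd d ` (fst d \<inter> fst d') = snd c ` (fst c \<inter> fst c' \<inter> V)" .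
    show "(snd d' \<circ> chart_inv d) (snd c q) = snd c' q" if "q \<in> fst c" "q \<in> fst c'" "q \<in> V" for q
      using that by (simp add: c pchart_inv pchart_simps)
  qed
qed

lemma cls_smooth: "smooth_map (subtopology M V) (restrict_atlas V A) NT AN cls"
  unfolding smooth_map_def
proof (intro conjI ballI cls_continuous)
  fix d d' assume "d \<in> restrict_atlas V A" "d' \<in> AN"
  then obtain c c' where c: "c \<in> A" "c' \<in> A" "d = (fst c \<inter> V, snd c)" "d' = pchart c'"
    by (auto simp: AN_def restrict_atlas_def)
  show "smooth_on (snd d ` {p \<in> fst d. cls p \<in> fst d'}) (snd d' \<circ> cls \<circ> chart_inv d)"
  proof (rule smooth_transition[OF c(1,2)])
    have "{p \<in> fst d. cls p \<in> fst d'} = fst c \<inter> fst c' \<inter> V"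
      using cls_inj by (auto simp: c pchart_simps inj_on_def)
    then show "snd d ` {p \<in> fst d. cls p \<in> fst d'} = snd c ` (fst c \<inter> fst c' \<inter> V)" by (simp add: c)
    show "(snd d' \<circ> cls \<circ> chart_inv d) (snd c q) = snd c' q" if "q \<in> fst c" "q \<in> fst c'" "q \<in> V" for q
      using that by (simp add: c restricted_chart_inv pchart_simps)
  qed
qed

lemma finv_smooth: "smooth_map NT AN (subtopology M V) (restrict_atlas V A) finv"
  unfolding smooth_map_def
proof (intro conjI ballI)
  obtain k where k: "homeomorphic_maps (subtopology M V) NT cls k"
    using cls_homeo homeomorphic_map_maps by blast
  show "continuous_map NT (subtopology M V) finv"
  proof (rule continuous_map_eq)
    show "continuous_map NT (subtopology M V) k" using k by (simp add: homeomorphic_maps_def)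
    fix z assume "z \<in> topspace NT"
    then obtain q where q: "q \<in> V" "z = cls q" using cls_image unfolding topspace_NT by blast
    then have "k z = q" using k unfolding homeomorphic_maps_def topspace_M_V by blast
    then show "k z = finv z" using q by simp
  qed
  fix d d' assume "d \<in> AN" "d' \<in> restrict_atlas V A"
  then obtain c c' where c: "c \<in> A" "c' \<in> A" "d = pchart c" "d' = (fst c' \<inter> V, snd c')"
    by (auto simp: AN_def restrict_atlas_def)
  show "smooth_on (snd d ` {p \<in> fst d. finv p \<in> fst d'}) (snd d' \<circ> finv \<circ> chart_inv d)"
  proof (rule smooth_transition[OF c(1,2)])
    have "{p \<in> fst d. finv p \<in> fst d'} = cls ` (fst c \<inter> fst c' \<inter> V)"
      by (auto simp: c pchart_simps)
    then show "snd d ` {p \<in> fst d. finv p \<in> fst d'} = snd c ` (fst c \<inter> fst c' \<inter> V)"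
      by (simp add: c pchart_simps image_image)
    show "(snd d' \<circ> finv \<circ> chart_inv d) (snd c q) = snd c' q" if "q \<in> fst c" "q \<in> fst c'" "q \<in> V" for q
      using that by (simp add: c pchart_inv)
  qed
qed

lemma cls_diffeomorphism: "diffeomorphism (subtopology M V) (restrict_atlas V A) NT AN cls"
  unfolding diffeomorphism_def topspace_M_V topspace_NT
  using cls_smooth finv_smooth cls_inj cls_image by (simp add: bij_betw_def finv_def)

text \<open>\<open>push_forward\<close> evaluates g t in the chart given by \<open>chart_at\<close>,
  with the Jacobian of the change from c to that chart; the transformation law of g t undoes this
  change.\<close>

lemma push_forward_eq:
  assumes c: "c \<in> A" and p: "p \<in> fst c" "p \<in> V" and t: "t \<in> {0..<T}"
  shows "push_forward A V cls (g t) (pchart c) (cls p) = g t c p"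
proof -
  let ?a = "chart_at A p"
  note a = chart_at[OF V_top[OF p(2)]]
  interpret riem_atlas M A "g t" by (rule atlas_at[OF t])
  define S where "S = snd c ` (fst c \<inter> (fst ?a \<inter> V))"
  have S: "open S" "snd c p \<in> S"
    unfolding S_def using p a
    by (auto intro!: chart_image_openin[OF c] openin_Int chart_openin[OF a(1)] V_open)
  have "frechet_derivative (snd ?a \<circ> finv \<circ> chart_inv (pchart c)) (at (snd c p)) =
      frechet_derivative (transition c ?a) (at (snd c p))"
    by (rule frechet_derivative_cong_open[OF S])
       (auto simp: S_def pchart_inv[OF c] transition_apply[OF c])
  then have "jacobian (snd ?a \<circ> finv \<circ> chart_inv (pchart c)) (at (snd c p)) = jacobian (transition c ?a) (at (snd c p))"
    by (simp add: jacobian_def)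
  then show ?thesis
    unfolding push_forward_def finv_def[symmetric]
    using metric_transform[OF c a(1) p(1) a(2)] p by (simp add: Let_def pchart_simps)
qed

section \<open>The limit metric\<close>

definition limit_metric :: "('a set, 4) metric_field" where
  "limit_metric d z = Lim (at_left T) (\<lambda>t. push_forward A V cls (g t) d z)"

lemma limit_metric_eq:
  assumes c: "c \<in> A" and p: "p \<in> fst c" "p \<in> V" and lim: "((\<lambda>t. g t c p) \<longlongrightarrow> B) (at_left T)"
  shows "((\<lambda>t. push_forward A V cls (g t) (pchart c) (cls p)) \<longlongrightarrow> B) (at_left T)"
    "limit_metric (pchart c) (cls p) = B"
proof -
  show *: "((\<lambda>t. push_forward A V cls (g t) (pchart c) (cls p)) \<longlongrightarrow> B) (at_left T)"
    by (rule Lim_transform_eventually[OF lim], rule ev_time[OF order_refl T_pos])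
       (simp add: push_forward_eq[OF c p])
  show "limit_metric (pchart c) (cls p) = B"
    unfolding limit_metric_def by (rule tendsto_Lim[OF _ *]) simp
qed

lemma limit_metric_local:
  assumes c: "c \<in> A" and p: "p \<in> fst c" "p \<in> V"
  shows "\<exists>\<rho> f. 0 < \<rho> \<and> ball (snd c p) \<rho> \<subseteq> chart_image c \<and> smooth_on (ball (snd c p) \<rho>) f \<and>
    (\<forall>q\<in>fst c \<inter> V. snd c q \<in> ball (snd c p) \<rho> \<longrightarrow>
       ((\<lambda>t. g t c q) \<longlongrightarrow> f (snd c q)) (at_left T) \<and> pos_def (f (snd c q)))"
proof -
  from regular_limit_metric[OF V_regular[OF p(2)] c p(1)]
  obtain \<rho> f where f: "0 < \<rho>" "ball (snd c p) \<rho> \<subseteq> chart_image c" "smooth_on (ball (snd c p) \<rho>) f"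
    "\<And>x. x \<in> ball (snd c p) \<rho> \<Longrightarrow> ((\<lambda>t. coord_metric (g t) c x) \<longlongrightarrow> f x) (at_left T) \<and> pos_def (f x)" by blast
  have "((\<lambda>t. g t c q) \<longlongrightarrow> f (snd c q)) (at_left T) \<and> pos_def (f (snd c q))"
    if "q \<in> fst c \<inter> V" "snd c q \<in> ball (snd c p) \<rho>" for q
    using f(4)[OF that(2)] that(1) chart_inv_left[OF c, of q] by (simp add: coord_metric_def)
  then show ?thesis using f(1-3) by blast
qed

lemma limit_metric_at:
  assumes c: "c \<in> A" and p: "p \<in> fst c" "p \<in> V"
  shows "((\<lambda>t. g t c p) \<longlongrightarrow> limit_metric (pchart c) (cls p)) (at_left T)"
    "pos_def (limit_metric (pchart c) (cls p))"
    "((\<lambda>t. push_forward A V cls (g t) (pchart c) (cls p)) \<longlongrightarrow> limit_metric (pchart c) (cls p)) (at_left T)"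
proof -
  obtain B where B: "((\<lambda>t. g t c p) \<longlongrightarrow> B) (at_left T)" "pos_def B"
    using limit_metric_local[OF assms] p by (metis IntI centre_in_ball)
  note e = limit_metric_eq[OF c p B(1)]
  show "((\<lambda>t. g t c p) \<longlongrightarrow> limit_metric (pchart c) (cls p)) (at_left T)"
    "pos_def (limit_metric (pchart c) (cls p))"
    "((\<lambda>t. push_forward A V cls (g t) (pchart c) (cls p)) \<longlongrightarrow> limit_metric (pchart c) (cls p)) (at_left T)"
    using e B by simp_all
qed

lemma tendsto_matrix_congruence:
  fixes F :: "real \<Rightarrow> real^'n^'n" and J :: "real^'n^'n"
  assumes "(F \<longlongrightarrow> B) net"
  shows "((\<lambda>t. transpose J ** F t ** J) \<longlongrightarrow> transpose J ** B ** J) net"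
proof (intro vec_tendstoI)
  fix i j
  show "((\<lambda>t. (transpose J ** F t ** J) $ i $ j) \<longlongrightarrow> (transpose J ** B ** J) $ i $ j) net"
    unfolding matrix_matrix_mult_def by (auto intro!: tendsto_intros assms)
qed

lemma limit_metric_riemannian: "riemannian_metric AN limit_metric"
  unfolding riemannian_metric_def Let_def
proof (intro conjI ballI allI impI)
  fix d z assume "d \<in> AN" "z \<in> fst d"
  then obtain c p where c: "c \<in> A" "d = pchart c" "p \<in> fst c" "p \<in> V" "z = cls p"
    by (auto simp: AN_def pchart_simps)
  note pd = limit_metric_at(2)[OF c(1,3,4)]
  show "transpose (limit_metric d z) = limit_metric d z"
    using pd c by (simp add: pos_def_def)
  show "0 < metric_form limit_metric d z u" if "u \<noteq> 0" for u
    using pd c that by (simp add: pos_def_def metric_form_def)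
next
  fix d assume "d \<in> AN"
  then obtain c where c: "c \<in> A" "d = pchart c" by (auto simp: AN_def)
  have op: "open (chart_image d)"
    unfolding c(2) pchart_image by (rule chart_image_openin[OF c(1) V_open])
  show "smooth_on (chart_image d) (coord_metric limit_metric d)"
  proof (rule smooth_on_local[OF op])
    fix x assume "x \<in> chart_image d"
    then obtain p where p: "p \<in> fst c" "p \<in> V" "x = snd c p" unfolding c(2) pchart_image by blast
    obtain \<rho> f where f: "0 < \<rho>" "smooth_on (ball (snd c p) \<rho>) f"
      "\<And>q. q \<in> fst c \<inter> V \<Longrightarrow> snd c q \<in> ball (snd c p) \<rho> \<Longrightarrow> ((\<lambda>t. g t c q) \<longlongrightarrow> f (snd c q)) (at_left T)"
      using limit_metric_local[OF c(1) p(1,2)] by blast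
    let ?U = "ball (snd c p) \<rho> \<inter> chart_image d"
    have U: "open ?U" using op by (intro open_Int) auto
    have "smooth_on ?U f" by (rule smooth_on_open_subset[OF f(2) U]) simp
    then have "smooth_on ?U (coord_metric limit_metric d)"
    proof (rule smooth_on_cong[THEN iffD1, rotated])
      fix y assume y: "y \<in> ?U"
      then obtain q where q: "q \<in> fst c" "q \<in> V" "y = snd c q" unfolding c(2) pchart_image by blast
      \<comment> \<open>By uniqueness of limits the limit metric agrees near p with the smooth
        function obtained in the chart of M.\<close>
      have "limit_metric (pchart c) (cls q) = f (snd c q)"
        by (rule limit_metric_eq(2)[OF c(1) q(1,2) f(3)]) (use q y in auto)
      then show "f y = coord_metric limit_metric d y"
        using q c pchart_inv[OF c(1)] by (simp add: coord_metric_def)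
    qed
    then show "\<exists>U. open U \<and> x \<in> U \<and> U \<subseteq> chart_image d \<and> smooth_on U (coord_metric limit_metric d)"
      using U f(1) p(3) \<open>x \<in> chart_image d\<close> by (intro exI[of _ ?U]) auto
  qed
next
  fix d d' z assume "d \<in> AN" "d' \<in> AN" "z \<in> fst d \<inter> fst d'"
  then obtain c c' p p' where c: "c \<in> A" "c' \<in> A" "d = pchart c" "d' = pchart c'"
    and "p \<in> fst c" "p \<in> V" "z = cls p" "p' \<in> fst c'" "p' \<in> V" "z = cls p'"
    by (auto simp: AN_def pchart_simps)
  then have p: "p \<in> fst c" "p \<in> fst c'" "p \<in> V" "z = cls p" using cls_inj by (auto simp: inj_on_def)
  define S where "S = snd c ` (fst c \<inter> (fst c' \<inter> V))"
  have S: "open S" "snd c p \<in> S"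
    unfolding S_def using p
    by (auto intro!: chart_image_openin[OF c(1)] openin_Int chart_openin[OF c(2)] V_open)
  let ?J = "jacobian (transition c c') (at (snd c p))"
  have "frechet_derivative (snd d' \<circ> chart_inv d) (at (snd c p)) = frechet_derivative (transition c c') (at (snd c p))"
    by (rule frechet_derivative_cong_open[OF S])
       (auto simp: S_def c(3,4) pchart_inv[OF c(1)] pchart_simps transition_apply[OF c(1)])
  then have J: "jacobian (snd d' \<circ> chart_inv d) (at (snd d z)) = ?J"
    using p by (simp add: jacobian_def c(3) pchart_simps)
  \<comment> \<open>The Jacobian does not depend on time, so the transformation law passes to the
    limit.\<close>
  have "\<forall>\<^sub>F t in at_left T. transpose ?J ** g t c' p ** ?J = g t c p"
    by (rule ev_time[OF order_refl T_pos])
       (rule riem_atlas.metric_transform[OF atlas_at c(1,2) p(1,2), symmetric])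
  then have "((\<lambda>t. g t c p) \<longlongrightarrow> transpose ?J ** limit_metric (pchart c') (cls p) ** ?J) (at_left T)"
    by (rule Lim_transform_eventually[OF tendsto_matrix_congruence[OF limit_metric_at(1)[OF c(2) p(2,3)]]])
  then have "limit_metric (pchart c) (cls p) = transpose ?J ** limit_metric (pchart c') (cls p) ** ?J"
    by (intro tendsto_unique[OF _ limit_metric_at(1)[OF c(1) p(1,3)]]) simp_all
  then show "limit_metric d z = transpose (jacobian (snd d' \<circ> chart_inv d) (at (snd d z))) **
      limit_metric d' z ** jacobian (snd d' \<circ> chart_inv d) (at (snd d z))"
    unfolding J using c p by simp
qed

lemma push_forward_tendsto:
  assumes "d \<in> AN" "z \<in> fst d"
  shows "((\<lambda>t. push_forward A V cls (g t) d z) \<longlongrightarrow> limit_metric d z) (at_left T)"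
  using assms limit_metric_at(3) by (auto simp: AN_def pchart_simps)

end

theorem proposition6p6:
  fixes M :: "'a topology" and A :: "('a, 4) chart set"
    and g :: "real \<Rightarrow> ('a, 4) metric_field"
    and T R v \<epsilon>0 J0 J1 J2 w :: real and cst :: "nat \<Rightarrow> real"
    and L0 L :: nat and \<tau> :: "nat \<Rightarrow> real" and p :: "nat \<Rightarrow> nat \<Rightarrow> 'a"
    and y x :: "nat \<Rightarrow> 'a set"
  assumes basic: "basic_assumptions M A T g"
    and constants: "regularity_constants M A T g R v \<epsilon>0 cst"
    and limit_dist_exists:
      "\<And>q q'. q \<in> topspace M \<Longrightarrow> q' \<in> topspace M \<Longrightarrow>
         \<exists>d. ((\<lambda>t. riem_dist M A (g t) q q') \<longlongrightarrow> d) (at_left T)"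
    and pos: "0 < J0" "0 < J1" "0 < J2" "0 < w"
    and covering:
      "\<And>s. good_time M A T g s \<Longrightarrow> 0 < s \<Longrightarrow> T - s \<le> w \<Longrightarrow>
         \<exists>P. covering_points M A T g \<epsilon>0 R J0 J1 J2 L0 s P"
    and times: "\<And>i. good_time M A T g (\<tau> i)" "\<And>i. 0 < \<tau> i" "\<And>i. T - \<tau> i \<le> w"
      "strict_mono \<tau>" "\<tau> \<longlonglongrightarrow> T"
    and points: "\<And>i. covering_points M A T g \<epsilon>0 R J0 J1 J2 L0 (\<tau> i) (p i)"
    and limits:
      "\<And>j. j \<in> {1..L0} \<Longrightarrow>
         limitin (limit_topology M A T g) (\<lambda>i. limit_class M A T g (p i j)) (y j) sequentially"
    and distinct_limits: "inj_on x {1..L}" "x ` {1..L} = y ` {1..L0}"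
  shows
    "let f = limit_class M A T g;
         N = limit_space M A T g - x ` {1..L};
         V = {q \<in> topspace M. f q \<in> N};
         NT = subtopology (limit_topology M A T g) N
     in openin M V \<and>
        (\<exists>AN :: ('a set, 4) chart set.
           smooth_manifold NT AN \<and>
           diffeomorphism (subtopology M V) (restrict_atlas V A) NT AN f \<and>
           (\<exists>l. riemannian_metric AN l \<and>
                (\<forall>c\<in>AN. \<forall>z\<in>fst c.
                   ((\<lambda>t. push_forward A V f (g t) c z) \<longlongrightarrow> l c z) (at_left T))))"
proof -
  interpret limit_flow M A T g
    by unfold_locales (use basic limit_dist_exists in auto)
  have "y j \<in> limit_space M A T g" if "j \<in> {1..L0}" for j
    using limitin_topspace[OF limits[OF that]] by (simp add: limit_topology_def L.topspace_mtopology)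
  then have Y: "y ` {1..L0} \<subseteq> limit_space M A T g" by blast
  \<comment> \<open>The limits y j may coincide, but only their set is removed, and by
    \<open>distinct_limits\<close> it is the set of the points x.\<close>
  interpret regular_part M A T g "y ` {1..L0}"
    by unfold_locales
       (use Y regular_away_from_limits[OF constants times(1,2,5) points limits] in simp_all)
  have "openin M V \<and> (\<exists>AN :: ('a set, 4) chart set. smooth_manifold NT AN \<and>
      diffeomorphism (subtopology M V) (restrict_atlas V A) NT AN cls \<and>
      (\<exists>l. riemannian_metric AN l \<and> (\<forall>c\<in>AN. \<forall>z\<in>fst c.
          ((\<lambda>t. push_forward A V cls (g t) c z) \<longlongrightarrow> l c z) (at_left T))))"
    using V_open AN_manifold cls_diffeomorphism limit_metric_riemannian push_forward_tendsto by blast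
  then show ?thesis
    unfolding Let_def distinct_limits(2) N_def[symmetric] V_def[symmetric] .
qed

end
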